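(* Let $1<p<\infty$, let $E$ be a (real) UMD Banach space, and let $(a_k)_{k=0}^\infty \subset \mathcal{L}(L^p(\Omega;E))$ be a sequence of bounded linear operators such that $\sum_{k=0}^\infty \|a_k\|_{\mathcal{L}(L^p(\Omega;E))} N^{-k} < \infty$ for some $N \geq 1$. If $(\phi(n))_{n\geq 0}\subset \mathcal{L}(L^p(\Omega;E))$ is a sequence of operators satisfying $\phi(n) = \sum_{k=0}^\infty a_k n^{-k}$ for all $n \geq N$, then the operator $T_\phi$ defined by $$T_\phi F := \sum_{n=0}^\infty \phi(n) J_n F, \qquad F \in \mathcal{P}(E),$$ extends to a bounded operator on $L^p(\Omega;E)$.
   Context: **Setting.** $(\Omega,\mathcal{F},\mathbb{P})$ is a complete probability space, $H$ is a real separable Hilbert space, and $W:H\to L^2(\Omega)$ is an isonormal Gaussian process, i.e. a linear isometry onto a closed subspace of $L^2(\Omega)$ consisting of (centred) Gaussian random variables. $\mathcal{F}$ is the $\sigma$-algebra generated by $W$. $\mathcal{L}(X)$ denotes the bounded linear operators on $X$. **Chaos projections.** The Hermite polynomials satisfy $H_0(x)=1$, $H_1(x)=x$, $(m+1)H_{m+1}(x)=xH_m(x)-H_{m-1}(x)$ for $m\ge1$. $\mathcal{H}_m$ ($m\ge0$) is the closure in $L^2(\Omega)$ of the linear span of $\{H_m(W(h)):\|h\|=1\}$; one has the orthogonal decomposition $L^2(\Omega)=\bigoplus_{m\ge0}\mathcal{H}_m$. $J_m$ is the orthogonal projection onto $\mathcal{H}_m$. For $E$ UMD and $1<p<\infty$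 the operator $J_m\otimes I$ extends to a bounded operator on $L^p(\Omega;E)$, again denoted by $J_m$. **Polynomials.** $\mathcal{P}(E)$ is the linear span of the functions $\varphi(W(h_1),\ldots,W(h_n))\cdot x$ with $n\ge1$, $\varphi$ a real polynomial in $n$ variables, $h_1,\ldots,h_n\in H$, $x\in E$. For $F\in\mathcal{P}(E)$ only finitely many $J_nF$ are non-zero. *)

theory Defs
  imports "HOL-Probability.Probability"
begin

section \<open>Bochner spaces and their operators\<close>

text \<open>
  The Banach space is not assumed separable, so the measurability and Bochner integral of the
  library (which need second countability) are replaced by their general versions.
  Elements of \<open>L\<^sup>p(M; E)\<close> are represented by strongly measurable functions; everything is
  understood up to equality almost everywhere, and \<open>Lp_norm\<close> is a seminorm on representatives.
\<close>

definition strongly_measurable :: "'w measure \<Rightarrow> ('w \<Rightarrow> 'b::topological_space) \<Rightarrow> bool" where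
  "strongly_measurable M f \<longleftrightarrow>
     (\<exists>s. (\<forall>i. simple_function M (s i)) \<and> (\<forall>\<omega>\<in>space M. (\<lambda>i. s i \<omega>) \<longlonglongrightarrow> f \<omega>))"

definition has_strong_integral ::
    "'w measure \<Rightarrow> ('w \<Rightarrow> 'b) \<Rightarrow> 'b::real_normed_vector \<Rightarrow> bool" where
  "has_strong_integral M f x \<longleftrightarrow> strongly_measurable M f \<and>
     (\<exists>s. (\<forall>i. Bochner_Integration.simple_bochner_integrable M (s i)) \<and>
          (\<lambda>i. \<integral>\<^sup>+\<omega>. ennreal (norm (f \<omega> - s i \<omega>)) \<partial>M) \<longlonglongrightarrow> 0 \<and>
          (\<lambda>i. Bochner_Integration.simple_bochner_integral M (s i)) \<longlonglongrightarrow> x)"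

definition Lp :: "'w measure \<Rightarrow> real \<Rightarrow> ('w \<Rightarrow> 'b::real_normed_vector) set" where
  "Lp M p = {f. strongly_measurable M f \<and> integrable M (\<lambda>\<omega>. norm (f \<omega>) powr p)}"

definition Lp_norm :: "'w measure \<Rightarrow> real \<Rightarrow> ('w \<Rightarrow> 'b::real_normed_vector) \<Rightarrow> real" where
  "Lp_norm M p f = (\<integral>\<omega>. norm (f \<omega>) powr p \<partial>M) powr (1 / p)"

text \<open>Bounded linear operators on \<open>L\<^sup>p(M; E)\<close>, as maps on representatives. Linearity
  together with boundedness implies that functions equal almost everywhere are mapped to functions
  equal almost everywhere.\<close>

definition Lp_operator ::
    "'w measure \<Rightarrow> real \<Rightarrow> (('w \<Rightarrow> 'b::real_normed_vector) \<Rightarrow> ('w \<Rightarrow> 'b)) \<Rightarrow> bool" where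
  "Lp_operator M p T \<longleftrightarrow>
     (\<forall>f\<in>Lp M p. T f \<in> Lp M p) \<and>
     (\<forall>f\<in>Lp M p. \<forall>g\<in>Lp M p. AE \<omega> in M. T (\<lambda>\<omega>. f \<omega> + g \<omega>) \<omega> = T f \<omega> + T g \<omega>) \<and>
     (\<forall>c. \<forall>f\<in>Lp M p. AE \<omega> in M. T (\<lambda>\<omega>. c *\<^sub>R f \<omega>) \<omega> = c *\<^sub>R T f \<omega>) \<and>
     (\<exists>C. \<forall>f\<in>Lp M p. Lp_norm M p (T f) \<le> C * Lp_norm M p f)"

text \<open>As for \<^const>\<open>onorm\<close>, functions of norm \<open>0\<close> contribute \<open>0 / 0 = 0\<close>.\<close>

definition Lp_opnorm ::
    "'w measure \<Rightarrow> real \<Rightarrow> (('w \<Rightarrow> 'b::real_normed_vector) \<Rightarrow> ('w \<Rightarrow> 'b)) \<Rightarrow> real" where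
  "Lp_opnorm M p T = (SUP f\<in>Lp M p. Lp_norm M p (T f) / Lp_norm M p f)"

definition Lp_op_sums ::
    "'w measure \<Rightarrow> real \<Rightarrow> (nat \<Rightarrow> ('w \<Rightarrow> 'b::real_normed_vector) \<Rightarrow> ('w \<Rightarrow> 'b)) \<Rightarrow>
      (('w \<Rightarrow> 'b) \<Rightarrow> ('w \<Rightarrow> 'b)) \<Rightarrow> bool" where
  "Lp_op_sums M p A S \<longleftrightarrow>
     (\<lambda>m. Lp_opnorm M p (\<lambda>f \<omega>. (\<Sum>k<m. A k f \<omega>) - S f \<omega>)) \<longlonglongrightarrow> 0"

definition Lp_sums ::
    "'w measure \<Rightarrow> real \<Rightarrow> (nat \<Rightarrow> 'w \<Rightarrow> 'b::real_normed_vector) \<Rightarrow> ('w \<Rightarrow> 'b) \<Rightarrow> bool" where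
  "Lp_sums M p u s \<longleftrightarrow>
     (\<forall>n. u n \<in> Lp M p) \<and> s \<in> Lp M p \<and>
     (\<lambda>m. Lp_norm M p (\<lambda>\<omega>. (\<Sum>n<m. u n \<omega>) - s \<omega>)) \<longlonglongrightarrow> 0"


section \<open>UMD spaces\<close>

text \<open>\<open>d 0, \<dots>, d (n - 1)\<close> is the difference sequence of an \<open>L\<^sup>p\<close>-martingale started at \<open>d 0\<close>,
  for the filtration \<open>F 0 \<subseteq> \<dots> \<subseteq> F (n - 1)\<close> of sub-sigma-algebras of \<open>M\<close>; the last clause is
  that the conditional expectation of \<open>d (i + 1)\<close> given \<open>F i\<close> vanishes.\<close>

definition martingale_difference ::
    "'s measure \<Rightarrow> real \<Rightarrow> nat \<Rightarrow> (nat \<Rightarrow> 's measure) \<Rightarrow> (nat \<Rightarrow> 's \<Rightarrow> 'b::real_normed_vector) \<Rightarrow> bool"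
  where
  "martingale_difference M p n F d \<longleftrightarrow>
     (\<forall>i<n. subalgebra M (F i)) \<and>
     (\<forall>i. Suc i < n \<longrightarrow> subalgebra (F (Suc i)) (F i)) \<and>
     (\<forall>i<n. d i \<in> Lp M p \<and> strongly_measurable (F i) (d i)) \<and>
     (\<forall>i. Suc i < n \<longrightarrow> (\<forall>A\<in>sets (F i).
        has_strong_integral M (\<lambda>\<omega>. indicator A \<omega> *\<^sub>R d (Suc i) \<omega>) 0))"

text \<open>The probability spaces range over all measures (with arbitrary sigma-algebra) on the type
  \<open>real\<close>. This loses nothing: finitely many strongly measurable functions generate, up to null sets,
  a countably generated sigma-algebra, and can therefore be transported to the real line.\<close>

definition UMD_space :: "'b::banach itself \<Rightarrow> bool" where
  "UMD_space _ \<longleftrightarrow>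
     (\<exists>p>1. \<exists>\<beta>. \<forall>(M :: real measure) n F (d :: nat \<Rightarrow> real \<Rightarrow> 'b) \<epsilon>.
        prob_space M \<and> martingale_difference M p n F d \<and> (\<forall>i<n. \<epsilon> i \<in> {-1, 1 :: real}) \<longrightarrow>
          Lp_norm M p (\<lambda>\<omega>. \<Sum>i<n. \<epsilon> i *\<^sub>R d i \<omega>) \<le> \<beta> * Lp_norm M p (\<lambda>\<omega>. \<Sum>i<n. d i \<omega>))"


section \<open>Isonormal Gaussian processes\<close>

definition centred_gaussian :: "'w measure \<Rightarrow> ('w \<Rightarrow> real) \<Rightarrow> bool" where
  "centred_gaussian M X \<longleftrightarrow> X \<in> borel_measurable M \<and>
     ((\<exists>\<sigma>>0. distributed M lborel X (normal_density 0 \<sigma>)) \<or> (AE \<omega> in M. X \<omega> = 0))"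

text \<open>The range is automatically closed in \<open>L\<^sup>2\<close>, being an isometric image of a complete space.\<close>

definition isonormal_process ::
    "'w measure \<Rightarrow> ('h::{real_inner, banach, second_countable_topology} \<Rightarrow> 'w \<Rightarrow> real) \<Rightarrow> bool" where
  "isonormal_process M W \<longleftrightarrow>
     (\<forall>h. centred_gaussian M (W h) \<and> W h \<in> Lp M 2) \<and>
     (\<forall>g h. AE \<omega> in M. W (g + h) \<omega> = W g \<omega> + W h \<omega>) \<and>
     (\<forall>c h. AE \<omega> in M. W (c *\<^sub>R h) \<omega> = c * W h \<omega>) \<and>
     (\<forall>h. Lp_norm M 2 (W h) = norm h)"

text \<open>Since \<open>W h\<close> is only determined up to null sets, the sigma-algebra generated by \<open>W\<close> is taken to
  include the null sets of the complete space \<open>M\<close>.\<close>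

definition sigma_algebra_generated_by ::
    "'w measure \<Rightarrow> ('h \<Rightarrow> 'w \<Rightarrow> real) \<Rightarrow> bool" where
  "sigma_algebra_generated_by M W \<longleftrightarrow>
     sets M = sigma_sets (space M)
       ({W h -` B \<inter> space M | h B. B \<in> sets borel} \<union> null_sets M)"


section \<open>Wiener chaos\<close>

fun hermite :: "nat \<Rightarrow> real \<Rightarrow> real" where
  "hermite 0 x = 1"
| "hermite (Suc 0) x = x"
| "hermite (Suc (Suc m)) x = (x * hermite (Suc m) x - hermite m x) / real (Suc (Suc m))"

definition fun_span :: "('w \<Rightarrow> 'b::real_vector) set \<Rightarrow> ('w \<Rightarrow> 'b) set" where
  "fun_span S = {\<lambda>\<omega>. \<Sum>i<k. c i *\<^sub>R g i \<omega> | (k :: nat) c g. \<forall>i<k. g i \<in> S}"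

definition chaos :: "'w measure \<Rightarrow> ('h::real_normed_vector \<Rightarrow> 'w \<Rightarrow> real) \<Rightarrow> nat \<Rightarrow> ('w \<Rightarrow> real) set"
  where
  "chaos M W m = {f \<in> Lp M 2. \<forall>e>0.
     \<exists>g \<in> fun_span {\<lambda>\<omega>. hermite m (W h \<omega>) | h. norm h = 1}. Lp_norm M 2 (\<lambda>\<omega>. f \<omega> - g \<omega>) < e}"

text \<open>The orthogonal projection of \<open>L\<^sup>2(M)\<close> onto the chaos, determined up to null sets.\<close>

definition chaos_proj ::
    "'w measure \<Rightarrow> ('h::real_normed_vector \<Rightarrow> 'w \<Rightarrow> real) \<Rightarrow> nat \<Rightarrow> ('w \<Rightarrow> real) \<Rightarrow> ('w \<Rightarrow> real)" where
  "chaos_proj M W m f = (SOME g. g \<in> chaos M W m \<and>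
     (\<forall>k\<in>chaos M W m. (\<integral>\<omega>. (f \<omega> - g \<omega>) * k \<omega> \<partial>M) = 0))"

text \<open>The operator \<open>J\<^sub>m \<otimes> I\<close> on \<open>L\<^sup>2(M) \<otimes> E\<close>, sending \<open>\<Sum>i. f i \<otimes> x i\<close> to \<open>\<Sum>i. J\<^sub>m (f i) \<otimes> x i\<close>.
  Up to null sets, the result does not depend on the chosen representation.\<close>

definition vchaos_proj ::
    "'w measure \<Rightarrow> ('h::real_normed_vector \<Rightarrow> 'w \<Rightarrow> real) \<Rightarrow> nat \<Rightarrow>
      ('w \<Rightarrow> 'b::real_normed_vector) \<Rightarrow> ('w \<Rightarrow> 'b)" where
  "vchaos_proj M W m F = (SOME G. \<exists>(n :: nat) f x.
     (\<forall>i<n. f i \<in> Lp M 2) \<and>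
     (AE \<omega> in M. F \<omega> = (\<Sum>i<n. f i \<omega> *\<^sub>R x i)) \<and>
     G = (\<lambda>\<omega>. \<Sum>i<n. chaos_proj M W m (f i) \<omega> *\<^sub>R x i))"


section \<open>Polynomials\<close>

text \<open>Real polynomials in the variables \<open>t 0, \<dots>, t (n - 1)\<close>; \<open>\<alpha>\<close> ranges over multi-indices.\<close>

definition polynomial_fun :: "nat \<Rightarrow> ((nat \<Rightarrow> real) \<Rightarrow> real) \<Rightarrow> bool" where
  "polynomial_fun n q \<longleftrightarrow>
     (\<exists>A c. finite A \<and> q = (\<lambda>t. \<Sum>\<alpha>\<in>A. c \<alpha> * (\<Prod>i<n. t i ^ (\<alpha> i :: nat))))"

definition wiener_polynomials :: "('h \<Rightarrow> 'w \<Rightarrow> real) \<Rightarrow> ('w \<Rightarrow> 'b::real_vector) set" where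
  "wiener_polynomials W =
     fun_span {\<lambda>\<omega>. q (\<lambda>i. W (h i) \<omega>) *\<^sub>R x | q (n :: nat) h x. 1 \<le> n \<and> polynomial_fun n q}"

end

theory Submission
  imports Defs "HOL-Real_Asymp.Real_Asymp"
begin

text \<open>
  Since \<open>N\<close> may be replaced by the next integer, the chaoses of order below \<open>N\<close> contribute finitely many
  operators \<open>\<phi> n J\<^sub>n\<close>. On the others \<open>T\<^sub>\<phi> = \<Sum>\<^sub>k a\<^sub>k R\<^sup>k\<close>, where \<open>R\<close> divides the chaos of order \<open>n \<ge> N\<close> by \<open>n\<close> and
  kills the lower ones, so it suffices that the \<open>J\<^sub>n\<close> are bounded and that \<open>\<parallel>R\<^sup>k\<parallel> \<le> C N\<^sup>-\<^sup>k\<close>.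

  Both are first proved on the cube \<open>{-1, 1}\<^sup>n\<close>, with Walsh functions in place of the Wiener chaos. The UMD
  property bounds the projection onto the first chaos, random splitting of the coordinates then gives
  \<open>\<parallel>J\<^sub>m\<parallel> \<le> D\<^sup>m\<close>, and hence the noise operator \<open>e\<^sup>-\<^sup>t\<^sup>L\<close> has norm at most \<open>C e\<^sup>-\<^sup>N\<^sup>t\<close> on the chaoses of order
  at least \<open>N\<close>; \<open>R\<close> is the integral of this over \<open>t \<ge> 0\<close>. Elementary symmetric polynomials of normalized sums of
  signs converge to Hermite polynomials of Gaussian variables, which transfers the bounds to \<open>M\<close>. Finally,
  the polynomials are dense because \<open>W\<close> generates the sigma-algebra.
\<close>

section \<open>Strong measurability and Lp spaces\<close>

text \<open>The bound on \<open>R^k\<close> must carry one constant \<open>C\<close> for all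
  \<open>k\<close>: iterating an estimate \<open>C / N\<close> for \<open>R\<close> alone would give
  \<open>C^k N^-k\<close>, and the series over \<open>k\<close> could then diverge. Hence the noise
  operator has to decay on the high chaoses at the full rate \<open>e^-Nt\<close>, up to a constant
  factor, and the induction over \<open>k\<close> carries an additional noise factor along. The rate
  is available because the exponential bound \<open>D^m\<close> for the projections is beaten by
  \<open>s^m\<close> when \<open>s D\<close> is at most 1/2; for all other \<open>s\<close> the
  factor \<open>s^N\<close> is bounded below and a finite constant serves.

  Orthogonality gives no norm estimates in a Banach space. All bounds on the cube are therefore
  proved with constants independent of the dimension, and this uniformity is what survives the
  central limit passage. The UMD property is given for some exponent only; hypercontractivity moves
  the first order bound to the given \<open>p\<close>, and it also supplies the moment bounds for
  sums of signs.\<close>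

lemma simple_function_compose_any:
  "simple_function M f \<Longrightarrow> simple_function M (\<lambda>w. h (f w))"
  using simple_function_compose[of M f h] by (simp add: comp_def)

lemma strongly_measurable_simple: "simple_function M f \<Longrightarrow> strongly_measurable M f"
  unfolding strongly_measurable_def by (rule exI[of _ "\<lambda>i. f"]) auto

lemma strongly_measurable_const [simp]: "strongly_measurable M (\<lambda>w. c)"
  by (intro strongly_measurable_simple) simp

lemma strongly_measurable_compose:
  assumes "strongly_measurable M f" "continuous_on UNIV h"
  shows "strongly_measurable M (\<lambda>w. h (f w))"
proof -
  obtain s where s: "\<And>i. simple_function M (s i)" "\<And>w. w \<in> space M \<Longrightarrow> (\<lambda>i. s i w) \<longlonglongrightarrow> f w"
    using assms(1) unfolding strongly_measurable_def by blast
  have "(\<lambda>i. h (s i w)) \<longlonglongrightarrow> h (f w)" if "w \<in> space M" for w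
    using continuous_on_tendsto_compose[OF assms(2) s(2)[OF that]] by simp
  then show ?thesis
    unfolding strongly_measurable_def using s(1) simple_function_compose_any
    by (intro exI[of _ "\<lambda>i w. h (s i w)"]) blast
qed

lemma strongly_measurable_Pair:
  assumes "strongly_measurable M f" "strongly_measurable M g"
  shows "strongly_measurable M (\<lambda>w. (f w, g w))"
proof -
  obtain s t where s: "\<And>i. simple_function M (s i)" "\<And>w. w \<in> space M \<Longrightarrow> (\<lambda>i. s i w) \<longlonglongrightarrow> f w"
    and t: "\<And>i. simple_function M (t i)" "\<And>w. w \<in> space M \<Longrightarrow> (\<lambda>i. t i w) \<longlonglongrightarrow> g w"
    using assms unfolding strongly_measurable_def by blast
  show ?thesis unfolding strongly_measurable_def
    by (rule exI[of _ "\<lambda>i w. (s i w, t i w)"]) (auto intro!: tendsto_Pair s t)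
qed

lemma strongly_measurable_add:
  fixes f g :: "'w \<Rightarrow> 'b::real_normed_vector"
  assumes "strongly_measurable M f" "strongly_measurable M g"
  shows "strongly_measurable M (\<lambda>w. f w + g w)"
  using strongly_measurable_compose[OF strongly_measurable_Pair[OF assms], of "\<lambda>z. fst z + snd z"]
  by (simp add: continuous_on_add continuous_on_fst continuous_on_snd continuous_on_id)

lemma strongly_measurable_scaleR:
  fixes g :: "'w \<Rightarrow> 'b::real_normed_vector"
  assumes "strongly_measurable M f" "strongly_measurable M g"
  shows "strongly_measurable M (\<lambda>w. f w *\<^sub>R g w)"
  using strongly_measurable_compose[OF strongly_measurable_Pair[OF assms], of "\<lambda>z. fst z *\<^sub>R snd z"]
  by (simp add: continuous_on_scaleR continuous_on_fst continuous_on_snd continuous_on_id)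

lemma strongly_measurable_real_iff:
  fixes f :: "'w \<Rightarrow> real"
  shows "strongly_measurable M f \<longleftrightarrow> f \<in> borel_measurable M"
proof
  assume "strongly_measurable M f"
  then obtain s where s: "\<And>i. simple_function M (s i)" "\<And>w. w \<in> space M \<Longrightarrow> (\<lambda>i. s i w) \<longlonglongrightarrow> f w"
    unfolding strongly_measurable_def by blast
  show "f \<in> borel_measurable M"
    by (rule borel_measurable_LIMSEQ_real[of M s]) (use s borel_measurable_simple_function in auto)
next
  assume "f \<in> borel_measurable M"
  from borel_measurable_implies_sequence_metric[OF this, of 0] show "strongly_measurable M f"
    unfolding strongly_measurable_def by blast
qed

lemma strongly_measurable_norm [measurable_dest]:
  fixes f :: "'w \<Rightarrow> 'b::real_normed_vector"
  assumes "strongly_measurable M f"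
  shows "(\<lambda>w. norm (f w)) \<in> borel_measurable M"
  using strongly_measurable_compose[OF assms, of norm] strongly_measurable_real_iff[of M "\<lambda>w. norm (f w)"]
  by (auto intro!: continuous_intros)

lemma strongly_measurable_sum:
  fixes f :: "'i \<Rightarrow> 'w \<Rightarrow> 'b::real_normed_vector"
  assumes "\<And>i. i \<in> I \<Longrightarrow> strongly_measurable M (f i)"
  shows "strongly_measurable M (\<lambda>w. \<Sum>i\<in>I. f i w)"
  using assms by (induction I rule: infinite_finite_induct) (auto intro!: strongly_measurable_add)

text \<open>For positive \<open>x\<close> and \<open>y\<close> this is convexity of the power
  function. If one of them is 0, it reduces to \<open>u powr p \<le> u\<close> for \<open>u\<close>
  in the unit interval, which is \<open>shrink\<close>.\<close>

lemma powr_convex_comb: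
  fixes x y t p :: real
  assumes "0 \<le> x" "0 \<le> y" "0 \<le> t" "t \<le> 1" "1 \<le> p"
  shows "(t * x + (1 - t) * y) powr p \<le> t * x powr p + (1 - t) * y powr p"
proof -
  have shrink: "(u * z) powr p \<le> u * z powr p" if "0 \<le> u" "u \<le> 1" "0 \<le> z" for u z :: real
  proof -
    have "u powr p \<le> u"
      using powr_mono'[of 1 p u] that assms by auto
    then show ?thesis using that by (simp add: powr_mult mult_right_mono)
  qed
  consider "x = 0" | "y = 0" | "0 < x" "0 < y" using assms by linarith
  then show ?thesis
  proof cases
    case 1 then show ?thesis using shrink[of "1 - t" y] assms by auto
  next
    case 2 then show ?thesis using shrink[of t x] assms by auto
  next
    case 3
    show ?thesis
      using convex_onD[OF powr_convex[OF assms(5)], of "1 - t" x y] 3 assms by (simp add: algebra_simps)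
  qed
qed

lemma powr_add_le:
  fixes x y p :: real
  assumes "0 \<le> x" "0 \<le> y" "1 \<le> p"
  shows "(x + y) powr p \<le> 2 powr p * (x powr p + y powr p)"
proof -
  have "(x + y) powr p = (2 * (1/2 * x + (1 - 1/2) * y)) powr p" by simp
  also have "\<dots> = 2 powr p * (1/2 * x + (1 - 1/2) * y) powr p"
    by (rule powr_mult)
  also have "\<dots> \<le> 2 powr p * (1/2 * x powr p + (1 - 1/2) * y powr p)"
    by (intro mult_left_mono powr_convex_comb) (use assms in auto)
  also have "\<dots> \<le> 2 powr p * (x powr p + y powr p)"
  proof (rule mult_left_mono)
    have "0 \<le> x powr p" "0 \<le> y powr p" by simp_all
    then show "1/2 * x powr p + (1 - 1/2) * y powr p \<le> x powr p + y powr p"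
      by (simp add: field_simps add_nonneg_nonneg)
  qed simp
  finally show ?thesis .
qed

section \<open>Lebesgue-Bochner spaces: Minkowski's inequality and dominated convergence\<close>

lemma LpD:
  assumes "f \<in> Lp M p"
  shows "strongly_measurable M f" "integrable M (\<lambda>w. norm (f w) powr p)"
  using assms by (auto simp: Lp_def)

lemma Lp_zero [simp]: "(\<lambda>w. 0) \<in> Lp M p"
  by (simp add: Lp_def)

lemma Lp_bound:
  assumes "strongly_measurable M f" "integrable M (\<lambda>w. g w powr p)"
    "AE w in M. norm (f w) \<le> g w" "0 \<le> p"
  shows "f \<in> Lp M p"
proof -
  note [measurable] = strongly_measurable_norm[OF assms(1)]
  have "integrable M (\<lambda>w. norm (f w) powr p)"
    by (rule Bochner_Integration.integrable_bound[OF assms(2)])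
       (use assms in \<open>auto intro!: powr_mono2\<close>)
  then show ?thesis using assms by (auto simp: Lp_def)
qed

lemma Lp_add:
  assumes "f \<in> Lp M p" "g \<in> Lp M p" "1 \<le> p"
  shows "(\<lambda>w. f w + g w) \<in> Lp M p"
proof -
  have sm: "strongly_measurable M (\<lambda>w. f w + g w)"
    using assms LpD(1) strongly_measurable_add by blast
  note [measurable] = strongly_measurable_norm[OF sm]
  have "integrable M (\<lambda>w. norm (f w + g w) powr p)"
  proof (rule Bochner_Integration.integrable_bound)
    show "integrable M (\<lambda>w. 2 powr p * (norm (f w) powr p + norm (g w) powr p))"
      using assms by (auto simp: Lp_def)
    have "norm (f w + g w) powr p \<le> 2 powr p * (norm (f w) powr p + norm (g w) powr p)" for w
    proof -
      have "norm (f w + g w) powr p \<le> (norm (f w) + norm (g w)) powr p"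
        using assms by (intro powr_mono2) (auto intro: norm_triangle_ineq)
      also have "\<dots> \<le> 2 powr p * (norm (f w) powr p + norm (g w) powr p)"
        using assms by (intro powr_add_le) auto
      finally show ?thesis .
    qed
    then show "AE w in M. norm (norm (f w + g w) powr p)
        \<le> norm (2 powr p * (norm (f w) powr p + norm (g w) powr p))" by auto
  qed measurable
  then show ?thesis using sm by (simp add: Lp_def)
qed

lemma Lp_scaleR:
  assumes "f \<in> Lp M p"
  shows "(\<lambda>w. c *\<^sub>R f w) \<in> Lp M p"
  using assms by (auto simp: Lp_def powr_mult intro!: strongly_measurable_scaleR)

lemma Lp_diff:
  assumes "f \<in> Lp M p" "g \<in> Lp M p" "1 \<le> p"
  shows "(\<lambda>w. f w - g w) \<in> Lp M p"
  using Lp_add[OF assms(1) Lp_scaleR[OF assms(2), of "-1"] assms(3)] by simp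

lemma Lp_sum:
  assumes "\<And>i. i \<in> I \<Longrightarrow> f i \<in> Lp M p" "1 \<le> p"
  shows "(\<lambda>w. \<Sum>i\<in>I. f i w) \<in> Lp M p"
  using assms by (induction I rule: infinite_finite_induct) (auto intro!: Lp_add)

lemma Lp_norm_nonneg [simp]: "0 \<le> Lp_norm M p f"
  by (simp add: Lp_norm_def)

lemma Lp_norm_powr:
  assumes "0 < p"
  shows "Lp_norm M p f powr p = (\<integral>w. norm (f w) powr p \<partial>M)"
  using assms by (simp add: Lp_norm_def powr_powr)

lemma Lp_norm_le_iff:
  assumes "0 < p" "0 \<le> C"
  shows "Lp_norm M p f \<le> C \<longleftrightarrow> (\<integral>w. norm (f w) powr p \<partial>M) \<le> C powr p"
proof
  assume "Lp_norm M p f \<le> C"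
  then have "Lp_norm M p f powr p \<le> C powr p" using assms by (intro powr_mono2) auto
  then show "(\<integral>w. norm (f w) powr p \<partial>M) \<le> C powr p" using Lp_norm_powr[OF assms(1)] by metis
next
  assume "(\<integral>w. norm (f w) powr p \<partial>M) \<le> C powr p"
  then have "Lp_norm M p f \<le> (C powr p) powr (1 / p)" unfolding Lp_norm_def
    using assms by (intro powr_mono2) auto
  then show "Lp_norm M p f \<le> C" using assms by (simp add: powr_powr)
qed

lemma Lp_norm_cong_AE:
  assumes "strongly_measurable M f" "strongly_measurable M g" "AE w in M. f w = g w"
  shows "Lp_norm M p f = Lp_norm M p g"
proof -
  note [measurable] = strongly_measurable_norm[OF assms(1)] strongly_measurable_norm[OF assms(2)]
  have "(\<integral>w. norm (f w) powr p \<partial>M) = (\<integral>w. norm (g w) powr p \<partial>M)"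
    by (rule integral_cong_AE) (use assms in auto)
  then show ?thesis by (simp add: Lp_norm_def)
qed

lemma Lp_norm_eq_0_iff:
  assumes "f \<in> Lp M p" "0 < p"
  shows "Lp_norm M p f = 0 \<longleftrightarrow> (AE w in M. f w = 0)"
proof -
  have "Lp_norm M p f = 0 \<longleftrightarrow> (\<integral>w. norm (f w) powr p \<partial>M) = 0"
    by (simp add: Lp_norm_def)
  also have "\<dots> \<longleftrightarrow> (AE w in M. norm (f w) powr p = 0)"
    by (rule integral_nonneg_eq_0_iff_AE) (use LpD[OF assms(1)] in auto)
  also have "\<dots> \<longleftrightarrow> (AE w in M. f w = 0)" by simp
  finally show ?thesis .
qed

lemma Lp_norm_zero [simp]: "Lp_norm M p (\<lambda>w. 0) = 0"
  by (simp add: Lp_norm_def)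

lemma Lp_norm_scaleR:
  assumes "0 < p"
  shows "Lp_norm M p (\<lambda>w. c *\<^sub>R f w) = \<bar>c\<bar> * Lp_norm M p f"
  using assms by (simp add: Lp_norm_def powr_mult powr_powr)

lemma Lp_norm_minus_commute: "Lp_norm M p (\<lambda>w. f w - g w) = Lp_norm M p (\<lambda>w. g w - f w)"
  by (simp add: Lp_norm_def norm_minus_commute)

lemma Lp_norm_mono:
  assumes "strongly_measurable M f" "g \<in> Lp M p" "AE w in M. norm (f w) \<le> norm (g w)" "0 < p"
  shows "Lp_norm M p f \<le> Lp_norm M p g"
proof -
  note [measurable] = strongly_measurable_norm[OF assms(1)]
  have "(\<integral>w. norm (f w) powr p \<partial>M) \<le> (\<integral>w. norm (g w) powr p \<partial>M)"
    by (rule integral_mono_AE') (use assms LpD[OF assms(2)] in \<open>auto intro!: powr_mono2\<close>)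
  then show ?thesis unfolding Lp_norm_def using assms by (intro powr_mono2) auto
qed

text \<open>Convexity of the power function, with weights proportional to the two norms.\<close>

lemma Lp_norm_triangle:
  assumes f: "f \<in> Lp M p" and g: "g \<in> Lp M p" and p: "1 \<le> p"
  shows "Lp_norm M p (\<lambda>w. f w + g w) \<le> Lp_norm M p f + Lp_norm M p g"
proof -
  define a b where "a = Lp_norm M p f" and "b = Lp_norm M p g"
  have nn: "0 \<le> a" "0 \<le> b" by (auto simp: a_def b_def)
  note fg = Lp_add[OF f g p]
  show ?thesis
  proof (cases "a = 0 \<or> b = 0")
    case True
    then have "(AE w in M. f w = 0) \<or> (AE w in M. g w = 0)"
      using Lp_norm_eq_0_iff[OF f] Lp_norm_eq_0_iff[OF g] p by (auto simp: a_def b_def)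
    then have "(AE w in M. f w + g w = g w) \<or> (AE w in M. f w + g w = f w)" by auto
    then have "Lp_norm M p (\<lambda>w. f w + g w) = b \<or> Lp_norm M p (\<lambda>w. f w + g w) = a"
      unfolding a_def b_def using Lp_norm_cong_AE LpD(1) f g fg by blast
    then show ?thesis using nn unfolding a_def b_def by linarith
  next
    case False
    then have pos: "0 < a" "0 < b" using nn by auto
    define t where "t = a / (a + b)"
    have t: "0 \<le> t" "t \<le> 1" using pos by (auto simp: t_def)
    have pw: "norm (f w + g w) powr p \<le>
       (a + b) powr p * (t * (norm (f w) powr p / a powr p) + (1 - t) * (norm (g w) powr p / b powr p))" for w
    proof -
      have "norm (f w + g w) powr p \<le> (norm (f w) + norm (g w)) powr p"
        using p by (intro powr_mono2) (auto intro: norm_triangle_ineq)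
      also have "norm (f w) + norm (g w) = (a + b) * (t * (norm (f w) / a) + (1 - t) * (norm (g w) / b))"
      proof -
        have "(a + b) * t = a" "(a + b) * (1 - t) = b" using pos by (auto simp: t_def field_simps)
        then have "(a + b) * (t * (norm (f w) / a) + (1 - t) * (norm (g w) / b))
            = a * (norm (f w) / a) + b * (norm (g w) / b)"
          by (metis (no_types) distrib_left mult.assoc)
        then show ?thesis using pos by simp
      qed
      also have "\<dots> powr p = (a + b) powr p * (t * (norm (f w) / a) + (1 - t) * (norm (g w) / b)) powr p"
        using pos t by (intro powr_mult)
      also have "\<dots> \<le> (a + b) powr p * (t * (norm (f w) / a) powr p + (1 - t) * (norm (g w) / b) powr p)"
        using pos t p by (intro mult_left_mono powr_convex_comb) auto
      finally show ?thesis using pos by (simp add: powr_divide)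
    qed
    have i: "integrable M (\<lambda>w. norm (f w) powr p)" "integrable M (\<lambda>w. norm (g w) powr p)"
      using f g by (auto simp: Lp_def)
    have "(\<integral>w. norm (f w + g w) powr p \<partial>M) \<le> (\<integral>w. (a + b) powr p *
        (t * (norm (f w) powr p / a powr p) + (1 - t) * (norm (g w) powr p / b powr p)) \<partial>M)"
      by (rule integral_mono) (use fg i pw in \<open>auto simp: Lp_def\<close>)
    also have "\<dots> = (a + b) powr p *
       (t * ((\<integral>w. norm (f w) powr p \<partial>M) / a powr p) + (1 - t) * ((\<integral>w. norm (g w) powr p \<partial>M) / b powr p))"
      using i by simp
    also have "\<dots> = (a + b) powr p * (t * 1 + (1 - t) * 1)"
    proof -
      have "(\<integral>w. norm (f w) powr p \<partial>M) = a powr p" "(\<integral>w. norm (g w) powr p \<partial>M) = b powr p"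
        using p Lp_norm_powr[of p M f] Lp_norm_powr[of p M g] by (simp_all add: a_def b_def)
      then show ?thesis using pos by simp
    qed
    finally have "(\<integral>w. norm (f w + g w) powr p \<partial>M) \<le> (a + b) powr p" by simp
    then show ?thesis unfolding a_def[symmetric] b_def[symmetric]
      using nn p by (subst Lp_norm_le_iff) auto
  qed
qed

lemma Lp_norm_triangle_diff:
  assumes "f \<in> Lp M p" "g \<in> Lp M p" "1 \<le> p"
  shows "Lp_norm M p (\<lambda>w. f w - g w) \<le> Lp_norm M p f + Lp_norm M p g"
  using Lp_norm_triangle[OF assms(1) Lp_scaleR[OF assms(2), of "-1"] assms(3)] assms
    Lp_norm_scaleR[of p M "-1" g] by simp

lemma Lp_norm_sum:
  assumes "\<And>i. i \<in> I \<Longrightarrow> f i \<in> Lp M p" "1 \<le> p"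
  shows "Lp_norm M p (\<lambda>w. \<Sum>i\<in>I. f i w) \<le> (\<Sum>i\<in>I. Lp_norm M p (f i))"
  using assms
proof (induction I rule: infinite_finite_induct)
  case (insert x F)
  have "Lp_norm M p (\<lambda>w. f x w + (\<Sum>i\<in>F. f i w)) \<le> Lp_norm M p (f x) + Lp_norm M p (\<lambda>w. \<Sum>i\<in>F. f i w)"
    by (rule Lp_norm_triangle) (use insert in \<open>auto intro!: Lp_sum\<close>)
  then show ?case using insert by auto
qed auto

lemma Lp_norm_dist_le:
  assumes "f \<in> Lp M p" "g \<in> Lp M p" "1 \<le> p"
  shows "\<bar>Lp_norm M p f - Lp_norm M p g\<bar> \<le> Lp_norm M p (\<lambda>w. f w - g w)"
  using Lp_norm_triangle[OF Lp_diff[OF assms] assms(2) assms(3)]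
    Lp_norm_triangle[OF Lp_diff[OF assms(2,1,3)] assms(1) assms(3)]
    Lp_norm_minus_commute[of M p f g] by simp

lemma Lp_norm_diff_triangle:
  assumes "f \<in> Lp M p" "g \<in> Lp M p" "h \<in> Lp M p" "1 \<le> p"
  shows "Lp_norm M p (\<lambda>w. f w - h w)
    \<le> Lp_norm M p (\<lambda>w. f w - g w) + Lp_norm M p (\<lambda>w. g w - h w)"
  using Lp_norm_triangle[OF Lp_diff[OF assms(1,2,4)] Lp_diff[OF assms(2,3,4)] assms(4)] by simp

lemma tendsto_powr_0:
  fixes f :: "nat \<Rightarrow> real"
  assumes "f \<longlonglongrightarrow> 0" "0 < a" "\<And>n. 0 \<le> f n"
  shows "(\<lambda>n. f n powr a) \<longlonglongrightarrow> 0"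
  using tendsto_powr'[OF assms(1) tendsto_const[of a]] assms by auto

lemma Lp_dominated_convergence:
  assumes f: "\<And>n. strongly_measurable M (f n)" "strongly_measurable M f'"
    and g: "integrable M (\<lambda>\<omega>. g \<omega> powr p)" and p: "0 < p"
    and b: "\<And>n. AE \<omega> in M. norm (f n \<omega>) \<le> g \<omega>"
    and lim: "AE \<omega> in M. (\<lambda>n. f n \<omega>) \<longlonglongrightarrow> f' \<omega>"
  shows "(\<lambda>n. Lp_norm M p (\<lambda>\<omega>. f n \<omega> - f' \<omega>)) \<longlonglongrightarrow> 0"
proof -
  have b': "AE \<omega> in M. \<forall>n. norm (f n \<omega>) \<le> g \<omega>" using b by (simp add: AE_all_countable)
  have b2: "AE \<omega> in M. norm (f' \<omega>) \<le> g \<omega>" using b' lim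
  proof eventually_elim
    case (elim \<omega>)
    show ?case by (rule LIMSEQ_le_const2[OF tendsto_norm[OF elim(2)]]) (use elim in auto)
  qed
  have sm: "strongly_measurable M (\<lambda>\<omega>. f n \<omega> - f' \<omega>)" for n
    using strongly_measurable_add[OF f(1)[of n] strongly_measurable_scaleR[OF strongly_measurable_const f(2), of "-1"]] by simp
  note [measurable] = strongly_measurable_norm[OF sm]
  have "(\<lambda>n. \<integral>\<omega>. norm (f n \<omega> - f' \<omega>) powr p \<partial>M) \<longlonglongrightarrow> (\<integral>\<omega>. 0 \<partial>M)"
  proof (rule integral_dominated_convergence[where w="\<lambda>\<omega>. 2 powr p * g \<omega> powr p"])
    show "integrable M (\<lambda>\<omega>. 2 powr p * g \<omega> powr p)" using g by simp
    show "AE \<omega> in M. (\<lambda>n. norm (f n \<omega> - f' \<omega>) powr p) \<longlonglongrightarrow> 0" using lim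
    proof eventually_elim
      case (elim \<omega>)
      have "(\<lambda>n. norm (f n \<omega> - f' \<omega>)) \<longlonglongrightarrow> 0" using elim LIM_zero tendsto_norm_zero by blast
      then show ?case using p by (intro tendsto_powr_0) auto
    qed
    show "AE \<omega> in M. norm (norm (f n \<omega> - f' \<omega>) powr p) \<le> 2 powr p * g \<omega> powr p" for n
      using b' b2
    proof eventually_elim
      case (elim \<omega>)
      have "norm (f n \<omega> - f' \<omega>) \<le> 2 * g \<omega>" using elim norm_triangle_ineq4[of "f n \<omega>" "f' \<omega>"]
        by (smt (verit, best))
      moreover have "0 \<le> g \<omega>" using elim(2) norm_ge_zero order_trans by blast
      ultimately have "norm (f n \<omega> - f' \<omega>) powr p \<le> (2 * g \<omega>) powr p" using p by (intro powr_mono2) auto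
      then show ?case using \<open>0 \<le> g \<omega>\<close> by (simp add: powr_mult)
    qed
  qed auto
  then have "(\<lambda>n. (\<integral>\<omega>. norm (f n \<omega> - f' \<omega>) powr p \<partial>M) powr (1 / p)) \<longlonglongrightarrow> 0"
    using p by (intro tendsto_powr_0) auto
  then show ?thesis by (simp add: Lp_norm_def)
qed

text \<open>Weighted arithmetic-geometric mean inequality for \<open>x powr q\<close> and 1, with
  weights \<open>p / q\<close> and \<open>1 - p / q\<close>. It is the source of the monotonicity of
  the norms in the exponent.\<close>

lemma powr_le_affine:
  fixes x p q :: real
  assumes "0 \<le> x" "0 < p" "p \<le> q"
  shows "x powr p \<le> (p / q) * x powr q + (1 - p / q)"
proof (cases "x = 0")
  case False
  have "(x powr q) powr (p / q) * 1 powr (1 - p / q) \<le> (p / q) * x powr q + (1 - p / q) * 1"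
    by (rule Youngs_inequality_0) (use assms False in auto)
  then show ?thesis using assms by (simp add: powr_powr)
qed (use assms in auto)

section \<open>Inclusions between Lp spaces over a probability space\<close>

context prob_space
begin

lemma Lp_subset:
  assumes "f \<in> Lp M q" "0 < p" "p \<le> q"
  shows "f \<in> Lp M p"
proof -
  note [measurable] = strongly_measurable_norm[OF LpD(1)[OF assms(1)]]
  have "integrable M (\<lambda>w. norm (f w) powr p)"
  proof (rule Bochner_Integration.integrable_bound)
    show "integrable M (\<lambda>w. (p / q) * norm (f w) powr q + (1 - p / q))"
      using LpD(2)[OF assms(1)] by simp
    show "AE w in M. norm (norm (f w) powr p) \<le> norm ((p / q) * norm (f w) powr q + (1 - p / q))"
    proof (rule AE_I2)
      fix w
      have "\<bar>norm (f w) powr p\<bar> \<le> (p / q) * norm (f w) powr q + (1 - p / q)"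
        using powr_le_affine[OF norm_ge_zero assms(2,3)] by simp
      then show "norm (norm (f w) powr p) \<le> norm ((p / q) * norm (f w) powr q + (1 - p / q))"
        unfolding real_norm_def using abs_ge_self order_trans by blast
    qed
  qed measurable
  then show ?thesis using LpD(1)[OF assms(1)] by (simp add: Lp_def)
qed

text \<open>After dividing \<open>f\<close> by its norm of order \<open>q\<close>, the affine bound
  integrates to \<open>p / q + (1 - p / q) = 1\<close>, because the total mass is 1.\<close>

lemma Lp_norm_mono_exponent:
  assumes f: "f \<in> Lp M q" and pq: "0 < p" "p \<le> q"
  shows "Lp_norm M p f \<le> Lp_norm M q f"
proof (cases "Lp_norm M q f = 0")
  case True
  then have "AE w in M. f w = 0" using Lp_norm_eq_0_iff[OF f] pq by auto
  then have "Lp_norm M p f = 0" using Lp_norm_eq_0_iff[OF Lp_subset[OF f pq]] pq by auto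
  then show ?thesis by simp
next
  case False
  define a where "a = Lp_norm M q f"
  have a: "0 < a" using False by (simp add: a_def order_less_le)
  note i = LpD(2)[OF f] LpD(2)[OF Lp_subset[OF f pq]]
  have "(\<integral>w. norm (f w) powr p / a powr p \<partial>M) \<le> (\<integral>w. (p / q) * (norm (f w) powr q / a powr q) + (1 - p / q) \<partial>M)"
  proof (rule integral_mono)
    fix w
    show "norm (f w) powr p / a powr p \<le> (p / q) * (norm (f w) powr q / a powr q) + (1 - p / q)"
      using powr_le_affine[of "norm (f w) / a" p q] a pq by (simp add: powr_divide)
  qed (use i in auto)
  also have "\<dots> = (p / q) * ((\<integral>w. norm (f w) powr q \<partial>M) / a powr q) + (1 - p / q)"
    using i by (simp add: prob_space)
  also have "(\<integral>w. norm (f w) powr q \<partial>M) = a powr q"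
    using Lp_norm_powr[of q M f] pq by (simp add: a_def)
  finally have "(\<integral>w. norm (f w) powr p \<partial>M) \<le> a powr p" using a by (simp add: field_simps)
  then show ?thesis unfolding a_def[symmetric] using a pq by (subst Lp_norm_le_iff) auto
qed

lemma Lp_bounded:
  assumes "strongly_measurable M f" "\<And>w. norm (f w) \<le> B" "0 \<le> p"
  shows "f \<in> Lp M p"
  by (rule Lp_bound[OF assms(1), of "\<lambda>_. B"]) (use assms in auto)

end

section \<open>Density of simple functions, completeness and extension of bounded operators\<close>

lemma Lp_simple_dense:
  assumes f: "f \<in> Lp M p" and p: "1 \<le> p" and e: "0 < e"
  shows "\<exists>s. simple_function M s \<and> s \<in> Lp M p \<and> Lp_norm M p (\<lambda>w. f w - s w) < e"
proof -
  obtain s where s: "\<And>i. simple_function M (s i)" "\<And>w. w \<in> space M \<Longrightarrow> (\<lambda>i. s i w) \<longlonglongrightarrow> f w"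
    using LpD(1)[OF f] unfolding strongly_measurable_def by blast
  \<comment> \<open>Truncation yields the integrable majorant \<open>2 * norm (f w)\<close> and
    keeps the pointwise limit: where \<open>f w\<close> is nonzero the truncation is eventually
    inactive, and where \<open>f w = 0\<close> all \<open>t i w\<close> are 0.\<close>
  define t where "t i w = (if norm (s i w) \<le> 2 * norm (f w) then s i w else 0)" for i w
  note [measurable] = strongly_measurable_norm[OF LpD(1)[OF f]]
  have [measurable]: "(\<lambda>w. norm (s i w)) \<in> borel_measurable M" for i
    using strongly_measurable_norm[OF strongly_measurable_simple[OF s(1)]] .
  have t: "simple_function M (t i)" for i
    unfolding t_def
  proof (rule simple_function_If)
    show "simple_function M (s i)" by (rule s)
    show "{x \<in> space M. norm (s i x) \<le> 2 * norm (f x)} \<in> sets M" by measurable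
  qed auto
  have b: "norm (t i w) \<le> 2 * norm (f w)" for i w by (simp add: t_def)
  have g: "integrable M (\<lambda>w. (2 * norm (f w)) powr p)" using LpD(2)[OF f] by (simp add: powr_mult)
  have lim: "(\<lambda>i. t i w) \<longlonglongrightarrow> f w" if "w \<in> space M" for w
  proof (cases "f w = 0")
    case True
    have "t i w = 0" for i using b[of i w] True by simp
    then show ?thesis using True by simp
  next
    case False
    have "(\<lambda>i. norm (s i w)) \<longlonglongrightarrow> norm (f w)" using s(2)[OF that] by (rule tendsto_norm)
    then have "\<forall>\<^sub>F i in sequentially. norm (s i w) < 2 * norm (f w)"
      by (rule order_tendstoD) (use False in auto)
    then have "\<forall>\<^sub>F i in sequentially. s i w = t i w" by eventually_elim (auto simp: t_def)
    then show ?thesis by (rule Lim_transform_eventually[OF s(2)[OF that]])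
  qed
  have "(\<lambda>i. Lp_norm M p (\<lambda>w. t i w - f w)) \<longlonglongrightarrow> 0"
    by (rule Lp_dominated_convergence[where g="\<lambda>w. 2 * norm (f w)"])
       (use t LpD(1)[OF f] g p b lim in \<open>auto intro: strongly_measurable_simple\<close>)
  from order_tendstoD(2)[OF this e] obtain i where "Lp_norm M p (\<lambda>w. t i w - f w) < e"
    by (auto simp: eventually_sequentially)
  moreover have "t i \<in> Lp M p"
    by (rule Lp_bound[OF strongly_measurable_simple[OF t] g]) (use b p in auto)
  ultimately show ?thesis using t[of i] Lp_norm_minus_commute[of M p f "t i"] by auto
qed

text \<open>The Riesz-Fischer argument, run on simple functions close to a fast subsequence, so that
  the limit is strongly measurable by construction. The increments are summable almost everywhere,
  since the norm of order 1 is at most that of order \<open>p\<close>; Fatou's lemma bounds the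
  distance to the limit.\<close>

lemma (in prob_space) Lp_complete:
  assumes f: "\<And>n. f n \<in> Lp M p" and p: "1 \<le> p"
    and C: "\<And>e. 0 < e \<Longrightarrow> \<exists>N. \<forall>m\<ge>N. \<forall>n\<ge>N. Lp_norm M p (\<lambda>w. f m w - f n w) < e"
  shows "\<exists>g\<in>Lp M (p :: real). (\<lambda>n. Lp_norm M p (\<lambda>w. f n w - g w :: 'b :: banach)) \<longlonglongrightarrow> 0"
proof -
  define e where "e j = (1/2 :: real) ^ j" for j :: nat
  have e: "0 < e j" for j by (simp add: e_def)
  have "\<forall>j. \<exists>K. \<forall>m\<ge>K. \<forall>n\<ge>K. Lp_norm M p (\<lambda>w. f m w - f n w) < e j"
    using C[OF e] by blast
  from choice[OF this] obtain N
    where "\<forall>j. \<forall>m\<ge>N j. \<forall>n\<ge>N j. Lp_norm M p (\<lambda>w. f m w - f n w) < e j" by (elim exE)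
  then have N: "Lp_norm M p (\<lambda>w. f m w - f n w) < e j" if "N j \<le> m" "N j \<le> n" for j m n
    using that by simp
  \<comment> \<open>The maximum makes \<open>r j\<close> dominate \<open>N i\<close> for every
    \<open>i \<le> j\<close>, so that \<open>f (r j)\<close> and \<open>f (r i)\<close> are within
    \<open>e j\<close> of each other whenever \<open>j \<le> i\<close>.\<close>
  define r where "r j = Max (N ` {..j}) + j" for j
  have rN: "N i \<le> r j" if "i \<le> j" for i j
    unfolding r_def by (rule trans_le_add1, rule Max_ge) (use that in auto)
  have "\<forall>j. \<exists>s. simple_function M s \<and> s \<in> Lp M p \<and> Lp_norm M p (\<lambda>w. f (r j) w - s w) < e j"
    using Lp_simple_dense[OF f p e] by blast
  from choice[OF this] obtain s
    where "\<forall>j. simple_function M (s j) \<and> s j \<in> Lp M p \<and> Lp_norm M p (\<lambda>w. f (r j) w - s j w) < e j"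
    by (elim exE)
  then have s: "simple_function M (s j)" "s j \<in> Lp M p"
    "Lp_norm M p (\<lambda>w. f (r j) w - s j w) < e j" for j by simp_all
  have d: "Lp_norm M p (\<lambda>w. s j w - s i w) \<le> 3 * e j" if "j \<le> i" for i j
  proof -
    have "Lp_norm M p (\<lambda>w. s j w - s i w) \<le> Lp_norm M p (\<lambda>w. s j w - f (r j) w)
       + (Lp_norm M p (\<lambda>w. f (r j) w - f (r i) w) + Lp_norm M p (\<lambda>w. f (r i) w - s i w))"
      using Lp_norm_diff_triangle[OF s(2) f s(2) p, of j i "r j"]
        Lp_norm_diff_triangle[OF f f s(2) p, of "r j" i "r i"] by linarith
    also have "\<dots> \<le> e j + (e j + e i)"
      using s(3)[of j] s(3)[of i] N[of j "r j" "r i"] rN[of j j] rN[of j i] that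
        Lp_norm_minus_commute[of M p "f (r j)" "s j"] by (intro add_mono) auto
    also have "e i \<le> e j" using that by (auto simp: e_def intro: power_decreasing)
    finally show ?thesis by simp
  qed
  define D where "D j w = norm (s j w - s (Suc j) w)" for j w
  have sd: "strongly_measurable M (\<lambda>w. s j w - s i w)" for i j
    using Lp_diff[OF s(2) s(2) p] LpD(1) by blast
  have [measurable]: "(\<lambda>w. norm (s j w - s i w)) \<in> borel_measurable M" for i j
    using strongly_measurable_norm[OF sd] .
  then have Dm[measurable]: "D j \<in> borel_measurable M" for j unfolding D_def .
  have D1: "(\<integral>\<^sup>+w. ennreal (D j w) \<partial>M) \<le> ennreal (3 * e j)" for j
  proof -
    have L1: "(\<lambda>w. s j w - s (Suc j) w) \<in> Lp M 1"
      by (rule Lp_subset[OF Lp_diff[OF s(2) s(2) p]]) (use p in auto)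
    have "(\<integral>\<^sup>+w. ennreal (D j w) \<partial>M) = ennreal (\<integral>w. D j w \<partial>M)"
      by (rule nn_integral_eq_integral) (use LpD(2)[OF L1] in \<open>auto simp: D_def\<close>)
    also have "(\<integral>w. D j w \<partial>M) = Lp_norm M 1 (\<lambda>w. s j w - s (Suc j) w)"
      by (simp add: Lp_norm_def D_def)
    also have "\<dots> \<le> Lp_norm M p (\<lambda>w. s j w - s (Suc j) w)"
      by (rule Lp_norm_mono_exponent[OF Lp_diff[OF s(2) s(2) p]]) (use p in auto)
    also have "\<dots> \<le> 3 * e j" by (rule d) simp
    finally show ?thesis by (simp add: ennreal_leI)
  qed
  have "(\<integral>\<^sup>+w. (\<Sum>j. ennreal (D j w)) \<partial>M) = (\<Sum>j. \<integral>\<^sup>+w. ennreal (D j w) \<partial>M)"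
    by (rule nn_integral_suminf) measurable
  also have "\<dots> \<le> (\<Sum>j. ennreal (3 * e j))" by (intro suminf_le D1) auto
  also have "\<dots> = ennreal (\<Sum>j. 3 * e j)"
    by (rule suminf_ennreal_eq) (auto simp: e_def intro!: summable_sums summable_mult)
  finally have fin: "(\<integral>\<^sup>+w. (\<Sum>j. ennreal (D j w)) \<partial>M) \<noteq> \<infinity>"
    by (auto simp: top_unique)
  have "AE w in M. (\<Sum>j. ennreal (D j w)) \<noteq> \<infinity>"
    by (rule nn_integral_PInf_AE[OF _ fin]) measurable
  note AEt = this
  have smb: "summable (\<lambda>j. D j w)" if "(\<Sum>j. ennreal (D j w)) \<noteq> \<infinity>" for w
    using that by (auto simp: D_def intro!: summable_suminf_not_top)
  have conv: "convergent (\<lambda>j. s j w)" if "summable (\<lambda>j. D j w)" for w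
  proof -
    have "summable (\<lambda>j. norm (s (Suc j) w - s j w))"
      using that by (simp add: D_def norm_minus_commute)
    then have "summable (\<lambda>j. s (Suc j) w - s j w)" by (rule summable_norm_cancel)
    then have "convergent (\<lambda>n. \<Sum>j<n. s (Suc j) w - s j w)" by (simp add: summable_iff_convergent)
    then have "convergent (\<lambda>n. s n w - s 0 w)" by (simp only: sum_lessThan_telescope[of "\<lambda>j. s j w"])
    then have "convergent (\<lambda>n. (s n w - s 0 w) + s 0 w)" by (intro convergent_add convergent_const)
    then show ?thesis by simp
  qed
  \<comment> \<open>The set where the increments are not summable is measurable, so cutting it off
    leaves the approximants simple and makes them converge at every point.\<close>
  define g where "g w = (if (\<Sum>j. ennreal (D j w)) \<noteq> \<infinity> then lim (\<lambda>j. s j w) else 0)" for w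
  have gsm: "strongly_measurable M g"
    unfolding strongly_measurable_def
  proof (intro exI conjI allI ballI)
    fix j
    show "simple_function M (\<lambda>w. if (\<Sum>j. ennreal (D j w)) \<noteq> \<infinity> then s j w else 0)"
      by (rule simple_function_If) (use s in auto)
  next
    fix w
    show "(\<lambda>j. if (\<Sum>j. ennreal (D j w)) \<noteq> \<infinity> then s j w else 0) \<longlonglongrightarrow> g w"
      using conv[OF smb, of w] by (auto simp: g_def convergent_LIMSEQ_iff)
  qed
  have lim: "AE w in M. (\<lambda>i. s i w) \<longlonglongrightarrow> g w" using AEt
    by eventually_elim (use conv[OF smb] in \<open>auto simp: g_def convergent_LIMSEQ_iff\<close>)
  have sgm: "strongly_measurable M (\<lambda>w. s j w - g w)" for j
    using strongly_measurable_add[OF LpD(1)[OF s(2)] strongly_measurable_scaleR[OF strongly_measurable_const gsm, of "-1"]] by simp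
  note [measurable] = strongly_measurable_norm[OF sgm]
  have F: "(\<integral>\<^sup>+w. ennreal (norm (s j w - g w) powr p) \<partial>M) \<le> ennreal ((3 * e j) powr p)" for j
  proof -
    have "(\<integral>\<^sup>+w. ennreal (norm (s j w - g w) powr p) \<partial>M)
       = (\<integral>\<^sup>+w. liminf (\<lambda>i. ennreal (norm (s j w - s i w) powr p)) \<partial>M)"
    proof (rule nn_integral_cong_AE, use lim in eventually_elim)
      case (elim w)
      have "(\<lambda>i. ennreal (norm (s j w - s i w) powr p)) \<longlonglongrightarrow> ennreal (norm (s j w - g w) powr p)"
        using p by (intro tendsto_ennrealI tendsto_powr' tendsto_norm tendsto_diff tendsto_const elim) auto
      from lim_imp_Liminf[OF _ this] show ?case by simp
    qed
    also have "\<dots> \<le> liminf (\<lambda>i. \<integral>\<^sup>+w. ennreal (norm (s j w - s i w) powr p) \<partial>M)"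
      by (rule nn_integral_liminf) measurable
    also have "\<dots> \<le> ennreal ((3 * e j) powr p)"
    proof -
      have "(\<integral>\<^sup>+w. ennreal (norm (s j w - s i w) powr p) \<partial>M) \<le> ennreal ((3 * e j) powr p)" if "j \<le> i" for i
      proof -
        have "(\<integral>\<^sup>+w. ennreal (norm (s j w - s i w) powr p) \<partial>M) = ennreal (\<integral>w. norm (s j w - s i w) powr p \<partial>M)"
          by (rule nn_integral_eq_integral) (use LpD(2)[OF Lp_diff[OF s(2) s(2) p]] in auto)
        then show ?thesis using d[OF that] p e[of j] by (subst (asm) Lp_norm_le_iff) (auto intro!: ennreal_leI)
      qed
      then show ?thesis
        by (intro Liminf_le) (auto simp: eventually_sequentially intro!: exI[of _ j])
    qed
    finally show ?thesis .
  qed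
  have sg: "(\<lambda>w. s j w - g w) \<in> Lp M p" for j
  proof -
    have "integrable M (\<lambda>w. norm (s j w - g w) powr p)"
      by (rule integrableI_bounded) (use F[of j] in \<open>auto simp: less_top[symmetric] top_unique\<close>)
    then show ?thesis using sgm by (simp add: Lp_def)
  qed
  have g: "g \<in> Lp M p" using Lp_diff[OF s(2)[of 0] sg[of 0] p] by simp
  have sgn: "Lp_norm M p (\<lambda>w. s j w - g w) \<le> 3 * e j" for j
  proof -
    have "ennreal (\<integral>w. norm (s j w - g w) powr p \<partial>M) \<le> ennreal ((3 * e j) powr p)"
      using F[of j] by (subst nn_integral_eq_integral[symmetric]) (use LpD(2)[OF sg] in auto)
    then show ?thesis using p e[of j] by (subst Lp_norm_le_iff) auto
  qed
  have main: "Lp_norm M p (\<lambda>w. f n w - g w) \<le> 5 * e j" if "r j \<le> n" for j n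
  proof -
    have "Lp_norm M p (\<lambda>w. f n w - g w) \<le> Lp_norm M p (\<lambda>w. f n w - f (r j) w)
       + (Lp_norm M p (\<lambda>w. f (r j) w - s j w) + Lp_norm M p (\<lambda>w. s j w - g w))"
      using Lp_norm_diff_triangle[OF f f g p, of n "r j"]
        Lp_norm_diff_triangle[OF f s(2) g p, of "r j" j] by linarith
    also have "\<dots> \<le> e j + (e j + 3 * e j)"
      using s(3)[of j] N[of j n "r j"] rN[of j j] that sgn[of j] by (intro add_mono) auto
    finally show ?thesis by simp
  qed
  have "(\<lambda>n. Lp_norm M p (\<lambda>w. f n w - g w)) \<longlonglongrightarrow> 0"
  proof (rule LIMSEQ_I)
    fix c :: real assume "0 < c"
    have "(\<lambda>j. 5 * e j) \<longlonglongrightarrow> 0" unfolding e_def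
      by (intro tendsto_mult_right_zero LIMSEQ_realpow_zero) auto
    from order_tendstoD(2)[OF this \<open>0 < c\<close>] obtain j where "5 * e j < c" by (auto simp: eventually_sequentially)
    then show "\<exists>no. \<forall>n\<ge>no. norm (Lp_norm M p (\<lambda>w. f n w - g w) - 0) < c"
      using main[of j] by (intro exI[of _ "r j"]) fastforce
  qed
  then show ?thesis using g by blast
qed

text \<open>The extension is a choice from \<open>rel\<close>, the closure of the graph of
  \<open>T0\<close>. Density and completeness make the domain of this closure the whole space, the
  bound makes it single-valued up to null sets, and linearity passes to limits of pairs.\<close>

lemma (in prob_space) Lp_extension:
  fixes T0 :: "('a \<Rightarrow> 'b::banach) \<Rightarrow> ('a \<Rightarrow> 'b)" and p :: real
  assumes p: "1 \<le> p" and V: "V \<subseteq> Lp M p"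
    and Vadd: "\<And>f g. f \<in> V \<Longrightarrow> g \<in> V \<Longrightarrow> (\<lambda>w. f w + g w) \<in> V"
    and Vscale: "\<And>f c. f \<in> V \<Longrightarrow> (\<lambda>w. c *\<^sub>R f w) \<in> V"
    and dense: "\<And>f e. f \<in> Lp M p \<Longrightarrow> 0 < e \<Longrightarrow> \<exists>v\<in>V. Lp_norm M p (\<lambda>w. f w - v w) < e"
    and T: "\<And>f. f \<in> V \<Longrightarrow> T0 f \<in> Lp M p"
    and Tadd: "\<And>f g. f \<in> V \<Longrightarrow> g \<in> V \<Longrightarrow> AE w in M. T0 (\<lambda>w. f w + g w) w = T0 f w + T0 g w"
    and Tscale: "\<And>f c. f \<in> V \<Longrightarrow> AE w in M. T0 (\<lambda>w. c *\<^sub>R f w) w = c *\<^sub>R T0 f w"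
    and Tb: "\<And>f. f \<in> V \<Longrightarrow> Lp_norm M p (T0 f) \<le> C * Lp_norm M p f"
  shows "\<exists>T. Lp_operator M p T \<and> (\<forall>v\<in>V. AE w in M. T v w = T0 v w)"
proof -
  have p0: "0 < p" using p by simp
  define rel where "rel f g \<longleftrightarrow> f \<in> Lp M p \<and> g \<in> Lp M p \<and> (\<exists>v. (\<forall>j. v j \<in> V) \<and>
     (\<lambda>j. Lp_norm M p (\<lambda>w. v j w - f w)) \<longlonglongrightarrow> 0 \<and> (\<lambda>j. Lp_norm M p (\<lambda>w. T0 (v j) w - g w)) \<longlonglongrightarrow> 0)" for f g
  have radd: "rel (\<lambda>w. f w + f' w) (\<lambda>w. g w + g' w)" if r: "rel f g" "rel f' g'" for f f' g g'
  proof -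
    obtain v v' where v: "\<And>j. v j \<in> V" "(\<lambda>j. Lp_norm M p (\<lambda>w. v j w - f w)) \<longlonglongrightarrow> 0"
        "(\<lambda>j. Lp_norm M p (\<lambda>w. T0 (v j) w - g w)) \<longlonglongrightarrow> 0"
      and v': "\<And>j. v' j \<in> V" "(\<lambda>j. Lp_norm M p (\<lambda>w. v' j w - f' w)) \<longlonglongrightarrow> 0"
        "(\<lambda>j. Lp_norm M p (\<lambda>w. T0 (v' j) w - g' w)) \<longlonglongrightarrow> 0"
      using r unfolding rel_def by blast
    have L: "f \<in> Lp M p" "g \<in> Lp M p" "f' \<in> Lp M p" "g' \<in> Lp M p" using r by (auto simp: rel_def)
    have "(\<lambda>j. Lp_norm M p (\<lambda>w. (v j w + v' j w) - (f w + f' w))) \<longlonglongrightarrow> 0"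
    proof (rule Lim_null_comparison)
      show "\<forall>\<^sub>F j in sequentially. norm (Lp_norm M p (\<lambda>w. (v j w + v' j w) - (f w + f' w)))
         \<le> Lp_norm M p (\<lambda>w. v j w - f w) + Lp_norm M p (\<lambda>w. v' j w - f' w)"
      proof (rule always_eventually, rule allI)
        fix j
        show "norm (Lp_norm M p (\<lambda>w. (v j w + v' j w) - (f w + f' w)))
         \<le> Lp_norm M p (\<lambda>w. v j w - f w) + Lp_norm M p (\<lambda>w. v' j w - f' w)"
          using Lp_norm_triangle[OF Lp_diff[OF _ L(1) p] Lp_diff[OF _ L(3) p] p, of "v j" "v' j"] v(1) v'(1) V
          by (simp add: algebra_simps subset_iff)
      qed
      show "(\<lambda>j. Lp_norm M p (\<lambda>w. v j w - f w) + Lp_norm M p (\<lambda>w. v' j w - f' w)) \<longlonglongrightarrow> 0"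
        using tendsto_add[OF v(2) v'(2)] by simp
    qed
    moreover have "(\<lambda>j. Lp_norm M p (\<lambda>w. T0 (\<lambda>w. v j w + v' j w) w - (g w + g' w))) \<longlonglongrightarrow> 0"
    proof (rule Lim_null_comparison)
      show "\<forall>\<^sub>F j in sequentially. norm (Lp_norm M p (\<lambda>w. T0 (\<lambda>w. v j w + v' j w) w - (g w + g' w)))
         \<le> Lp_norm M p (\<lambda>w. T0 (v j) w - g w) + Lp_norm M p (\<lambda>w. T0 (v' j) w - g' w)"
      proof (rule always_eventually, rule allI)
        fix j
        have "Lp_norm M p (\<lambda>w. T0 (\<lambda>w. v j w + v' j w) w - (g w + g' w))
            = Lp_norm M p (\<lambda>w. (T0 (v j) w - g w) + (T0 (v' j) w - g' w))"
        proof (rule Lp_norm_cong_AE)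
          show "strongly_measurable M (\<lambda>w. T0 (\<lambda>w. v j w + v' j w) w - (g w + g' w))"
            by (rule LpD(1)[OF Lp_diff[OF T[OF Vadd[OF v(1) v'(1)]] Lp_add[OF L(2,4) p] p]])
          show "strongly_measurable M (\<lambda>w. (T0 (v j) w - g w) + (T0 (v' j) w - g' w))"
            by (rule LpD(1)[OF Lp_add[OF Lp_diff[OF T[OF v(1)] L(2) p] Lp_diff[OF T[OF v'(1)] L(4) p] p]])
          show "AE w in M. T0 (\<lambda>w. v j w + v' j w) w - (g w + g' w) = (T0 (v j) w - g w) + (T0 (v' j) w - g' w)"
            using Tadd[OF v(1) v'(1), of j j] by eventually_elim simp
        qed
        also have "\<dots> \<le> Lp_norm M p (\<lambda>w. T0 (v j) w - g w) + Lp_norm M p (\<lambda>w. T0 (v' j) w - g' w)"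
          by (rule Lp_norm_triangle[OF Lp_diff[OF T[OF v(1)] L(2) p] Lp_diff[OF T[OF v'(1)] L(4) p] p])
        finally show "norm (Lp_norm M p (\<lambda>w. T0 (\<lambda>w. v j w + v' j w) w - (g w + g' w)))
         \<le> Lp_norm M p (\<lambda>w. T0 (v j) w - g w) + Lp_norm M p (\<lambda>w. T0 (v' j) w - g' w)" by simp
      qed
      show "(\<lambda>j. Lp_norm M p (\<lambda>w. T0 (v j) w - g w) + Lp_norm M p (\<lambda>w. T0 (v' j) w - g' w)) \<longlonglongrightarrow> 0"
        using tendsto_add[OF v(3) v'(3)] by simp
    qed
    ultimately show ?thesis unfolding rel_def using L p v(1) v'(1) Vadd
      by (intro conjI Lp_add exI[of _ "\<lambda>j w. v j w + v' j w"]) auto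
  qed
  have rscale: "rel (\<lambda>w. c *\<^sub>R f w) (\<lambda>w. c *\<^sub>R g w)" if r: "rel f g" for f g c
  proof -
    obtain v where v: "\<And>j. v j \<in> V" "(\<lambda>j. Lp_norm M p (\<lambda>w. v j w - f w)) \<longlonglongrightarrow> 0"
        "(\<lambda>j. Lp_norm M p (\<lambda>w. T0 (v j) w - g w)) \<longlonglongrightarrow> 0"
      using r unfolding rel_def by blast
    have L: "f \<in> Lp M p" "g \<in> Lp M p" using r by (auto simp: rel_def)
    have "(\<lambda>j. Lp_norm M p (\<lambda>w. c *\<^sub>R v j w - c *\<^sub>R f w)) \<longlonglongrightarrow> 0"
      using tendsto_mult_right_zero[OF v(2), of "\<bar>c\<bar>"]
      by (simp add: scaleR_diff_right[symmetric] Lp_norm_scaleR[OF p0])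
    moreover have "(\<lambda>j. Lp_norm M p (\<lambda>w. T0 (\<lambda>w. c *\<^sub>R v j w) w - c *\<^sub>R g w)) \<longlonglongrightarrow> 0"
    proof -
      have "Lp_norm M p (\<lambda>w. T0 (\<lambda>w. c *\<^sub>R v j w) w - c *\<^sub>R g w) = Lp_norm M p (\<lambda>w. c *\<^sub>R (T0 (v j) w - g w))" for j
      proof (rule Lp_norm_cong_AE)
        show "strongly_measurable M (\<lambda>w. T0 (\<lambda>w. c *\<^sub>R v j w) w - c *\<^sub>R g w)"
          by (rule LpD(1)[OF Lp_diff[OF T[OF Vscale[OF v(1)]] Lp_scaleR[OF L(2)] p]])
        show "strongly_measurable M (\<lambda>w. c *\<^sub>R (T0 (v j) w - g w))"
          by (rule LpD(1)[OF Lp_scaleR[OF Lp_diff[OF T[OF v(1)] L(2) p]]])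
        show "AE w in M. T0 (\<lambda>w. c *\<^sub>R v j w) w - c *\<^sub>R g w = c *\<^sub>R (T0 (v j) w - g w)"
          using Tscale[OF v(1), of c j] by eventually_elim (simp add: scaleR_diff_right)
      qed
      then show ?thesis
        using tendsto_mult_right_zero[OF v(3), of "\<bar>c\<bar>"] by (simp add: Lp_norm_scaleR[OF p0])
    qed
    ultimately show ?thesis unfolding rel_def using L p v(1) Vscale
      by (intro conjI Lp_scaleR exI[of _ "\<lambda>j w. c *\<^sub>R v j w"]) auto
  qed
  have rbound: "Lp_norm M p g \<le> C * Lp_norm M p f" if r: "rel f g" for f g
  proof -
    obtain v where v: "\<And>j. v j \<in> V" "(\<lambda>j. Lp_norm M p (\<lambda>w. v j w - f w)) \<longlonglongrightarrow> 0"
        "(\<lambda>j. Lp_norm M p (\<lambda>w. T0 (v j) w - g w)) \<longlonglongrightarrow> 0"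
      using r unfolding rel_def by blast
    have L: "f \<in> Lp M p" "g \<in> Lp M p" using r by (auto simp: rel_def)
    have 1: "(\<lambda>j. Lp_norm M p (v j)) \<longlonglongrightarrow> Lp_norm M p f"
      by (rule LIM_zero_cancel, rule Lim_null_comparison[OF _ v(2)])
         (use Lp_norm_dist_le[OF _ L(1) p] v(1) V in \<open>auto intro!: always_eventually\<close>)
    have 2: "(\<lambda>j. Lp_norm M p (T0 (v j))) \<longlonglongrightarrow> Lp_norm M p g"
      by (rule LIM_zero_cancel, rule Lim_null_comparison[OF _ v(3)])
         (use Lp_norm_dist_le[OF T L(2) p] v(1) V in \<open>auto intro!: always_eventually\<close>)
    show ?thesis
      by (rule LIMSEQ_le[OF 2 tendsto_mult_left[OF 1]]) (use Tb v(1) in auto)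
  qed
  have ruv: "AE w in M. g w = g' w" if r: "rel f g" "rel f g'" for f g g'
  proof -
    have L: "g \<in> Lp M p" "g' \<in> Lp M p" using r by (auto simp: rel_def)
    have "rel (\<lambda>w. f w + (-1) *\<^sub>R f w) (\<lambda>w. g w + (-1) *\<^sub>R g' w)" by (intro radd rscale r)
    from rbound[OF this] have "Lp_norm M p (\<lambda>w. g w - g' w) = 0"
      using Lp_norm_nonneg[of M p "\<lambda>w. g w - g' w"] by simp
    then have "AE w in M. g w - g' w = 0" using Lp_norm_eq_0_iff[OF Lp_diff[OF L p] p0] by simp
    then show ?thesis by eventually_elim simp
  qed
  have rV: "rel v (T0 v)" if "v \<in> V" for v
    unfolding rel_def using that V T by (intro conjI exI[of _ "\<lambda>_. v"]) auto
  have rex: "\<exists>g. rel f g" if f: "f \<in> Lp M p" for f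
  proof -
    have "\<exists>v\<in>V. Lp_norm M p (\<lambda>w. f w - v w) < 1 / real (Suc j)" for j by (rule dense[OF f]) auto
    then obtain v where v: "\<And>j. v j \<in> V" "\<And>j. Lp_norm M p (\<lambda>w. f w - v j w) < 1 / real (Suc j)" by metis
    have vL: "v j \<in> Lp M p" for j using v V by auto
    have lim: "(\<lambda>j. Lp_norm M p (\<lambda>w. v j w - f w)) \<longlonglongrightarrow> 0"
    proof (rule Lim_null_comparison)
      show "\<forall>\<^sub>F j in sequentially. norm (Lp_norm M p (\<lambda>w. v j w - f w)) \<le> 1 / real (Suc j)"
        using v(2) Lp_norm_minus_commute[of M p f] by (intro always_eventually allI) (simp add: less_imp_le)
    qed (rule LIMSEQ_Suc[OF lim_1_over_n])
    have diffb: "Lp_norm M p (\<lambda>w. T0 (v m) w - T0 (v n) w) \<le> \<bar>C\<bar> * Lp_norm M p (\<lambda>w. v m w - v n w)" for m n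
    proof -
      have a: "(\<lambda>w. v m w + (-1) *\<^sub>R v n w) \<in> V" by (intro Vadd Vscale v)
      have "Lp_norm M p (\<lambda>w. T0 (v m) w - T0 (v n) w) = Lp_norm M p (T0 (\<lambda>w. v m w + (-1) *\<^sub>R v n w))"
      proof (rule Lp_norm_cong_AE[OF LpD(1)[OF Lp_diff[OF T T p]] LpD(1)[OF T]])
        show "AE w in M. T0 (v m) w - T0 (v n) w = T0 (\<lambda>w. v m w + (-1) *\<^sub>R v n w) w"
          using Tadd[OF v(1) Vscale[OF v(1)], of m "-1" n] Tscale[OF v(1), of "-1" n]
          by eventually_elim simp
      qed (use v a in auto)
      also have "\<dots> \<le> C * Lp_norm M p (\<lambda>w. v m w + (-1) *\<^sub>R v n w)" by (rule Tb[OF a])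
      also have "\<dots> \<le> \<bar>C\<bar> * Lp_norm M p (\<lambda>w. v m w - v n w)" by (simp add: mult_right_mono)
      finally show ?thesis .
    qed
    have "\<exists>g\<in>Lp M p. (\<lambda>n. Lp_norm M p (\<lambda>w. T0 (v n) w - g w)) \<longlonglongrightarrow> 0"
    proof (rule Lp_complete[OF T[OF v(1)] p])
      fix e :: real assume "0 < e"
      then have e': "0 < e / (2 * (\<bar>C\<bar> + 1))" by simp
      from order_tendstoD(2)[OF lim e'] obtain N where N: "\<And>n. N \<le> n \<Longrightarrow> Lp_norm M p (\<lambda>w. v n w - f w) < e / (2 * (\<bar>C\<bar> + 1))"
        by (auto simp: eventually_sequentially)
      show "\<exists>N. \<forall>m\<ge>N. \<forall>n\<ge>N. Lp_norm M p (\<lambda>w. T0 (v m) w - T0 (v n) w) < e"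
      proof (intro exI[of _ N] allI impI)
        fix m n assume mn: "N \<le> m" "N \<le> n"
        have "Lp_norm M p (\<lambda>w. v m w - v n w) < 2 * (e / (2 * (\<bar>C\<bar> + 1)))"
          using Lp_norm_diff_triangle[OF vL f vL p, of m n] N[OF mn(1)] N[OF mn(2)]
            Lp_norm_minus_commute[of M p f "v n"] by simp
        then have "(\<bar>C\<bar> + 1) * Lp_norm M p (\<lambda>w. v m w - v n w) < e"
          by (simp add: field_simps)
        moreover have "\<bar>C\<bar> * Lp_norm M p (\<lambda>w. v m w - v n w) \<le> (\<bar>C\<bar> + 1) * Lp_norm M p (\<lambda>w. v m w - v n w)"
          by (intro mult_right_mono) auto
        ultimately show "Lp_norm M p (\<lambda>w. T0 (v m) w - T0 (v n) w) < e" using diffb[of m n] by linarith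
      qed
    qed
    then show ?thesis using v(1) lim f unfolding rel_def by blast
  qed
  define T where "T f = (SOME g. rel f g)" for f
  have TT: "rel f (T f)" if "f \<in> Lp M p" for f
    unfolding T_def using rex[OF that] by (rule someI_ex)
  have "Lp_operator M p T"
    unfolding Lp_operator_def
  proof (intro conjI ballI allI exI[of _ C])
    fix f :: "'a \<Rightarrow> 'b" assume f: "f \<in> Lp M p"
    show "T f \<in> Lp M p" using TT[OF f] by (simp add: rel_def)
    show "Lp_norm M p (T f) \<le> C * Lp_norm M p f" by (rule rbound[OF TT[OF f]])
    show "AE w in M. T (\<lambda>w. c *\<^sub>R f w) w = c *\<^sub>R T f w" for c
      by (rule ruv[OF TT[OF Lp_scaleR[OF f]] rscale[OF TT[OF f]]])
    fix g :: "'a \<Rightarrow> 'b" assume g: "g \<in> Lp M p"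
    show "AE w in M. T (\<lambda>w. f w + g w) w = T f w + T g w"
      by (rule ruv[OF TT[OF Lp_add[OF f g p]] radd[OF TT[OF f] TT[OF g]]])
  qed
  moreover have "AE w in M. T v w = T0 v w" if "v \<in> V" for v
    using ruv[OF TT rV[OF that]] that V by blast
  ultimately show ?thesis by blast
qed

section \<open>The discrete cube\<close>

text \<open>A point of the cube is the set \<open>A\<close> of coordinates whose sign is -1. Points
  and indices of Walsh functions are thus both subsets of \<open>S\<close>.\<close>

definition cube :: "nat set \<Rightarrow> nat set measure" where
  "cube S = uniform_count_measure (Pow S)"

definition rsign :: "nat set \<Rightarrow> nat \<Rightarrow> real" where
  "rsign A i = (if i \<in> A then -1 else 1)"

definition walsh :: "nat set \<Rightarrow> nat set \<Rightarrow> real" where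
  "walsh B A = (\<Prod>i\<in>B. rsign A i)"

definition wsum :: "nat set \<Rightarrow> (nat set \<Rightarrow> 'b::real_vector) \<Rightarrow> nat set \<Rightarrow> 'b" where
  "wsum S x A = (\<Sum>B\<in>Pow S. walsh B A *\<^sub>R x B)"

section \<open>Norms and Walsh expansions on the cube\<close>

lemma simple_function_uniform_count_measure:
  assumes "finite X"
  shows "simple_function (uniform_count_measure X) f"
  using assms by (simp add: uniform_count_measure_def)

lemma Lp_uniform_count_measure:
  fixes f :: "'x \<Rightarrow> 'b::real_normed_vector"
  assumes "finite X"
  shows "f \<in> Lp (uniform_count_measure X) p"
proof -
  have "integrable (uniform_count_measure X) (\<lambda>w. norm (f w) powr p)"
    using assms by (simp add: uniform_count_measure_def integrable_point_measure_finite)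
  then show ?thesis using assms
    by (simp add: Lp_def strongly_measurable_simple simple_function_uniform_count_measure)
qed

lemma Lp_norm_uniform_count_measure:
  assumes "finite X"
  shows "Lp_norm (uniform_count_measure X) p f = ((\<Sum>x\<in>X. norm (f x) powr p) / card X) powr (1 / p)"
  using assms by (simp add: Lp_norm_def integral_uniform_count_measure)

lemma Lp_norm_uniform_count_measure_powr:
  assumes "finite X" "0 < p"
  shows "Lp_norm (uniform_count_measure X) p f powr p = (\<Sum>x\<in>X. norm (f x) powr p) / card X"
  using assms by (simp add: Lp_norm_powr integral_uniform_count_measure)

lemma Lp_cube [simp]:
  fixes f :: "nat set \<Rightarrow> 'b::real_normed_vector"
  shows "finite S \<Longrightarrow> f \<in> Lp (cube S) p"
  by (simp add: cube_def Lp_uniform_count_measure)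

lemma Lp_norm_cube_powr:
  assumes "finite S" "0 < p"
  shows "Lp_norm (cube S) p f powr p = (\<Sum>A\<in>Pow S. norm (f A) powr p) / 2 ^ card S"
  using assms by (simp add: cube_def Lp_norm_uniform_count_measure_powr card_Pow)

lemma Lp_norm_cube_cong:
  assumes "finite S" "\<And>A. A \<subseteq> S \<Longrightarrow> f A = g A"
  shows "Lp_norm (cube S) p f = Lp_norm (cube S) p g"
proof -
  have "(\<Sum>A\<in>Pow S. norm (f A) powr p) = (\<Sum>A\<in>Pow S. norm (g A) powr p)"
    by (rule sum.cong) (use assms in auto)
  then show ?thesis using assms(1) unfolding cube_def by (simp add: Lp_norm_uniform_count_measure)
qed

lemma prob_space_cube: "finite S \<Longrightarrow> prob_space (cube S)"
  unfolding cube_def by (rule prob_space_uniform_count_measure) auto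

lemma sum_Pow_insert:
  fixes f :: "'i set \<Rightarrow> 'b::comm_monoid_add"
  assumes "finite S" "i \<notin> S"
  shows "(\<Sum>A\<in>Pow (insert i S). f A) = (\<Sum>A\<in>Pow S. f A + f (insert i A))"
proof -
  have "(\<Sum>A\<in>Pow (insert i S). f A) = (\<Sum>A\<in>Pow S. f A) + (\<Sum>A\<in>insert i ` Pow S. f A)"
    unfolding Pow_insert by (rule sum.union_disjoint) (use assms in auto)
  also have "(\<Sum>A\<in>insert i ` Pow S. f A) = (\<Sum>A\<in>Pow S. f (insert i A))"
    using assms by (subst sum.reindex) (auto intro!: inj_onI)
  finally show ?thesis by (simp add: sum.distrib)
qed

lemma Lp_norm_cube_insert:
  assumes "finite S" "i \<notin> S" "0 < p"
  shows "Lp_norm (cube (insert i S)) p f powr p =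
    (Lp_norm (cube S) p f powr p + Lp_norm (cube S) p (\<lambda>A. f (insert i A)) powr p) / 2"
  using assms by (simp add: Lp_norm_cube_powr sum_Pow_insert sum.distrib field_simps)

lemma walsh_empty [simp]: "walsh {} A = 1"
  by (simp add: walsh_def)

lemma wsum_insert:
  assumes "finite S" "i \<notin> S"
  shows "wsum (insert i S) x A = wsum S x A + rsign A i *\<^sub>R wsum S (\<lambda>B. x (insert i B)) A"
proof -
  have "walsh (insert i B) A = rsign A i * walsh B A" if "B \<in> Pow S" for B
    unfolding walsh_def by (rule prod.insert) (use that assms finite_subset in auto)
  then have "(\<Sum>B\<in>Pow S. walsh (insert i B) A *\<^sub>R x (insert i B))
      = (\<Sum>B\<in>Pow S. rsign A i *\<^sub>R walsh B A *\<^sub>R x (insert i B))"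
    by (intro sum.cong) auto
  then show ?thesis using assms
    by (simp add: wsum_def sum_Pow_insert sum.distrib scaleR_sum_right)
qed

lemma walsh_insert_point: "i \<notin> B \<Longrightarrow> walsh B (insert i A) = walsh B A"
  unfolding walsh_def rsign_def by (rule prod.cong) auto

lemma wsum_add: "wsum S (\<lambda>B. x B + y B) A = wsum S x A + wsum S y A"
  by (simp add: wsum_def scaleR_add_right sum.distrib)

lemma wsum_scaleR: "wsum S (\<lambda>B. c *\<^sub>R x B) A = c *\<^sub>R wsum S x A"
  by (simp add: wsum_def scaleR_sum_right mult.commute)

lemma wsum_sum: "wsum S (\<lambda>B. \<Sum>i\<in>I. x i B) A = (\<Sum>i\<in>I. wsum S (x i) A)"
  by (simp add: wsum_def scaleR_sum_right sum.swap[of _ I])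

lemma wsum_cong: "(\<And>B. B \<subseteq> S \<Longrightarrow> x B = y B) \<Longrightarrow> wsum S x A = wsum S y A"
  by (simp add: wsum_def)

lemma wsum_plus_point:
  assumes "finite S" "i \<notin> S" "A \<subseteq> S"
  shows "wsum (insert i S) x A = wsum S (\<lambda>B. x B + x (insert i B)) A"
proof -
  have "rsign A i = 1" using assms by (auto simp: rsign_def)
  then show ?thesis using assms by (simp add: wsum_insert wsum_add)
qed

lemma wsum_minus_point:
  assumes "finite S" "i \<notin> S"
  shows "wsum (insert i S) x (insert i A) = wsum S (\<lambda>B. x B - x (insert i B)) A"
proof -
  have "wsum S y (insert i A) = wsum S y A" for y :: "nat set \<Rightarrow> 'a"
    unfolding wsum_def
  proof (rule sum.cong[OF refl])
    fix B assume "B \<in> Pow S"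
    then have "i \<notin> B" using assms by auto
    then show "walsh B (insert i A) *\<^sub>R y B = walsh B A *\<^sub>R y B" by (simp add: walsh_insert_point)
  qed
  moreover have "rsign (insert i A) i = -1" by (simp add: rsign_def)
  ultimately show ?thesis using assms wsum_add[of S x "\<lambda>B. (-1) *\<^sub>R x (insert i B)" A]
      wsum_scaleR[of S "-1" "\<lambda>B. x (insert i B)"] by (simp add: wsum_insert)
qed

text \<open>For \<open>i \<in> B\<close>, changing the sign of coordinate \<open>i\<close> changes
  the sign of \<open>walsh B\<close>, so the points cancel in pairs.\<close>

lemma sum_walsh:
  assumes "finite S" "B \<subseteq> S" "B \<noteq> {}"
  shows "(\<Sum>A\<in>Pow S. walsh B A) = 0"
proof -
  obtain i where i: "i \<in> B" using assms by auto
  define S' where "S' = S - {i}"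
  have S: "S = insert i S'" "finite S'" "i \<notin> S'" using i assms by (auto simp: S'_def)
  have "walsh B A + walsh B (insert i A) = 0" if "A \<in> Pow S'" for A
  proof -
    have B: "B = insert i (B - {i})" "finite (B - {i})" using i assms finite_subset by auto
    have "walsh B A' = rsign A' i * walsh (B - {i}) A'" for A'
      unfolding walsh_def by (subst B(1), rule prod.insert) (use B in auto)
    moreover have "walsh (B - {i}) (insert i A) = walsh (B - {i}) A" by (rule walsh_insert_point) simp
    moreover have "rsign A i = 1" "rsign (insert i A) i = -1" using that S by (auto simp: rsign_def)
    ultimately show ?thesis by simp
  qed
  then show ?thesis unfolding S(1) using S by (simp add: sum_Pow_insert)
qed

section \<open>Hypercontractivity of the noise operator\<close>

lemma powr_le_cancel:
  fixes x y q :: real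
  assumes "x powr q \<le> y powr q" "0 \<le> y" "0 < q"
  shows "x \<le> y"
proof (rule ccontr)
  assume "\<not> x \<le> y"
  then have "y powr q < x powr q" using assms by (intro powr_less_mono2) auto
  then show False using assms by simp
qed

text \<open>Only the triangle inequality is used on the remaining coordinates, so no positivity of the
  semigroup has to be invoked in the vector-valued setting.\<close>

lemma hypercontractive_of_two_point:
  fixes x :: "nat set \<Rightarrow> 'b::real_normed_vector" and p q \<sigma> :: real
  assumes two: "\<And>u v. 0 \<le> u \<Longrightarrow> 0 \<le> v \<Longrightarrow>
      (((1 + \<sigma>) / 2 * u + (1 - \<sigma>) / 2 * v) powr q + ((1 - \<sigma>) / 2 * u + (1 + \<sigma>) / 2 * v) powr q) / 2
        \<le> ((u powr p + v powr p) / 2) powr (q / p)"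
    and \<sigma>: "0 \<le> \<sigma>" "\<sigma> \<le> 1" and p: "1 \<le> p" and q: "1 \<le> q" and S: "finite S"
  shows "Lp_norm (cube S) q (wsum S (\<lambda>B. \<sigma> ^ card B *\<^sub>R x B)) \<le> Lp_norm (cube S) p (wsum S x)"
  using S
proof (induction S arbitrary: x rule: finite_induct)
  case empty
  have "Lp_norm (cube {}) r f = norm (f {})" if "1 \<le> r" for r and f :: "nat set \<Rightarrow> 'b"
    using that by (simp add: cube_def Lp_norm_uniform_count_measure powr_powr)
  then show ?case using p q by (simp add: wsum_def)
next
  case (insert i S)
  \<comment> \<open>\<open>y\<close> and \<open>z\<close> are the coefficient families of the
    function on the two half cubes determined by the sign of coordinate \<open>i\<close>. In this
    coordinate the noise operator mixes the two with weights \<open>(1 + \<sigma>) / 2\<close> and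
    \<open>(1 - \<sigma>) / 2\<close>.\<close>
  define y z where "y B = x B + x (insert i B)" and "z B = x B - x (insert i B)" for B
  define u v where "u = Lp_norm (cube S) p (wsum S y)" and "v = Lp_norm (cube S) p (wsum S z)"
  let ?T = "wsum (insert i S) (\<lambda>B. \<sigma> ^ card B *\<^sub>R x B)"
  \<comment> \<open>The induction hypothesis is applied to the mixed function as a whole;
    Minkowski's inequality is used only afterwards, for the exponent \<open>p\<close>.\<close>
  have key: "Lp_norm (cube S) q (wsum S (\<lambda>B. \<sigma> ^ card B *\<^sub>R (c *\<^sub>R y B + d *\<^sub>R z B))) \<le> c * u + d * v"
    if "0 \<le> c" "0 \<le> d" for c d
  proof -
    have "Lp_norm (cube S) q (wsum S (\<lambda>B. \<sigma> ^ card B *\<^sub>R (c *\<^sub>R y B + d *\<^sub>R z B)))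
       \<le> Lp_norm (cube S) p (wsum S (\<lambda>B. c *\<^sub>R y B + d *\<^sub>R z B))" by (rule insert.IH)
    also have "wsum S (\<lambda>B. c *\<^sub>R y B + d *\<^sub>R z B) = (\<lambda>A. c *\<^sub>R wsum S y A + d *\<^sub>R wsum S z A)"
      by (rule ext) (simp add: wsum_add wsum_scaleR)
    also have "Lp_norm (cube S) p \<dots> \<le> Lp_norm (cube S) p (\<lambda>A. c *\<^sub>R wsum S y A) + Lp_norm (cube S) p (\<lambda>A. d *\<^sub>R wsum S z A)"
      using insert p by (intro Lp_norm_triangle) auto
    also have "\<dots> = c * u + d * v" using that p by (simp add: Lp_norm_scaleR u_def v_def)
    finally show ?thesis .
  qed
  have nn: "0 \<le> u" "0 \<le> v" by (auto simp: u_def v_def)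
  have e: "x B + \<sigma> *\<^sub>R x (insert i B) = ((1 + \<sigma>) / 2) *\<^sub>R y B + ((1 - \<sigma>) / 2) *\<^sub>R z B"
    "x B - \<sigma> *\<^sub>R x (insert i B) = ((1 - \<sigma>) / 2) *\<^sub>R y B + ((1 + \<sigma>) / 2) *\<^sub>R z B" for B
  proof -
    have "((1 + \<sigma>) / 2) *\<^sub>R y B + ((1 - \<sigma>) / 2) *\<^sub>R z B =
       ((1 + \<sigma>) / 2 + (1 - \<sigma>) / 2) *\<^sub>R x B + ((1 + \<sigma>) / 2 - (1 - \<sigma>) / 2) *\<^sub>R x (insert i B)"
      unfolding y_def z_def by (simp only: scaleR_add_right scaleR_diff_right scaleR_add_left scaleR_diff_left) simp
    moreover have "(1 + \<sigma>) / 2 + (1 - \<sigma>) / 2 = 1" "(1 + \<sigma>) / 2 - (1 - \<sigma>) / 2 = \<sigma>" by (simp_all add: field_simps)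
    ultimately show "x B + \<sigma> *\<^sub>R x (insert i B) = ((1 + \<sigma>) / 2) *\<^sub>R y B + ((1 - \<sigma>) / 2) *\<^sub>R z B" by simp
    have "((1 - \<sigma>) / 2) *\<^sub>R y B + ((1 + \<sigma>) / 2) *\<^sub>R z B =
       ((1 - \<sigma>) / 2 + (1 + \<sigma>) / 2) *\<^sub>R x B + ((1 - \<sigma>) / 2 - (1 + \<sigma>) / 2) *\<^sub>R x (insert i B)"
      unfolding y_def z_def by (simp only: scaleR_add_right scaleR_diff_right scaleR_add_left scaleR_diff_left) simp
    moreover have "(1 - \<sigma>) / 2 + (1 + \<sigma>) / 2 = 1" "(1 - \<sigma>) / 2 - (1 + \<sigma>) / 2 = - \<sigma>" by (simp_all add: field_simps)
    ultimately show "x B - \<sigma> *\<^sub>R x (insert i B) = ((1 - \<sigma>) / 2) *\<^sub>R y B + ((1 + \<sigma>) / 2) *\<^sub>R z B" by simp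
  qed
  have cB: "card (insert i B) = Suc (card B)" if "B \<subseteq> S" for B
    by (rule card_insert_disjoint) (use that insert finite_subset in auto)
  have 1: "Lp_norm (cube S) q ?T \<le> (1 + \<sigma>) / 2 * u + (1 - \<sigma>) / 2 * v"
  proof -
    have "Lp_norm (cube S) q ?T = Lp_norm (cube S) q (wsum S (\<lambda>B. \<sigma> ^ card B *\<^sub>R (((1 + \<sigma>) / 2) *\<^sub>R y B + ((1 - \<sigma>) / 2) *\<^sub>R z B)))"
    proof (rule Lp_norm_cube_cong[OF insert(1)])
      fix A assume "A \<subseteq> S"
      then have "?T A = wsum S (\<lambda>B. \<sigma> ^ card B *\<^sub>R x B + \<sigma> ^ card (insert i B) *\<^sub>R x (insert i B)) A"
        using insert by (simp add: wsum_plus_point)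
      also have "\<dots> = wsum S (\<lambda>B. \<sigma> ^ card B *\<^sub>R (((1 + \<sigma>) / 2) *\<^sub>R y B + ((1 - \<sigma>) / 2) *\<^sub>R z B)) A"
        unfolding e[symmetric] by (rule wsum_cong) (simp add: cB scaleR_add_right mult.commute)
      finally show "?T A = wsum S (\<lambda>B. \<sigma> ^ card B *\<^sub>R (((1 + \<sigma>) / 2) *\<^sub>R y B + ((1 - \<sigma>) / 2) *\<^sub>R z B)) A" .
    qed
    also have "\<dots> \<le> (1 + \<sigma>) / 2 * u + (1 - \<sigma>) / 2 * v" by (rule key) (use \<sigma> in auto)
    finally show ?thesis .
  qed
  have 2: "Lp_norm (cube S) q (\<lambda>A. ?T (insert i A)) \<le> (1 - \<sigma>) / 2 * u + (1 + \<sigma>) / 2 * v"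
  proof -
    have "Lp_norm (cube S) q (\<lambda>A. ?T (insert i A)) = Lp_norm (cube S) q (wsum S (\<lambda>B. \<sigma> ^ card B *\<^sub>R (((1 - \<sigma>) / 2) *\<^sub>R y B + ((1 + \<sigma>) / 2) *\<^sub>R z B)))"
    proof (rule Lp_norm_cube_cong[OF insert(1)])
      fix A assume "A \<subseteq> S"
      then have "?T (insert i A) = wsum S (\<lambda>B. \<sigma> ^ card B *\<^sub>R x B - \<sigma> ^ card (insert i B) *\<^sub>R x (insert i B)) A"
        using insert by (simp add: wsum_minus_point)
      also have "\<dots> = wsum S (\<lambda>B. \<sigma> ^ card B *\<^sub>R (((1 - \<sigma>) / 2) *\<^sub>R y B + ((1 + \<sigma>) / 2) *\<^sub>R z B)) A"
        unfolding e[symmetric] by (rule wsum_cong) (simp add: cB scaleR_diff_right mult.commute)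
      finally show "?T (insert i A) = wsum S (\<lambda>B. \<sigma> ^ card B *\<^sub>R (((1 - \<sigma>) / 2) *\<^sub>R y B + ((1 + \<sigma>) / 2) *\<^sub>R z B)) A" .
    qed
    also have "\<dots> \<le> (1 - \<sigma>) / 2 * u + (1 + \<sigma>) / 2 * v" by (rule key) (use \<sigma> in auto)
    finally show ?thesis .
  qed
  \<comment> \<open>What is left is a statement about the two numbers \<open>u\<close> and
    \<open>v\<close>, the norms on the half cubes.\<close>
  have "Lp_norm (cube (insert i S)) q ?T powr q \<le>
      (((1 + \<sigma>) / 2 * u + (1 - \<sigma>) / 2 * v) powr q + ((1 - \<sigma>) / 2 * u + (1 + \<sigma>) / 2 * v) powr q) / 2"
    using insert(1,2) q 1 2 by (subst Lp_norm_cube_insert) (auto intro!: divide_right_mono add_mono powr_mono2)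
  also have "\<dots> \<le> ((u powr p + v powr p) / 2) powr (q / p)" by (rule two[OF nn])
  also have "(u powr p + v powr p) / 2 = Lp_norm (cube (insert i S)) p (wsum (insert i S) x) powr p"
  proof -
    have "Lp_norm (cube S) p (wsum (insert i S) x) = u" unfolding u_def
      by (rule Lp_norm_cube_cong[OF insert(1)]) (use insert in \<open>simp add: wsum_plus_point y_def[abs_def]\<close>)
    moreover have "Lp_norm (cube S) p (\<lambda>A. wsum (insert i S) x (insert i A)) = v" unfolding v_def
      by (rule Lp_norm_cube_cong[OF insert(1)]) (use insert in \<open>simp add: wsum_minus_point z_def[abs_def]\<close>)
    ultimately show ?thesis using insert(1,2) p by (subst Lp_norm_cube_insert) auto
  qed
  also have "\<dots> powr (q / p) = Lp_norm (cube (insert i S)) p (wsum (insert i S) x) powr q"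
    using p by (simp add: powr_powr)
  finally show ?case by (rule powr_le_cancel) (use q in auto)
qed

text \<open>The even part \<open>a\<close> and the odd part \<open>b\<close> of
  \<open>(1 + s)^n\<close> are bounded together: \<open>a\<close> gains \<open>s * b\<close> and
  \<open>b\<close> gains \<open>s * a\<close> in each step, and the odd part stays below
  \<open>(2^n - 1) * s\<close>.\<close>

lemma even_part_upper:
  fixes s :: real
  assumes "0 \<le> s" "s \<le> 1"
  shows "((1 + s) ^ n + (1 - s) ^ n) / 2 \<le> 1 + 2 ^ n * s\<^sup>2"
proof -
  define a b where "a n = ((1 + s) ^ n + (1 - s) ^ n) / 2" and "b n = ((1 + s) ^ n - (1 - s) ^ n) / 2" for n
  have rec: "a (Suc n) = a n + s * b n" "b (Suc n) = b n + s * a n" for n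
    by (simp_all add: a_def b_def field_simps)
  have "a n \<le> 1 + (2 ^ n - 1) * s\<^sup>2 \<and> b n \<le> (2 ^ n - 1) * s" for n
  proof (induction n)
    case 0 then show ?case by (simp add: a_def b_def)
  next
    case (Suc n)
    have pw: "(1::real) \<le> 2 ^ n" by simp
    have "s * b n \<le> s * ((2 ^ n - 1) * s)" using Suc assms by (intro mult_left_mono) auto
    then have "a (Suc n) \<le> 1 + (2 ^ n - 1) * s\<^sup>2 + (2 ^ n - 1) * s\<^sup>2"
      using Suc unfolding rec by (simp add: power2_eq_square algebra_simps)
    also have "\<dots> \<le> 1 + (2 ^ Suc n - 1) * s\<^sup>2" by (simp add: algebra_simps)
    finally have 1: "a (Suc n) \<le> 1 + (2 ^ Suc n - 1) * s\<^sup>2" .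
    have "s\<^sup>2 \<le> 1" using assms by (simp add: power_le_one)
    then have "(2 ^ n - 1) * s\<^sup>2 \<le> (2 ^ n - 1) * 1" using pw by (intro mult_left_mono) auto
    moreover have "a n \<le> 1 + (2 ^ n - 1) * s\<^sup>2" using Suc by blast
    ultimately have "a n \<le> 1 + (2 ^ n - 1) * 1" by (meson add_left_mono order_trans)
    then have "a n \<le> 2 ^ n" by simp
    then have "s * a n \<le> s * 2 ^ n" using assms by (intro mult_left_mono) auto
    then have "b (Suc n) \<le> (2 ^ Suc n - 1) * s" using Suc unfolding rec by (simp add: algebra_simps)
    with 1 show ?case by simp
  qed
  then have "a n \<le> 1 + (2 ^ n - 1) * s\<^sup>2" by blast
  also have "\<dots> \<le> 1 + 2 ^ n * s\<^sup>2" by (simp add: algebra_simps)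
  finally show ?thesis by (simp add: a_def)
qed

text \<open>The difference of the two sides has nonnegative derivative, as
  \<open>(1 + x)^(p - 1)\<close> is at least 1 and \<open>(1 - x)^(p - 1)\<close> at most
  \<open>1 - (p - 1) x\<close>. The first of these bounds is crude, which is why the constant is
  only half of the Taylor coefficient \<open>p (p - 1) / 2\<close>.\<close>

lemma even_part_lower:
  fixes t p :: real
  assumes t: "0 \<le> t" "t \<le> 1" and p: "1 < p" "p \<le> 2"
  shows "1 + p * (p - 1) / 4 * t\<^sup>2 \<le> ((1 + t) powr p + (1 - t) powr p) / 2"
proof -
  define h where "h t = (1 + t) powr p + (1 - t) powr p - p * (p - 1) / 2 * t\<^sup>2" for t
  have "h 0 \<le> h t"
  proof (rule DERIV_nonneg_imp_increasing_open[OF t(1)])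
    fix x assume x: "0 < x" "x < t"
    have d: "(h has_real_derivative (p * (1 + x) powr (p - 1) - p * (1 - x) powr (p - 1) - p * (p - 1) * x)) (at x)"
      unfolding h_def using x t by (auto intro!: derivative_eq_intros simp: field_simps)
    have "(1 - x) powr (p - 1) \<le> (p - 1) / 1 * (1 - x) powr 1 + (1 - (p - 1) / 1)"
      by (rule powr_le_affine) (use x t p in auto)
    then have "(1 - x) powr (p - 1) \<le> 1 - (p - 1) * x" using x t by (simp add: algebra_simps)
    moreover have "1 \<le> (1 + x) powr (p - 1)" using x p by (intro ge_one_powr_ge_zero) auto
    ultimately have "(p - 1) * x \<le> (1 + x) powr (p - 1) - (1 - x) powr (p - 1)" by linarith
    then have "p * ((p - 1) * x) \<le> p * ((1 + x) powr (p - 1) - (1 - x) powr (p - 1))"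
      using p by (intro mult_left_mono) auto
    then have "0 \<le> p * (1 + x) powr (p - 1) - p * (1 - x) powr (p - 1) - p * (p - 1) * x"
      by (simp add: algebra_simps)
    with d show "\<exists>y. (h has_real_derivative y) (at x) \<and> 0 \<le> y" by blast
  next
    have "continuous_on {0..t} (\<lambda>x. (1 + x) powr p)" "continuous_on {0..t} (\<lambda>x. (1 - x) powr p)"
      using t p by (auto intro!: continuous_on_powr' continuous_on_add continuous_on_diff)
    then show "continuous_on {0..t} h" unfolding h_def
      by (intro continuous_on_add continuous_on_diff continuous_on_mult continuous_on_power
          continuous_on_const continuous_on_id)
  qed
  moreover have "h 0 = 2" by (simp add: h_def)
  moreover have "h t = (1 + t) powr p + (1 - t) powr p - 2 * (p * (p - 1) / 4 * t\<^sup>2)" by (simp add: h_def)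
  ultimately show ?thesis by argo
qed

text \<open>By symmetry and homogeneity \<open>u = a (1 + t)\<close> and
  \<open>v = a (1 - t)\<close> with \<open>t\<close> in the unit interval. The left side is then an
  even part of an integer power, at most \<open>1 + 2^n \<sigma>^2 t^2\<close> up to the factor
  \<open>a^n\<close>, and the right side is at least \<open>1 + p (p - 1) t^2 / 4\<close>, since
  \<open>n / p\<close> is at least 1. The assumption on \<open>\<sigma>\<close> compares the
  two.\<close>

lemma two_point_inequality:
  fixes p u v \<sigma> :: real and n :: nat
  assumes p: "1 < p" "p \<le> 2" and n: "2 \<le> n"
    and \<sigma>: "0 \<le> \<sigma>" "\<sigma> < 1" "2 ^ n * \<sigma>\<^sup>2 \<le> p * (p - 1) / 4" and uv: "0 \<le> u" "0 \<le> v"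
  shows "(((1 + \<sigma>) / 2 * u + (1 - \<sigma>) / 2 * v) powr n + ((1 - \<sigma>) / 2 * u + (1 + \<sigma>) / 2 * v) powr n) / 2
        \<le> ((u powr p + v powr p) / 2) powr (n / p)"
  using uv
proof (induction u v rule: linorder_wlog)
  case (sym u v)
  then show ?case by (simp add: add.commute)
next
  case (le v u)
  show ?case
  proof (cases "u = 0")
    case True
    then show ?thesis using le n by simp
  next
    case False
    define a t where "a = (u + v) / 2" and "t = (u - v) / (u + v)"
    have a: "0 < a" using False le by (auto simp: a_def)
    have t: "0 \<le> t" "t \<le> 1" using False le by (auto simp: t_def divide_simps)
    have at: "a * t = (u - v) / 2" using a by (simp add: a_def t_def field_simps)
    have st: "0 \<le> \<sigma> * t" "\<sigma> * t \<le> 1" "\<sigma> * t < 1"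
      using \<sigma> t mult_le_one[of \<sigma> t] mult_left_le[of t \<sigma>] by auto
    have e: "(1 + \<sigma>) / 2 * v + (1 - \<sigma>) / 2 * u = a * (1 - \<sigma> * t)"
      "(1 - \<sigma>) / 2 * v + (1 + \<sigma>) / 2 * u = a * (1 + \<sigma> * t)"
      "u = a * (1 + t)" "v = a * (1 - t)"
    proof -
      have *: "a * (1 + r * t) = a + r * (a * t)" for r by (simp add: algebra_simps)
      show "u = a * (1 + t)" "v = a * (1 - t)" using *[of 1] *[of "-1"] unfolding at by (simp_all add: a_def field_simps)
      show "(1 + \<sigma>) / 2 * v + (1 - \<sigma>) / 2 * u = a * (1 - \<sigma> * t)"
        "(1 - \<sigma>) / 2 * v + (1 + \<sigma>) / 2 * u = a * (1 + \<sigma> * t)"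
        using *[of \<sigma>] *[of "-\<sigma>"] unfolding at by (simp_all add: a_def field_simps)
    qed
    have "((1 + \<sigma>) / 2 * v + (1 - \<sigma>) / 2 * u) powr n + ((1 - \<sigma>) / 2 * v + (1 + \<sigma>) / 2 * u) powr n
       = a ^ n * ((1 - \<sigma> * t) ^ n + (1 + \<sigma> * t) ^ n)"
    proof -
      have pos: "0 < a * (1 - \<sigma> * t)" "0 < a * (1 + \<sigma> * t)" using a st by (auto intro!: mult_pos_pos)
      show ?thesis
        unfolding e(1,2) powr_realpow[OF pos(1)] powr_realpow[OF pos(2)] power_mult_distrib
        by (simp add: distrib_left)
    qed
    also have "\<dots> / 2 \<le> a ^ n * (1 + 2 ^ n * (\<sigma> * t)\<^sup>2)"
      using even_part_upper[OF st(1,2), of n] a by (simp add: add.commute)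
    also have "\<dots> \<le> a ^ n * (1 + p * (p - 1) / 4 * t\<^sup>2)"
      using a mult_right_mono[OF \<sigma>(3), of "t\<^sup>2"] by (simp add: power_mult_distrib mult_ac)
    also have "\<dots> \<le> a ^ n * (((1 + t) powr p + (1 - t) powr p) / 2) powr 1"
      using even_part_lower[OF t p] a by (intro mult_left_mono) auto
    also have "\<dots> \<le> a ^ n * (((1 + t) powr p + (1 - t) powr p) / 2) powr (n / p)"
    proof (intro mult_left_mono powr_mono)
      have "0 \<le> p * (p - 1) / 4 * t\<^sup>2" using p by simp
      then show "1 \<le> ((1 + t) powr p + (1 - t) powr p) / 2" using even_part_lower[OF t p] by linarith
      show "1 \<le> n / p" using p n by (simp add: field_simps)
    qed (use a in auto)
    also have "a ^ n = (a powr p) powr (n / p)" using a p by (simp add: powr_powr powr_realpow)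
    also have "(a powr p) powr (n / p) * (((1 + t) powr p + (1 - t) powr p) / 2) powr (n / p)
       = (a powr p * (((1 + t) powr p + (1 - t) powr p) / 2)) powr (n / p)"
      by (rule powr_mult[symmetric])
    also have "a powr p * (((1 + t) powr p + (1 - t) powr p) / 2) = (v powr p + u powr p) / 2"
      unfolding e(3,4) powr_mult by (simp add: distrib_left)
    finally show ?thesis .
  qed
qed

text \<open>The first exponent is lowered to \<open>r = min p 2\<close>, the second raised to an
  integer \<open>n\<close>, at least 2, and \<open>\<sigma>\<close> turns the condition of the
  two-point inequality into an equality. It depends on \<open>p\<close> and \<open>q\<close> only,
  hence serves all cubes at once.\<close>

lemma hypercontractivity:
  fixes p q :: real
  assumes p: "1 < p" and q: "0 < q"
  shows "\<exists>\<sigma>>0. \<sigma> < 1 \<and> (\<forall>S (x :: nat set \<Rightarrow> 'b::real_normed_vector). finite S \<longrightarrow>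
     Lp_norm (cube S) q (wsum S (\<lambda>B. \<sigma> ^ card B *\<^sub>R x B)) \<le> Lp_norm (cube S) p (wsum S x))"
proof -
  define r where "r = min p 2"
  define n where "n = nat \<lceil>max q 2\<rceil>"
  have r: "1 < r" "r \<le> 2" "r \<le> p" using p by (auto simp: r_def)
  have n: "2 \<le> n" "q \<le> n" unfolding n_def by linarith+
  define \<sigma> where "\<sigma> = sqrt (r * (r - 1) / 4 / 2 ^ n)"
  have s2: "\<sigma>\<^sup>2 = r * (r - 1) / 4 / 2 ^ n" using r by (simp add: \<sigma>_def)
  have \<sigma>0: "0 < \<sigma>" using r by (simp add: \<sigma>_def)
  have "r * (r - 1) \<le> 2 * 1" using r by (intro mult_mono) auto
  then have "\<sigma>\<^sup>2 \<le> (1/2) / 2 ^ n" unfolding s2 by (intro divide_right_mono) auto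
  also have "\<dots> \<le> (1/2) / 1" by (intro divide_left_mono) auto
  finally have "\<sigma>\<^sup>2 < 1" by linarith
  then have \<sigma>1: "\<sigma> < 1" by (simp add: power_less_one_iff \<sigma>0 abs_square_less_1)
  have "Lp_norm (cube S) q (wsum S (\<lambda>B. \<sigma> ^ card B *\<^sub>R x B)) \<le> Lp_norm (cube S) p (wsum S x)"
    if S: "finite S" for S and x :: "nat set \<Rightarrow> 'b"
  proof -
    interpret prob_space "cube S" by (rule prob_space_cube[OF S])
    have "Lp_norm (cube S) q (wsum S (\<lambda>B. \<sigma> ^ card B *\<^sub>R x B)) \<le> Lp_norm (cube S) n (wsum S (\<lambda>B. \<sigma> ^ card B *\<^sub>R x B))"
      by (rule Lp_norm_mono_exponent) (use S q n in auto)
    also have "\<dots> \<le> Lp_norm (cube S) r (wsum S x)"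
    proof (rule hypercontractive_of_two_point)
      fix u v :: real assume "0 \<le> u" "0 \<le> v"
      then show "(((1 + \<sigma>) / 2 * u + (1 - \<sigma>) / 2 * v) powr n + ((1 - \<sigma>) / 2 * u + (1 + \<sigma>) / 2 * v) powr n) / 2
        \<le> ((u powr r + v powr r) / 2) powr (n / r)"
        using r n \<sigma>0 \<sigma>1 s2 by (intro two_point_inequality) auto
    qed (use \<sigma>0 \<sigma>1 r n S in auto)
    also have "\<dots> \<le> Lp_norm (cube S) p (wsum S x)"
      by (rule Lp_norm_mono_exponent) (use S r in auto)
    finally show ?thesis .
  qed
  then show ?thesis using \<sigma>0 \<sigma>1 by blast
qed

section \<open>The first chaos projection on the cube of a UMD space\<close>

lemma sum_eq_0_of_reflection:
  fixes f :: "'x \<Rightarrow> 'b::real_vector"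
  assumes "bij_betw \<tau> X X" "\<And>x. x \<in> X \<Longrightarrow> f (\<tau> x) = - f x"
  shows "(\<Sum>x\<in>X. f x) = 0"
proof -
  have "(\<Sum>x\<in>X. f x) = (\<Sum>x\<in>X. f (\<tau> x))" by (rule sum.reindex_bij_betw[OF assms(1), symmetric])
  also have "\<dots> = - (\<Sum>x\<in>X. f x)" using assms(2) by (simp add: sum_negf)
  finally have "2 *\<^sub>R (\<Sum>x\<in>X. f x) = 0" by (simp add: scaleR_2 eq_neg_iff_add_eq_0)
  then show ?thesis by simp
qed

section \<open>Martingale transforms on finite probability spaces\<close>

lemma simple_bochner_integral_uniform_count_measure:
  fixes f :: "'x \<Rightarrow> 'b::real_normed_vector"
  assumes "finite X"
  shows "Bochner_Integration.simple_bochner_integral (uniform_count_measure X) f = (1 / card X) *\<^sub>R (\<Sum>x\<in>X. f x)"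
proof -
  have "Bochner_Integration.simple_bochner_integral (uniform_count_measure X) f
     = (\<Sum>y\<in>f ` X. (card {x\<in>X. f x = y} / card X) *\<^sub>R y)"
    unfolding Bochner_Integration.simple_bochner_integral_def
    by (rule sum.cong) (use assms in \<open>auto simp: space_uniform_count_measure measure_uniform_count_measure\<close>)
  also have "\<dots> = (1 / card X) *\<^sub>R (\<Sum>y\<in>f ` X. card {x\<in>X. f x = y} *\<^sub>R y)"
    by (simp add: scaleR_sum_right)
  also have "(\<Sum>y\<in>f ` X. card {x\<in>X. f x = y} *\<^sub>R y) = (\<Sum>y\<in>f ` X. \<Sum>x\<in>{x\<in>X. f x = y}. f x)"
    by (rule sum.cong[OF refl]) (simp add: sum_constant_scaleR)
  also have "\<dots> = (\<Sum>x\<in>X. f x)" by (rule sum.image_gen[OF assms, symmetric])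
  finally show ?thesis .
qed

lemma has_strong_integral_uniform_count_measure:
  fixes f :: "'x \<Rightarrow> 'b::real_normed_vector"
  assumes "finite X" "X \<noteq> {}"
  shows "has_strong_integral (uniform_count_measure X) f ((1 / card X) *\<^sub>R (\<Sum>x\<in>X. f x))"
proof -
  interpret prob_space "uniform_count_measure X" by (rule prob_space_uniform_count_measure) fact+
  have "Bochner_Integration.simple_bochner_integrable (uniform_count_measure X) f"
    using assms(1) by (auto intro!: Bochner_Integration.simple_bochner_integrable.intros
        simp: simple_function_uniform_count_measure)
  then show ?thesis unfolding has_strong_integral_def
    using assms by (intro conjI exI[of _ "\<lambda>_. f"])
      (auto simp: simple_bochner_integral_uniform_count_measure intro!: strongly_measurable_simple
        simple_function_uniform_count_measure)
qed

text \<open>A family of symmetries \<open>\<tau> k\<close>, such that \<open>\<tau> k\<close> flips the sign of \<open>d k\<close> and leaves the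
  earlier \<open>d j\<close> alone, makes \<open>d\<close> a martingale difference sequence: the \<open>k\<close>-th sigma-algebra
  consists of the sets that are invariant under all later symmetries.\<close>

lemma UMD_space_reflections:
  assumes "UMD_space TYPE('b::banach)"
  shows "\<exists>p>1. \<exists>\<beta>\<ge>0. \<forall>(X :: 'x set) n (d :: nat \<Rightarrow> 'x \<Rightarrow> 'b) \<tau> \<epsilon>.
     finite X \<longrightarrow> X \<noteq> {} \<longrightarrow> (\<forall>k<n. bij_betw (\<tau> k) X X) \<longrightarrow>
     (\<forall>k<n. \<forall>x\<in>X. d k (\<tau> k x) = - d k x) \<longrightarrow>
     (\<forall>k<n. \<forall>j<n. k < j \<longrightarrow> (\<forall>x\<in>X. d k (\<tau> j x) = d k x)) \<longrightarrow>
     (\<forall>k<n. \<epsilon> k \<in> {-1, 1 :: real}) \<longrightarrow>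
     Lp_norm (uniform_count_measure X) p (\<lambda>x. \<Sum>k<n. \<epsilon> k *\<^sub>R d k x)
       \<le> \<beta> * Lp_norm (uniform_count_measure X) p (\<lambda>x. \<Sum>k<n. d k x)"
proof -
  define P where "P p \<beta> \<longleftrightarrow> (\<forall>(M :: real measure) n F (d :: nat \<Rightarrow> real \<Rightarrow> 'b) \<epsilon>.
        prob_space M \<and> martingale_difference M p n F d \<and> (\<forall>i<n. \<epsilon> i \<in> {-1, 1 :: real}) \<longrightarrow>
          Lp_norm M p (\<lambda>w. \<Sum>i<n. \<epsilon> i *\<^sub>R d i w) \<le> \<beta> * Lp_norm M p (\<lambda>w. \<Sum>i<n. d i w))" for p \<beta>
  have "\<exists>p>1. \<exists>\<beta>. P p \<beta>" using assms unfolding UMD_space_def P_def .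
  then obtain p \<beta> where p: "1 < p" and "P p \<beta>" by blast
  note U = \<open>P p \<beta>\<close>[unfolded P_def, THEN spec, THEN spec, THEN spec, THEN spec, THEN spec, THEN mp]
  have "Lp_norm (uniform_count_measure X) p (\<lambda>x. \<Sum>k<n. \<epsilon> k *\<^sub>R d k x)
       \<le> \<bar>\<beta>\<bar> * Lp_norm (uniform_count_measure X) p (\<lambda>x. \<Sum>k<n. d k x)"
    if X: "finite X" "X \<noteq> {}" and \<tau>: "\<forall>k<n. bij_betw (\<tau> k) X X"
      and d1: "\<forall>k<n. \<forall>x\<in>X. d k (\<tau> k x) = - d k x"
      and d2: "\<forall>k<n. \<forall>j<n. k < j \<longrightarrow> (\<forall>x\<in>X. d k (\<tau> j x) = d k x)"
      and \<epsilon>: "\<forall>k<n. \<epsilon> k \<in> {-1, 1 :: real}"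
    for X :: "'x set" and n and d :: "nat \<Rightarrow> 'x \<Rightarrow> 'b" and \<tau> \<epsilon>
  proof -
    \<comment> \<open>\<open>UMD_space\<close> speaks of measures on the reals, so the finite set is
      embedded there; \<open>g\<close> is the inverse of the embedding.\<close>
    obtain e0 :: "'x \<Rightarrow> nat" where e0: "inj_on e0 X" using finite_imp_inj_to_nat_seg[OF X(1)] by blast
    define e where "e x = real (e0 x)" for x
    have e: "inj_on e X" using e0 by (auto simp: inj_on_def e_def)
    define g where "g = the_inv_into X e"
    have g: "g (e x) = x" if "x \<in> X" for x unfolding g_def by (rule the_inv_into_f_f[OF e that])
    define Y where "Y = e ` X"
    define M where "M = uniform_count_measure Y"
    define G where "G k = {A. A \<subseteq> Y \<and> (\<forall>j. k < j \<and> j < n \<longrightarrow> (\<forall>x\<in>X. e (\<tau> j x) \<in> A \<longleftrightarrow> e x \<in> A))}" for k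
    have Y: "finite Y" "Y \<noteq> {}" using X by (auto simp: Y_def)
    have M: "space M = Y" "sets M = Pow Y" by (simp_all add: M_def space_uniform_count_measure sets_uniform_count_measure)
    have ps: "prob_space M" unfolding M_def by (rule prob_space_uniform_count_measure[OF Y])
    have \<tau>X: "\<tau> j x \<in> X" if "x \<in> X" "j < n" for x j using \<tau> that bij_betwE by blast
    have SA: "sigma_algebra Y (G k)" for k
      unfolding sigma_algebra_iff2
    proof (intro conjI ballI allI impI)
      fix A assume A: "A \<in> G k"
      show "Y - A \<in> G k" using A \<tau>X by (auto simp: G_def Y_def)
    next
      fix A :: "nat \<Rightarrow> real set" assume "range A \<subseteq> G k"
      then have "A i \<in> G k" for i by blast
      then show "\<Union> (range A) \<in> G k" unfolding G_def by blast
    qed (auto simp: G_def)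
    define F where "F k = measure_of Y (G k) (\<lambda>_. 0)" for k
    have F: "space (F k) = Y" "sets (F k) = G k" for k
      unfolding F_def using SA[of k] by (auto simp: G_def space_measure_of_conv intro!: sigma_algebra.sets_measure_of_eq)
    have Gmono: "G i \<subseteq> G (Suc i)" for i by (auto simp: G_def)
    \<comment> \<open>The reflection \<open>\<tau> (Suc i)\<close> preserves every set of
      \<open>G i\<close> and turns \<open>d (Suc i)\<close> into its negative, so the integral
      equals its own negative.\<close>
    have int0: "has_strong_integral M (\<lambda>w. indicator A w *\<^sub>R d (Suc i) (g w)) 0"
      if i: "Suc i < n" and A: "A \<in> G i" for i A
    proof -
      have "(\<Sum>y\<in>Y. indicator A y *\<^sub>R d (Suc i) (g y)) = (\<Sum>x\<in>X. indicator A (e x) *\<^sub>R d (Suc i) (g (e x)))"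
        unfolding Y_def by (simp add: sum.reindex[OF e])
      also have "\<dots> = (\<Sum>x\<in>X. indicator A (e x) *\<^sub>R d (Suc i) x)" by (simp add: g cong: sum.cong)
      also have "\<dots> = 0"
      proof (rule sum_eq_0_of_reflection)
        show "bij_betw (\<tau> (Suc i)) X X" using \<tau> i by blast
        fix x assume x: "x \<in> X"
        have "indicator A (e (\<tau> (Suc i) x)) = (indicator A (e x) :: real)"
          using A x i by (auto simp: G_def indicator_def)
        then show "indicator A (e (\<tau> (Suc i) x)) *\<^sub>R d (Suc i) (\<tau> (Suc i) x) = - (indicator A (e x) *\<^sub>R d (Suc i) x)"
          using d1 i x by simp
      qed
      finally have "(\<Sum>y\<in>Y. indicator A y *\<^sub>R d (Suc i) (g y)) = 0" .
      then show ?thesis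
        using has_strong_integral_uniform_count_measure[OF Y, of "\<lambda>w. indicator A w *\<^sub>R d (Suc i) (g w)"]
        by (simp add: M_def)
    qed
    have sm: "strongly_measurable (F k) (\<lambda>y. d k (g y))" if k: "k < n" for k
    proof (rule strongly_measurable_simple)
      have "(\<lambda>y. d k (g y)) -` {z} \<inter> Y \<in> G k" for z
        using d2 k \<tau>X by (auto simp: G_def Y_def g)
      then show "simple_function (F k) (\<lambda>y. d k (g y))"
        unfolding simple_function_def F using Y by auto
    qed
    have "martingale_difference M p n F (\<lambda>k y. d k (g y))"
      unfolding martingale_difference_def
    proof (intro conjI allI impI ballI)
      fix i
      show "subalgebra M (F i)" by (auto simp: subalgebra_def F M G_def)
      show "subalgebra (F (Suc i)) (F i)" using Gmono by (auto simp: subalgebra_def F)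
      show "(\<lambda>y. d i (g y)) \<in> Lp M p" using Y by (simp add: M_def Lp_uniform_count_measure)
      show "has_strong_integral M (\<lambda>w. indicator A w *\<^sub>R d (Suc i) (g w)) 0" if "Suc i < n" "A \<in> sets (F i)" for A
        using int0 that F by simp
      show "strongly_measurable (F i) (\<lambda>y. d i (g y))" if "i < n" using sm[OF that] .
    qed
    from U[OF conjI[OF ps conjI[OF this \<epsilon>]]]
    have "Lp_norm M p (\<lambda>w. \<Sum>i<n. \<epsilon> i *\<^sub>R d i (g w)) \<le> \<beta> * Lp_norm M p (\<lambda>w. \<Sum>i<n. d i (g w))" .
    also have "\<dots> \<le> \<bar>\<beta>\<bar> * Lp_norm M p (\<lambda>w. \<Sum>i<n. d i (g w))" by (intro mult_right_mono) auto
    finally have "Lp_norm M p (\<lambda>w. \<Sum>i<n. \<epsilon> i *\<^sub>R d i (g w)) \<le> \<bar>\<beta>\<bar> * Lp_norm M p (\<lambda>w. \<Sum>i<n. d i (g w))" .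
    moreover have tr: "Lp_norm M p (\<lambda>y. h (g y)) = Lp_norm (uniform_count_measure X) p h" for h :: "'x \<Rightarrow> 'b"
    proof -
      have "(\<Sum>y\<in>Y. norm (h (g y)) powr p) = (\<Sum>x\<in>X. norm (h x) powr p)"
        unfolding Y_def by (subst sum.reindex[OF e]) (simp add: g cong: sum.cong)
      moreover have "card Y = card X" unfolding Y_def by (rule card_image[OF e])
      ultimately show ?thesis unfolding M_def using X Y by (simp add: Lp_norm_uniform_count_measure)
    qed
    ultimately show ?thesis
      using tr[of "\<lambda>x. \<Sum>k<n. \<epsilon> k *\<^sub>R d k x"] tr[of "\<lambda>x. \<Sum>k<n. d k x"] by simp
  qed
  note * = this
  show ?thesis
  proof (rule exI[of _ p], intro conjI, rule p, rule exI[of _ "\<bar>\<beta>\<bar>"], intro conjI allI impI)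
    fix X :: "'x set" and n and d :: "nat \<Rightarrow> 'x \<Rightarrow> 'b" and \<tau> \<epsilon>
    assume a: "finite X" "X \<noteq> {}" "\<forall>k<n. bij_betw (\<tau> k) X X"
      "\<forall>k<n. \<forall>x\<in>X. d k (\<tau> k x) = - d k x"
      "\<forall>k<n. \<forall>j<n. k < j \<longrightarrow> (\<forall>x\<in>X. d k (\<tau> j x) = d k x)"
      "\<forall>k<n. \<epsilon> k \<in> {-1, 1 :: real}"
    show "Lp_norm (uniform_count_measure X) p (\<lambda>x. \<Sum>k<n. \<epsilon> k *\<^sub>R d k x)
       \<le> \<bar>\<beta>\<bar> * Lp_norm (uniform_count_measure X) p (\<lambda>x. \<Sum>k<n. d k x)"
      by (rule *[OF a])
  qed simp
qed

section \<open>Decoupling the martingale differences of a Walsh expansion\<close>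

definition flip :: "nat \<Rightarrow> nat set \<Rightarrow> nat set" where
  "flip i A = (if i \<in> A then A - {i} else insert i A)"

lemma flip_flip [simp]: "flip i (flip i A) = A"
  by (auto simp: flip_def)

lemma flip_subset: "i \<in> S \<Longrightarrow> A \<subseteq> S \<Longrightarrow> flip i A \<subseteq> S"
  by (auto simp: flip_def)

lemma rsign_flip: "rsign (flip i A) j = (if j = i then - rsign A j else rsign A j)"
proof (cases "j = i")
  case True
  have "i \<in> flip i A \<longleftrightarrow> i \<notin> A" by (auto simp: flip_def)
  then show ?thesis using True unfolding rsign_def by (cases "i \<in> A") simp_all
next
  case False
  then have "j \<in> flip i A \<longleftrightarrow> j \<in> A" by (auto simp: flip_def)
  then show ?thesis using False unfolding rsign_def by (cases "j \<in> A") simp_all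
qed

lemma walsh_flip: "i \<notin> B \<Longrightarrow> walsh B (flip i A) = walsh B A"
  unfolding walsh_def by (rule prod.cong) (auto simp: rsign_flip)

lemma sum_lessThan_double:
  fixes f :: "nat \<Rightarrow> 'b::comm_monoid_add"
  shows "(\<Sum>k<2*n. f k) = (\<Sum>i<n. f (2*i) + f (2*i+1))"
proof (induction n)
  case (Suc n)
  have "2 * Suc n = Suc (Suc (2 * n))" by simp
  then have "(\<Sum>k<2*Suc n. f k) = (\<Sum>k<2*n. f k) + (f (2*n) + f (2*n+1))"
    by (simp only: sum.lessThan_Suc) (simp add: add.assoc)
  then show ?case using Suc by simp
qed simp

text \<open>The factor \<open>g_i\<close> in the martingale difference
  \<open>\<epsilon>_i g_i\<close> of a Walsh expansion, for the natural order of the coordinates: it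
  collects the terms whose largest index is \<open>i\<close> and omits that index.\<close>

definition predictable :: "nat set \<Rightarrow> (nat set \<Rightarrow> 'b::real_vector) \<Rightarrow> nat \<Rightarrow> nat set \<Rightarrow> 'b" where
  "predictable S x i A = (if i \<in> S then wsum (S \<inter> {..<i}) (\<lambda>B. x (insert i B)) A else 0)"

lemma wsum_eq_sum_predictable:
  assumes "finite S" "S \<subseteq> {..<N}"
  shows "wsum S x A = x {} + (\<Sum>i<N. rsign A i *\<^sub>R predictable S x i A)"
proof -
  have "wsum (S \<inter> {..<n}) x A = x {} + (\<Sum>i<n. rsign A i *\<^sub>R predictable S x i A)" for n
  proof (induction n)
    case 0 then show ?case by (simp add: wsum_def)
  next
    case (Suc n)
    show ?case
    proof (cases "n \<in> S")
      case True
      then have "S \<inter> {..<Suc n} = insert n (S \<inter> {..<n})" by auto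
      then have "wsum (S \<inter> {..<Suc n}) x A = wsum (S \<inter> {..<n}) x A + rsign A n *\<^sub>R wsum (S \<inter> {..<n}) (\<lambda>B. x (insert n B)) A"
        using assms by (simp add: wsum_insert)
      then show ?thesis using Suc True by (simp add: predictable_def)
    next
      case False
      then have "S \<inter> {..<Suc n} = S \<inter> {..<n}" by (auto simp: less_Suc_eq)
      then show ?thesis using Suc False by (simp add: predictable_def)
    qed
  qed
  moreover have "S \<inter> {..<N} = S" using assms by auto
  ultimately show ?thesis by metis
qed

lemma predictable_flip: "i \<le> j \<Longrightarrow> predictable S x i (flip j A) = predictable S x i A"
  unfolding predictable_def wsum_def
proof (rule if_cong[OF refl _ refl], rule sum.cong[OF refl])
  fix B assume "i \<le> j" "B \<in> Pow (S \<inter> {..<i})"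
  then have "j \<notin> B" by auto
  then show "walsh B (flip j A) *\<^sub>R x (insert i B) = walsh B A *\<^sub>R x (insert i B)" by (simp add: walsh_flip)
qed

lemma sum_Pow_wsum:
  fixes x :: "nat set \<Rightarrow> 'b::real_vector"
  assumes "finite S" "R \<subseteq> S"
  shows "(\<Sum>A\<in>Pow S. wsum R x A) = 2 ^ card S *\<^sub>R x {}"
proof -
  have "(\<Sum>A\<in>Pow S. wsum R x A) = (\<Sum>B\<in>Pow R. (\<Sum>A\<in>Pow S. walsh B A) *\<^sub>R x B)"
    unfolding wsum_def by (subst sum.swap) (simp add: scaleR_sum_left)
  also have "\<dots> = (\<Sum>B\<in>Pow R. if B = {} then 2 ^ card S *\<^sub>R x {} else 0)"
  proof (rule sum.cong[OF refl])
    fix B assume "B \<in> Pow R"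
    then show "(\<Sum>A\<in>Pow S. walsh B A) *\<^sub>R x B = (if B = {} then 2 ^ card S *\<^sub>R x {} else 0)"
      using sum_walsh[of S B] assms by (auto simp: card_Pow)
  qed
  also have "\<dots> = 2 ^ card S *\<^sub>R x {}"
    using assms finite_subset by (subst sum.delta) auto
  finally show ?thesis .
qed

lemma sum_predictable:
  assumes "finite S" "i \<in> S"
  shows "(\<Sum>A\<in>Pow S. predictable S x i A) = 2 ^ card S *\<^sub>R x {i}"
  using sum_Pow_wsum[of S "S \<inter> {..<i}" "\<lambda>B. x (insert i B)"] assms by (simp add: predictable_def)

lemma norm_mean_le_Lp_norm_cube:
  fixes f :: "nat set \<Rightarrow> 'b::real_normed_vector"
  assumes "finite S" "1 \<le> p"
  shows "norm ((1 / 2 ^ card S) *\<^sub>R (\<Sum>A\<in>Pow S. f A)) \<le> Lp_norm (cube S) p f"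
proof -
  have "norm ((1 / 2 ^ card S) *\<^sub>R (\<Sum>A\<in>Pow S. f A)) = norm (\<Sum>A\<in>Pow S. f A) / 2 ^ card S"
    by simp
  also have "\<dots> \<le> (\<Sum>A\<in>Pow S. norm (f A)) / 2 ^ card S"
    by (intro divide_right_mono norm_sum) simp
  also have "(\<Sum>A\<in>Pow S. norm (f A)) / 2 ^ card S = Lp_norm (cube S) 1 f powr 1"
    using assms(1) by (subst Lp_norm_cube_powr) auto
  also have "\<dots> = Lp_norm (cube S) 1 f" by (rule powr_one) simp
  also have "\<dots> \<le> Lp_norm (cube S) p f"
    by (rule prob_space.Lp_norm_mono_exponent[OF prob_space_cube[OF assms(1)] Lp_cube[OF assms(1)]])
       (use assms(2) in simp_all)
  finally show ?thesis .
qed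

lemma predictable_first_chaos:
  assumes "finite S" "i \<in> S"
  shows "predictable S (\<lambda>B. if card B = 1 then x B else 0) i A = x {i}"
proof -
  have "wsum (S \<inter> {..<i}) (\<lambda>B. if card (insert i B) = 1 then x (insert i B) else 0) A
     = (\<Sum>B\<in>Pow (S \<inter> {..<i}). if B = {} then x {i} else 0)"
    unfolding wsum_def
  proof (rule sum.cong[OF refl])
    fix B assume B: "B \<in> Pow (S \<inter> {..<i})"
    then have "finite B" "i \<notin> B" using assms finite_subset by auto
    then have "card (insert i B) = 1 \<longleftrightarrow> B = {}" by simp
    then show "walsh B A *\<^sub>R (if card (insert i B) = 1 then x (insert i B) else 0) = (if B = {} then x {i} else 0)"
      by (cases "B = {}") simp_all
  qed
  also have "\<dots> = x {i}" using assms by simp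
  finally show ?thesis using assms(2) unfolding predictable_def by (simp only: if_True)
qed

text \<open>With \<open>d i = \<epsilon>\<^sub>i g\<^sub>i\<close> the martingale differences of \<open>f\<close> and an independent copy \<open>\<epsilon>'\<close> of the signs,
  both \<open>(\<epsilon>\<^sub>i + \<epsilon>'\<^sub>i) g\<^sub>i / 2\<close> and \<open>(\<epsilon>\<^sub>i - \<epsilon>'\<^sub>i) g\<^sub>i / 2\<close> are martingale differences, and changing the
  signs of the latter replaces \<open>\<epsilon>\<^sub>i g\<^sub>i\<close> by \<open>\<epsilon>'\<^sub>i g\<^sub>i\<close>. Averaging over \<open>\<epsilon>\<close> turns \<open>g\<^sub>i\<close> into the first order
  coefficient.\<close>

lemma first_chaos_bound_UMD:
  assumes "UMD_space TYPE('b::banach)"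
  shows "\<exists>p>1. \<exists>C\<ge>0. \<forall>S (x :: nat set \<Rightarrow> 'b). finite S \<longrightarrow>
     Lp_norm (cube S) p (wsum S (\<lambda>B. if card B = 1 then x B else 0)) \<le> C * Lp_norm (cube S) p (wsum S x)"
proof -
  define Q where "Q p \<beta> \<longleftrightarrow> (\<forall>(X :: (nat set \<times> nat set) set) n (d :: nat \<Rightarrow> (nat set \<times> nat set) \<Rightarrow> 'b) \<tau> \<epsilon>.
     finite X \<longrightarrow> X \<noteq> {} \<longrightarrow> (\<forall>k<n. bij_betw (\<tau> k) X X) \<longrightarrow>
     (\<forall>k<n. \<forall>x\<in>X. d k (\<tau> k x) = - d k x) \<longrightarrow>
     (\<forall>k<n. \<forall>j<n. k < j \<longrightarrow> (\<forall>x\<in>X. d k (\<tau> j x) = d k x)) \<longrightarrow>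
     (\<forall>k<n. \<epsilon> k \<in> {-1, 1 :: real}) \<longrightarrow>
     Lp_norm (uniform_count_measure X) p (\<lambda>x. \<Sum>k<n. \<epsilon> k *\<^sub>R d k x)
       \<le> \<beta> * Lp_norm (uniform_count_measure X) p (\<lambda>x. \<Sum>k<n. d k x))" for p \<beta>
  have "\<exists>p>1. \<exists>\<beta>\<ge>0. Q p \<beta>" using UMD_space_reflections[OF assms] unfolding Q_def .
  then obtain p \<beta> where p: "1 < p" and \<beta>: "0 \<le> \<beta>" and "Q p \<beta>" by blast
  note U = \<open>Q p \<beta>\<close>[unfolded Q_def, THEN spec, THEN spec, THEN spec, THEN spec, THEN spec,
      THEN mp, THEN mp, THEN mp, THEN mp, THEN mp, THEN mp]
  have "Lp_norm (cube S) p (wsum S (\<lambda>B. if card B = 1 then x B else 0)) \<le> (2 * \<beta>) * Lp_norm (cube S) p (wsum S x)"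
    if S: "finite S" for S and x :: "nat set \<Rightarrow> 'b"
  proof -
    obtain N where N: "S \<subseteq> {..<N}" using S finite_nat_bounded by blast
    define X where "X = Pow S \<times> Pow S"
    define g where "g i A = predictable S x i A" for i A
    \<comment> \<open>Coordinate \<open>i\<close> occupies the times \<open>2 i\<close> and
      \<open>2 i + 1\<close>, which carry the half sum and the half difference of the two signs.
      Both symmetries flip the two copies of the coordinate. The odd one does so only where the
      signs differ: there the half sum vanishes and is left alone, while elsewhere the half
      difference is 0 and has nothing to flip.\<close>
    define \<tau> where "\<tau> k z = (if k div 2 \<in> S \<and> (even k \<or> (k div 2 \<in> fst z \<longleftrightarrow> k div 2 \<notin> snd z))
      then (flip (k div 2) (fst z), flip (k div 2) (snd z)) else z)" for k :: nat and z :: "nat set \<times> nat set"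
    define d where "d k z = ((rsign (fst z) (k div 2) + (if even k then 1 else -1) * rsign (snd z) (k div 2)) / 2) *\<^sub>R g (k div 2) (fst z)" for k z
    define \<epsilon> where "\<epsilon> k = (if even k then 1 else -1 :: real)" for k :: nat
    have g0: "g i A = 0" if "i \<notin> S" for i A using that by (simp add: g_def predictable_def)
    have X: "finite X" "X \<noteq> {}" using S by (auto simp: X_def)
    have inS: "j \<in> flip i A \<longleftrightarrow> (if j = i then i \<notin> A else j \<in> A)" for i j A by (auto simp: flip_def)
    have \<tau>\<tau>: "\<tau> k (\<tau> k z) = z" for k z
      by (cases "k div 2 \<in> S \<and> (even k \<or> (k div 2 \<in> fst z \<longleftrightarrow> k div 2 \<notin> snd z))") (auto simp: \<tau>_def inS)
    have \<tau>X: "\<tau> k z \<in> X" if "z \<in> X" for k z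
      using that flip_subset[of "k div 2" S] by (auto simp: \<tau>_def X_def mem_Times_iff)
    have bij: "bij_betw (\<tau> k) X X" for k
      by (rule bij_betw_byWitness[where f'="\<tau> k"]) (use \<tau>\<tau> \<tau>X in auto)
    have gf: "g i (flip j A) = g i A" if "i \<le> j" for i j A using that by (simp add: g_def predictable_flip)
    have rs: "rsign A i = 1 \<or> rsign A i = -1" "rsign A i = rsign B i \<longleftrightarrow> (i \<in> A \<longleftrightarrow> i \<in> B)" for A B i
      by (auto simp: rsign_def)
    have d1: "d k (\<tau> k z) = - d k z" for k z
    proof (cases "k div 2 \<in> S \<and> (even k \<or> (k div 2 \<in> fst z \<longleftrightarrow> k div 2 \<notin> snd z))")
      case True
      then have "\<tau> k z = (flip (k div 2) (fst z), flip (k div 2) (snd z))" by (simp add: \<tau>_def)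
      then have "d k (\<tau> k z) = ((- (rsign (fst z) (k div 2) + (if even k then 1 else -1) * rsign (snd z) (k div 2))) / 2) *\<^sub>R g (k div 2) (fst z)"
        unfolding d_def by (simp add: rsign_flip gf)
      also have "\<dots> = - d k z" unfolding d_def by (simp only: minus_divide_left[symmetric] scaleR_minus_left)
      finally show ?thesis .
    next
      case False
      then have t: "\<tau> k z = z" by (simp only: \<tau>_def if_False)
      show ?thesis
      proof (cases "k div 2 \<in> S")
        case True
        then have "odd k" "rsign (fst z) (k div 2) = rsign (snd z) (k div 2)" using False rs(2) by auto
        then have "d k z = 0" by (simp add: d_def)
        then show ?thesis using t by simp
      qed (simp add: t, simp add: d_def g0)
    qed
    have d2: "d k (\<tau> j z) = d k z" if kj: "k < j" for k j z
    proof (cases "\<tau> j z = z")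
      case False
      then have t: "\<tau> j z = (flip (j div 2) (fst z), flip (j div 2) (snd z))"
        and c: "even j \<or> (j div 2 \<in> fst z \<longleftrightarrow> j div 2 \<notin> snd z)" by (auto simp: \<tau>_def split: if_splits)
      have le: "k div 2 \<le> j div 2" using kj by (simp add: div_le_mono)
      have gg: "g (k div 2) (flip (j div 2) (fst z)) = g (k div 2) (fst z)" by (rule gf[OF le])
      show ?thesis
      proof (cases "k div 2 = j div 2")
        case True
        then have eo: "even k" "odd j" using kj by presburger+
        then have "rsign (fst z) (k div 2) = - rsign (snd z) (k div 2)"
          using c True unfolding rsign_def by auto
        then show ?thesis using gg True eo by (simp add: d_def t rsign_flip)
      next
        case False
        then show ?thesis using gg by (simp add: d_def t rsign_flip)
      qed
    qed simp
    have \<epsilon>: "\<forall>k<2*N. \<epsilon> k \<in> {-1, 1}" by (simp add: \<epsilon>_def)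
    have s1: "(\<Sum>k<2*N. d k z) = wsum S x (fst z) - x {}" for z
    proof -
      have "(\<Sum>k<2*N. d k z) = (\<Sum>i<N. rsign (fst z) i *\<^sub>R g i (fst z))"
        unfolding sum_lessThan_double by (rule sum.cong[OF refl]) (simp add: d_def scaleR_add_left[symmetric] add_divide_distrib diff_divide_distrib)
      then show ?thesis using wsum_eq_sum_predictable[OF S N, of x "fst z"] by (simp add: g_def)
    qed
    have s2: "(\<Sum>k<2*N. \<epsilon> k *\<^sub>R d k z) = (\<Sum>i<N. rsign (snd z) i *\<^sub>R g i (fst z))" for z
      unfolding sum_lessThan_double
      by (rule sum.cong[OF refl]) (simp add: d_def \<epsilon>_def scaleR_add_left[symmetric] add_divide_distrib diff_divide_distrib)
    define G where "G A A' = (\<Sum>i<N. rsign A' i *\<^sub>R g i A)" for A A'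
    let ?f = "\<lambda>A. wsum S x A - x {}"
    have "Lp_norm (uniform_count_measure X) p (\<lambda>z. \<Sum>k<2*N. \<epsilon> k *\<^sub>R d k z)
       \<le> \<beta> * Lp_norm (uniform_count_measure X) p (\<lambda>z. \<Sum>k<2*N. d k z)"
      by (rule U[of X "2*N" \<tau> d \<epsilon>, OF X]) (use bij d1 d2 \<epsilon> in auto)
    then have main: "Lp_norm (uniform_count_measure X) p (\<lambda>z. G (fst z) (snd z))
        \<le> \<beta> * Lp_norm (uniform_count_measure X) p (\<lambda>z. ?f (fst z))"
      unfolding s1 s2 G_def .
    have cX: "real (card X) = 2 ^ card S * 2 ^ card S"
      using S by (simp add: X_def card_cartesian_product card_Pow)
    have p0: "0 < p" using p by simp
    have pr: "(\<Sum>z\<in>X. h (fst z) (snd z)) = (\<Sum>A'\<in>Pow S. \<Sum>A\<in>Pow S. h A A')" for h :: "nat set \<Rightarrow> nat set \<Rightarrow> real"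
      unfolding X_def by (subst sum.swap) (simp add: sum.cartesian_product split_beta)
    have r: "Lp_norm (uniform_count_measure X) p (\<lambda>z. ?f (fst z)) = Lp_norm (cube S) p ?f"
    proof -
      have "Lp_norm (uniform_count_measure X) p (\<lambda>z. ?f (fst z)) powr p = Lp_norm (cube S) p ?f powr p"
        using S p0 X cX pr[of "\<lambda>A A'. norm (?f A) powr p"]
        by (simp add: Lp_norm_uniform_count_measure_powr Lp_norm_cube_powr card_Pow)
      then show ?thesis using p0 powr_inj[of p "Lp_norm (uniform_count_measure X) p (\<lambda>z. ?f (fst z))" "Lp_norm (cube S) p ?f"]
        by (metis Lp_norm_nonneg order.antisym order_refl powr_le_cancel)
    qed
    have l: "Lp_norm (cube S) p (\<lambda>A'. \<Sum>i<N. rsign A' i *\<^sub>R (if i \<in> S then x {i} else 0))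
        \<le> Lp_norm (uniform_count_measure X) p (\<lambda>z. G (fst z) (snd z))"
    proof (rule powr_le_cancel[OF _ Lp_norm_nonneg p0])
      have pt: "norm (\<Sum>i<N. rsign A' i *\<^sub>R (if i \<in> S then x {i} else 0)) powr p
         \<le> (\<Sum>A\<in>Pow S. norm (G A A') powr p) / 2 ^ card S" for A'
      proof -
        have "(\<Sum>A\<in>Pow S. g i A) = 2 ^ card S *\<^sub>R (if i \<in> S then x {i} else 0)" for i
          using sum_predictable[OF S, of i x] g0[of i] by (simp add: g_def)
        then have "(\<Sum>A\<in>Pow S. G A A') = 2 ^ card S *\<^sub>R (\<Sum>i<N. rsign A' i *\<^sub>R (if i \<in> S then x {i} else 0))"
          unfolding G_def by (subst sum.swap) (simp add: scaleR_sum_right[symmetric] mult.commute del: scaleR_zero_right, simp add: scaleR_sum_right mult.commute)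
        then have "(\<Sum>i<N. rsign A' i *\<^sub>R (if i \<in> S then x {i} else 0)) = (1 / 2 ^ card S) *\<^sub>R (\<Sum>A\<in>Pow S. G A A')"
          by simp
        then have "norm (\<Sum>i<N. rsign A' i *\<^sub>R (if i \<in> S then x {i} else 0)) \<le> Lp_norm (cube S) p (\<lambda>A. G A A')"
          using norm_mean_le_Lp_norm_cube[OF S, of p "\<lambda>A. G A A'"] p by simp
        then have "norm (\<Sum>i<N. rsign A' i *\<^sub>R (if i \<in> S then x {i} else 0)) powr p \<le> Lp_norm (cube S) p (\<lambda>A. G A A') powr p"
          using p0 by (intro powr_mono2) auto
        then show ?thesis using Lp_norm_cube_powr[OF S p0, of "\<lambda>A. G A A'"] by simp
      qed
      have "Lp_norm (cube S) p (\<lambda>A'. \<Sum>i<N. rsign A' i *\<^sub>R (if i \<in> S then x {i} else 0)) powr p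
         \<le> (\<Sum>A'\<in>Pow S. (\<Sum>A\<in>Pow S. norm (G A A') powr p) / 2 ^ card S) / 2 ^ card S"
        unfolding Lp_norm_cube_powr[OF S p0] by (intro divide_right_mono sum_mono pt) simp
      also have "\<dots> = Lp_norm (uniform_count_measure X) p (\<lambda>z. G (fst z) (snd z)) powr p"
        unfolding Lp_norm_uniform_count_measure_powr[OF X(1) p0] cX pr[of "\<lambda>A A'. norm (G A A') powr p"]
        by (simp add: sum_divide_distrib)
      finally show "Lp_norm (cube S) p (\<lambda>A'. \<Sum>i<N. rsign A' i *\<^sub>R (if i \<in> S then x {i} else 0)) powr p
         \<le> Lp_norm (uniform_count_measure X) p (\<lambda>z. G (fst z) (snd z)) powr p" .
    qed
    have w: "wsum S (\<lambda>B. if card B = 1 then x B else 0) = (\<lambda>A'. \<Sum>i<N. rsign A' i *\<^sub>R (if i \<in> S then x {i} else 0))"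
    proof (rule ext)
      fix A'
      have "predictable S (\<lambda>B. if card B = 1 then x B else 0) i A' = (if i \<in> S then x {i} else 0)" for i
        using predictable_first_chaos[OF S, of i x A'] by (auto simp: predictable_def)
      then show "wsum S (\<lambda>B. if card B = 1 then x B else 0) A' = (\<Sum>i<N. rsign A' i *\<^sub>R (if i \<in> S then x {i} else 0))"
        using wsum_eq_sum_predictable[OF S N, of "\<lambda>B. if card B = 1 then x B else 0" A'] by simp
    qed
    have "Lp_norm (cube S) p (wsum S (\<lambda>B. if card B = 1 then x B else 0)) \<le> \<beta> * Lp_norm (cube S) p ?f"
      using l main unfolding w r by (rule order_trans)
    \<comment> \<open>The martingale starts without the mean \<open>x {}\<close>. Its norm is at
      most that of the function, so removing it costs a factor 2.\<close>
    also have "\<dots> \<le> \<beta> * (2 * Lp_norm (cube S) p (wsum S x))"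
    proof (rule mult_left_mono[OF _ \<beta>])
      have "x {} = (1 / 2 ^ card S) *\<^sub>R (\<Sum>A\<in>Pow S. wsum S x A)" using sum_Pow_wsum[OF S, of S x] by simp
      then have "norm (x {}) \<le> Lp_norm (cube S) p (wsum S x)"
        using norm_mean_le_Lp_norm_cube[OF S, of p "wsum S x"] p by simp
      moreover have "Lp_norm (cube S) p (\<lambda>A. x {}) = norm (x {})"
        using S p by (simp add: cube_def Lp_norm_uniform_count_measure powr_powr card_Pow)
      moreover have "Lp_norm (cube S) p ?f \<le> Lp_norm (cube S) p (wsum S x) + Lp_norm (cube S) p (\<lambda>A. x {})"
        using S p by (intro Lp_norm_triangle_diff) auto
      ultimately show "Lp_norm (cube S) p ?f \<le> 2 * Lp_norm (cube S) p (wsum S x)" by linarith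
    qed
    finally show ?thesis by simp
  qed
  then show ?thesis using p \<beta> by (intro exI[of _ p] conjI exI[of _ "2 * \<beta>"]) auto
qed

section \<open>Bounded multipliers on the cube\<close>

text \<open>The multiplier \<open>c\<close> acts on the chaos decomposition of the cube, and the
  bound is uniform in the dimension. This uniformity is what allows a limit over larger and larger
  cubes.\<close>

definition mult_bounded :: "'b::real_normed_vector itself \<Rightarrow> real \<Rightarrow> (nat \<Rightarrow> real) \<Rightarrow> real \<Rightarrow> bool" where
  "mult_bounded _ p c C \<longleftrightarrow> (\<forall>S (x :: nat set \<Rightarrow> 'b). finite S \<longrightarrow>
     Lp_norm (cube S) p (wsum S (\<lambda>B. c (card B) *\<^sub>R x B)) \<le> C * Lp_norm (cube S) p (wsum S x))"

section \<open>Calculus of multiplier bounds\<close>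

lemma mult_boundedD:
  fixes x :: "nat set \<Rightarrow> 'b::real_normed_vector"
  assumes "mult_bounded TYPE('b) p c C" "finite S"
  shows "Lp_norm (cube S) p (wsum S (\<lambda>B. c (card B) *\<^sub>R x B)) \<le> C * Lp_norm (cube S) p (wsum S x)"
  using assms unfolding mult_bounded_def by blast

lemma mult_bounded_mono:
  assumes "mult_bounded TYPE('b::real_normed_vector) p c C" "C \<le> D"
  shows "mult_bounded TYPE('b) p c D"
  unfolding mult_bounded_def
  using mult_boundedD[OF assms(1)] mult_right_mono[OF assms(2) Lp_norm_nonneg] order_trans by blast

lemma mult_bounded_scale:
  assumes "mult_bounded TYPE('b::real_normed_vector) p c C" "0 < p"
  shows "mult_bounded TYPE('b) p (\<lambda>m. a * c m) (\<bar>a\<bar> * C)"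
  unfolding mult_bounded_def
proof (intro allI impI)
  fix S :: "nat set" and x :: "nat set \<Rightarrow> 'b" assume S: "finite S"
  have "wsum S (\<lambda>B. (a * c (card B)) *\<^sub>R x B) = (\<lambda>A. a *\<^sub>R wsum S (\<lambda>B. c (card B) *\<^sub>R x B) A)"
    by (rule ext) (simp add: wsum_scaleR[symmetric])
  then have "Lp_norm (cube S) p (wsum S (\<lambda>B. (a * c (card B)) *\<^sub>R x B)) = \<bar>a\<bar> * Lp_norm (cube S) p (wsum S (\<lambda>B. c (card B) *\<^sub>R x B))"
    using Lp_norm_scaleR[OF assms(2)] by metis
  also have "\<dots> \<le> \<bar>a\<bar> * (C * Lp_norm (cube S) p (wsum S x))"
    by (intro mult_left_mono mult_boundedD assms S) simp
  finally show "Lp_norm (cube S) p (wsum S (\<lambda>B. (a * c (card B)) *\<^sub>R x B)) \<le> (\<bar>a\<bar> * C) * Lp_norm (cube S) p (wsum S x)"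
    by (simp add: mult.assoc)
qed

lemma mult_bounded_sum:
  assumes "\<And>i. i \<in> I \<Longrightarrow> mult_bounded TYPE('b::real_normed_vector) p (c i) (C i)" "1 \<le> p"
  shows "mult_bounded TYPE('b) p (\<lambda>m. \<Sum>i\<in>I. c i m) (\<Sum>i\<in>I. C i)"
  unfolding mult_bounded_def
proof (intro allI impI)
  fix S :: "nat set" and x :: "nat set \<Rightarrow> 'b" assume S: "finite S"
  have "wsum S (\<lambda>B. (\<Sum>i\<in>I. c i (card B)) *\<^sub>R x B) = (\<lambda>A. \<Sum>i\<in>I. wsum S (\<lambda>B. c i (card B) *\<^sub>R x B) A)"
    by (rule ext) (simp add: wsum_sum[symmetric] scaleR_sum_left)
  then have "Lp_norm (cube S) p (wsum S (\<lambda>B. (\<Sum>i\<in>I. c i (card B)) *\<^sub>R x B))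
     \<le> (\<Sum>i\<in>I. Lp_norm (cube S) p (wsum S (\<lambda>B. c i (card B) *\<^sub>R x B)))"
    using S assms(2) by (simp add: Lp_norm_sum)
  also have "\<dots> \<le> (\<Sum>i\<in>I. C i * Lp_norm (cube S) p (wsum S x))"
    by (intro sum_mono mult_boundedD assms S)
  finally show "Lp_norm (cube S) p (wsum S (\<lambda>B. (\<Sum>i\<in>I. c i (card B)) *\<^sub>R x B)) \<le> (\<Sum>i\<in>I. C i) * Lp_norm (cube S) p (wsum S x)"
    by (simp add: sum_distrib_right)
qed

lemma mult_bounded_add:
  assumes "mult_bounded TYPE('b::real_normed_vector) p c C" "mult_bounded TYPE('b) p d D" "1 \<le> p"
  shows "mult_bounded TYPE('b) p (\<lambda>m. c m + d m) (C + D)"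
  using mult_bounded_sum[where 'b='b, of "{True, False}" p "\<lambda>b. if b then c else d" "\<lambda>b. if b then C else D"]
    assms by simp

text \<open>Pointwise convergence of the multipliers suffices, because a fixed cube has only
  finitely many Walsh functions.\<close>

lemma mult_bounded_limit:
  assumes c: "\<And>n. mult_bounded TYPE('b::real_normed_vector) p (c n) (C n)"
    and lim: "\<And>m. (\<lambda>n. c n m) \<longlonglongrightarrow> c' m" "C \<longlonglongrightarrow> C'" and p: "1 \<le> p"
  shows "mult_bounded TYPE('b) p c' C'"
  unfolding mult_bounded_def
proof (intro allI impI)
  fix S :: "nat set" and x :: "nat set \<Rightarrow> 'b" assume S: "finite S"
  have "(\<lambda>n. Lp_norm (cube S) p (wsum S (\<lambda>B. c n (card B) *\<^sub>R x B))) \<longlonglongrightarrow> Lp_norm (cube S) p (wsum S (\<lambda>B. c' (card B) *\<^sub>R x B))"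
  proof (rule LIM_zero_cancel, rule Lim_null_comparison)
    let ?b = "\<lambda>n. \<Sum>B\<in>Pow S. \<bar>c n (card B) - c' (card B)\<bar> * Lp_norm (cube S) p (\<lambda>A. walsh B A *\<^sub>R x B)"
    show "\<forall>\<^sub>F n in sequentially. norm (Lp_norm (cube S) p (wsum S (\<lambda>B. c n (card B) *\<^sub>R x B))
        - Lp_norm (cube S) p (wsum S (\<lambda>B. c' (card B) *\<^sub>R x B))) \<le> ?b n"
    proof (intro always_eventually allI)
      fix n
      have "\<bar>Lp_norm (cube S) p (wsum S (\<lambda>B. c n (card B) *\<^sub>R x B)) - Lp_norm (cube S) p (wsum S (\<lambda>B. c' (card B) *\<^sub>R x B))\<bar>
        \<le> Lp_norm (cube S) p (\<lambda>A. wsum S (\<lambda>B. c n (card B) *\<^sub>R x B) A - wsum S (\<lambda>B. c' (card B) *\<^sub>R x B) A)"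
        using S p by (intro Lp_norm_dist_le) auto
      also have "(\<lambda>A. wsum S (\<lambda>B. c n (card B) *\<^sub>R x B) A - wsum S (\<lambda>B. c' (card B) *\<^sub>R x B) A)
          = (\<lambda>A. \<Sum>B\<in>Pow S. (c n (card B) - c' (card B)) *\<^sub>R (walsh B A *\<^sub>R x B))"
        by (rule ext) (simp add: wsum_def sum_subtractf scaleR_diff_left left_diff_distrib right_diff_distrib mult.commute)
      also have "Lp_norm (cube S) p \<dots> \<le> (\<Sum>B\<in>Pow S. Lp_norm (cube S) p (\<lambda>A. (c n (card B) - c' (card B)) *\<^sub>R (walsh B A *\<^sub>R x B)))"
        using S p by (intro Lp_norm_sum) auto
      also have "\<dots> = ?b n" using p by (intro sum.cong refl Lp_norm_scaleR) auto
      finally show "norm (Lp_norm (cube S) p (wsum S (\<lambda>B. c n (card B) *\<^sub>R x B))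
        - Lp_norm (cube S) p (wsum S (\<lambda>B. c' (card B) *\<^sub>R x B))) \<le> ?b n" by simp
    qed
    show "?b \<longlonglongrightarrow> 0"
      by (intro tendsto_null_sum tendsto_mult_left_zero tendsto_rabs_zero LIM_zero lim)
  qed
  then show "Lp_norm (cube S) p (wsum S (\<lambda>B. c' (card B) *\<^sub>R x B)) \<le> C' * Lp_norm (cube S) p (wsum S x)"
    by (rule LIMSEQ_le[OF _ tendsto_mult_right[OF lim(2)]]) (use mult_boundedD[OF c S] in auto)
qed

text \<open>The two-point criterion with equal exponents: the mixing weights in one coordinate form
  a doubly stochastic matrix, so convexity of the power function gives it.\<close>

lemma mult_bounded_power:
  assumes "0 \<le> s" "s \<le> 1" "1 \<le> p"
  shows "mult_bounded TYPE('b::real_normed_vector) p (\<lambda>m. s ^ m) 1"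
  unfolding mult_bounded_def
proof (intro allI impI)
  fix S :: "nat set" and x :: "nat set \<Rightarrow> 'b" assume S: "finite S"
  have "Lp_norm (cube S) p (wsum S (\<lambda>B. s ^ card B *\<^sub>R x B)) \<le> Lp_norm (cube S) p (wsum S x)"
  proof (rule hypercontractive_of_two_point)
    fix u v :: real assume uv: "0 \<le> u" "0 \<le> v"
    have "((1 + s) / 2 * u + (1 - (1 + s) / 2) * v) powr p \<le> (1 + s) / 2 * u powr p + (1 - (1 + s) / 2) * v powr p"
      by (rule powr_convex_comb) (use uv assms in auto)
    moreover have "((1 - s) / 2 * u + (1 - (1 - s) / 2) * v) powr p \<le> (1 - s) / 2 * u powr p + (1 - (1 - s) / 2) * v powr p"
      by (rule powr_convex_comb) (use uv assms in auto)
    moreover have "1 - (1 + s) / 2 = (1 - s) / 2" "1 - (1 - s) / 2 = (1 + s) / 2" by (simp_all add: field_simps)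
    ultimately have "((1 + s) / 2 * u + (1 - s) / 2 * v) powr p + ((1 - s) / 2 * u + (1 + s) / 2 * v) powr p
        \<le> ((1 + s) / 2 + (1 - s) / 2) * u powr p + ((1 + s) / 2 + (1 - s) / 2) * v powr p"
      by (simp add: distrib_right)
    also have "(1 + s) / 2 + (1 - s) / 2 = 1" by (simp add: field_simps)
    finally show "(((1 + s) / 2 * u + (1 - s) / 2 * v) powr p + ((1 - s) / 2 * u + (1 + s) / 2 * v) powr p) / 2
        \<le> ((u powr p + v powr p) / 2) powr (p / p)" using assms by simp
  qed (use assms S in auto)
  then show "Lp_norm (cube S) p (wsum S (\<lambda>B. s ^ card B *\<^sub>R x B)) \<le> 1 * Lp_norm (cube S) p (wsum S x)" by simp
qed

text \<open>Hypercontractivity moves the exponent: the first chaos is an eigenspace of the noise operator,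
  which may be applied before or after the projection.\<close>

lemma mult_bounded_first_chaos:
  assumes "UMD_space TYPE('b::banach)" and p: "1 < p"
  shows "\<exists>C\<ge>0. mult_bounded TYPE('b) p (\<lambda>m. if m = 1 then 1 else 0) C"
proof -
  define R where "R p C \<longleftrightarrow> (\<forall>S (x :: nat set \<Rightarrow> 'b). finite S \<longrightarrow>
     Lp_norm (cube S) p (wsum S (\<lambda>B. if card B = 1 then x B else 0)) \<le> C * Lp_norm (cube S) p (wsum S x))" for p C
  have "\<exists>p>1. \<exists>C\<ge>0. R p C" using first_chaos_bound_UMD[OF assms(1)] unfolding R_def .
  then obtain q C where q: "1 < q" and C: "0 \<le> C" and R: "R q C" by blast
  have Rq: "Lp_norm (cube S) q (wsum S (\<lambda>B. if card B = 1 then x B else 0)) \<le> C * Lp_norm (cube S) q (wsum S x)"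
    if "finite S" for S and x :: "nat set \<Rightarrow> 'b" using R that unfolding R_def by blast
  define H where "H r r' \<sigma> \<longleftrightarrow> (\<forall>S (x :: nat set \<Rightarrow> 'b). finite S \<longrightarrow>
     Lp_norm (cube S) r' (wsum S (\<lambda>B. \<sigma> ^ card B *\<^sub>R x B)) \<le> Lp_norm (cube S) r (wsum S x))" for r r' \<sigma>
  have Hex: "\<exists>\<sigma>>0. \<sigma> < 1 \<and> H r r' \<sigma>" if "1 < r" "1 < r'" for r r'
    using hypercontractivity[of r r', where 'b='b] that unfolding H_def by auto
  obtain \<sigma> where \<sigma>: "0 < \<sigma>" "H q p \<sigma>" using Hex[OF q p] by blast
  obtain \<tau> where \<tau>: "0 < \<tau>" "H p q \<tau>" using Hex[OF p q] by blast
  have "R p (C / min \<sigma> \<tau>)"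
    unfolding R_def
  proof (intro allI impI)
    fix S :: "nat set" and x :: "nat set \<Rightarrow> 'b" assume S: "finite S"
    interpret prob_space "cube S" by (rule prob_space_cube[OF S])
    have C': "C / \<sigma> \<le> C / min \<sigma> \<tau>" "C / \<tau> \<le> C / min \<sigma> \<tau>" using \<sigma>(1) \<tau>(1) C by (auto intro!: divide_left_mono)
    have sc: "Lp_norm (cube S) r (wsum S (\<lambda>B. s ^ card B *\<^sub>R (if card B = 1 then x B else 0)))
        = s * Lp_norm (cube S) r (wsum S (\<lambda>B. if card B = 1 then x B else 0))" if "0 < s" "1 < r" for s r
    proof -
      have "wsum S (\<lambda>B. s ^ card B *\<^sub>R (if card B = 1 then x B else 0)) = (\<lambda>A. s *\<^sub>R wsum S (\<lambda>B. if card B = 1 then x B else 0) A)"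
        unfolding wsum_scaleR[symmetric] by (rule ext, rule wsum_cong) simp
      then show ?thesis using that Lp_norm_scaleR[of r "cube S" s] by simp
    qed
    show "Lp_norm (cube S) p (wsum S (\<lambda>B. if card B = 1 then x B else 0)) \<le> C / min \<sigma> \<tau> * Lp_norm (cube S) p (wsum S x)"
    \<comment> \<open>If the UMD exponent \<open>q\<close> is the smaller one, the noise operator is
      applied after the projection and raises the exponent from \<open>q\<close> to
      \<open>p\<close>. Otherwise it is applied before, to the given function, and raises the
      exponent from \<open>p\<close> to \<open>q\<close>.\<close>
    proof (cases "q \<le> p")
      case True
      have "\<sigma> * Lp_norm (cube S) p (wsum S (\<lambda>B. if card B = 1 then x B else 0)) \<le> Lp_norm (cube S) q (wsum S (\<lambda>B. if card B = 1 then x B else 0))"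
        using \<sigma>(2)[unfolded H_def, rule_format, OF S, of "\<lambda>B. if card B = 1 then x B else 0"]
        unfolding sc[OF \<sigma>(1) p] .
      also have "\<dots> \<le> C * Lp_norm (cube S) q (wsum S x)" by (rule Rq[OF S])
      also have "\<dots> \<le> C * Lp_norm (cube S) p (wsum S x)"
        by (intro mult_left_mono C Lp_norm_mono_exponent) (use S q True in auto)
      finally have "Lp_norm (cube S) p (wsum S (\<lambda>B. if card B = 1 then x B else 0)) \<le> C / \<sigma> * Lp_norm (cube S) p (wsum S x)"
        using \<sigma>(1) by (simp add: field_simps)
      also have "\<dots> \<le> C / min \<sigma> \<tau> * Lp_norm (cube S) p (wsum S x)" by (intro mult_right_mono C') simp
      finally show ?thesis .
    next
      case False
      have "\<tau> * Lp_norm (cube S) p (wsum S (\<lambda>B. if card B = 1 then x B else 0)) \<le> \<tau> * Lp_norm (cube S) q (wsum S (\<lambda>B. if card B = 1 then x B else 0))"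
        by (intro mult_left_mono Lp_norm_mono_exponent) (use S p False \<tau> in auto)
      also have "\<dots> = Lp_norm (cube S) q (wsum S (\<lambda>B. if card B = 1 then \<tau> ^ card B *\<^sub>R x B else 0))"
        unfolding sc[OF \<tau>(1) q, symmetric] by (simp add: if_distrib cong: if_cong)
      also have "\<dots> \<le> C * Lp_norm (cube S) q (wsum S (\<lambda>B. \<tau> ^ card B *\<^sub>R x B))" by (rule Rq[OF S])
      also have "\<dots> \<le> C * Lp_norm (cube S) p (wsum S x)"
        by (rule mult_left_mono[OF \<tau>(2)[unfolded H_def, rule_format, OF S] C])
      finally have "Lp_norm (cube S) p (wsum S (\<lambda>B. if card B = 1 then x B else 0)) \<le> C / \<tau> * Lp_norm (cube S) p (wsum S x)"
        using \<tau>(1) by (simp add: field_simps)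
      also have "\<dots> \<le> C / min \<sigma> \<tau> * Lp_norm (cube S) p (wsum S x)" by (intro mult_right_mono C') simp
      finally show ?thesis .
    qed
  qed
  moreover have "(if card B = 1 then 1 else 0) *\<^sub>R x B = (if card B = 1 then x B else 0)" for x :: "nat set \<Rightarrow> 'b" and B by simp
  ultimately have "mult_bounded TYPE('b) p (\<lambda>m. if m = 1 then 1 else 0) (C / min \<sigma> \<tau>)"
    unfolding mult_bounded_def R_def by simp
  then show ?thesis using C \<sigma>(1) \<tau>(1) by (intro exI[of _ "C / min \<sigma> \<tau>"]) auto
qed

section \<open>Projections onto higher chaoses by random splitting of the coordinates\<close>

lemma sum_Pow_split:
  fixes f :: "'i set \<Rightarrow> 'c::comm_monoid_add"
  assumes "finite S" "U \<subseteq> S"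
  shows "(\<Sum>A\<in>Pow S. f A) = (\<Sum>A2\<in>Pow (S - U). \<Sum>A1\<in>Pow U. f (A1 \<union> A2))"
proof -
  have "(\<Sum>A2\<in>Pow (S - U). \<Sum>A1\<in>Pow U. f (A1 \<union> A2)) = (\<Sum>z\<in>Pow (S - U) \<times> Pow U. f (snd z \<union> fst z))"
    by (simp add: sum.cartesian_product split_beta)
  also have "\<dots> = (\<Sum>A\<in>Pow S. f A)"
    by (rule sum.reindex_bij_witness[where i="\<lambda>A. (A - U, A \<inter> U)" and j="\<lambda>z. snd z \<union> fst z"])
       (use assms in \<open>auto simp: Int_Un_distrib2\<close>)
  finally show ?thesis by simp
qed

lemma walsh_Un:
  assumes "finite S" "U \<subseteq> S" "B1 \<subseteq> U" "A1 \<subseteq> U" "B2 \<subseteq> S - U" "A2 \<subseteq> S - U"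
  shows "walsh (B1 \<union> B2) (A1 \<union> A2) = walsh B1 A1 * walsh B2 A2"
proof -
  have fin: "finite B1" "finite B2" using assms finite_subset by (metis Diff_subset order_trans)+
  have "walsh (B1 \<union> B2) (A1 \<union> A2) = (\<Prod>i\<in>B1. rsign (A1 \<union> A2) i) * (\<Prod>i\<in>B2. rsign (A1 \<union> A2) i)"
    unfolding walsh_def by (rule prod.union_disjoint) (use assms fin in auto)
  also have "(\<Prod>i\<in>B1. rsign (A1 \<union> A2) i) = walsh B1 A1"
    unfolding walsh_def by (rule prod.cong[OF refl]) (use assms in \<open>auto simp: rsign_def\<close>)
  also have "(\<Prod>i\<in>B2. rsign (A1 \<union> A2) i) = walsh B2 A2"
    unfolding walsh_def by (rule prod.cong[OF refl]) (use assms in \<open>auto simp: rsign_def\<close>)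
  finally show ?thesis .
qed

lemma wsum_Un:
  assumes "finite S" "U \<subseteq> S" "A1 \<subseteq> U" "A2 \<subseteq> S - U"
  shows "wsum S x (A1 \<union> A2) = wsum U (\<lambda>B1. \<Sum>B2\<in>Pow (S - U). walsh B2 A2 *\<^sub>R x (B1 \<union> B2)) A1"
proof -
  have "wsum S x (A1 \<union> A2) = (\<Sum>B2\<in>Pow (S - U). \<Sum>B1\<in>Pow U. walsh (B1 \<union> B2) (A1 \<union> A2) *\<^sub>R x (B1 \<union> B2))"
    unfolding wsum_def by (rule sum_Pow_split[OF assms(1,2)])
  also have "\<dots> = (\<Sum>B2\<in>Pow (S - U). \<Sum>B1\<in>Pow U. walsh B1 A1 *\<^sub>R walsh B2 A2 *\<^sub>R x (B1 \<union> B2))"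
    by (intro sum.cong refl) (use assms in \<open>simp add: walsh_Un\<close>)
  also have "\<dots> = wsum U (\<lambda>B1. \<Sum>B2\<in>Pow (S - U). walsh B2 A2 *\<^sub>R x (B1 \<union> B2)) A1"
    unfolding wsum_def by (subst sum.swap) (simp add: scaleR_sum_right)
  finally show ?thesis .
qed

text \<open>Fubini: with the signs outside \<open>U\<close> frozen at \<open>A2\<close>, the
  function is a Walsh expansion over \<open>U\<close> with coefficients \<open>y A2\<close>, to
  which the multiplier bound applies. The powers of the norms are then summed over
  \<open>A2\<close>.\<close>

lemma mult_bounded_subcube:
  fixes x :: "nat set \<Rightarrow> 'b::real_normed_vector"
  assumes c: "mult_bounded TYPE('b) p c C" and C: "0 \<le> C" and p: "1 \<le> p" and S: "finite S" "U \<subseteq> S"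
  shows "Lp_norm (cube S) p (wsum S (\<lambda>B. c (card (B \<inter> U)) *\<^sub>R x B)) \<le> C * Lp_norm (cube S) p (wsum S x)"
proof (rule powr_le_cancel)
  show p0: "0 < p" using p by simp
  have U: "finite U" using S finite_subset by blast
  define y where "y A2 B1 = (\<Sum>B2\<in>Pow (S - U). walsh B2 A2 *\<^sub>R x (B1 \<union> B2))" for A2 B1
  have N: "(\<Sum>A1\<in>Pow U. norm (f A1) powr p) = 2 ^ card U * Lp_norm (cube U) p f powr p" for f :: "nat set \<Rightarrow> 'b"
    using Lp_norm_cube_powr[OF U p0, of f] by simp
  have e: "wsum S (\<lambda>B. c (card (B \<inter> U)) *\<^sub>R x B) (A1 \<union> A2) = wsum U (\<lambda>B1. c (card B1) *\<^sub>R y A2 B1) A1"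
    if "A2 \<in> Pow (S - U)" "A1 \<in> Pow U" for A1 A2
  proof -
    have "wsum S (\<lambda>B. c (card (B \<inter> U)) *\<^sub>R x B) (A1 \<union> A2)
       = wsum U (\<lambda>B1. \<Sum>B2\<in>Pow (S - U). walsh B2 A2 *\<^sub>R c (card ((B1 \<union> B2) \<inter> U)) *\<^sub>R x (B1 \<union> B2)) A1"
      by (rule wsum_Un[OF S]) (use that in auto)
    also have "\<dots> = wsum U (\<lambda>B1. c (card B1) *\<^sub>R y A2 B1) A1"
    proof (rule wsum_cong)
      fix B1 assume B1: "B1 \<subseteq> U"
      have "(\<Sum>B2\<in>Pow (S - U). walsh B2 A2 *\<^sub>R c (card ((B1 \<union> B2) \<inter> U)) *\<^sub>R x (B1 \<union> B2))
         = (\<Sum>B2\<in>Pow (S - U). c (card B1) *\<^sub>R walsh B2 A2 *\<^sub>R x (B1 \<union> B2))"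
      proof (rule sum.cong[OF refl])
        fix B2 assume "B2 \<in> Pow (S - U)"
        then have "(B1 \<union> B2) \<inter> U = B1" using B1 by auto
        then show "walsh B2 A2 *\<^sub>R c (card ((B1 \<union> B2) \<inter> U)) *\<^sub>R x (B1 \<union> B2) = c (card B1) *\<^sub>R walsh B2 A2 *\<^sub>R x (B1 \<union> B2)"
          by (simp add: mult.commute)
      qed
      then show "(\<Sum>B2\<in>Pow (S - U). walsh B2 A2 *\<^sub>R c (card ((B1 \<union> B2) \<inter> U)) *\<^sub>R x (B1 \<union> B2)) = c (card B1) *\<^sub>R y A2 B1"
        by (simp add: y_def scaleR_sum_right)
    qed
    finally show ?thesis .
  qed
  have "(\<Sum>A\<in>Pow S. norm (wsum S (\<lambda>B. c (card (B \<inter> U)) *\<^sub>R x B) A) powr p)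
     = (\<Sum>A2\<in>Pow (S - U). \<Sum>A1\<in>Pow U. norm (wsum U (\<lambda>B1. c (card B1) *\<^sub>R y A2 B1) A1) powr p)"
    unfolding sum_Pow_split[OF S] by (intro sum.cong refl) (simp add: e)
  also have "\<dots> \<le> (\<Sum>A2\<in>Pow (S - U). C powr p * (\<Sum>A1\<in>Pow U. norm (wsum U (y A2) A1) powr p))"
  proof (rule sum_mono)
    fix A2
    have "Lp_norm (cube U) p (wsum U (\<lambda>B1. c (card B1) *\<^sub>R y A2 B1)) powr p \<le> (C * Lp_norm (cube U) p (wsum U (y A2))) powr p"
      using p0 mult_boundedD[OF c U] by (intro powr_mono2) auto
    then show "(\<Sum>A1\<in>Pow U. norm (wsum U (\<lambda>B1. c (card B1) *\<^sub>R y A2 B1) A1) powr p) \<le> C powr p * (\<Sum>A1\<in>Pow U. norm (wsum U (y A2) A1) powr p)"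
      unfolding N by (simp add: powr_mult mult_ac)
  qed
  also have "\<dots> = C powr p * (\<Sum>A\<in>Pow S. norm (wsum S x A) powr p)"
    unfolding sum_Pow_split[OF S] sum_distrib_left[symmetric]
    by (intro arg_cong[where f="\<lambda>z. C powr p * z"] sum.cong refl) (simp add: wsum_Un[OF S] y_def[abs_def])
  finally have "(\<Sum>A\<in>Pow S. norm (wsum S (\<lambda>B. c (card (B \<inter> U)) *\<^sub>R x B) A) powr p) / 2 ^ card S
      \<le> C powr p * ((\<Sum>A\<in>Pow S. norm (wsum S x A) powr p) / 2 ^ card S)"
    by (simp add: divide_right_mono)
  then show "Lp_norm (cube S) p (wsum S (\<lambda>B. c (card (B \<inter> U)) *\<^sub>R x B)) powr p \<le> (C * Lp_norm (cube S) p (wsum S x)) powr p"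
    using S(1) p0 by (simp add: powr_mult Lp_norm_cube_powr)
qed (use C in auto)

lemma sum_binomial_weights:
  fixes \<theta> :: real
  assumes "finite S"
  shows "(\<Sum>U\<in>Pow S. \<theta> ^ card U * (1 - \<theta>) ^ card (S - U)) = 1"
  using prod_add[OF assms, of "\<lambda>_. \<theta>" "\<lambda>_. 1 - \<theta>"] by simp

text \<open>The left side is the probability that a random \<open>U\<close>, containing each index
  independently with probability \<open>\<theta>\<close>, catches exactly one element of
  \<open>B\<close> and leaves \<open>m - 1\<close> of them outside. The indices off \<open>B\<close>
  contribute total weight 1, and the caught element can be chosen in \<open>m\<close> ways.\<close>

lemma sum_weights_split:
  fixes \<theta> :: real
  assumes S: "finite S" and B: "B \<subseteq> S" and m: "1 \<le> m"
  shows "(\<Sum>U\<in>Pow S. \<theta> ^ card U * (1 - \<theta>) ^ card (S - U) *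
            ((if card (B \<inter> U) = 1 then 1 else 0) * (if card (B \<inter> (S - U)) = m - 1 then 1 else 0)))
       = (if card B = m then m * \<theta> * (1 - \<theta>) ^ (m - 1) else 0)"
proof -
  have fB: "finite B" using S B finite_subset by blast
  let ?w = "\<lambda>U. \<theta> ^ card U * (1 - \<theta>) ^ card (S - U) *
            ((if card (B \<inter> U) = 1 then 1 else 0) * (if card (B \<inter> (S - U)) = m - 1 then 1 else 0))"
  have sp: "?w (U1 \<union> U2) = (\<theta> ^ card U2 * (1 - \<theta>) ^ card (S - B - U2)) *
       (if card U1 = 1 \<and> card B = m then \<theta> * (1 - \<theta>) ^ (m - 1) else 0)"
    if "U2 \<in> Pow (S - B)" "U1 \<in> Pow B" for U1 U2
  proof -
    have f: "finite U1" "finite U2" using that fB S finite_subset by (auto intro: finite_subset)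
    have c1: "card (U1 \<union> U2) = card U1 + card U2" by (rule card_Un_disjoint) (use f that in auto)
    have "S - (U1 \<union> U2) = (B - U1) \<union> (S - B - U2)" using that B by auto
    moreover have "card ((B - U1) \<union> (S - B - U2)) = card (B - U1) + card (S - B - U2)"
      by (rule card_Un_disjoint) (use S fB in auto)
    ultimately have c2: "card (S - (U1 \<union> U2)) = card (B - U1) + card (S - B - U2)" by simp
    have c3: "B \<inter> (U1 \<union> U2) = U1" "B \<inter> (S - (U1 \<union> U2)) = B - U1" using that B by auto
    have c4: "card (B - U1) = card B - card U1" "card U1 \<le> card B"
      using that f fB by (auto simp: card_Diff_subset card_mono)
    show ?thesis
    proof (cases "card U1 = 1 \<and> card B = m")
      case True
      then have "card (B - U1) = m - 1" "card U1 = 1" "card B = m" using c4 by auto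
      then show ?thesis unfolding c1 c2 c3 by (simp add: power_add mult_ac)
    next
      case False
      then have "\<not> (card U1 = 1 \<and> card (B - U1) = m - 1)" using c4 m by auto
      then show ?thesis using False unfolding c3 by auto
    qed
  qed
  have "(\<Sum>U\<in>Pow S. ?w U) = (\<Sum>U2\<in>Pow (S - B). \<Sum>U1\<in>Pow B. ?w (U1 \<union> U2))"
    by (rule sum_Pow_split[OF S B])
  also have "\<dots> = (\<Sum>U2\<in>Pow (S - B). \<Sum>U1\<in>Pow B. (\<theta> ^ card U2 * (1 - \<theta>) ^ card (S - B - U2)) *
       (if card U1 = 1 \<and> card B = m then \<theta> * (1 - \<theta>) ^ (m - 1) else 0))"
    by (intro sum.cong refl sp)
  also have "\<dots> = (\<Sum>U1\<in>Pow B. if card U1 = 1 \<and> card B = m then \<theta> * (1 - \<theta>) ^ (m - 1) else 0)"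
    unfolding sum_product[symmetric] using sum_binomial_weights[of "S - B" \<theta>] S by simp
  also have "\<dots> = (if card B = m then m * \<theta> * (1 - \<theta>) ^ (m - 1) else 0)"
  proof (cases "card B = m")
    case True
    have "(\<Sum>U1\<in>Pow B. if card U1 = 1 \<and> card B = m then \<theta> * (1 - \<theta>) ^ (m - 1) else 0)
       = (\<Sum>U1\<in>{U1\<in>Pow B. card U1 = 1}. \<theta> * (1 - \<theta>) ^ (m - 1))"
      using True fB by (subst sum.inter_filter) auto
    also have "\<dots> = card {U1. U1 \<subseteq> B \<and> card U1 = 1} * (\<theta> * (1 - \<theta>) ^ (m - 1))" by simp
    also have "card {U1. U1 \<subseteq> B \<and> card U1 = 1} = m" using n_subsets[OF fB, of 1] True by simp
    finally show ?thesis using True by simp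
  qed simp
  finally show ?thesis .
qed

text \<open>Splitting the coordinates at random, with probability \<open>1 / m\<close> for the part that is to carry
  exactly one factor, costs only a factor \<open>(1 - 1 / m)\<^sup>m\<^sup>-\<^sup>1 \<ge> 1 / 3\<close> per step, whence the
  exponential growth.\<close>

lemma mult_bounded_chaos:
  assumes "UMD_space TYPE('b::banach)" and p: "1 < p"
  shows "\<exists>D\<ge>1. \<forall>m. mult_bounded TYPE('b) p (\<lambda>j. if j = m then 1 else 0) (D ^ m)"
proof -
  obtain C0 where C0: "mult_bounded TYPE('b) p (\<lambda>m. if m = 1 then 1 else 0) C0"
    using mult_bounded_first_chaos[OF assms] by blast
  define C where "C = max 1 C0"
  have C: "1 \<le> C" and R1: "mult_bounded TYPE('b) p (\<lambda>m. if m = 1 then 1 else 0) C"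
    using mult_bounded_mono[OF C0] by (auto simp: C_def)
  have p1: "1 \<le> p" "0 < p" using p by auto
  have main: "mult_bounded TYPE('b) p (\<lambda>j. if j = m then 1 else 0) ((3 * C) ^ m)" for m
  proof (induction m rule: less_induct)
    case (less m)
    consider "m = 0" | "m = 1" | "2 \<le> m" by linarith
    then show ?case
    proof cases
      case 1
      show ?thesis unfolding mult_bounded_def 1
      proof (intro allI impI)
        fix S :: "nat set" and x :: "nat set \<Rightarrow> 'b" assume S: "finite S"
        have "wsum S (\<lambda>B. (if card B = 0 then 1 else 0) *\<^sub>R x B) = (\<lambda>A. x {})"
        proof (rule ext)
          fix A
          have "wsum S (\<lambda>B. (if card B = 0 then 1 else 0) *\<^sub>R x B) A = (\<Sum>B\<in>Pow S. if B = {} then x {} else 0)"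
            unfolding wsum_def
          proof (rule sum.cong[OF refl])
            fix B assume "B \<in> Pow S"
            then have "finite B" using S finite_subset by auto
            then show "walsh B A *\<^sub>R (if card B = 0 then 1 else 0) *\<^sub>R x B = (if B = {} then x {} else 0)" by simp
          qed
          also have "\<dots> = x {}" using S by simp
          finally show "wsum S (\<lambda>B. (if card B = 0 then 1 else 0) *\<^sub>R x B) A = x {}" .
        qed
        moreover have "Lp_norm (cube S) p (\<lambda>A. x {}) = norm (x {})"
          using S p by (simp add: cube_def Lp_norm_uniform_count_measure powr_powr card_Pow)
        moreover have "x {} = (1 / 2 ^ card S) *\<^sub>R (\<Sum>A\<in>Pow S. wsum S x A)" using sum_Pow_wsum[OF S, of S x] by simp
        ultimately show "Lp_norm (cube S) p (wsum S (\<lambda>B. (if card B = 0 then 1 else 0) *\<^sub>R x B)) \<le> (3 * C) ^ 0 * Lp_norm (cube S) p (wsum S x)"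
          using norm_mean_le_Lp_norm_cube[OF S p1(1), of "wsum S x"] by simp
      qed
    next
      case 2
      then show ?thesis using mult_bounded_mono[OF R1, of "(3 * C) ^ m"] C by simp
    next
      case 3
      define \<theta> where "\<theta> = 1 / real m"
      have \<theta>: "0 \<le> \<theta>" "0 \<le> 1 - \<theta>" using 3 by (auto simp: \<theta>_def)
      define w where "w S U = \<theta> ^ card U * (1 - \<theta>) ^ card (S - U)" for S U :: "nat set"
      define K where "K = (1 - \<theta>) ^ (m - 1)"
      have mK: "real m * \<theta> * (1 - \<theta>) ^ (m - 1) = K" using 3 by (simp add: \<theta>_def K_def)
      \<comment> \<open>The reciprocal \<open>1 / K\<close> equals
        \<open>(1 + 1 / (m - 1))^(m - 1)\<close>, which is at most \<open>exp 1\<close>.\<close>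
      have "1 \<le> 3 * K"
      proof -
        have "1 / (1 - \<theta>) = 1 + 1 / real (m - 1)" using 3 by (simp add: \<theta>_def field_simps of_nat_diff)
        also have "\<dots> \<le> exp (1 / real (m - 1))" by (rule exp_ge_add_one_self)
        finally have "(1 / (1 - \<theta>)) ^ (m - 1) \<le> exp (1 / real (m - 1)) ^ (m - 1)"
          using \<theta> by (intro power_mono) auto
        also have "\<dots> = exp 1" using 3 by (simp add: exp_of_nat_mult[symmetric])
        also have "\<dots> \<le> 3" by (rule exp_le)
        finally have "1 / K \<le> 3" by (simp add: K_def power_divide)
        moreover have "0 < K" using 3 by (simp add: K_def \<theta>_def)
        ultimately show ?thesis by (simp add: field_simps)
      qed
      let ?d = "\<lambda>j. if j = m - 1 then 1 else 0 :: real"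
      let ?c = "\<lambda>j. if j = 1 then 1 else 0 :: real"
      have IH: "mult_bounded TYPE('b) p ?d ((3 * C) ^ (m - 1))" using less.IH[of "m - 1"] 3 by simp
      show ?thesis unfolding mult_bounded_def
      proof (intro allI impI)
        fix S :: "nat set" and x :: "nat set \<Rightarrow> 'b" assume S: "finite S"
        \<comment> \<open>\<open>f U\<close> keeps the Walsh functions with exactly one index in
          \<open>U\<close> and \<open>m - 1\<close> outside, a composition of the first order
          projection on \<open>U\<close> with the projection of order \<open>m - 1\<close> on the
          rest. Its mean over the random \<open>U\<close> is \<open>K\<close> times the projection
          of order \<open>m\<close>.\<close>
        define f where "f U = wsum S (\<lambda>B. ?c (card (B \<inter> U)) *\<^sub>R ?d (card (B \<inter> (S - U))) *\<^sub>R x B)" for U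
        have fb: "Lp_norm (cube S) p (f U) \<le> C * ((3 * C) ^ (m - 1) * Lp_norm (cube S) p (wsum S x))" if "U \<in> Pow S" for U
        proof -
          have "Lp_norm (cube S) p (f U) \<le> C * Lp_norm (cube S) p (wsum S (\<lambda>B. ?d (card (B \<inter> (S - U))) *\<^sub>R x B))"
            unfolding f_def by (rule mult_bounded_subcube[OF R1]) (use C p1 S that in auto)
          also have "\<dots> \<le> C * ((3 * C) ^ (m - 1) * Lp_norm (cube S) p (wsum S x))"
            by (intro mult_left_mono mult_bounded_subcube[OF IH]) (use C p1 S that in auto)
          finally show ?thesis .
        qed
        have eq: "(\<lambda>A. \<Sum>U\<in>Pow S. w S U *\<^sub>R f U A) = (\<lambda>A. K *\<^sub>R wsum S (\<lambda>B. (if card B = m then 1 else 0) *\<^sub>R x B) A)"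
        proof (rule ext)
          fix A
          have "(\<Sum>U\<in>Pow S. w S U *\<^sub>R f U A) = wsum S (\<lambda>B. (\<Sum>U\<in>Pow S. w S U * (?c (card (B \<inter> U)) * ?d (card (B \<inter> (S - U))))) *\<^sub>R x B) A"
            unfolding f_def wsum_scaleR[symmetric] wsum_sum[symmetric] scaleR_sum_left by simp
          also have "\<dots> = wsum S (\<lambda>B. K *\<^sub>R (if card B = m then 1 else 0) *\<^sub>R x B) A"
          proof (rule wsum_cong)
            fix B assume B: "B \<subseteq> S"
            have "(\<Sum>U\<in>Pow S. w S U * (?c (card (B \<inter> U)) * ?d (card (B \<inter> (S - U))))) = (if card B = m then K else 0)"
              unfolding w_def using sum_weights_split[OF S B, of m \<theta>] 3 mK by simp
            then show "(\<Sum>U\<in>Pow S. w S U * (?c (card (B \<inter> U)) * ?d (card (B \<inter> (S - U))))) *\<^sub>R x B = K *\<^sub>R (if card B = m then 1 else 0) *\<^sub>R x B"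
              by simp
          qed
          also have "\<dots> = K *\<^sub>R wsum S (\<lambda>B. (if card B = m then 1 else 0) *\<^sub>R x B) A" by (rule wsum_scaleR)
          finally show "(\<Sum>U\<in>Pow S. w S U *\<^sub>R f U A) = K *\<^sub>R wsum S (\<lambda>B. (if card B = m then 1 else 0) *\<^sub>R x B) A" .
        qed
        let ?R = "Lp_norm (cube S) p (wsum S (\<lambda>B. (if card B = m then 1 else 0) *\<^sub>R x B))"
        have K0: "0 \<le> K" using \<theta> by (simp add: K_def)
        have w0: "0 \<le> w S U" for U using \<theta> by (simp add: w_def)
        have "K * ?R = Lp_norm (cube S) p (\<lambda>A. \<Sum>U\<in>Pow S. w S U *\<^sub>R f U A)"
          unfolding eq using p1 K0 by (simp add: Lp_norm_scaleR)
        also have "\<dots> \<le> (\<Sum>U\<in>Pow S. Lp_norm (cube S) p (\<lambda>A. w S U *\<^sub>R f U A))"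
          using S p1 by (intro Lp_norm_sum) auto
        also have "\<dots> = (\<Sum>U\<in>Pow S. w S U * Lp_norm (cube S) p (f U))"
          using p1 w0 by (simp add: Lp_norm_scaleR)
        also have "\<dots> \<le> (\<Sum>U\<in>Pow S. w S U * (C * ((3 * C) ^ (m - 1) * Lp_norm (cube S) p (wsum S x))))"
          by (intro sum_mono mult_left_mono fb w0)
        also have "\<dots> = C * ((3 * C) ^ (m - 1) * Lp_norm (cube S) p (wsum S x))"
          unfolding sum_distrib_right[symmetric] w_def sum_binomial_weights[OF S] by simp
        finally have "3 * (K * ?R) \<le> 3 * (C * ((3 * C) ^ (m - 1) * Lp_norm (cube S) p (wsum S x)))" by simp
        moreover have "1 * ?R \<le> (3 * K) * ?R" using \<open>1 \<le> 3 * K\<close> by (intro mult_right_mono) auto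
        moreover have "(3 * C) ^ m = 3 * C * (3 * C) ^ (m - 1)" using 3 by (simp add: power_eq_if)
        ultimately show "?R \<le> (3 * C) ^ m * Lp_norm (cube S) p (wsum S x)" by (simp add: mult_ac)
      qed
    qed
  qed
  then show ?thesis using C by (intro exI[of _ "3 * C"]) auto
qed

section \<open>Tails of the noise operator and inverse powers of the number operator\<close>

lemma sum_delta_upto:
  fixes a :: "nat \<Rightarrow> real"
  assumes "finite J"
  shows "(\<Sum>j\<in>J. a j * (if m = j then 1 else 0)) = (if m \<in> J then a m else 0)"
proof -
  have "(\<Sum>j\<in>J. a j * (if m = j then 1 else 0)) = (\<Sum>j\<in>J. if m = j then a m else 0)"
    by (rule sum.cong) auto
  then show ?thesis using assms by simp
qed

text \<open>For small \<open>s\<close> the tail of the chaos expansion is summed with the exponential bounds, for the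
  other \<open>s\<close> the finitely many lower chaoses are subtracted from the noise operator.\<close>

lemma mult_bounded_power_tail:
  assumes D: "1 \<le> D" "\<And>m. mult_bounded TYPE('b::real_normed_vector) p (\<lambda>j. if j = m then 1 else 0) (D ^ m)"
    and p: "1 \<le> p"
  shows "\<exists>C\<ge>0. \<forall>s. 0 < s \<and> s \<le> 1 \<longrightarrow>
     mult_bounded TYPE('b) p (\<lambda>m. if N < m then s ^ m else 0) (C * s ^ N)"
proof -
  define K where "K = 1 + (\<Sum>m\<le>N. D ^ m)"
  have K: "1 \<le> K" using D by (simp add: K_def sum_nonneg)
  \<comment> \<open>If \<open>s * D\<close> exceeds 1/2, then \<open>(2 * s * D)^N\<close> is at
    least 1, and multiplying the constant bound \<open>K\<close> by it produces the desired factor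
    \<open>s^N\<close>.\<close>
  define C where "C = K * (2 * D) ^ N"
  have C: "0 \<le> C" using K D by (simp add: C_def)
  have p0: "0 < p" using p by simp
  have sm: "mult_bounded TYPE('b) p (\<lambda>m. \<Sum>j\<in>J. s ^ j * (if m = j then 1 else 0)) (\<Sum>j\<in>J. (s * D) ^ j)"
    if "0 < s" for s and J :: "nat set"
  proof (rule mult_bounded_sum[OF _ p])
    fix j
    show "mult_bounded TYPE('b) p (\<lambda>m. s ^ j * (if m = j then 1 else 0)) ((s * D) ^ j)"
      using mult_bounded_scale[OF D(2)[of j] p0, of "s ^ j"] that by (simp add: power_mult_distrib)
  qed
  have "mult_bounded TYPE('b) p (\<lambda>m. if N < m then s ^ m else 0) (C * s ^ N)" if s: "0 < s" "s \<le> 1" for s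
  proof (cases "s * D \<le> 1 / 2")
    case True
    define r where "r = s * D"
    have r: "0 < r" "r \<le> 1/2" using True s D by (auto simp: r_def)
    have geo: "(\<Sum>j\<in>{N<..<N + L}. r ^ j) \<le> C * s ^ N" for L
    proof -
      have "(\<Sum>j\<in>{N<..<N + L}. r ^ j) \<le> (\<Sum>j\<in>{0 + N..<L + N}. r ^ j)"
        by (rule sum_mono2) (use r in auto)
      also have "\<dots> = r ^ N * (\<Sum>j<L. r ^ j)"
        unfolding sum.shift_bounds_nat_ivl by (simp add: sum_distrib_left power_add mult.commute atLeast0LessThan)
      also have "\<dots> \<le> r ^ N * 2"
      proof (rule mult_left_mono)
        have "(\<Sum>j<L. r ^ j) = (1 - r ^ L) / (1 - r)" using r by (simp add: sum_gp_strict)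
        also have "\<dots> \<le> 1 / (1 - r)" using r by (intro divide_right_mono) auto
        also have "\<dots> \<le> 2" using r by (simp add: field_simps)
        finally show "(\<Sum>j<L. r ^ j) \<le> 2" .
      qed (use r in auto)
      also have "\<dots> \<le> (K * (2 * D) ^ N) * s ^ N"
      proof -
        have "(2::real) \<le> K"
          using sum_mono2[of "{..N}" "{0}" "\<lambda>m. D ^ m"] D by (simp add: K_def)
        moreover have "D ^ N \<le> (2 * D) ^ N" using D by (intro power_mono) auto
        ultimately have "2 * D ^ N \<le> K * (2 * D) ^ N" using D K by (intro mult_mono) auto
        then have "2 * D ^ N * s ^ N \<le> K * (2 * D) ^ N * s ^ N" using s by (intro mult_right_mono) auto
        then show ?thesis by (simp add: r_def power_mult_distrib mult_ac)
      qed
      finally show ?thesis by (simp add: C_def)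
    qed
    have b: "mult_bounded TYPE('b) p (\<lambda>m. if m \<in> {N<..<N + L} then s ^ m else 0) (C * s ^ N)" for L
      using mult_bounded_mono[OF sm[OF s(1), of "{N<..<N + L}"] geo[of L, unfolded r_def]]
      by (simp add: sum_delta_upto del: greaterThanLessThan_iff)
    show ?thesis
    proof (rule mult_bounded_limit[OF b _ tendsto_const p])
      fix m
      have "\<forall>\<^sub>F L in sequentially. (if m \<in> {N<..<N + L} then s ^ m else 0) = (if N < m then s ^ m else 0)"
        using eventually_gt_at_top[of m] by eventually_elim auto
      then show "(\<lambda>L. if m \<in> {N<..<N + L} then s ^ m else 0) \<longlonglongrightarrow> (if N < m then s ^ m else 0)"
        by (rule tendsto_eventually)
    qed
  next
    case False
    have f1: "mult_bounded TYPE('b) p (\<lambda>m. s ^ m + (- 1) * (\<Sum>j\<in>{..N}. s ^ j * (if m = j then 1 else 0)))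
       (1 + \<bar>- 1\<bar> * (\<Sum>j\<in>{..N}. (s * D) ^ j))"
      by (intro mult_bounded_add mult_bounded_scale mult_bounded_power sm p p0) (use s in auto)
    have f2: "(\<lambda>m. s ^ m + (- 1) * (\<Sum>j\<in>{..N}. s ^ j * (if m = j then 1 else 0))) = (\<lambda>m. if N < m then s ^ m else 0)"
      by (rule ext, subst sum_delta_upto) auto
    have f3: "1 + \<bar>- 1\<bar> * (\<Sum>j\<in>{..N}. (s * D) ^ j) \<le> C * s ^ N"
    proof -
      have "(s * D) ^ j \<le> D ^ j" for j using s D by (intro power_mono mult_left_le_one_le) auto
      then have "1 + (\<Sum>j\<in>{..N}. (s * D) ^ j) \<le> K" unfolding K_def by (intro add_left_mono sum_mono)
      also have "\<dots> \<le> K * (2 * (s * D)) ^ N"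
      proof -
        have "1 \<le> (2 * (s * D)) ^ N" using False by (intro one_le_power) simp
        then have "K * 1 \<le> K * (2 * (s * D)) ^ N" using K by (intro mult_left_mono) auto
        then show ?thesis by simp
      qed
      also have "\<dots> = C * s ^ N" by (simp add: C_def power_mult_distrib mult_ac)
      finally show ?thesis by simp
    qed
    show ?thesis using mult_bounded_mono[OF f1 f3] unfolding f2 .
  qed
  then show ?thesis using C by blast
qed

text \<open>The factor \<open>1 / m\<close> is the integral of \<open>e\<^sup>-\<^sup>m\<^sup>t\<close> over \<open>t \<ge> 0\<close>; here it is replaced by the Riemann
  sum \<open>\<Sum>j\<ge>1. h e\<^sup>-\<^sup>m\<^sup>j\<^sup>h = h / (e\<^sup>m\<^sup>h - 1)\<close>, which has the same effect on the bound.\<close>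

definition riemann :: "real \<Rightarrow> nat \<Rightarrow> real" where
  "riemann h m = h / (exp (m * h) - 1)"

lemma riemann_sums:
  assumes "0 < h" "1 \<le> m"
  shows "(\<lambda>j. h * exp (- (real (Suc j) * h)) ^ m) sums riemann h m"
proof -
  define r where "r = exp (- (real m * h))"
  have mh: "0 < real m * h" using assms by simp
  have r: "0 < r" "r < 1" using mh by (auto simp: r_def)
  have "(\<lambda>j. h * r * r ^ j) sums (h * r * (1 / (1 - r)))"
    using r by (intro sums_mult geometric_sums) auto
  moreover have "h * r * r ^ j = h * exp (- (real (Suc j) * h)) ^ m" for j
    by (simp add: r_def exp_of_nat_mult[symmetric] exp_add[symmetric] algebra_simps mult_exp_exp)
  moreover have "h * r * (1 / (1 - r)) = riemann h m"
  proof -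
    have "r * exp (real m * h) = 1" by (simp add: r_def exp_minus_inverse mult.commute exp_minus field_simps)
    then have "1 - r = (exp (real m * h) - 1) * r" by (simp add: algebra_simps)
    moreover have "exp (real m * h) - 1 > 0" using mh by simp
    ultimately show ?thesis using r unfolding riemann_def by simp
  qed
  ultimately show ?thesis by simp
qed

text \<open>The factor \<open>s^m\<close> is what the induction lives on: one more factor
  \<open>riemann h m\<close> is a superposition of noise factors \<open>exp (- (j + 1) h)^m\<close>,
  which are absorbed by replacing \<open>s\<close> with \<open>u j\<close>. The bounds for the
  \<open>u j\<close> sum to one more factor \<open>riemann h N\<close>, so \<open>C\<close> does not
  grow with \<open>k\<close>.\<close>

lemma mult_bounded_riemann:
  assumes C: "0 \<le> C" and N: "1 \<le> N" and p: "1 \<le> p" and h: "0 < h"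
    and tail: "\<And>s. 0 < s \<Longrightarrow> s \<le> 1 \<Longrightarrow>
     mult_bounded TYPE('b::real_normed_vector) p (\<lambda>m. if N < m then s ^ m else 0) (C * s ^ N)"
    and s: "0 < s" "s \<le> 1"
  shows "mult_bounded TYPE('b) p (\<lambda>m. if N < m then s ^ m * riemann h m ^ k else 0) (C * s ^ N * riemann h N ^ k)"
  using s
proof (induction k arbitrary: s)
  case 0
  then show ?case using tail by (simp cong: if_cong)
next
  case (Suc k)
  define u where "u j = s * exp (- (real (Suc j) * h))" for j
  have e1: "exp (- (real (Suc j) * h)) \<le> 1" for j using h by simp
  have u: "0 < u j" "u j \<le> 1" for j using Suc.prems mult_le_one[OF Suc.prems(2) _ e1[of j]] by (auto simp: u_def)
  let ?c = "\<lambda>L m. \<Sum>j<L. h * (if N < m then u j ^ m * riemann h m ^ k else 0)"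
  have b: "mult_bounded TYPE('b) p (?c L) (\<Sum>j<L. \<bar>h\<bar> * (C * u j ^ N * riemann h N ^ k))" for L
    by (intro mult_bounded_sum mult_bounded_scale Suc.IH u p) (use p in auto)
  show ?case
  proof (rule mult_bounded_limit[OF b _ _ p])
    fix m
    show "(\<lambda>L. ?c L m) \<longlonglongrightarrow> (if N < m then s ^ m * riemann h m ^ Suc k else 0)"
    proof (cases "N < m")
      case True
      then have "(\<lambda>j. (s ^ m * riemann h m ^ k) * (h * exp (- (real (Suc j) * h)) ^ m)) sums ((s ^ m * riemann h m ^ k) * riemann h m)"
        by (intro sums_mult riemann_sums h) auto
      moreover have "(\<lambda>j. (s ^ m * riemann h m ^ k) * (h * exp (- (real (Suc j) * h)) ^ m)) = (\<lambda>j. h * (if N < m then u j ^ m * riemann h m ^ k else 0))"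
        using True by (simp add: u_def power_mult_distrib mult_ac)
      ultimately have "(\<lambda>j. h * (if N < m then u j ^ m * riemann h m ^ k else 0)) sums ((s ^ m * riemann h m ^ k) * riemann h m)"
        by (simp only:)
      moreover have "(s ^ m * riemann h m ^ k) * riemann h m = (if N < m then s ^ m * riemann h m ^ Suc k else 0)"
        using True by simp
      ultimately show ?thesis unfolding sums_def by (simp only:)
    qed simp
  next
    have "(\<lambda>j. (C * s ^ N * riemann h N ^ k) * (h * exp (- (real (Suc j) * h)) ^ N)) sums ((C * s ^ N * riemann h N ^ k) * riemann h N)"
      by (intro sums_mult riemann_sums h N)
    moreover have "(\<lambda>j. (C * s ^ N * riemann h N ^ k) * (h * exp (- (real (Suc j) * h)) ^ N)) = (\<lambda>j. \<bar>h\<bar> * (C * u j ^ N * riemann h N ^ k))"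
      using h by (simp add: u_def power_mult_distrib mult_ac)
    ultimately have "(\<lambda>j. \<bar>h\<bar> * (C * u j ^ N * riemann h N ^ k)) sums ((C * s ^ N * riemann h N ^ k) * riemann h N)"
      by (simp only:)
    moreover have "(C * s ^ N * riemann h N ^ k) * riemann h N = C * s ^ N * riemann h N ^ Suc k" by simp
    ultimately show "(\<lambda>L. \<Sum>j<L. \<bar>h\<bar> * (C * u j ^ N * riemann h N ^ k)) \<longlonglongrightarrow> C * s ^ N * riemann h N ^ Suc k"
      unfolding sums_def by (simp only:)
  qed
qed

lemma riemann_tendsto:
  assumes "1 \<le> m"
  shows "(\<lambda>n. riemann (1 / real (Suc n)) m) \<longlonglongrightarrow> 1 / real m"
proof -
  define c where "c = real m"
  have c: "0 < c" using assms by (simp add: c_def)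
  have "((\<lambda>h::real. h / (exp (c * h) - 1)) \<longlongrightarrow> inverse c) (at_right 0)" using c by real_asymp
  moreover have "filterlim (\<lambda>n. 1 / real (Suc n)) (at_right 0) sequentially" by real_asymp
  ultimately show ?thesis unfolding riemann_def c_def inverse_eq_divide by (rule filterlim_compose)
qed

text \<open>Here \<open>s = 1\<close> and the mesh tends to 0. The tail estimate covers the orders
  above \<open>N\<close>; the chaos of order \<open>N\<close> itself is added through its projection
  with factor \<open>N^-k\<close>, whence the constant \<open>C + D^N\<close>.\<close>

lemma mult_bounded_inverse_powers:
  assumes U: "UMD_space TYPE('b::banach)" and p: "1 < p" and N: "1 \<le> N"
  shows "\<exists>C\<ge>0. \<forall>k. mult_bounded TYPE('b) p (\<lambda>m. if N \<le> m then (1 / real m) ^ k else 0) (C * (1 / real N) ^ k)"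
proof -
  obtain D where D: "1 \<le> D" "\<And>m. mult_bounded TYPE('b) p (\<lambda>j. if j = m then 1 else 0) (D ^ m)"
    using mult_bounded_chaos[OF U p] by blast
  have p1: "1 \<le> p" "0 < p" using p by auto
  obtain C where C: "0 \<le> C" and tail: "\<And>s. 0 < s \<Longrightarrow> s \<le> 1 \<Longrightarrow>
     mult_bounded TYPE('b) p (\<lambda>m. if N < m then s ^ m else 0) (C * s ^ N)"
    using mult_bounded_power_tail[OF D p1(1), of N] by blast
  have 1: "mult_bounded TYPE('b) p (\<lambda>m. if N < m then (1 / real m) ^ k else 0) (C * (1 / real N) ^ k)" for k
  proof (rule mult_bounded_limit[OF _ _ _ p1(1)])
    fix n
    show "mult_bounded TYPE('b) p (\<lambda>m. if N < m then 1 ^ m * riemann (1 / real (Suc n)) m ^ k else 0) (C * 1 ^ N * riemann (1 / real (Suc n)) N ^ k)"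
      by (rule mult_bounded_riemann[OF C N p1(1) _ tail]) auto
  next
    fix m
    show "(\<lambda>n. if N < m then 1 ^ m * riemann (1 / real (Suc n)) m ^ k else 0) \<longlonglongrightarrow> (if N < m then (1 / real m) ^ k else 0)"
      using tendsto_power[OF riemann_tendsto[of m], of k] N by auto
  next
    show "(\<lambda>n. C * 1 ^ N * riemann (1 / real (Suc n)) N ^ k) \<longlonglongrightarrow> C * (1 / real N) ^ k"
      using tendsto_mult_left[OF tendsto_power[OF riemann_tendsto[OF N], of k], of C] by simp
  qed
  have 2: "mult_bounded TYPE('b) p (\<lambda>m. (if N < m then (1 / real m) ^ k else 0) + (1 / real N) ^ k * (if m = N then 1 else 0))
     (C * (1 / real N) ^ k + \<bar>(1 / real N) ^ k\<bar> * D ^ N)" for k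
    by (intro mult_bounded_add mult_bounded_scale 1 D(2) p1)
  have "(\<lambda>m. (if N < m then (1 / real m) ^ k else 0) + (1 / real N) ^ k * (if m = N then 1 else 0))
      = (\<lambda>m. if N \<le> m then (1 / real m) ^ k else 0)" for k by (rule ext) auto
  moreover have "C * (1 / real N) ^ k + \<bar>(1 / real N) ^ k\<bar> * D ^ N = (C + D ^ N) * (1 / real N) ^ k" for k
    by (simp add: algebra_simps)
  ultimately have "\<forall>k. mult_bounded TYPE('b) p (\<lambda>m. if N \<le> m then (1 / real m) ^ k else 0) ((C + D ^ N) * (1 / real N) ^ k)"
    using 2 by simp
  then show ?thesis using C D by (intro exI[of _ "C + D ^ N"]) auto
qed

section \<open>Moments of an isonormal process\<close>

locale isonormal = prob_space M for M :: "'w measure" +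
  fixes W :: "'h::{real_inner, banach, second_countable_topology} \<Rightarrow> 'w \<Rightarrow> real"
  assumes isonormal: "isonormal_process M W"
begin

section \<open>The law of the Gaussian variables and their moments\<close>

lemma W_measurable [measurable]: "W h \<in> borel_measurable M"
  using isonormal by (simp add: isonormal_process_def centred_gaussian_def)

lemma W_add: "AE w in M. W (g + h) w = W g w + W h w"
  using isonormal by (simp add: isonormal_process_def)

lemma W_scaleR: "AE w in M. W (c *\<^sub>R h) w = c * W h w"
  using isonormal by (simp add: isonormal_process_def)

lemma W_norm: "Lp_norm M 2 (W h) = norm h"
  using isonormal by (simp add: isonormal_process_def)

lemma W_zero: "AE w in M. W 0 w = 0"
  using W_scaleR[of 0 0] by simp

lemma W_sum:
  assumes "finite I"
  shows "AE w in M. W (\<Sum>i\<in>I. c i *\<^sub>R h i) w = (\<Sum>i\<in>I. c i * W (h i) w)"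
  using assms
proof (induction I rule: finite_induct)
  case empty
  then show ?case using W_zero by simp
next
  case (insert i I)
  from insert.IH W_add[of "c i *\<^sub>R h i" "\<Sum>i\<in>I. c i *\<^sub>R h i"] W_scaleR[of "c i" "h i"]
  show ?case by eventually_elim (use insert in simp)
qed

lemma W_normalize:
  assumes "h \<noteq> 0"
  shows "AE w in M. W h w = norm h * W (h /\<^sub>R norm h) w"
  using W_scaleR[of "norm h" "h /\<^sub>R norm h"] assms by simp

text \<open>Norm 1 excludes the null alternative in \<open>centred_gaussian\<close>, and since the
  variance is the squared norm, it forces \<open>\<sigma> = 1\<close>.\<close>

lemma W_distributed:
  assumes "norm u = 1"
  shows "distributed M lborel (W u) std_normal_density"
proof -
  have L: "W u \<in> Lp M 2" and g: "(\<exists>\<sigma>>0. distributed M lborel (W u) (normal_density 0 \<sigma>)) \<or> (AE w in M. W u w = 0)"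
    using isonormal by (auto simp: isonormal_process_def centred_gaussian_def)
  have "\<not> (AE w in M. W u w = 0)"
    using Lp_norm_eq_0_iff[OF L] W_norm[of u] assms by simp
  then obtain \<sigma> where \<sigma>: "0 < \<sigma>" and d: "distributed M lborel (W u) (normal_density 0 \<sigma>)" using g by blast
  have "(\<integral>w. (W u w)\<^sup>2 \<partial>M) = \<sigma>\<^sup>2"
    using normal_distributed_variance[OF \<sigma> d] normal_distributed_expectation[OF \<sigma> d] by simp
  moreover have "(\<integral>w. (W u w)\<^sup>2 \<partial>M) = 1"
  proof -
    have "(\<integral>w. norm (W u w) powr 2 \<partial>M) = Lp_norm M 2 (W u) powr 2" by (rule Lp_norm_powr[symmetric]) simp
    also have "\<dots> = 1" using W_norm[of u] assms by simp
    finally show ?thesis by simp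
  qed
  ultimately have "\<sigma>\<^sup>2 = 1" by simp
  then have "\<sigma> = 1" using \<sigma> by (simp add: power2_eq_1_iff)
  then show ?thesis using d by simp
qed

lemma W_char:
  assumes "norm u = 1"
  shows "(\<integral>w. cos (t * W u w) \<partial>M) = exp (- (t\<^sup>2) / 2)" "(\<integral>w. sin (t * W u w) \<partial>M) = 0"
proof -
  have d: "distr M lborel (W u) = std_normal_distribution"
    using W_distributed[OF assms] by (simp add: distributed_def)
  have i: "integrable M (\<lambda>w. iexp (t * W u w))"
    by (rule integrable_const_bound[where B=1]) auto
  have "(\<integral>w. iexp (t * W u w) \<partial>M) = char std_normal_distribution t"
    unfolding char_def d[symmetric] by (subst integral_distr) auto
  also have "\<dots> = complex_of_real (exp (- (t\<^sup>2) / 2))" by (simp add: char_std_normal_distribution)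
  finally have e: "(\<integral>w. iexp (t * W u w) \<partial>M) = complex_of_real (exp (- (t\<^sup>2) / 2))" .
  have "(\<integral>w. cos (t * W u w) \<partial>M) = Re (\<integral>w. iexp (t * W u w) \<partial>M)"
    using i by (subst integral_Re[symmetric]) (auto simp: Re_exp)
  then show "(\<integral>w. cos (t * W u w) \<partial>M) = exp (- (t\<^sup>2) / 2)" unfolding e by simp
  have "(\<integral>w. sin (t * W u w) \<partial>M) = Im (\<integral>w. iexp (t * W u w) \<partial>M)"
    using i by (subst integral_Im[symmetric]) (auto simp: Im_exp)
  then show "(\<integral>w. sin (t * W u w) \<partial>M) = 0" unfolding e by simp
qed

lemma expectation_cos_W: "(\<integral>w. cos (W h w + \<theta>) \<partial>M) = cos \<theta> * exp (- ((norm h)\<^sup>2) / 2)"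
proof (cases "h = 0")
  case True
  have "(\<integral>w. cos (W h w + \<theta>) \<partial>M) = (\<integral>w. cos \<theta> \<partial>M)"
    by (rule integral_cong_AE) (use W_zero True in auto)
  then show ?thesis using True by (simp add: prob_space)
next
  case False
  define u where "u = h /\<^sub>R norm h"
  have u: "norm u = 1" using False by (simp add: u_def)
  have i: "integrable M (\<lambda>w. cos (norm h * W u w))" "integrable M (\<lambda>w. sin (norm h * W u w))"
    by (rule integrable_const_bound[where B=1]; auto)+
  have "(\<integral>w. cos (W h w + \<theta>) \<partial>M) = (\<integral>w. cos (norm h * W u w) * cos \<theta> - sin (norm h * W u w) * sin \<theta> \<partial>M)"
  proof (rule integral_cong_AE)
    show "AE w in M. cos (W h w + \<theta>) = cos (norm h * W u w) * cos \<theta> - sin (norm h * W u w) * sin \<theta>"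
      using W_normalize[OF False] by eventually_elim (simp add: u_def cos_add)
  qed auto
  also have "\<dots> = exp (- ((norm h)\<^sup>2) / 2) * cos \<theta>"
    using i W_char[OF u, of "norm h"] by simp
  finally show ?thesis by (simp add: mult.commute)
qed

text \<open>Completing the square turns \<open>exp (c x)\<close> times the standard normal density
  into \<open>exp (c^2 / 2)\<close> times the normal density with mean \<open>c\<close>.\<close>

lemma integrable_exp_W: "integrable M (\<lambda>w. exp (c * W h w))"
proof -
  have unit: "integrable M (\<lambda>w. exp (c * W u w))" if u: "norm u = 1" for c u
  proof -
    have "integrable lborel (\<lambda>x. exp (c\<^sup>2 / 2) * normal_density c 1 x)" by simp
    moreover have "exp (c\<^sup>2 / 2) * normal_density c 1 x = std_normal_density x * exp (c * x)" for x
      by (simp add: normal_density_def exp_add[symmetric] power2_eq_square field_simps)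
    ultimately have "integrable lborel (\<lambda>x. std_normal_density x * exp (c * x))" by simp
    then show ?thesis
      using distributed_integrable[OF W_distributed[OF u], of "\<lambda>x. exp (c * x)"] by simp
  qed
  show ?thesis
  proof (cases "h = 0")
    case True
    have "integrable M (\<lambda>w. 1 :: real)" by simp
    moreover have "AE w in M. exp (c * W h w) = 1" using W_zero True by auto
    ultimately show ?thesis by (subst integrable_cong_AE[where g="\<lambda>_. 1"]) auto
  next
    case False
    have "AE w in M. exp (c * W h w) = exp ((c * norm h) * W (h /\<^sub>R norm h) w)"
      using W_normalize[OF False] by eventually_elim simp
    moreover have "norm (h /\<^sub>R norm h) = 1" using False by simp
    ultimately show ?thesis using unit[of "h /\<^sub>R norm h" "c * norm h"]
      by (subst integrable_cong_AE) auto
  qed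
qed

text \<open>Finite moments of all orders, a class that is closed under products, as a single Lp
  space is not. All majorants for dominated convergence below come from it.\<close>

definition moments :: "('w \<Rightarrow> real) \<Rightarrow> bool" where
  "moments f \<longleftrightarrow> (\<forall>r\<ge>1. f \<in> Lp M r)"

lemma momentsD: "moments f \<Longrightarrow> 0 < r \<Longrightarrow> f \<in> Lp M r"
  using Lp_subset[of f "max 1 r" r] by (simp add: moments_def)

lemma moments_measurable: "moments f \<Longrightarrow> f \<in> borel_measurable M"
  using LpD(1)[OF momentsD[of f 1]] strongly_measurable_real_iff by auto

lemma moments_integrable:
  assumes "moments f"
  shows "integrable M f"
proof -
  have "integrable M (\<lambda>w. norm (f w))" using LpD(2)[OF momentsD[OF assms, of 1]] by simp
  then show ?thesis using integrable_norm_iff moments_measurable[OF assms] by blast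
qed

lemma moments_bounded: "f \<in> borel_measurable M \<Longrightarrow> (\<And>w. \<bar>f w\<bar> \<le> B) \<Longrightarrow> moments f"
  unfolding moments_def by (auto intro!: Lp_bounded simp: strongly_measurable_real_iff)

lemma moments_const [simp]: "moments (\<lambda>w. c)"
  by (rule moments_bounded[of _ "\<bar>c\<bar>"]) auto

lemma moments_add: "moments f \<Longrightarrow> moments g \<Longrightarrow> moments (\<lambda>w. f w + g w)"
  unfolding moments_def by (auto intro: Lp_add)

lemma moments_sum: "(\<And>i. i \<in> I \<Longrightarrow> moments (f i)) \<Longrightarrow> moments (\<lambda>w. \<Sum>i\<in>I. f i w)"
  unfolding moments_def by (auto intro: Lp_sum)

lemma moments_mono:
  assumes "f \<in> borel_measurable M" "moments g" "AE w in M. \<bar>f w\<bar> \<le> \<bar>g w\<bar>"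
  shows "moments f"
  unfolding moments_def
proof (intro allI impI)
  fix r :: real assume r: "1 \<le> r"
  show "f \<in> Lp M r"
    by (rule Lp_bound[of _ _ "\<lambda>w. \<bar>g w\<bar>"])
       (use assms r LpD(2)[OF momentsD[OF assms(2)]] in \<open>auto simp: strongly_measurable_real_iff\<close>)
qed

lemma moments_mult:
  assumes "moments f" "moments g"
  shows "moments (\<lambda>w. f w * g w)"
  unfolding moments_def
proof (intro allI impI)
  fix r :: real assume r: "1 \<le> r"
  note [measurable] = assms[THEN moments_measurable]
  have "integrable M (\<lambda>w. norm (f w * g w) powr r)"
  proof (rule Bochner_Integration.integrable_bound)
    show "integrable M (\<lambda>w. norm (f w) powr (2 * r) + norm (g w) powr (2 * r))"
      using r by (intro Bochner_Integration.integrable_add LpD(2) momentsD assms) auto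
    have "\<bar>a * b\<bar> powr r \<le> \<bar>a\<bar> powr (2 * r) + \<bar>b\<bar> powr (2 * r)" for a b :: real
    proof -
      have "\<bar>a * b\<bar> powr r = \<bar>a\<bar> powr r * \<bar>b\<bar> powr r" by (simp add: abs_mult powr_mult)
      also have "\<dots> \<le> (\<bar>a\<bar> powr r)\<^sup>2 + (\<bar>b\<bar> powr r)\<^sup>2"
      proof -
        have "0 \<le> \<bar>a\<bar> powr r * \<bar>b\<bar> powr r" by simp
        then show ?thesis using sum_squares_bound[of "\<bar>a\<bar> powr r" "\<bar>b\<bar> powr r"] by linarith
      qed
      also have "\<dots> = \<bar>a\<bar> powr (2 * r) + \<bar>b\<bar> powr (2 * r)"
        by (simp add: power2_eq_square powr_add[symmetric])
      finally show ?thesis .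
    qed
    then show "AE w in M. norm (norm (f w * g w) powr r) \<le> norm (norm (f w) powr (2 * r) + norm (g w) powr (2 * r))"
      by simp
  qed measurable
  then show "(\<lambda>w. f w * g w) \<in> Lp M r" by (simp add: Lp_def strongly_measurable_real_iff)
qed

lemma moments_power: "moments f \<Longrightarrow> moments (\<lambda>w. f w ^ n)"
  by (induction n) (auto intro: moments_mult)

lemma moments_exp_W: "moments (\<lambda>w. exp (c * W h w))"
  unfolding moments_def
proof (intro allI impI)
  fix r :: real assume r: "1 \<le> r"
  have "integrable M (\<lambda>w. norm (exp (c * W h w)) powr r)"
    using integrable_exp_W[of "r * c" h] by (simp add: powr_def mult.assoc)
  then show "(\<lambda>w. exp (c * W h w)) \<in> Lp M r" by (simp add: Lp_def strongly_measurable_real_iff)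
qed

lemma exp_abs_le: "exp \<bar>x\<bar> \<le> exp x + exp (- x :: real)"
  by (cases "0 \<le> x") auto

lemma moments_exp_abs_W: "moments (\<lambda>w. exp \<bar>c * W h w\<bar>)"
proof (rule moments_mono[OF _ moments_add[OF moments_exp_W[of c h] moments_exp_W[of "-c" h]]])
  have "\<bar>exp \<bar>c * W h w\<bar>\<bar> \<le> \<bar>exp (c * W h w) + exp (- c * W h w)\<bar>" for w
    using exp_abs_le[of "c * W h w"] exp_gt_zero[of "c * W h w"] exp_gt_zero[of "- c * W h w"] by simp
  then show "AE w in M. \<bar>exp \<bar>c * W h w\<bar>\<bar> \<le> \<bar>exp (c * W h w) + exp (- c * W h w)\<bar>" by simp
qed measurable

lemma moments_W: "moments (W h)"
proof (rule moments_mono[OF _ moments_exp_abs_W[of 1 h]])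
  have "\<bar>W h w\<bar> \<le> \<bar>exp \<bar>1 * W h w\<bar>\<bar>" for w
    using exp_ge_add_one_self[of "\<bar>W h w\<bar>"] by (simp del: exp_ge_add_one_self)
  then show "AE w in M. \<bar>W h w\<bar> \<le> \<bar>exp \<bar>1 * W h w\<bar>\<bar>" by simp
qed measurable

lemma moments_prod_list: "moments (\<lambda>w. prod_list (map (\<lambda>g. W g w) gs))"
  by (induction gs) (auto intro: moments_mult moments_W)

lemma Lp_moments_scaleR:
  fixes x :: "'b::real_normed_vector"
  assumes "moments f" "1 \<le> p"
  shows "(\<lambda>w. f w *\<^sub>R x) \<in> Lp M p"
proof (rule Lp_bound[of _ _ "\<lambda>w. \<bar>f w\<bar> * norm x"])
  show "strongly_measurable M (\<lambda>w. f w *\<^sub>R x)"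
    using moments_measurable[OF assms(1)] by (intro strongly_measurable_scaleR) (auto simp: strongly_measurable_real_iff)
  show "integrable M (\<lambda>w. (\<bar>f w\<bar> * norm x) powr p)"
    using LpD(2)[OF momentsD[OF assms(1), of p]] assms by (simp add: powr_mult)
qed (use assms in auto)

end

section \<open>Polynomials and Hermite sums\<close>

lemma fun_span_memI:
  fixes k :: nat
  assumes "\<And>i. i < k \<Longrightarrow> g i \<in> S"
  shows "(\<lambda>w. \<Sum>i<k. c i *\<^sub>R g i w) \<in> fun_span S"
  unfolding fun_span_def using assms by blast

definition lin_comb :: "('w \<Rightarrow> 'b::real_vector) set \<Rightarrow> ('w \<Rightarrow> 'b) \<Rightarrow> nat \<Rightarrow> (nat \<Rightarrow> real) \<Rightarrow> (nat \<Rightarrow> 'w \<Rightarrow> 'b) \<Rightarrow> bool"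
  where "lin_comb S f k c g \<longleftrightarrow> f = (\<lambda>w. \<Sum>i<k. c i *\<^sub>R g i w) \<and> (\<forall>i<k. g i \<in> S)"

lemma fun_span_memE: "f \<in> fun_span S \<Longrightarrow> \<exists>k c g. lin_comb S f k c g"
  unfolding fun_span_def lin_comb_def by blast

lemma lin_combD:
  assumes "lin_comb S f k c g"
  shows "f = (\<lambda>w. \<Sum>i<k. c i *\<^sub>R g i w)" "\<And>i. i < k \<Longrightarrow> g i \<in> S"
  using assms unfolding lin_comb_def by simp_all

lemma fun_span_base: "g \<in> S \<Longrightarrow> g \<in> fun_span S"
  using fun_span_memI[of "Suc 0" "\<lambda>_. g" S "\<lambda>_. 1"] by simp

lemma fun_span_zero: "(\<lambda>w. 0) \<in> fun_span S"
  using fun_span_memI[of 0 "\<lambda>_ _. 0" S "\<lambda>_. 0"] by simp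

lemma fun_span_add:
  assumes "f \<in> fun_span S" "g \<in> fun_span S"
  shows "(\<lambda>w. f w + g w) \<in> fun_span S"
proof -
  obtain k c u where "lin_comb (S) f k c u"
    using assms(1) by (blast dest: fun_span_memE)
  note f = lin_combD[OF this]
  obtain l d v where "lin_comb (S) g l d v"
    using assms(2) by (blast dest: fun_span_memE)
  note g = lin_combD[OF this]
  have "(\<lambda>w. f w + g w) = (\<lambda>w. \<Sum>i<k + l. (if i < k then c i else d (i - k)) *\<^sub>R (if i < k then u i else v (i - k)) w)"
  proof (rule ext)
    fix w
    have "(\<Sum>i<k + l. (if i < k then c i else d (i - k)) *\<^sub>R (if i < k then u i else v (i - k)) w)
       = (\<Sum>i<k. c i *\<^sub>R u i w) + (\<Sum>i<l. d i *\<^sub>R v i w)"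
      by (simp add: sum.nat_group[symmetric] lessThan_atLeast0 sum.atLeastLessThan_concat[of 0 k "k + l", symmetric]
         sum.shift_bounds_nat_ivl[of _ 0 k l, simplified add.commute[of _ k], simplified])
    then show "f w + g w = (\<Sum>i<k + l. (if i < k then c i else d (i - k)) *\<^sub>R (if i < k then u i else v (i - k)) w)"
      by (simp add: f g)
  qed
  then show ?thesis using fun_span_memI[of "k + l" "\<lambda>i. if i < k then u i else v (i - k)" S] f g by simp
qed

lemma fun_span_scaleR:
  assumes "f \<in> fun_span S"
  shows "(\<lambda>w. a *\<^sub>R f w) \<in> fun_span S"
proof -
  obtain k c u where "lin_comb (S) f k c u"
    using assms(1) by (blast dest: fun_span_memE)
  note f = lin_combD[OF this]
  then show ?thesis using fun_span_memI[of k u S "\<lambda>i. a * c i"] by (simp add: scaleR_sum_right)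
qed

lemma fun_span_sum:
  assumes "\<And>i. i \<in> I \<Longrightarrow> f i \<in> fun_span S"
  shows "(\<lambda>w. \<Sum>i\<in>I. f i w) \<in> fun_span S"
  using assms by (induction I rule: infinite_finite_induct) (auto intro: fun_span_add fun_span_zero)

lemma fun_span_least:
  assumes "S \<subseteq> fun_span T"
  shows "fun_span S \<subseteq> fun_span T"
proof
  fix f assume "f \<in> fun_span S"
  then obtain k c u where "lin_comb (S) f k c u"
    using fun_span_memE by blast
  note f = lin_combD[OF this]
  show "f \<in> fun_span T" unfolding f(1)
    by (intro fun_span_sum fun_span_scaleR) (use f assms in auto)
qed

text \<open>Finite differences at the points \<open>1, 2, 4, \<dots>\<close>: passing from \<open>f\<close> to \<open>2\<^sup>j f - f (2 \<cdot>)\<close> removes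
  the monomial of degree \<open>j\<close> and only rescales the others.\<close>

lemma first_coefficient_weights:
  "\<exists>(n::nat) w t. \<forall>j\<le>d. (\<Sum>l<n. w l * t l ^ j) = (if j = 1 then 1 else 0 :: real)"
proof -
  define good where "good d \<longleftrightarrow> (\<exists>(n::nat) w t. (\<Sum>l<n. w l * t l ^ 1) = (1::real) \<and> (\<forall>j<d. j \<noteq> 1 \<longrightarrow> (\<Sum>l<n. w l * t l ^ j) = 0))" for d :: nat
  have "good d" for d
  proof (induction d)
    case 0
    show ?case unfolding good_def by (intro exI[of _ 1] exI[of _ "\<lambda>_. 1"]) auto
  next
    case (Suc d)
    obtain n :: nat and w t where n: "(\<Sum>l<n. w l * t l ^ 1) = (1::real)" "\<And>j. j < d \<Longrightarrow> j \<noteq> 1 \<Longrightarrow> (\<Sum>l<n. w l * t l ^ j) = 0"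
      using Suc unfolding good_def by blast
    show ?case
    proof (cases "d = 1")
      case True
      show ?thesis unfolding good_def
        by (rule exI[of _ n], rule exI[of _ w], rule exI[of _ t]) (use n True in \<open>auto simp: less_Suc_eq\<close>)
    next
      case False
      \<comment> \<open>The new family multiplies the moment of order \<open>j\<close> by
        \<open>(2^d - 2^j) / K\<close>, so this \<open>K\<close> keeps the first moment equal to 1.
        It is nonzero because \<open>d\<close> is not 1.\<close>
      define K where "K = (2::real) ^ d - 2"
      have K: "K \<noteq> 0"
      proof (cases "d = 0")
        case False
        then have "2 \<le> d" using \<open>d \<noteq> 1\<close> by simp
        then have "(2::real) ^ 2 \<le> 2 ^ d" by (intro power_increasing) auto
        then show ?thesis by (simp add: K_def)
      qed (simp add: K_def)
      let ?w = "\<lambda>l. if l < n then 2 ^ d / K * w l else - (1 / K) * w (l - n)"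
      let ?t = "\<lambda>l. if l < n then t l else 2 * t (l - n)"
      have s: "(\<Sum>l<n + n. ?w l * ?t l ^ j) = (2 ^ d - 2 ^ j) / K * (\<Sum>l<n. w l * t l ^ j)" for j
      proof -
        have "(\<Sum>l<n + n. ?w l * ?t l ^ j) = (\<Sum>l<n. ?w l * ?t l ^ j) + (\<Sum>l<n. ?w (l + n) * ?t (l + n) ^ j)"
          using sum.atLeastLessThan_concat[of 0 n "n + n" "\<lambda>l. ?w l * ?t l ^ j"]
            sum.shift_bounds_nat_ivl[of "\<lambda>l. ?w l * ?t l ^ j" 0 n n]
          by (simp add: lessThan_atLeast0)
        also have "\<dots> = 2 ^ d / K * (\<Sum>l<n. w l * t l ^ j) - 2 ^ j / K * (\<Sum>l<n. w l * t l ^ j)"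
          by (simp add: sum_distrib_left power_mult_distrib sum_negf[symmetric] mult_ac)
        finally show ?thesis by (simp add: diff_divide_distrib left_diff_distrib)
      qed
      show ?thesis unfolding good_def
      proof (rule exI[of _ "n + n"], rule exI[of _ ?w], rule exI[of _ ?t], intro conjI allI impI)
        show "(\<Sum>l<n + n. ?w l * ?t l ^ 1) = 1" unfolding s n(1) using K by (simp add: K_def)
        fix j assume j: "j < Suc d" "j \<noteq> 1"
        show "(\<Sum>l<n + n. ?w l * ?t l ^ j) = 0" unfolding s using n(2)[of j] j by (cases "j = d") auto
      qed
    qed
  qed
  then obtain n :: nat and w t where n: "(\<Sum>l<n. w l * t l ^ 1) = (1::real)" "\<And>j. j < Suc d \<Longrightarrow> j \<noteq> 1 \<Longrightarrow> (\<Sum>l<n. w l * t l ^ j) = 0"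
    unfolding good_def by blast
  show ?thesis
  proof (rule exI[of _ n], rule exI[of _ w], rule exI[of _ t], intro allI impI)
    fix j assume "j \<le> d"
    then show "(\<Sum>l<n. w l * t l ^ j) = (if j = 1 then 1 else 0)" using n by (cases "j = 1") auto
  qed
qed

section \<open>Polynomials as Hermite sums, up to null sets\<close>

lemma hermite_recurrence: "x * hermite (Suc m) x = real (Suc (Suc m)) * hermite (Suc (Suc m)) x + hermite m x"
  by simp

text \<open>Read backwards, the three-term recurrence shows that multiplication by \<open>x\<close>
  sends a Hermite polynomial to a combination of its two neighbours; the degree grows by at most
  one.\<close>

lemma power_eq_hermite_sum: "\<exists>a. \<forall>x. x ^ m = (\<Sum>j\<le>m. a j * hermite j x)"
proof (induction m)
  case 0
  show ?case by (rule exI[of _ "\<lambda>_. 1"]) simp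
next
  case (Suc m)
  then obtain a where a: "\<And>x. x ^ m = (\<Sum>j\<le>m. a j * hermite j x)" by blast
  define S where "S d = {f. \<exists>b. \<forall>x. f x = (\<Sum>j\<le>d. b j * hermite j x)}" for d :: nat
  have add: "(\<lambda>x. f x + g x) \<in> S d" if fg: "f \<in> S d" "g \<in> S d" for f g d
  proof -
    obtain b where "\<forall>x. f x = (\<Sum>j\<le>d. b j * hermite j x)" using fg(1) unfolding S_def by blast
    moreover obtain c where "\<forall>x. g x = (\<Sum>j\<le>d. c j * hermite j x)" using fg(2) unfolding S_def by blast
    ultimately show ?thesis unfolding S_def by (intro CollectI exI[of _ "\<lambda>j. b j + c j"]) (simp add: sum.distrib distrib_right)
  qed
  have scale: "(\<lambda>x. r * f x) \<in> S d" if f: "f \<in> S d" for f r d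
  proof -
    obtain b where "\<forall>x. f x = (\<Sum>j\<le>d. b j * hermite j x)" using f unfolding S_def by blast
    then show ?thesis unfolding S_def by (intro CollectI exI[of _ "\<lambda>j. r * b j"]) (simp add: sum_distrib_left mult.assoc)
  qed
  have base: "hermite j \<in> S d" if "j \<le> d" for j d
  proof -
    have "hermite j x = (\<Sum>i\<le>d. (if i = j then 1 else 0) * hermite i x)" for x
      using that by (subst sum.cong[OF refl, of _ _ "\<lambda>i. if i = j then hermite j x else 0"]) auto
    then show ?thesis unfolding S_def by (intro CollectI exI[of _ "\<lambda>i. if i = j then 1 else 0"]) blast
  qed
  have zero: "(\<lambda>x. 0) \<in> S d" for d unfolding S_def by (intro CollectI exI[of _ "\<lambda>_. 0"]) simp
  have sums: "(\<lambda>x. \<Sum>i\<in>I. f i x) \<in> S d" if "finite I" "\<And>i. i \<in> I \<Longrightarrow> f i \<in> S d" for I :: "nat set" and f d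
    using that by (induction I rule: finite_induct) (auto intro: add zero)
  have step: "(\<lambda>x. x * hermite j x) \<in> S (Suc m)" if "j \<le> m" for j
  proof (cases j)
    case 0
    then show ?thesis using base[of 1 "Suc m"] by (simp add: fun_eq_iff[THEN iffD2, of "hermite (Suc 0)" "\<lambda>x. x"])
  next
    case (Suc i)
    have "(\<lambda>x. real (Suc (Suc i)) * hermite (Suc (Suc i)) x + hermite i x) \<in> S (Suc m)"
      by (intro add scale base) (use that Suc in auto)
    then show ?thesis unfolding Suc hermite_recurrence[symmetric] .
  qed
  have "(\<lambda>x. \<Sum>j\<in>{..m}. a j * (x * hermite j x)) \<in> S (Suc m)"
    by (intro sums scale step) auto
  moreover have "(\<lambda>x. \<Sum>j\<in>{..m}. a j * (x * hermite j x)) = (\<lambda>x. x ^ Suc m)"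
    by (rule ext) (simp add: a sum_distrib_left mult_ac)
  ultimately show ?case unfolding S_def by simp
qed

context isonormal
begin

text \<open>Lists with repetitions replace multi-indices, so that a product of monomials is given by
  concatenation.\<close>

definition monomial :: "'h list \<Rightarrow> 'w \<Rightarrow> real" where
  "monomial gs w = prod_list (map (\<lambda>g. W g w) gs)"

lemma monomial_append: "monomial (gs @ hs) w = monomial gs w * monomial hs w"
  by (simp add: monomial_def)

lemma monomial_replicate: "monomial (replicate n h) w = W h w ^ n"
  by (simp add: monomial_def prod_list_replicate)

lemma moments_monomial: "moments (monomial gs)"
  unfolding monomial_def[abs_def] by (rule moments_prod_list)

lemma monomial_wiener_polynomial: "(\<lambda>w. monomial gs w *\<^sub>R x) \<in> wiener_polynomials W"
proof -
  define n where "n = Suc (length gs)"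
  define h where "h i = (if i < length gs then gs ! i else 0)" for i
  define q :: "(nat \<Rightarrow> real) \<Rightarrow> real"
    where "q t = (\<Sum>\<alpha>\<in>{\<lambda>i. if i < length gs then 1 else 0 :: nat}. 1 * (\<Prod>i<n. t i ^ \<alpha> i))" for t
  have q: "polynomial_fun n q" unfolding polynomial_fun_def q_def[abs_def]
    by (intro exI[of _ "{\<lambda>i. if i < length gs then 1 else 0}"] exI[of _ "\<lambda>_. 1"]) auto
  have "monomial gs w = q (\<lambda>i. W (h i) w)" for w
  proof -
    have "monomial gs w = (\<Prod>i<length gs. W (gs ! i) w)"
      unfolding monomial_def by (simp add: prod.list_conv_set_nth atLeast0LessThan)
    also have "\<dots> = q (\<lambda>i. W (h i) w)" unfolding q_def n_def by (simp add: h_def)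
    finally show ?thesis .
  qed
  then have "(\<lambda>w. monomial gs w *\<^sub>R x) = (\<lambda>w. q (\<lambda>i. W (h i) w) *\<^sub>R x)" by simp
  then show ?thesis unfolding wiener_polynomials_def
    using q by (intro fun_span_base CollectI exI[of _ q] exI[of _ n] exI[of _ h] exI[of _ x]) (simp add: n_def)
qed

lemma wiener_polynomials_eq_monomials:
  "wiener_polynomials W = fun_span {\<lambda>w. monomial gs w *\<^sub>R x | gs x. True}"
proof (rule antisym)
  show "wiener_polynomials W \<subseteq> fun_span {\<lambda>w. monomial gs w *\<^sub>R x | gs x. True}"
    unfolding wiener_polynomials_def
  proof (rule fun_span_least, rule subsetI)
    fix F :: "'w \<Rightarrow> 'b"
    assume "F \<in> {\<lambda>w. q (\<lambda>i. W (h i) w) *\<^sub>R x |q n h x. 1 \<le> n \<and> polynomial_fun n q}"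
    then obtain q n h x where F: "F = (\<lambda>w. q (\<lambda>i. W (h i) w) *\<^sub>R x)" and "polynomial_fun n q" by blast
    then obtain A c where q: "finite A" "q = (\<lambda>t. \<Sum>\<alpha>\<in>A. c \<alpha> * (\<Prod>i<n. t i ^ (\<alpha> i :: nat)))"
      unfolding polynomial_fun_def by blast
    define gs where "gs \<alpha> = concat (map (\<lambda>i. replicate (\<alpha> i) (h i)) [0..<n])" for \<alpha> :: "nat \<Rightarrow> nat"
    have g: "monomial (gs \<alpha>) w = (\<Prod>i<n. W (h i) w ^ \<alpha> i)" for \<alpha> w
      unfolding gs_def by (induction n) (auto simp: monomial_append monomial_replicate, simp add: monomial_def)
    have "F = (\<lambda>w. \<Sum>\<alpha>\<in>A. c \<alpha> *\<^sub>R (monomial (gs \<alpha>) w *\<^sub>R x))"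
      unfolding F q g by (simp add: scaleR_sum_left)
    also have "\<dots> \<in> fun_span {\<lambda>w. monomial gs w *\<^sub>R x | gs x. True}"
      by (intro fun_span_sum fun_span_scaleR fun_span_base) blast
    finally show "F \<in> fun_span {\<lambda>w. monomial gs w *\<^sub>R x | gs x. True}" .
  qed
  show "fun_span {\<lambda>w. monomial gs w *\<^sub>R x | gs x. True} \<subseteq> wiener_polynomials W"
    unfolding wiener_polynomials_def
    by (rule fun_span_least) (use monomial_wiener_polynomial in \<open>auto simp: wiener_polynomials_def\<close>)
qed

lemma wiener_polynomials_Lp:
  fixes F :: "'w \<Rightarrow> 'b::real_normed_vector"
  assumes "F \<in> wiener_polynomials W" "1 \<le> p"
  shows "F \<in> Lp M p"
proof -
  obtain k c u where "lin_comb ({\<lambda>w. monomial gs w *\<^sub>R x | gs x. True}) F k c u"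
    using assms(1) unfolding wiener_polynomials_eq_monomials by (blast dest: fun_span_memE)
  note F = lin_combD(1)[OF this] and u = lin_combD(2)[OF this]
  have "u i \<in> Lp M p" if "i < k" for i
    using u[OF that] Lp_moments_scaleR[OF moments_monomial assms(2)] by auto
  then show ?thesis unfolding F by (intro Lp_sum Lp_scaleR assms(2)) auto
qed

text \<open>\<open>W\<close> is linear only almost everywhere, separately for each pair of vectors,
  so the rewriting of polynomials takes place up to null sets.\<close>

definition ae_in :: "('w \<Rightarrow> 'b) set \<Rightarrow> ('w \<Rightarrow> 'b) \<Rightarrow> bool" where
  "ae_in S f \<longleftrightarrow> (\<exists>g\<in>S. AE w in M. f w = g w)"

lemma ae_inI: "g \<in> S \<Longrightarrow> AE w in M. f w = g w \<Longrightarrow> ae_in S f"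
  unfolding ae_in_def by (rule bexI)

lemma ae_in_mem: "f \<in> S \<Longrightarrow> ae_in S f"
  unfolding ae_in_def by (rule bexI[of _ f]) auto

lemma ae_in_cong:
  assumes "AE w in M. f w = g w" "ae_in S g"
  shows "ae_in S f"
proof -
  obtain u where "u \<in> S" "AE w in M. g w = u w" using assms(2) unfolding ae_in_def by blast
  then show ?thesis unfolding ae_in_def using assms(1) by (intro bexI[of _ u]) auto
qed

lemma ae_in_span_sum:
  assumes "finite I" "\<And>i. i \<in> I \<Longrightarrow> ae_in (fun_span S) (f i)"
  shows "ae_in (fun_span S) (\<lambda>w. \<Sum>i\<in>I. f i w)"
proof -
  have "\<forall>i\<in>I. \<exists>g. g \<in> fun_span S \<and> (AE w in M. f i w = g w)" using assms(2) unfolding ae_in_def by blast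
  from bchoice[OF this] obtain g where g: "\<forall>i\<in>I. g i \<in> fun_span S \<and> (AE w in M. f i w = g i w)" ..
  have "AE w in M. \<forall>i\<in>I. f i w = g i w" using g assms(1) by (intro AE_finite_allI) auto
  then have "AE w in M. (\<Sum>i\<in>I. f i w) = (\<Sum>i\<in>I. g i w)" by eventually_elim (auto intro: sum.cong)
  moreover have "(\<lambda>w. \<Sum>i\<in>I. g i w) \<in> fun_span S" using g by (intro fun_span_sum) auto
  ultimately show ?thesis by (rule ae_inI[rotated])
qed

lemma ae_in_span_scaleR:
  assumes "ae_in (fun_span S) f"
  shows "ae_in (fun_span S) (\<lambda>w. a *\<^sub>R f w)"
proof -
  obtain u where u: "u \<in> fun_span S" "AE w in M. f w = u w" using assms unfolding ae_in_def by blast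
  then show ?thesis unfolding ae_in_def by (intro bexI[of _ "\<lambda>w. a *\<^sub>R u w"] fun_span_scaleR) auto
qed

definition powers :: "('w \<Rightarrow> real) set" where
  "powers = {\<lambda>w. W h w ^ m | h m. True}"

definition hermites :: "('w \<Rightarrow> real) set" where
  "hermites = {\<lambda>w. hermite m (W h w) | h m. norm h = 1}"

text \<open>Polarization: \<open>(m + 1) W(h)^m W(g)\<close> is the coefficient of \<open>t\<close>
  in the power \<open>W(h + t g)^(m + 1)\<close>, and the weights extract it from finitely many
  values of \<open>t\<close>.\<close>

lemma power_mult_ae_in_powers: "ae_in (fun_span powers) (\<lambda>\<omega>. W h \<omega> ^ m * W g \<omega>)"
proof -
  obtain n :: nat and w t where n: "\<And>j. j \<le> Suc m \<Longrightarrow> (\<Sum>l<n. w l * t l ^ j) = (if j = 1 then 1 else 0 :: real)"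
    using first_coefficient_weights[of "Suc m"] by blast
  have alg: "(\<Sum>l<n. w l * (y + t l * z) ^ Suc m) = real (Suc m) * (y ^ m * z)" for y z :: real
  proof -
    have "(\<Sum>l<n. w l * (y + t l * z) ^ Suc m) = (\<Sum>l<n. w l * (\<Sum>j\<le>Suc m. real (Suc m choose j) * (t l * z) ^ j * y ^ (Suc m - j)))"
      by (subst binomial_ring[symmetric]) (simp add: add.commute)
    also have "\<dots> = (\<Sum>j\<le>Suc m. (\<Sum>l<n. w l * t l ^ j) * (real (Suc m choose j) * z ^ j * y ^ (Suc m - j)))"
      unfolding sum_distrib_left sum_distrib_right by (subst sum.swap) (simp add: power_mult_distrib mult_ac)
    also have "\<dots> = (\<Sum>j\<le>Suc m. if j = 1 then real (Suc m choose 1) * z ^ 1 * y ^ (Suc m - 1) else 0)"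
      by (rule sum.cong) (auto simp: n)
    also have "\<dots> = real (Suc m) * (y ^ m * z)" by (subst sum.delta) auto
    finally show ?thesis .
  qed
  have "AE \<omega> in M. W (h + t l *\<^sub>R g) \<omega> = W h \<omega> + t l * W g \<omega>" for l
    using W_add[of h "t l *\<^sub>R g"] W_scaleR[of "t l" g] by eventually_elim simp
  then have "AE \<omega> in M. \<forall>l\<in>{..<n}. W (h + t l *\<^sub>R g) \<omega> = W h \<omega> + t l * W g \<omega>" by (intro AE_finite_allI) auto
  then have e: "AE \<omega> in M. W h \<omega> ^ m * W g \<omega> = (\<Sum>l<n. (w l / Suc m) *\<^sub>R W (h + t l *\<^sub>R g) \<omega> ^ Suc m)"
  proof eventually_elim
    case (elim \<omega>)
    have "(\<Sum>l<n. (w l / Suc m) *\<^sub>R W (h + t l *\<^sub>R g) \<omega> ^ Suc m) = (\<Sum>l<n. w l * (W h \<omega> + t l * W g \<omega>) ^ Suc m) / Suc m"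
      unfolding sum_divide_distrib by (rule sum.cong) (use elim in auto)
    also have "\<dots> = W h \<omega> ^ m * W g \<omega>" unfolding alg by simp
    finally show ?case by simp
  qed
  have "(\<lambda>\<omega>. \<Sum>l<n. (w l / Suc m) *\<^sub>R W (h + t l *\<^sub>R g) \<omega> ^ Suc m) \<in> fun_span powers"
    by (intro fun_span_sum fun_span_scaleR fun_span_base) (unfold powers_def, blast)
  then show ?thesis by (rule ae_inI[OF _ e])
qed

text \<open>Up to a null set \<open>W h\<close> is a scalar multiple of \<open>W u\<close> for a
  unit vector \<open>u\<close>; for \<open>h = 0\<close> this \<open>u\<close> is the given
  \<open>e\<close>, with scalar 0. The power of \<open>W u\<close> is then expanded in Hermite
  polynomials.\<close>

lemma power_ae_in_hermites:
  assumes e: "norm (e :: 'h) = 1"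
  shows "ae_in (fun_span hermites) (\<lambda>w. W h w ^ m)"
proof -
  obtain u c where u: "norm u = 1" "AE w in M. W h w = c * W u w"
  proof (cases "h = 0")
    case True
    then show ?thesis using that[of e 0] e W_zero by simp
  next
    case False
    then show ?thesis using that[of "h /\<^sub>R norm h" "norm h"] W_normalize[OF False] by simp
  qed
  obtain a where a: "\<And>x. x ^ m = (\<Sum>j\<le>m. a j * hermite j x)" using power_eq_hermite_sum[of m] by blast
  have "AE w in M. W h w ^ m = (\<Sum>j\<le>m. (c ^ m * a j) *\<^sub>R hermite j (W u w))"
    using u(2)
  proof eventually_elim
    case (elim w)
    then show ?case using a[of "W u w"] by (simp add: power_mult_distrib sum_distrib_left mult_ac)
  qed
  moreover have "(\<lambda>w. \<Sum>j\<le>m. (c ^ m * a j) *\<^sub>R hermite j (W u w)) \<in> fun_span hermites"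
    using u(1) by (intro fun_span_sum fun_span_scaleR fun_span_base) (auto simp: hermites_def)
  ultimately show ?thesis by (rule ae_inI[rotated])
qed

lemma monomial_ae_in_powers: "ae_in (fun_span powers) (monomial gs)"
proof (induction gs)
  case Nil
  have "monomial [] = (\<lambda>w. W 0 w ^ 0)" by (auto simp: monomial_def)
  then have "monomial [] \<in> powers" unfolding powers_def by blast
  then show ?case using ae_in_mem fun_span_base by blast
next
  case (Cons g gs)
  then obtain f where "f \<in> fun_span powers" and f: "AE w in M. monomial gs w = f w" unfolding ae_in_def by blast
  then obtain k c u where "lin_comb (powers) f k c u"
    using fun_span_memE by blast
  note f' = lin_combD[OF this]
  have "ae_in (fun_span powers) (\<lambda>w. \<Sum>i\<in>{..<k}. c i *\<^sub>R (u i w * W g w))"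
  proof (intro ae_in_span_sum ae_in_span_scaleR)
    fix i assume "i \<in> {..<k}"
    then obtain h m where "u i = (\<lambda>w. W h w ^ m)" using f'(2) unfolding powers_def by blast
    then show "ae_in (fun_span powers) (\<lambda>w. u i w * W g w)" using power_mult_ae_in_powers by simp
  qed simp
  moreover have "AE w in M. monomial (g # gs) w = (\<Sum>i\<in>{..<k}. c i *\<^sub>R (u i w * W g w))"
    using f by eventually_elim (simp add: monomial_def f' sum_distrib_left mult_ac)
  ultimately show ?case by (rule ae_in_cong[rotated])
qed

lemma monomial_ae_in_hermites:
  assumes e: "norm (e :: 'h) = 1"
  shows "ae_in (fun_span hermites) (monomial gs)"
proof -
  obtain f where "f \<in> fun_span powers" and f: "AE w in M. monomial gs w = f w"
    using monomial_ae_in_powers[of gs] unfolding ae_in_def by blast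
  then obtain k c u where "lin_comb (powers) f k c u"
    using fun_span_memE by blast
  note f' = lin_combD[OF this]
  have "ae_in (fun_span hermites) (\<lambda>w. \<Sum>i\<in>{..<k}. c i *\<^sub>R u i w)"
  proof (intro ae_in_span_sum ae_in_span_scaleR)
    fix i assume "i \<in> {..<k}"
    then obtain h m where "u i = (\<lambda>w. W h w ^ m)" using f'(2) unfolding powers_def by blast
    then show "ae_in (fun_span hermites) (u i)" using power_ae_in_hermites[OF e] by simp
  qed simp
  then show ?thesis using ae_in_cong[OF f] f'(1) by simp
qed

text \<open>The chaos decomposition of a polynomial is read off this normal form.\<close>

definition hsum :: "nat \<Rightarrow> (nat \<Rightarrow> nat) \<Rightarrow> (nat \<Rightarrow> 'h) \<Rightarrow> (nat \<Rightarrow> 'b::real_vector) \<Rightarrow> 'w \<Rightarrow> 'b" where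
  "hsum k m h v w = (\<Sum>i<k. hermite (m i) (W (h i) w) *\<^sub>R v i)"

definition vhermites :: "('w \<Rightarrow> 'b::real_vector) set" where
  "vhermites = {\<lambda>w. hermite m (W h w) *\<^sub>R x | m h x. norm h = 1}"

lemma wiener_polynomial_hsum:
  fixes F :: "'w \<Rightarrow> 'b::real_vector"
  assumes e: "norm (e :: 'h) = 1" and F: "F \<in> wiener_polynomials W"
  shows "\<exists>k m h v. (\<forall>i<k. norm (h i) = 1) \<and> (AE \<omega> in M. F \<omega> = hsum k m h v \<omega>)"
proof -
  have mono: "ae_in (fun_span vhermites) (\<lambda>\<omega>. monomial gs \<omega> *\<^sub>R x)" for gs and x :: 'b
  proof -
    obtain f where "f \<in> fun_span hermites" and f: "AE \<omega> in M. monomial gs \<omega> = f \<omega>"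
      using monomial_ae_in_hermites[OF e, of gs] unfolding ae_in_def by blast
    then obtain k c u where "lin_comb (hermites) f k c u"
      using fun_span_memE by blast
    note f' = lin_combD[OF this]
    have "(\<lambda>\<omega>. \<Sum>i\<in>{..<k}. c i *\<^sub>R (u i \<omega> *\<^sub>R x)) \<in> fun_span vhermites"
    proof (intro fun_span_sum fun_span_scaleR fun_span_base)
      fix i assume "i \<in> {..<k}"
      then obtain h m where "u i = (\<lambda>\<omega>. hermite m (W h \<omega>))" "norm h = 1"
        using f'(2)[of i] unfolding hermites_def by blast
      then show "(\<lambda>\<omega>. u i \<omega> *\<^sub>R x) \<in> vhermites"
        unfolding vhermites_def by (intro CollectI exI[of _ m] exI[of _ h] exI[of _ x]) simp
    qed
    moreover have "AE \<omega> in M. monomial gs \<omega> *\<^sub>R x = (\<Sum>i\<in>{..<k}. c i *\<^sub>R (u i \<omega> *\<^sub>R x))"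
      using f by eventually_elim (simp add: f' scaleR_sum_left)
    ultimately show ?thesis by (rule ae_inI)
  qed
  obtain k c u where "lin_comb ({\<lambda>\<omega>. monomial gs \<omega> *\<^sub>R x | gs x. True}) F k c u"
    using F unfolding wiener_polynomials_eq_monomials by (blast dest: fun_span_memE)
  note F' = lin_combD(1)[OF this] and u = lin_combD(2)[OF this]
  have "ae_in (fun_span vhermites) (\<lambda>\<omega>. \<Sum>i\<in>{..<k}. c i *\<^sub>R u i \<omega>)"
  proof (intro ae_in_span_sum ae_in_span_scaleR)
    fix i assume "i \<in> {..<k}"
    then obtain gs x where "u i = (\<lambda>\<omega>. monomial gs \<omega> *\<^sub>R x)" using u by blast
    then show "ae_in (fun_span vhermites) (u i)" using mono[of gs x] by simp
  qed simp
  then obtain G where "G \<in> fun_span vhermites" and G: "AE \<omega> in M. F \<omega> = G \<omega>" unfolding ae_in_def F' by blast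
  then obtain l d w where "lin_comb (vhermites) G l d w"
    using fun_span_memE by blast
  note G' = lin_combD[OF this]
  have "\<forall>i\<in>{..<l}. \<exists>z. w i = (\<lambda>\<omega>. hermite (fst z) (W (fst (snd z)) \<omega>) *\<^sub>R snd (snd z)) \<and> norm (fst (snd z)) = 1"
    using G'(2) unfolding vhermites_def by fastforce
  from bchoice[OF this] obtain z where z: "\<And>i. i < l \<Longrightarrow> w i = (\<lambda>\<omega>. hermite (fst (z i)) (W (fst (snd (z i))) \<omega>) *\<^sub>R snd (snd (z i)))"
    "\<And>i. i < l \<Longrightarrow> norm (fst (snd (z i))) = 1" by blast
  have "G \<omega> = hsum l (\<lambda>i. fst (z i)) (\<lambda>i. fst (snd (z i))) (\<lambda>i. d i *\<^sub>R snd (snd (z i))) \<omega>" for \<omega>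
    unfolding G' hsum_def by (rule sum.cong) (auto simp: z)
  then show ?thesis using G z(2) by (intro exI[of _ l] exI) auto
qed

end

section \<open>Density of the polynomials\<close>

text \<open>The sine coefficients are dominated by those of the exponential series. This is the
  majorant for all partial sums at once, integrable because Gaussian variables have exponential
  moments.\<close>

lemma sin_taylor_bound: "\<bar>\<Sum>j<n. sin_coeff j * x ^ j\<bar> \<le> exp \<bar>x :: real\<bar>"
proof -
  have "\<bar>\<Sum>j<n. sin_coeff j * x ^ j\<bar> \<le> (\<Sum>j<n. \<bar>sin_coeff j * x ^ j\<bar>)" by (rule sum_abs)
  also have "\<dots> \<le> (\<Sum>j<n. \<bar>x\<bar> ^ j /\<^sub>R fact j)"
  proof (rule sum_mono)
    fix j
    have "\<bar>sin_coeff j\<bar> \<le> inverse (fact j :: real)" by (auto simp: sin_coeff_def abs_mult power_abs field_simps)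
    then have "\<bar>sin_coeff j\<bar> * \<bar>x\<bar> ^ j \<le> inverse (fact j) * \<bar>x\<bar> ^ j" by (rule mult_right_mono) simp
    then show "\<bar>sin_coeff j * x ^ j\<bar> \<le> \<bar>x\<bar> ^ j /\<^sub>R fact j" by (simp add: abs_mult power_abs)
  qed
  also have "\<dots> \<le> (\<Sum>j. \<bar>x\<bar> ^ j /\<^sub>R fact j)"
    by (rule sum_le_suminf[OF summable_exp_generic]) auto
  also have "\<dots> = exp \<bar>x\<bar>" by (simp add: exp_def)
  finally show ?thesis .
qed

lemma scaled_sin_tendsto: "(\<lambda>n. real (Suc n) * sin (x / real (Suc n))) \<longlonglongrightarrow> x"
proof -
  have "((\<lambda>h. sin (x * h) / h) \<longlongrightarrow> x) (at_right (0::real))"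
  proof -
    have "((\<lambda>h::real. sin (x * h)) has_real_derivative x) (at 0)"
      by (auto intro!: derivative_eq_intros)
    then have "((\<lambda>h. sin (x * h) / h) \<longlongrightarrow> x) (at 0)" by (simp add: has_field_derivative_iff)
    then show ?thesis by (rule tendsto_mono[rotated]) (simp add: at_le)
  qed
  moreover have "filterlim (\<lambda>n. 1 / real (Suc n)) (at_right 0) sequentially" by real_asymp
  ultimately have "(\<lambda>n. sin (x * (1 / real (Suc n))) / (1 / real (Suc n))) \<longlonglongrightarrow> x" by (rule filterlim_compose)
  then show ?thesis by (simp add: mult.commute)
qed

lemma abs_scaled_sin_le:
  assumes "0 < R"
  shows "\<bar>R * sin (x / R)\<bar> \<le> \<bar>x :: real\<bar>"
proof -
  have "\<bar>R * sin (x / R)\<bar> = R * \<bar>sin (x / R)\<bar>" using assms by (simp add: abs_mult)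
  also have "\<dots> \<le> R * \<bar>x / R\<bar>" using assms by (intro mult_left_mono abs_sin_x_le_abs_x) auto
  finally show ?thesis using assms by simp
qed

context isonormal
begin

definition poly_closure :: "real \<Rightarrow> ('w \<Rightarrow> 'b::real_normed_vector) set" where
  "poly_closure p = {f \<in> Lp M p. \<forall>e>0. \<exists>v\<in>wiener_polynomials W. Lp_norm M p (\<lambda>w. f w - v w) < e}"

section \<open>The closure of the polynomials in the Bochner space\<close>

lemma wiener_polynomials_add:
  "f \<in> wiener_polynomials W \<Longrightarrow> g \<in> wiener_polynomials W \<Longrightarrow> (\<lambda>w. f w + g w) \<in> wiener_polynomials W"
  unfolding wiener_polynomials_def by (rule fun_span_add)

lemma wiener_polynomials_scaleR:
  "f \<in> wiener_polynomials W \<Longrightarrow> (\<lambda>w. c *\<^sub>R f w) \<in> wiener_polynomials W"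
  unfolding wiener_polynomials_def by (rule fun_span_scaleR)

lemma wiener_polynomials_zero: "(\<lambda>w. 0) \<in> wiener_polynomials W"
  unfolding wiener_polynomials_def by (rule fun_span_zero)

lemma poly_closure_base:
  assumes "f \<in> wiener_polynomials W" "1 \<le> p"
  shows "f \<in> poly_closure p"
  unfolding poly_closure_def using assms wiener_polynomials_Lp[OF assms] by (auto intro!: bexI[of _ f])

lemma poly_closure_add:
  assumes f: "f \<in> poly_closure p" and g: "g \<in> poly_closure p" and p: "1 \<le> p"
  shows "(\<lambda>w. f w + g w) \<in> poly_closure p"
proof -
  have L: "f \<in> Lp M p" "g \<in> Lp M p" using f g by (auto simp: poly_closure_def)
  have "\<exists>v\<in>wiener_polynomials W. Lp_norm M p (\<lambda>w. f w + g w - v w) < e" if e: "0 < e" for e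
  proof -
    obtain u where u: "u \<in> wiener_polynomials W" "Lp_norm M p (\<lambda>w. f w - u w) < e / 2"
      using f half_gt_zero[OF e] unfolding poly_closure_def by blast
    obtain v where v: "v \<in> wiener_polynomials W" "Lp_norm M p (\<lambda>w. g w - v w) < e / 2"
      using g half_gt_zero[OF e] unfolding poly_closure_def by blast
    have "Lp_norm M p (\<lambda>w. f w + g w - (u w + v w)) = Lp_norm M p (\<lambda>w. (f w - u w) + (g w - v w))"
      by (simp add: algebra_simps)
    also have "\<dots> \<le> Lp_norm M p (\<lambda>w. f w - u w) + Lp_norm M p (\<lambda>w. g w - v w)"
      by (intro Lp_norm_triangle Lp_diff L wiener_polynomials_Lp u v p)
    also have "\<dots> < e" using u v by simp
    finally show ?thesis by (rule bexI[OF _ wiener_polynomials_add[OF u(1) v(1)]])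
  qed
  then show ?thesis using Lp_add[OF L p] by (auto simp: poly_closure_def)
qed

lemma poly_closure_scaleR:
  assumes f: "f \<in> poly_closure p" and p: "1 \<le> p"
  shows "(\<lambda>w. c *\<^sub>R f w) \<in> poly_closure p"
proof -
  have L: "f \<in> Lp M p" using f by (auto simp: poly_closure_def)
  have "\<exists>v\<in>wiener_polynomials W. Lp_norm M p (\<lambda>w. c *\<^sub>R f w - v w) < e" if e: "0 < e" for e
  proof -
    have "0 < e / (\<bar>c\<bar> + 1)" using e by simp
    then obtain u where u: "u \<in> wiener_polynomials W" "Lp_norm M p (\<lambda>w. f w - u w) < e / (\<bar>c\<bar> + 1)"
      using f unfolding poly_closure_def by blast
    have "Lp_norm M p (\<lambda>w. c *\<^sub>R f w - c *\<^sub>R u w) = \<bar>c\<bar> * Lp_norm M p (\<lambda>w. f w - u w)"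
      using p by (simp add: scaleR_diff_right[symmetric] Lp_norm_scaleR)
    also have "\<dots> \<le> (\<bar>c\<bar> + 1) * Lp_norm M p (\<lambda>w. f w - u w)" by (intro mult_right_mono) auto
    also have "\<dots> < (\<bar>c\<bar> + 1) * (e / (\<bar>c\<bar> + 1))" by (intro mult_strict_left_mono u(2)) auto
    also have "\<dots> = e" by simp
    finally show ?thesis by (rule bexI[OF _ wiener_polynomials_scaleR[OF u(1)]])
  qed
  then show ?thesis using Lp_scaleR[OF L] by (auto simp: poly_closure_def)
qed

lemma poly_closure_sum:
  assumes "\<And>i. i \<in> I \<Longrightarrow> f i \<in> poly_closure p" "1 \<le> p"
  shows "(\<lambda>w. \<Sum>i\<in>I. f i w) \<in> poly_closure p"
  using assms(1)
proof (induction I rule: infinite_finite_induct)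
  case (insert i I)
  then show ?case using poly_closure_add[of "f i" p "\<lambda>w. \<Sum>i\<in>I. f i w"] assms(2) by simp
qed (use poly_closure_base[OF wiener_polynomials_zero assms(2)] in auto)

lemma poly_closure_closed:
  assumes f: "f \<in> Lp M p" and p: "1 \<le> p"
    and a: "\<And>e. 0 < e \<Longrightarrow> \<exists>g\<in>poly_closure p. Lp_norm M p (\<lambda>w. f w - g w) < e"
  shows "f \<in> poly_closure p"
proof -
  have "\<exists>v\<in>wiener_polynomials W. Lp_norm M p (\<lambda>w. f w - v w) < e" if e: "0 < e" for e
  proof -
    obtain g where g: "g \<in> poly_closure p" "Lp_norm M p (\<lambda>w. f w - g w) < e / 2"
      using a[OF half_gt_zero[OF e]] by blast
    obtain v where v: "v \<in> wiener_polynomials W" "Lp_norm M p (\<lambda>w. g w - v w) < e / 2"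
      using g(1) half_gt_zero[OF e] unfolding poly_closure_def by blast
    have "g \<in> Lp M p" using g by (auto simp: poly_closure_def)
    from Lp_norm_diff_triangle[OF f this wiener_polynomials_Lp[OF v(1) p] p]
    show ?thesis using g v by (intro bexI[of _ v]) auto
  qed
  then show ?thesis using f by (auto simp: poly_closure_def)
qed

lemma poly_closure_limit:
  assumes f: "f \<in> Lp M p" and p: "1 \<le> p"
    and g: "\<And>n. g n \<in> poly_closure p" "(\<lambda>n. Lp_norm M p (\<lambda>w. g n w - f w)) \<longlonglongrightarrow> 0"
  shows "f \<in> poly_closure p"
proof (rule poly_closure_closed[OF f p])
  fix e :: real assume "0 < e"
  from order_tendstoD(2)[OF g(2) this] obtain n where "Lp_norm M p (\<lambda>w. g n w - f w) < e"
    by (auto simp: eventually_sequentially)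
  then show "\<exists>h\<in>poly_closure p. Lp_norm M p (\<lambda>w. f w - h w) < e"
    using g(1) Lp_norm_minus_commute[of M p f "g n"] by (intro bexI[of _ "g n"]) auto
qed

text \<open>The bounded multipliers \<open>g\<close> with \<open>g q\<close> in the closure of the polynomials for every polynomial
  \<open>q\<close> are stable under multiplication by \<open>sin (c W h)\<close>, because the sine series converges in \<open>L\<^sup>p\<close>,
  and under bounded pointwise limits. Since \<open>R sin (x / R)\<close> tends to \<open>x\<close>, this gives all bounded
  continuous functions of \<open>W h\<close>, and then the indicators of all events.\<close>

definition pmult :: "real \<Rightarrow> ('w \<Rightarrow> real) set" where
  "pmult p = {g \<in> borel_measurable M. (\<exists>B. \<forall>w. \<bar>g w\<bar> \<le> B) \<and> (\<forall>gs. (\<lambda>w. g w * monomial gs w) \<in> poly_closure p)}"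

section \<open>Multipliers of the closure\<close>

lemma monomial_measurable [measurable]: "monomial gs \<in> borel_measurable M"
  by (rule moments_measurable[OF moments_monomial])

lemma pmult_one:
  assumes "1 \<le> p"
  shows "(\<lambda>w. 1) \<in> pmult p"
  using poly_closure_base[OF monomial_wiener_polynomial[of _ "1::real"] assms]
  by (auto simp: pmult_def intro!: exI[of _ 1])

lemma pmult_add:
  assumes "f \<in> pmult p" "g \<in> pmult p" "1 \<le> p"
  shows "(\<lambda>w. f w + g w) \<in> pmult p"
proof -
  obtain B C where B: "\<And>w. \<bar>f w\<bar> \<le> B" "\<And>w. \<bar>g w\<bar> \<le> C" using assms by (auto simp: pmult_def)
  have "\<bar>f w + g w\<bar> \<le> B + C" for w using B[of w] by linarith
  moreover have "(\<lambda>w. (f w + g w) * monomial gs w) \<in> poly_closure p" for gs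
    using poly_closure_add[of "\<lambda>w. f w * monomial gs w" p "\<lambda>w. g w * monomial gs w"] assms
    by (simp add: pmult_def distrib_right)
  ultimately show ?thesis using assms unfolding pmult_def by auto
qed

lemma pmult_scale:
  assumes "f \<in> pmult p" "1 \<le> p"
  shows "(\<lambda>w. c * f w) \<in> pmult p"
proof -
  obtain B where B: "\<And>w. \<bar>f w\<bar> \<le> B" using assms by (auto simp: pmult_def)
  have "\<bar>c * f w\<bar> \<le> \<bar>c\<bar> * B" for w using B[of w] by (simp add: abs_mult mult_left_mono)
  moreover have "(\<lambda>w. (c * f w) * monomial gs w) \<in> poly_closure p" for gs
    using poly_closure_scaleR[of "\<lambda>w. f w * monomial gs w" p c] assms
    by (simp add: pmult_def mult.assoc)
  ultimately show ?thesis using assms unfolding pmult_def by auto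
qed

lemma pmult_sum:
  assumes "\<And>i. i \<in> I \<Longrightarrow> f i \<in> pmult p" "1 \<le> p"
  shows "(\<lambda>w. \<Sum>i\<in>I. f i w) \<in> pmult p"
  using assms(1)
proof (induction I rule: infinite_finite_induct)
  case (insert i I)
  then show ?case using pmult_add[of "f i" p "\<lambda>w. \<Sum>i\<in>I. f i w"] assms(2) by simp
qed (use pmult_scale[OF pmult_one, of p 0] assms(2) in auto)

text \<open>After multiplication by a monomial the sequence is dominated by \<open>B\<close> times
  the monomial, which has all moments, so the convergence takes place in Lp and the closure is not
  left.\<close>

lemma pmult_limit:
  assumes f: "\<And>n. f n \<in> pmult p" "\<And>n w. \<bar>f n w\<bar> \<le> B" and g: "g \<in> borel_measurable M" "\<And>w. \<bar>g w\<bar> \<le> B"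
    and lim: "AE w in M. (\<lambda>n. f n w) \<longlonglongrightarrow> g w" and p: "1 \<le> p"
  shows "g \<in> pmult p"
proof -
  have "(\<lambda>w. g w * monomial gs w) \<in> poly_closure p" for gs
  proof (rule poly_closure_limit[OF _ p])
    have m: "moments (\<lambda>w. B * monomial gs w)" by (intro moments_mult moments_const moments_monomial)
    have "moments (\<lambda>w. g w * monomial gs w)"
      by (intro moments_mult moments_monomial moments_bounded[OF g])
    then show "(\<lambda>w. g w * monomial gs w) \<in> Lp M p" using p by (simp add: momentsD)
    show "(\<lambda>w. f n w * monomial gs w) \<in> poly_closure p" for n using f by (simp add: pmult_def)
    have [measurable]: "f n \<in> borel_measurable M" for n using f by (simp add: pmult_def)
    note [measurable] = g(1)
    show "(\<lambda>n. Lp_norm M p (\<lambda>w. f n w * monomial gs w - g w * monomial gs w)) \<longlonglongrightarrow> 0"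
    proof (rule Lp_dominated_convergence[where g="\<lambda>w. norm (B * monomial gs w)"])
      show "integrable M (\<lambda>w. norm (B * monomial gs w) powr p)" using LpD(2)[OF momentsD[OF m]] p by simp
      show "AE w in M. norm (f n w * monomial gs w) \<le> norm (B * monomial gs w)" for n
      proof (rule AE_I2)
        fix w
        have "\<bar>f n w\<bar> * \<bar>monomial gs w\<bar> \<le> \<bar>B\<bar> * \<bar>monomial gs w\<bar>"
          using f(2)[of n w] by (intro mult_right_mono) auto
        then show "norm (f n w * monomial gs w) \<le> norm (B * monomial gs w)" by (simp add: abs_mult)
      qed
      show "AE w in M. (\<lambda>n. f n w * monomial gs w) \<longlonglongrightarrow> g w * monomial gs w"
        using lim by eventually_elim (intro tendsto_mult_right)
    qed (use p in \<open>auto simp: strongly_measurable_real_iff\<close>)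
  qed
  then show ?thesis using g by (auto simp: pmult_def)
qed

text \<open>A partial sum of the sine series times a monomial is a combination of monomials, so
  \<open>f\<close> carries it into the closure. The majorant
  \<open>B * exp \<bar>c * W h\<bar>\<close> times the monomial again has all moments.\<close>

lemma pmult_sin:
  assumes f: "f \<in> pmult p" and p: "1 \<le> p"
  shows "(\<lambda>w. f w * sin (c * W h w)) \<in> pmult p"
proof -
  obtain B where B: "\<And>w. \<bar>f w\<bar> \<le> B" using f by (auto simp: pmult_def)
  have B0: "0 \<le> B" using B[of undefined] by simp
  have fm[measurable]: "f \<in> borel_measurable M" using f by (simp add: pmult_def)
  have b: "\<bar>f w * sin (c * W h w)\<bar> \<le> B" for w
    using mult_mono[OF B[of w] abs_sin_le_one[of "c * W h w"]] B0 by (simp add: abs_mult)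
  have "(\<lambda>w. (f w * sin (c * W h w)) * monomial gs w) \<in> poly_closure p" for gs
  proof (rule poly_closure_limit[OF _ p])
    define t where "t n w = (\<Sum>j<n. sin_coeff j * (c * W h w) ^ j)" for n w
    have "moments (\<lambda>w. (f w * sin (c * W h w)) * monomial gs w)"
      by (intro moments_mult moments_monomial moments_bounded[OF _ b]) measurable
    then show "(\<lambda>w. (f w * sin (c * W h w)) * monomial gs w) \<in> Lp M p" using p by (simp add: momentsD)
    show "(\<lambda>w. f w * t n w * monomial gs w) \<in> poly_closure p" for n
    proof -
      have "(\<lambda>w. \<Sum>j<n. (sin_coeff j * c ^ j) *\<^sub>R (f w * monomial (replicate j h @ gs) w)) \<in> poly_closure p"
        using f p by (intro poly_closure_sum poly_closure_scaleR) (auto simp: pmult_def)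
      then show ?thesis
        by (simp add: t_def monomial_append monomial_replicate sum_distrib_left sum_distrib_right power_mult_distrib mult_ac)
    qed
    have m: "moments (\<lambda>w. B * exp \<bar>c * W h w\<bar> * monomial gs w)"
      by (intro moments_mult moments_const moments_monomial moments_exp_abs_W)
    have [measurable]: "t n \<in> borel_measurable M" for n unfolding t_def by measurable
    show "(\<lambda>n. Lp_norm M p (\<lambda>w. f w * t n w * monomial gs w - f w * sin (c * W h w) * monomial gs w)) \<longlonglongrightarrow> 0"
    proof (rule Lp_dominated_convergence[where g="\<lambda>w. norm (B * exp \<bar>c * W h w\<bar> * monomial gs w)"])
      show "integrable M (\<lambda>w. norm (B * exp \<bar>c * W h w\<bar> * monomial gs w) powr p)" using LpD(2)[OF momentsD[OF m]] p by simp
      show "AE w in M. norm (f w * t n w * monomial gs w) \<le> norm (B * exp \<bar>c * W h w\<bar> * monomial gs w)" for n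
      proof (rule AE_I2)
        fix w
        have "\<bar>f w\<bar> * \<bar>t n w\<bar> \<le> B * exp \<bar>c * W h w\<bar>"
          unfolding t_def using B B0 sin_taylor_bound by (intro mult_mono) auto
        then have "\<bar>f w\<bar> * \<bar>t n w\<bar> * \<bar>monomial gs w\<bar> \<le> B * exp \<bar>c * W h w\<bar> * \<bar>monomial gs w\<bar>"
          by (rule mult_right_mono) simp
        then show "norm (f w * t n w * monomial gs w) \<le> norm (B * exp \<bar>c * W h w\<bar> * monomial gs w)"
          using B0 by (simp add: abs_mult)
      qed
      show "AE w in M. (\<lambda>n. f w * t n w * monomial gs w) \<longlonglongrightarrow> f w * sin (c * W h w) * monomial gs w"
      proof (rule AE_I2)
        fix w
        have "(\<lambda>n. t n w) \<longlonglongrightarrow> sin (c * W h w)"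
          using sin_converges[of "c * W h w"] unfolding t_def sums_def by simp
        then show "(\<lambda>n. f w * t n w * monomial gs w) \<longlonglongrightarrow> f w * sin (c * W h w) * monomial gs w"
          by (intro tendsto_mult_right tendsto_mult_left)
      qed
    qed (use p in \<open>auto simp: strongly_measurable_real_iff\<close>)
  qed
  then show ?thesis using b unfolding pmult_def by auto
qed

lemma pmult_sin_power:
  assumes "f \<in> pmult p" "1 \<le> p"
  shows "(\<lambda>w. f w * sin (c * W h w) ^ j) \<in> pmult p"
proof (induction j)
  case (Suc j)
  then show ?case using pmult_sin[OF Suc assms(2), of c h] by (simp add: mult_ac)
qed (use assms in simp)

text \<open>Since \<open>sin (W h / R)\<close> stays in a compact interval, Weierstrass
  approximation applies to \<open>u \<mapsto> g (R * u)\<close> there, and polynomials in the sine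
  are covered by \<open>pmult_sin_power\<close>. Letting \<open>R\<close> run through the positive
  integers recovers \<open>g (W h)\<close>.\<close>

lemma pmult_continuous:
  assumes f: "f \<in> pmult p" and p: "1 \<le> p" and g: "continuous_on UNIV g" "\<And>x. \<bar>g x\<bar> \<le> C"
  shows "(\<lambda>w. f w * g (W h w)) \<in> pmult p"
proof -
  obtain B where B: "\<And>w. \<bar>f w\<bar> \<le> B" using f by (auto simp: pmult_def)
  have B0: "0 \<le> B" using B[of undefined] by simp
  have fm[measurable]: "f \<in> borel_measurable M" using f by (simp add: pmult_def)
  have [measurable]: "g \<in> borel_measurable borel" using g(1) by (rule borel_measurable_continuous_onI)
  have 1: "(\<lambda>w. f w * g (R * sin (W h w / R))) \<in> pmult p" if R: "0 < R" for R
  proof -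
    have cont: "continuous_on {-1..1} (\<lambda>u. g (R * u))"
      by (rule continuous_on_compose2[OF g(1)]) (auto intro!: continuous_intros)
    have "\<exists>q. real_polynomial_function q \<and> (\<forall>u\<in>{-1..1}. \<bar>g (R * u) - q u\<bar> < 1 / real (Suc n))" for n
    proof -
      obtain q where "real_polynomial_function q" "\<And>x. x \<in> {-1..1} \<Longrightarrow> \<bar>g (R * x) - q x\<bar> < 1 / real (Suc n)"
        by (rule Stone_Weierstrass_real_polynomial_function[OF compact_Icc cont, of "1 / real (Suc n)"]) auto
      then show ?thesis by blast
    qed
    then have "\<forall>n. \<exists>q. real_polynomial_function q \<and> (\<forall>u\<in>{-1..1}. \<bar>g (R * u) - q u\<bar> < 1 / real (Suc n))" ..
    from choice[OF this] obtain q where q': "\<forall>n. real_polynomial_function (q n) \<and> (\<forall>u\<in>{-1..1}. \<bar>g (R * u) - q n u\<bar> < 1 / real (Suc n))" ..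
    then have q: "\<And>n. real_polynomial_function (q n)"
      "\<And>n u. u \<in> {-1..1} \<Longrightarrow> \<bar>g (R * u) - q n u\<bar> < 1 / real (Suc n)" by simp_all
    have sin_in: "sin y \<in> {-1..1}" for y :: real by auto
    show ?thesis
    proof (rule pmult_limit[where f="\<lambda>n w. f w * q n (sin (W h w / R))" and B="B * (C + 1)"])
      fix n
      obtain a d where a: "q n = (\<lambda>x. \<Sum>i\<le>d. a i * x ^ i)" using q(1)[of n] unfolding real_polynomial_function_iff_sum by blast
      have "(\<lambda>w. \<Sum>i\<le>d. a i * (f w * sin ((1 / R) * W h w) ^ i)) \<in> pmult p"
        by (intro pmult_sum pmult_scale pmult_sin_power f p)
      then show "(\<lambda>w. f w * q n (sin (W h w / R))) \<in> pmult p"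
        by (simp add: a sum_distrib_left mult_ac)
    next
      fix n w
      have "\<bar>g (R * sin (W h w / R)) - q n (sin (W h w / R))\<bar> < 1 / real (Suc n)" by (rule q(2)[OF sin_in])
      moreover have "1 / real (Suc n) \<le> 1" by simp
      ultimately have "\<bar>q n (sin (W h w / R))\<bar> \<le> C + 1" using g(2)[of "R * sin (W h w / R)"] by linarith
      then show "\<bar>f w * q n (sin (W h w / R))\<bar> \<le> B * (C + 1)"
        unfolding abs_mult using B B0 by (intro mult_mono) auto
    next
      fix w
      have "\<bar>f w\<bar> * \<bar>g (R * sin (W h w / R))\<bar> \<le> B * (C + 1)"
        using B B0 g(2)[of "R * sin (W h w / R)"] by (intro mult_mono) auto
      then show "\<bar>f w * g (R * sin (W h w / R))\<bar> \<le> B * (C + 1)" by (simp add: abs_mult)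
    next
      have "(\<lambda>n. q n (sin (W h w / R))) \<longlonglongrightarrow> g (R * sin (W h w / R))" for w
      proof (rule LIM_zero_cancel, rule Lim_null_comparison)
        show "\<forall>\<^sub>F n in sequentially. norm (q n (sin (W h w / R)) - g (R * sin (W h w / R))) \<le> 1 / real (Suc n)"
          using q(2)[OF sin_in] by (intro always_eventually allI) (simp add: abs_minus_commute less_imp_le)
      qed (rule LIMSEQ_Suc[OF lim_1_over_n])
      then show "AE w in M. (\<lambda>n. f w * q n (sin (W h w / R))) \<longlonglongrightarrow> f w * g (R * sin (W h w / R))"
        by (intro AE_I2 tendsto_mult_left)
    qed (use p in measurable)
  qed
  have bd: "\<bar>f w * g y\<bar> \<le> B * C" for w y
    unfolding abs_mult using B B0 g(2) by (intro mult_mono) auto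
  show ?thesis
  proof (rule pmult_limit[where f="\<lambda>n w. f w * g (real (Suc n) * sin (W h w / real (Suc n)))"])
    show "AE w in M. (\<lambda>n. f w * g (real (Suc n) * sin (W h w / real (Suc n)))) \<longlonglongrightarrow> f w * g (W h w)"
      by (intro AE_I2 tendsto_mult_left continuous_on_tendsto_compose[OF g(1) scaled_sin_tendsto]) auto
  qed (use 1 bd p in auto)
qed

text \<open>Asking that the indicator preserve all of \<open>pmult\<close>, rather than that it lie
  in the closure, makes intersections immediate. The class is then a sigma-algebra without any
  detour through generating systems stable under intersection.\<close>

definition pevents :: "real \<Rightarrow> 'w set set" where
  "pevents p = {A \<in> sets M. \<forall>f\<in>pmult p. (\<lambda>w. f w * indicator A w) \<in> pmult p}"

lemma peventsD: "A \<in> pevents p \<Longrightarrow> f \<in> pmult p \<Longrightarrow> (\<lambda>w. f w * indicator A w) \<in> pmult p"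
  by (simp add: pevents_def)

lemma pmultD: "f \<in> pmult p \<Longrightarrow> (\<lambda>w. f w * monomial gs w) \<in> poly_closure p"
  by (simp add: pmult_def)

lemma pevents_sigma_algebra:
  assumes p: "1 \<le> p"
  shows "{} \<in> pevents p" "\<And>A. A \<in> pevents p \<Longrightarrow> space M - A \<in> pevents p"
    "\<And>A :: nat \<Rightarrow> 'w set. (\<And>i. A i \<in> pevents p) \<Longrightarrow> (\<Union>i. A i) \<in> pevents p"
proof -
  have zero: "(\<lambda>w. 0) \<in> pmult p" using pmult_scale[OF pmult_one[OF p] p, of 0] by simp
  show "{} \<in> pevents p" using zero by (simp add: pevents_def)
  \<comment> \<open>Boundedness in \<open>pmult\<close> refers to all points, also those outside
    \<open>space M\<close>, whereas set identities for events give equality inside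
    \<open>space M\<close> only.\<close>
  have ae: "g \<in> pmult p" if f: "f \<in> pmult p" "g \<in> borel_measurable M" "\<And>w. \<bar>g w\<bar> \<le> B" "\<And>w. w \<in> space M \<Longrightarrow> f w = g w" for f g B
  proof -
    obtain B' where B': "\<And>w. \<bar>f w\<bar> \<le> B'" using f by (auto simp: pmult_def)
    show ?thesis
    proof (rule pmult_limit[where f="\<lambda>_. f" and B="max B B'", OF _ _ f(2) _ _ p])
      show "AE w in M. (\<lambda>n::nat. f w) \<longlonglongrightarrow> g w" by (rule AE_I2) (simp add: f(4))
      show "\<bar>f w\<bar> \<le> max B B'" "\<bar>g w\<bar> \<le> max B B'" for w using B'[of w] f(3)[of w] by auto
    qed (use f in auto)
  qed
  have bdd: "\<exists>B. \<forall>w. \<bar>f w * indicator A w\<bar> \<le> B" if f: "f \<in> pmult p" for f and A :: "'w set"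
  proof -
    obtain B where B: "\<And>w. \<bar>f w\<bar> \<le> B" using f by (auto simp: pmult_def)
    then have "\<bar>f w * indicator A w\<bar> \<le> B" for w
      using B[of w] by (auto simp: indicator_def intro: order_trans[OF abs_ge_zero])
    then show ?thesis by blast
  qed
  have meas: "(\<lambda>w. f w * indicator A w) \<in> borel_measurable M" if "f \<in> pmult p" "A \<in> sets M" for f and A :: "'w set"
    using that by (auto simp: pmult_def)
  show compl: "space M - A \<in> pevents p" if A: "A \<in> pevents p" for A
  proof -
    have AM: "A \<in> sets M" using A by (simp add: pevents_def)
    have "(\<lambda>w. f w * indicator (space M - A) w) \<in> pmult p" if f: "f \<in> pmult p" for f
    proof -
      obtain B where B: "\<And>w. \<bar>f w * indicator (space M - A) w\<bar> \<le> B" using bdd[OF f] by blast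
      have fA: "(\<lambda>w. f w * indicator A w) \<in> pmult p" using A f by (simp add: pevents_def)
      have d: "(\<lambda>w. f w + (-1) * (f w * indicator A w)) \<in> pmult p"
        by (rule pmult_add[OF f pmult_scale[OF fA p] p])
      show ?thesis
        by (rule ae[OF d meas[OF f] B]) (use AM in \<open>auto simp: indicator_def\<close>)
    qed
    then show ?thesis using AM by (auto simp: pevents_def)
  qed
  have int: "A \<inter> B \<in> pevents p" if "A \<in> pevents p" "B \<in> pevents p" for A B
    using that by (auto simp: pevents_def indicator_inter_arith mult.assoc[symmetric])
  have un: "A \<union> B \<in> pevents p" if A: "A \<in> pevents p" and B: "B \<in> pevents p" for A B
  proof -
    have "A \<subseteq> space M" "B \<subseteq> space M" using A B sets.sets_into_space by (auto simp: pevents_def)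
    then have "A \<union> B = space M - ((space M - A) \<inter> (space M - B))" by auto
    then show ?thesis using compl[OF int[OF compl[OF A] compl[OF B]]] by simp
  qed
  show "(\<Union>i. A i) \<in> pevents p" if A: "\<And>i. A i \<in> pevents p" for A :: "nat \<Rightarrow> 'w set"
  proof -
    have AM: "A i \<in> sets M" for i using A by (simp add: pevents_def)
    have Un: "(\<Union>i<n. A i) \<in> pevents p" for n
    proof (induction n)
      case (Suc n)
      then show ?case using un[OF Suc A[of n]] by (simp add: lessThan_Suc Un_commute)
    qed (use \<open>{} \<in> pevents p\<close> in simp)
    have "(\<lambda>w. f w * indicator (\<Union>i. A i) w) \<in> pmult p" if f: "f \<in> pmult p" for f
    proof -
      obtain B where B: "\<And>w. \<bar>f w\<bar> \<le> B" using f by (auto simp: pmult_def)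
      have Bi: "\<bar>f w * indicator D w\<bar> \<le> B" for w D
        using B[of w] by (auto simp: indicator_def intro: order_trans[OF abs_ge_zero])
      show ?thesis
      proof (rule pmult_limit[where f="\<lambda>n w. f w * indicator (\<Union>i<n. A i) w" and B=B])
        show "(\<lambda>w. f w * indicator (\<Union>i<n. A i) w) \<in> pmult p" for n using Un[of n] f by (simp add: pevents_def)
        show "AE w in M. (\<lambda>n. f w * indicator (\<Union>i<n. A i) w) \<longlonglongrightarrow> f w * indicator (\<Union>i. A i) w"
          by (intro AE_I2 tendsto_mult_left LIMSEQ_indicator_UN)
        show "(\<lambda>w. f w * indicator (\<Union>i. A i) w) \<in> borel_measurable M" by (rule meas[OF f]) (use AM in auto)
      qed (use Bi p in auto)
    qed
    then show ?thesis using AM by (auto simp: pevents_def)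
  qed
qed

text \<open>The preimages in \<open>pevents\<close> come from a sigma-algebra on the line, so
  half-lines suffice; their indicators are bounded limits of continuous functions of
  \<open>W h\<close>.\<close>

lemma W_vimage_pevents:
  assumes p: "1 \<le> p" and B: "B \<in> sets borel"
  shows "W h -` B \<inter> space M \<in> pevents p"
proof -
  have "B \<in> sigma_sets UNIV (range (\<lambda>a::real. {..a}))" using B by (simp add: borel_eq_atMost)
  then show ?thesis
  proof (induction rule: sigma_sets.induct)
    case (Basic S)
    then obtain a where S: "S = {..a}" by blast
    have "(\<lambda>w. f w * indicator (W h -` S \<inter> space M) w) \<in> pmult p" if f: "f \<in> pmult p" for f
    proof -
      \<comment> \<open>For \<open>n \<ge> 1\<close> these are ramps falling linearly from 1 at
        \<open>a\<close> to 0 at \<open>a + 1 / n\<close>.\<close>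
      define g where "g n x = max 0 (min 1 (1 - real n * (x - a)))" for n :: nat and x
      obtain B where B: "\<And>w. \<bar>f w\<bar> \<le> B" using f by (auto simp: pmult_def)
      have B0: "0 \<le> B" using B[of undefined] by simp
      have g01: "\<bar>g n x\<bar> \<le> 1" for n x by (simp add: g_def)
      have gc: "continuous_on UNIV (g n)" for n unfolding g_def by (intro continuous_intros)
      have lim: "(\<lambda>n. g n x) \<longlonglongrightarrow> indicator S x" for x
      proof (cases "x \<le> a")
        case True
        then have "g n x = 1" for n by (simp add: g_def mult_nonneg_nonpos)
        then show ?thesis using True S by simp
      next
        case False
        obtain n0 :: nat where n0: "1 / (x - a) < n0" using reals_Archimedean2 by blast
        have "\<forall>\<^sub>F n in sequentially. g n x = 0"
          using eventually_ge_at_top[of n0]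
        proof eventually_elim
          case (elim n)
          have "1 / (x - a) \<le> real n" using n0 elim by linarith
          then have "1 \<le> real n * (x - a)" using False by (simp add: field_simps)
          then show ?case by (simp add: g_def)
        qed
        then show ?thesis using False S by (simp add: tendsto_eventually)
      qed
      have Bg: "\<bar>f w * c\<bar> \<le> B" if "\<bar>c\<bar> \<le> 1" for w c
        using mult_mono[OF B[of w] that B0] by (simp add: abs_mult)
      show ?thesis
      proof (rule pmult_limit[where f="\<lambda>n w. f w * g n (W h w)" and B=B, OF _ _ _ _ _ p])
        show "(\<lambda>w. f w * g n (W h w)) \<in> pmult p" for n by (rule pmult_continuous[OF f p gc g01])
        show "\<bar>f w * g n (W h w)\<bar> \<le> B" for n w by (rule Bg[OF g01])
        show "\<bar>f w * indicator (W h -` S \<inter> space M) w\<bar> \<le> B" for w by (rule Bg) (simp add: indicator_def)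
        have [measurable]: "f \<in> borel_measurable M" "S \<in> sets borel" using f S by (auto simp: pmult_def)
        show "(\<lambda>w. f w * indicator (W h -` S \<inter> space M) w) \<in> borel_measurable M" by measurable
        show "AE w in M. (\<lambda>n. f w * g n (W h w)) \<longlonglongrightarrow> f w * indicator (W h -` S \<inter> space M) w"
        proof (rule AE_I2)
          fix w assume "w \<in> space M"
          then have "indicator (W h -` S \<inter> space M) w = (indicator S (W h w) :: real)" by (simp add: indicator_def)
          then show "(\<lambda>n. f w * g n (W h w)) \<longlonglongrightarrow> f w * indicator (W h -` S \<inter> space M) w"
            using lim[of "W h w"] by (simp add: tendsto_mult_left)
        qed
      qed
    qed
    moreover have "W h -` S \<inter> space M \<in> sets M" unfolding S by measurable
    ultimately show ?case by (simp add: pevents_def)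
  next
    case Empty
    then show ?case using pevents_sigma_algebra(1)[OF p] by simp
  next
    case (Compl S)
    have "W h -` (UNIV - S) \<inter> space M = space M - (W h -` S \<inter> space M)" by auto
    then show ?case using pevents_sigma_algebra(2)[OF p Compl.IH] by simp
  next
    case (Union S)
    have "W h -` (\<Union>i. S i) \<inter> space M = (\<Union>i. W h -` S i \<inter> space M)" by auto
    then show ?case using pevents_sigma_algebra(3)[OF p Union.IH] by simp
  qed
qed

text \<open>A function times the indicator of a null set is an almost sure limit of the multiplier
  0.\<close>

lemma null_sets_pevents:
  assumes p: "1 \<le> p" and N: "N \<in> null_sets M"
  shows "N \<in> pevents p"
proof -
  have "(\<lambda>w. f w * indicator N w) \<in> pmult p" if f: "f \<in> pmult p" for f
  proof (rule pmult_limit[where f="\<lambda>_ _. 0" and B="SOME B. \<forall>w. \<bar>f w\<bar> \<le> B", OF _ _ _ _ _ p])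
    have "\<exists>B. \<forall>w. \<bar>f w\<bar> \<le> B" using f by (simp add: pmult_def)
    then have B: "\<bar>f w\<bar> \<le> (SOME B. \<forall>w. \<bar>f w\<bar> \<le> B)" for w by (rule someI2_ex) blast
    then show "\<bar>0 :: real\<bar> \<le> (SOME B. \<forall>w. \<bar>f w\<bar> \<le> B)" "\<bar>f w * indicator N w\<bar> \<le> (SOME B. \<forall>w. \<bar>f w\<bar> \<le> B)" for w
      using order_trans[OF abs_ge_zero B[of undefined]] by (auto simp: indicator_def)
    show "(\<lambda>w. 0) \<in> pmult p" using pmult_scale[OF pmult_one[OF p] p, of 0] by simp
    show "AE w in M. (\<lambda>n::nat. 0) \<longlonglongrightarrow> f w * indicator N w"
      using AE_not_in[OF N] by eventually_elim simp
    show "(\<lambda>w. f w * indicator N w) \<in> borel_measurable M" using f N by (auto simp: pmult_def)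
  qed
  then show ?thesis using N by (auto simp: pevents_def)
qed

text \<open>Every event lies in \<open>pevents\<close>, since the generators do; the multiplier 1
  and the empty monomial then give real indicators. Multiplying an approximating real polynomial by
  a fixed vector handles \<open>indicator A *\<^sub>R x\<close>, and sums of such functions exhaust
  the simple functions.\<close>

theorem polynomials_dense:
  fixes f :: "'w \<Rightarrow> 'b::real_normed_vector"
  assumes gen: "sigma_algebra_generated_by M W" and p: "1 \<le> p" and f: "f \<in> Lp M p" and e: "0 < e"
  shows "\<exists>v\<in>wiener_polynomials W. Lp_norm M p (\<lambda>\<omega>. f \<omega> - v \<omega>) < e"
proof -
  have p0: "0 < p" using p by simp
  have ev: "A \<in> pevents p" if "A \<in> sets M" for A
  proof -
    have "A \<in> sigma_sets (space M) ({W h -` B \<inter> space M | h B. B \<in> sets borel} \<union> null_sets M)"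
      using that gen[unfolded sigma_algebra_generated_by_def] by blast
    then show ?thesis
    proof (induction rule: sigma_sets.induct)
      case (Basic S)
      then show ?case using W_vimage_pevents[OF p] null_sets_pevents[OF p] by blast
    qed (use pevents_sigma_algebra[OF p] in auto)
  qed
  have ind: "(indicator A :: 'w \<Rightarrow> real) \<in> poly_closure p" if "A \<in> sets M" for A
  proof -
    have "(\<lambda>\<omega>. 1 * indicator A \<omega>) \<in> pmult p" by (rule peventsD[OF ev[OF that] pmult_one[OF p]])
    then have "(\<lambda>\<omega>. 1 * indicator A \<omega> * monomial [] \<omega>) \<in> poly_closure p" by (rule pmultD)
    then show ?thesis by (simp add: monomial_def eta_contract_eq)
  qed
  have vec: "(\<lambda>\<omega>. indicator A \<omega> *\<^sub>R x) \<in> poly_closure p" if A: "A \<in> sets M" for A and x :: 'b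
  proof -
    have L: "(\<lambda>\<omega>. indicator A \<omega> *\<^sub>R x) \<in> Lp M p"
      by (rule Lp_moments_scaleR[OF moments_bounded[of _ 1] p]) (use A in \<open>auto simp: indicator_def\<close>)
    have "\<exists>v\<in>wiener_polynomials W. Lp_norm M p (\<lambda>\<omega>. indicator A \<omega> *\<^sub>R x - v \<omega>) < e" if e: "0 < e" for e
    proof -
      have "0 < e / (norm x + 1)" using e by (simp add: add_nonneg_pos)
      then obtain v :: "'w \<Rightarrow> real"
        where v: "v \<in> wiener_polynomials W" "Lp_norm M p (\<lambda>\<omega>. indicator A \<omega> - v \<omega>) < e / (norm x + 1)"
        using ind[OF A] unfolding poly_closure_def by blast
      from v(1)[unfolded wiener_polynomials_eq_monomials, THEN fun_span_memE] obtain k c u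
        where lc: "lin_comb {\<lambda>\<omega>. monomial gs \<omega> *\<^sub>R x | gs x. True} v k c u" by (elim exE)
      note v' = lin_combD[OF lc]
      have "(\<lambda>\<omega>. \<Sum>i<k. c i *\<^sub>R (u i \<omega> *\<^sub>R x)) \<in> fun_span {\<lambda>\<omega>. monomial gs \<omega> *\<^sub>R x | gs x. True}"
      proof (intro fun_span_sum fun_span_scaleR)
        fix i assume "i \<in> {..<k}"
        then obtain gs and y :: real where "u i = (\<lambda>\<omega>. monomial gs \<omega> *\<^sub>R y)" using v'(2) by blast
        then have "(\<lambda>\<omega>. u i \<omega> *\<^sub>R x) = (\<lambda>\<omega>. monomial gs \<omega> *\<^sub>R (y *\<^sub>R x))" by simp
        then show "(\<lambda>\<omega>. u i \<omega> *\<^sub>R x) \<in> fun_span {\<lambda>\<omega>. monomial gs \<omega> *\<^sub>R x | gs x. True}"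
          by (intro fun_span_base CollectI exI[of _ gs] exI[of _ "y *\<^sub>R x"]) simp
      qed
      then have w: "(\<lambda>\<omega>. v \<omega> *\<^sub>R x) \<in> wiener_polynomials W"
        by (simp add: wiener_polynomials_eq_monomials v'(1) scaleR_sum_left)
      have "Lp_norm M p (\<lambda>\<omega>. indicator A \<omega> *\<^sub>R x - v \<omega> *\<^sub>R x) = norm x * Lp_norm M p (\<lambda>\<omega>. indicator A \<omega> - v \<omega>)"
      proof -
        have "Lp_norm M p (\<lambda>\<omega>. indicator A \<omega> *\<^sub>R x - v \<omega> *\<^sub>R x) = Lp_norm M p (\<lambda>\<omega>. norm x *\<^sub>R (indicator A \<omega> - v \<omega>))"
          unfolding Lp_norm_def by (simp add: scaleR_diff_left[symmetric] abs_mult mult.commute)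
        then show ?thesis unfolding Lp_norm_scaleR[OF p0] by simp
      qed
      also have "\<dots> \<le> (norm x + 1) * Lp_norm M p (\<lambda>\<omega>. indicator A \<omega> - v \<omega>)" by (intro mult_right_mono) auto
      also have "\<dots> < (norm x + 1) * (e / (norm x + 1))" by (intro mult_strict_left_mono v(2)) (simp add: add_nonneg_pos)
      also have "\<dots> = e" using norm_ge_zero[of x] by (simp add: add_nonneg_eq_0_iff)
      finally show ?thesis by (rule bexI[OF _ w])
    qed
    then show ?thesis using L by (auto simp: poly_closure_def)
  qed
  have "f \<in> poly_closure p"
  proof (rule poly_closure_closed[OF f p])
    fix d :: real assume "0 < d"
    from Lp_simple_dense[OF f p this] obtain s where s: "simple_function M s" "s \<in> Lp M p"
      "Lp_norm M p (\<lambda>\<omega>. f \<omega> - s \<omega>) < d" by (elim exE conjE)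
    define r where "r \<omega> = (\<Sum>y\<in>s ` space M. indicator (s -` {y} \<inter> space M) \<omega> *\<^sub>R y)" for \<omega>
    have fin: "finite (s ` space M)" and sets: "\<And>y. s -` {y} \<inter> space M \<in> sets M"
      using simple_functionD[OF s(1)] by auto
    have r: "r \<in> poly_closure p" unfolding r_def[abs_def] by (intro poly_closure_sum vec sets p)
    have rs: "r \<omega> = s \<omega>" if "\<omega> \<in> space M" for \<omega>
    proof -
      have "r \<omega> = (\<Sum>y\<in>s ` space M. if y = s \<omega> then s \<omega> else 0)"
        unfolding r_def by (rule sum.cong) (use that in \<open>auto simp: indicator_def\<close>)
      then show ?thesis using that fin by simp
    qed
    have rL: "r \<in> Lp M p" using r by (simp add: poly_closure_def)
    have "Lp_norm M p (\<lambda>\<omega>. f \<omega> - r \<omega>) = Lp_norm M p (\<lambda>\<omega>. f \<omega> - s \<omega>)"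
      by (rule Lp_norm_cong_AE[OF LpD(1)[OF Lp_diff[OF f rL p]] LpD(1)[OF Lp_diff[OF f s(2) p]]])
         (use rs in \<open>auto intro!: AE_I2\<close>)
    then show "\<exists>g\<in>poly_closure p. Lp_norm M p (\<lambda>\<omega>. f \<omega> - g \<omega>) < d" using r s(3) by (intro bexI[of _ r]) auto
  qed
  then show ?thesis using e by (auto simp: poly_closure_def)
qed

end

section \<open>Elementary symmetric polynomials of signs\<close>

definition esp :: "nat set \<Rightarrow> (nat \<Rightarrow> real) \<Rightarrow> nat \<Rightarrow> real" where
  "esp S y m = (\<Sum>B\<in>Pow S. if card B = m then \<Prod>b\<in>B. y b else 0)"

text \<open>These mixed sums interpolate between the power sums, at \<open>m = 0\<close>, and the
  elementary symmetric polynomials, at \<open>i = 1\<close>. They turn Newton's identities into a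
  recursion that exchanges an order \<open>m\<close> for a power \<open>i\<close>.\<close>

definition esp_power :: "nat set \<Rightarrow> (nat \<Rightarrow> real) \<Rightarrow> nat \<Rightarrow> nat \<Rightarrow> real" where
  "esp_power S y m i = (\<Sum>b\<in>S. y b ^ i * esp (S - {b}) y m)"

section \<open>Newton's identities and the Hermite recurrence\<close>

lemma esp_insert:
  assumes "finite S" "a \<notin> S"
  shows "esp (insert a S) y (Suc m) = esp S y (Suc m) + y a * esp S y m"
proof -
  have "(if card (insert a B) = Suc m then \<Prod>b\<in>insert a B. y b else 0)
      = y a * (if card B = m then \<Prod>b\<in>B. y b else 0)" if "B \<in> Pow S" for B
  proof -
    have "finite B" "a \<notin> B" using that assms finite_subset by auto
    then show ?thesis by simp
  qed
  then show ?thesis unfolding esp_def sum_Pow_insert[OF assms]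
    by (simp add: sum.distrib sum_distrib_left)
qed

lemma esp_0: "finite S \<Longrightarrow> esp S y 0 = 1"
proof -
  assume S: "finite S"
  have "esp S y 0 = (\<Sum>B\<in>Pow S. if B = {} then 1 else 0)"
    unfolding esp_def
  proof (rule sum.cong[OF refl])
    fix B assume "B \<in> Pow S"
    then have "finite B" using S finite_subset by auto
    then show "(if card B = 0 then \<Prod>b\<in>B. y b else 0) = (if B = {} then 1 else 0)" by simp
  qed
  then show ?thesis using S by simp
qed

lemma esp_remove:
  assumes "finite S" "b \<in> S"
  shows "esp S y (Suc m) = esp (S - {b}) y (Suc m) + y b * esp (S - {b}) y m"
  using esp_insert[of "S - {b}" b y m] assms by (simp add: insert_absorb)

lemma esp_power_0: "finite S \<Longrightarrow> esp_power S y 0 i = (\<Sum>b\<in>S. y b ^ i)"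
  by (simp add: esp_power_def esp_0)

text \<open>Newton's identities, without alternating sums.\<close>

lemma esp_power_Suc:
  assumes "finite S"
  shows "esp_power S y (Suc m) i = (\<Sum>b\<in>S. y b ^ i) * esp S y (Suc m) - esp_power S y m (Suc i)"
proof -
  have "esp_power S y (Suc m) i = (\<Sum>b\<in>S. y b ^ i * (esp S y (Suc m) - y b * esp (S - {b}) y m))"
    unfolding esp_power_def by (rule sum.cong) (use assms in \<open>auto simp: esp_remove\<close>)
  then show ?thesis by (simp add: esp_power_def sum_subtractf sum_distrib_left right_diff_distrib mult_ac)
qed

text \<open>A set of \<open>m + 1\<close> indices is obtained once for each choice of its
  distinguished element \<open>b\<close>.\<close>

lemma esp_power_1:
  assumes "finite S"
  shows "esp_power S y m 1 = real (Suc m) * esp S y (Suc m)"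
  using assms
proof (induction S arbitrary: m rule: finite_induct)
  case empty
  then show ?case by (simp add: esp_power_def esp_def)
next
  case (insert a S)
  have rem: "insert a S - {b} = insert a (S - {b})" if "b \<in> S" for b using that insert by auto
  have a: "insert a S - {a} = S" using insert by auto
  show ?case
  proof (cases m)
    case 0
    have "esp S y (Suc 0) = (\<Sum>b\<in>S. y b)"
      using insert.IH[of 0] esp_power_0[OF insert(1), of y 1] by simp
    then show ?thesis using 0 insert(1,2) esp_insert[OF insert(1,2), of y 0]
      by (simp add: esp_power_0 esp_0)
  next
    case (Suc m')
    have "esp_power (insert a S) y m 1 = y a * esp S y m + (\<Sum>b\<in>S. y b * esp (insert a (S - {b})) y m)"
      unfolding esp_power_def using insert by (simp add: a rem)
    also have "(\<Sum>b\<in>S. y b * esp (insert a (S - {b})) y m) = (\<Sum>b\<in>S. y b * (esp (S - {b}) y m + y a * esp (S - {b}) y m'))"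
      unfolding Suc by (rule sum.cong[OF refl], subst esp_insert) (use insert in auto)
    also have "\<dots> = esp_power S y m 1 + y a * esp_power S y m' 1"
      unfolding esp_power_def by (simp add: distrib_left sum.distrib sum_distrib_left mult_ac)
    also have "\<dots> = real (Suc m) * esp S y (Suc m) + y a * (real m * esp S y m)"
      unfolding insert.IH Suc by simp
    finally show ?thesis using esp_insert[of S a y m] insert by (simp add: algebra_simps)
  qed
qed

text \<open>If the second power sum is \<open>1\<close> and the higher ones are small, the elementary symmetric
  polynomials satisfy the Hermite recursion up to a small error.\<close>

lemma esp_hermite_bound:
  "\<exists>C\<ge>0. \<forall>S y \<delta>. finite S \<and> 0 \<le> \<delta> \<and> \<delta> \<le> 1 \<and> (\<Sum>b\<in>S. (y b)\<^sup>2) = 1 \<and> (\<forall>i\<ge>3. \<bar>\<Sum>b\<in>S. y b ^ i\<bar> \<le> \<delta>) \<longrightarrow>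
     \<bar>esp S y m\<bar> \<le> C * (1 + \<bar>\<Sum>b\<in>S. y b\<bar>) ^ m \<and>
     \<bar>esp S y m - hermite m (\<Sum>b\<in>S. y b)\<bar> \<le> \<delta> * C * (1 + \<bar>\<Sum>b\<in>S. y b\<bar>) ^ m \<and>
     (\<forall>i\<ge>3. \<bar>esp_power S y m i\<bar> \<le> \<delta> * C * (1 + \<bar>\<Sum>b\<in>S. y b\<bar>) ^ m) \<and>
     \<bar>esp S y m - esp_power S y m 2\<bar> \<le> \<delta> * C * (1 + \<bar>\<Sum>b\<in>S. y b\<bar>) ^ m"
proof -
  define ok where "ok S y \<delta> \<longleftrightarrow> finite S \<and> 0 \<le> \<delta> \<and> \<delta> \<le> 1 \<and> (\<Sum>b\<in>S. (y b)\<^sup>2) = 1 \<and> (\<forall>i\<ge>3. \<bar>\<Sum>b\<in>S. y b ^ i\<bar> \<le> \<delta>)"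
    for S and y :: "nat \<Rightarrow> real" and \<delta> :: real
  define s where "s S y = (\<Sum>b\<in>S. y b)" for S and y :: "nat \<Rightarrow> real"
  define w where "w S y = 1 + \<bar>s S y\<bar>" for S y
  define P1 where "P1 m C \<longleftrightarrow> (\<forall>S y \<delta>. ok S y \<delta> \<longrightarrow> \<bar>esp S y m\<bar> \<le> C * w S y ^ m)" for m C
  define P2 where "P2 m C \<longleftrightarrow> (\<forall>S y \<delta>. ok S y \<delta> \<longrightarrow> \<bar>esp S y m - hermite m (s S y)\<bar> \<le> \<delta> * C * w S y ^ m)" for m C
  define P3 where "P3 m C \<longleftrightarrow> (\<forall>S y \<delta>. ok S y \<delta> \<longrightarrow> (\<forall>i\<ge>3. \<bar>esp_power S y m i\<bar> \<le> \<delta> * C * w S y ^ m))" for m C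
  define P4 where "P4 m C \<longleftrightarrow> (\<forall>S y \<delta>. ok S y \<delta> \<longrightarrow> \<bar>esp S y m - esp_power S y m 2\<bar> \<le> \<delta> * C * w S y ^ m)" for m C
  define good where "good m \<longleftrightarrow> (\<exists>C\<ge>0. P1 m C \<and> P2 m C \<and> P3 m C \<and> P4 m C)" for m
  have w1: "1 \<le> w S y" for S y by (simp add: w_def)
  have wp: "w S y ^ a \<le> w S y ^ b" if "a \<le> b" for S y a b using that w1 by (intro power_increasing)
  have wpp: "0 \<le> w S y ^ a" for S y a using w1[of S y] by simp
  have g0: "good 0"
    unfolding good_def P1_def P2_def P3_def P4_def ok_def
  proof (intro exI[of _ 1] conjI allI impI, goal_cases)
    case (4 S y \<delta> i) then show ?case by (simp add: esp_power_0)
  next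
    case (5 S y \<delta>) then show ?case by (simp add: esp_power_0 esp_0)
  qed (auto simp: esp_0)
  have mono: "d * C * w S y ^ a \<le> d * D * w S y ^ b" if "0 \<le> d" "0 \<le> C" "C \<le> D" "a \<le> b" for d C D S y a b
    using that wpp[of S y a] by (intro mult_mono wp mult_left_mono mult_nonneg_nonneg) auto
  \<comment> \<open>In Newton's identity for order \<open>m + 1\<close> a power sum of index at
    least 3 contributes \<open>\<delta>\<close> times the bound \<open>P1\<close>. For index 2 the
    power sum is exactly 1, which leaves \<open>esp_power S y m 3\<close> as the whole error of
    \<open>P4\<close>.\<close>
  have step34: "\<exists>D\<ge>0. P3 (Suc m) D \<and> P4 (Suc m) D" if C: "0 \<le> C" "P3 m C" and E: "0 \<le> E" "P1 (Suc m) E" for m C E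
  proof (intro exI[of _ "C + E"] conjI)
    show "0 \<le> C + E" using C E by simp
    show "P3 (Suc m) (C + E)" unfolding P3_def
    proof (intro allI impI)
      fix S y \<delta> and i :: nat assume ok: "ok S y \<delta>" and i: "3 \<le> i"
      have fin: "finite S" and d: "0 \<le> \<delta>" and pi: "\<bar>\<Sum>b\<in>S. y b ^ i\<bar> \<le> \<delta>" using ok i by (auto simp: ok_def)
      have "\<bar>esp_power S y (Suc m) i\<bar> \<le> \<bar>\<Sum>b\<in>S. y b ^ i\<bar> * \<bar>esp S y (Suc m)\<bar> + \<bar>esp_power S y m (Suc i)\<bar>"
        unfolding esp_power_Suc[OF fin] by (metis abs_mult abs_triangle_ineq4)
      also have "\<dots> \<le> \<delta> * (E * w S y ^ Suc m) + \<delta> * C * w S y ^ m"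
        using E(2) C(2) ok i pi d unfolding P1_def P3_def by (intro add_mono mult_mono) auto
      also have "\<dots> \<le> \<delta> * (E * w S y ^ Suc m) + \<delta> * C * w S y ^ Suc m"
        by (intro add_left_mono mono) (use d C in auto)
      also have "\<dots> = \<delta> * (C + E) * w S y ^ Suc m" by (simp add: algebra_simps)
      finally show "\<bar>esp_power S y (Suc m) i\<bar> \<le> \<delta> * (C + E) * w S y ^ Suc m" .
    qed
    show "P4 (Suc m) (C + E)" unfolding P4_def
    proof (intro allI impI)
      fix S y \<delta> assume ok: "ok S y \<delta>"
      have fin: "finite S" and d: "0 \<le> \<delta>" and p2: "(\<Sum>b\<in>S. y b ^ 2) = 1" using ok by (auto simp: ok_def)
      have "esp S y (Suc m) - esp_power S y (Suc m) 2 = esp_power S y m 3"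
        unfolding esp_power_Suc[OF fin] p2 by (simp add: numeral_3_eq_3 numeral_2_eq_2)
      moreover have "\<bar>esp_power S y m 3\<bar> \<le> \<delta> * C * w S y ^ m" using C(2) ok unfolding P3_def by blast
      moreover have "\<delta> * C * w S y ^ m \<le> \<delta> * (C + E) * w S y ^ Suc m" by (rule mono) (use d C E in auto)
      ultimately show "\<bar>esp S y (Suc m) - esp_power S y (Suc m) 2\<bar> \<le> \<delta> * (C + E) * w S y ^ Suc m" by linarith
    qed
  qed
  have up: "P1 m C \<Longrightarrow> P1 m D" "P2 m C \<Longrightarrow> P2 m D" "P3 m C \<Longrightarrow> P3 m D" "P4 m C \<Longrightarrow> P4 m D"
    if CD: "0 \<le> C" "C \<le> D" for m C D
  proof -
    show "P1 m C \<Longrightarrow> P1 m D" unfolding P1_def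
      using mult_right_mono[OF CD(2) wpp] order_trans by blast
    have m': "\<delta> * C * w S y ^ m \<le> \<delta> * D * w S y ^ m" if "ok S y \<delta>" for S y \<delta>
      by (rule mono) (use that CD in \<open>auto simp: ok_def\<close>)
    show "P2 m C \<Longrightarrow> P2 m D" unfolding P2_def using m' order_trans by blast
    show "P3 m C \<Longrightarrow> P3 m D" unfolding P3_def using m' order_trans by blast
    show "P4 m C \<Longrightarrow> P4 m D" unfolding P4_def using m' order_trans by blast
  qed
  have pack: "good m" if "0 \<le> C" "P1 m C" "P2 m C" "0 \<le> D" "P3 m D" "P4 m D" for m C D
    unfolding good_def using that up[of C "C + D"] up[of D "C + D"] by (intro exI[of _ "C + D"]) auto
  have e1: "esp S y (Suc 0) = s S y" if "finite S" for S y
    using esp_power_1[OF that, of y 0] esp_power_0[OF that, of y 1] by (simp add: s_def)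
  have g1: "good (Suc 0)"
  proof -
    obtain C where C: "0 \<le> C" "P3 0 C" using g0 unfolding good_def by blast
    have P1: "P1 (Suc 0) 1" unfolding P1_def ok_def using e1 by (auto simp: w_def)
    have P2: "P2 (Suc 0) 1" unfolding P2_def ok_def using e1 by (auto simp: w_def)
    obtain D where "0 \<le> D" "P3 (Suc 0) D" "P4 (Suc 0) D" using step34[OF C _ P1] by auto
    then show ?thesis using pack[OF _ P1 P2] by auto
  qed
  have g2: "good (Suc (Suc m))" if gm: "good m" "good (Suc m)" for m
  proof -
    obtain C where C: "0 \<le> C" "P1 m C" "P2 m C" "P4 m C" using gm(1) unfolding good_def by blast
    obtain D where D: "0 \<le> D" "P1 (Suc m) D" "P2 (Suc m) D" "P3 (Suc m) D" using gm(2) unfolding good_def by blast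
    define E where "E = D + C + C"
    have E: "0 \<le> E" using C D by (simp add: E_def)
    \<comment> \<open>Newton's identity at power 1 has the shape of the Hermite recurrence, with
      \<open>esp_power S y m 2\<close> in the place of the polynomial of order \<open>m\<close>. The
      bound \<open>P4\<close> measures the difference.\<close>
    have rec: "real (Suc (Suc m)) * esp S y (Suc (Suc m)) = s S y * esp S y (Suc m) - esp_power S y m 2" if "finite S" for S y
      using esp_power_1[OF that, of y "Suc m"] esp_power_Suc[OF that, of y m 1] by (simp add: s_def numeral_2_eq_2)
    have div: "\<bar>x\<bar> \<le> z" if "\<bar>real (Suc (Suc m)) * x\<bar> \<le> z" for x z :: real
    proof -
      have "1 * \<bar>x\<bar> \<le> real (Suc (Suc m)) * \<bar>x\<bar>" by (intro mult_right_mono) auto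
      then show ?thesis using that by (simp add: abs_mult)
    qed
    have sw: "\<bar>s S y\<bar> \<le> w S y" for S y by (simp add: w_def)
    have P1: "P1 (Suc (Suc m)) E" unfolding P1_def
    proof (intro allI impI, rule div)
      fix S y \<delta> assume ok: "ok S y \<delta>"
      have fin: "finite S" and d: "0 \<le> \<delta>" "\<delta> \<le> 1" using ok by (auto simp: ok_def)
      have b: "\<bar>esp S y (Suc m)\<bar> \<le> D * w S y ^ Suc m" "\<bar>esp S y m\<bar> \<le> C * w S y ^ m"
        "\<bar>esp S y m - esp_power S y m 2\<bar> \<le> \<delta> * C * w S y ^ m"
        using D(2) C(2,4) ok unfolding P1_def P4_def by blast+
      have "\<delta> * C * w S y ^ m \<le> 1 * C * w S y ^ m" using d C wpp by (intro mult_right_mono) auto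
      then have q: "\<bar>esp_power S y m 2\<bar> \<le> C * w S y ^ m + C * w S y ^ m" using b by linarith
      have "\<bar>s S y\<bar> * \<bar>esp S y (Suc m)\<bar> \<le> w S y * (D * w S y ^ Suc m)"
        using sw b(1) w1[of S y] by (intro mult_mono) auto
      then have "\<bar>s S y * esp S y (Suc m)\<bar> \<le> D * w S y ^ Suc (Suc m)" by (simp add: abs_mult mult_ac)
      moreover have "C * w S y ^ m \<le> C * w S y ^ Suc (Suc m)" by (intro mult_left_mono wp C) auto
      ultimately show "\<bar>real (Suc (Suc m)) * esp S y (Suc (Suc m))\<bar> \<le> E * w S y ^ Suc (Suc m)"
        unfolding rec[OF fin] E_def distrib_right using q by linarith
    qed
    have P2: "P2 (Suc (Suc m)) E" unfolding P2_def
    proof (intro allI impI, rule div)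
      fix S y \<delta> assume ok: "ok S y \<delta>"
      have fin: "finite S" and d: "0 \<le> \<delta>" "\<delta> \<le> 1" using ok by (auto simp: ok_def)
      have b: "\<bar>esp S y (Suc m) - hermite (Suc m) (s S y)\<bar> \<le> \<delta> * D * w S y ^ Suc m"
        "\<bar>esp S y m - hermite m (s S y)\<bar> \<le> \<delta> * C * w S y ^ m"
        "\<bar>esp S y m - esp_power S y m 2\<bar> \<le> \<delta> * C * w S y ^ m"
        using D(3) C(3,4) ok unfolding P2_def P4_def by blast+
      have "real (Suc (Suc m)) * (esp S y (Suc (Suc m)) - hermite (Suc (Suc m)) (s S y))
         = (s S y * esp S y (Suc m) - esp_power S y m 2) - (s S y * hermite (Suc m) (s S y) - hermite m (s S y))"
        unfolding right_diff_distrib rec[OF fin] by simp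
      also have "\<dots> = s S y * (esp S y (Suc m) - hermite (Suc m) (s S y)) - (esp S y m - hermite m (s S y)) + (esp S y m - esp_power S y m 2)"
        by (simp add: algebra_simps)
      finally have eq: "real (Suc (Suc m)) * (esp S y (Suc (Suc m)) - hermite (Suc (Suc m)) (s S y)) = \<dots>" .
      have "\<bar>s S y\<bar> * \<bar>esp S y (Suc m) - hermite (Suc m) (s S y)\<bar> \<le> w S y * (\<delta> * D * w S y ^ Suc m)"
        using sw b(1) w1[of S y] by (intro mult_mono) auto
      then have "\<bar>s S y * (esp S y (Suc m) - hermite (Suc m) (s S y))\<bar> \<le> \<delta> * D * w S y ^ Suc (Suc m)"
        by (simp add: abs_mult mult_ac)
      moreover have "\<delta> * C * w S y ^ m \<le> \<delta> * C * w S y ^ Suc (Suc m)" by (rule mono) (use d C in auto)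
      ultimately show "\<bar>real (Suc (Suc m)) * (esp S y (Suc (Suc m)) - hermite (Suc (Suc m)) (s S y))\<bar> \<le> \<delta> * E * w S y ^ Suc (Suc m)"
        unfolding eq E_def distrib_right distrib_left using b by linarith
    qed
    obtain G where "0 \<le> G" "P3 (Suc (Suc m)) G" "P4 (Suc (Suc m)) G" using step34[OF D(1,4) E P1] by auto
    then show ?thesis using pack[OF E P1 P2] by auto
  qed
  have "good m \<and> good (Suc m)"
    by (induction m) (use g0 g1 g2 in auto)
  then obtain C where C: "0 \<le> C" "P1 m C" "P2 m C" "P3 m C" "P4 m C" unfolding good_def by blast
  show ?thesis
  proof (rule exI[of _ C], intro conjI[OF C(1)] allI impI)
    fix S :: "nat set" and y :: "nat \<Rightarrow> real" and \<delta> :: real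
    assume "finite S \<and> 0 \<le> \<delta> \<and> \<delta> \<le> 1 \<and> (\<Sum>b\<in>S. (y b)\<^sup>2) = 1 \<and> (\<forall>i\<ge>3. \<bar>\<Sum>b\<in>S. y b ^ i\<bar> \<le> \<delta>)"
    then have ok: "ok S y \<delta>" unfolding ok_def .
    show "\<bar>esp S y m\<bar> \<le> C * (1 + \<bar>\<Sum>b\<in>S. y b\<bar>) ^ m \<and>
     \<bar>esp S y m - hermite m (\<Sum>b\<in>S. y b)\<bar> \<le> \<delta> * C * (1 + \<bar>\<Sum>b\<in>S. y b\<bar>) ^ m \<and>
     (\<forall>i\<ge>3. \<bar>esp_power S y m i\<bar> \<le> \<delta> * C * (1 + \<bar>\<Sum>b\<in>S. y b\<bar>) ^ m) \<and>
     \<bar>esp S y m - esp_power S y m 2\<bar> \<le> \<delta> * C * (1 + \<bar>\<Sum>b\<in>S. y b\<bar>) ^ m"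
      using C(2)[unfolded P1_def, rule_format, OF ok] C(3)[unfolded P2_def, rule_format, OF ok]
        C(4)[unfolded P3_def, rule_format, OF ok] C(5)[unfolded P4_def, rule_format, OF ok]
      unfolding w_def s_def by (intro conjI allI impI)
  qed
qed

text \<open>A symmetric polynomial of order \<open>m\<close> in weighted signs lies exactly in the
  chaos of order \<open>m\<close> of the cube, so multipliers act on it by a scalar. A Hermite
  polynomial of the sign sum would meet several chaoses.\<close>

lemma esp_eq_wsum:
  assumes "finite S"
  shows "esp S (\<lambda>b. c b * rsign A b) m *\<^sub>R v = wsum S (\<lambda>B. (if card B = m then \<Prod>b\<in>B. c b else 0) *\<^sub>R v) A"
  unfolding esp_def wsum_def scaleR_sum_left
  by (rule sum.cong[OF refl]) (simp add: prod.distrib walsh_def mult.commute)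

section \<open>Moments and characteristic functions of sums of signs\<close>

lemma sum_signs_square:
  assumes "finite S"
  shows "(\<Sum>A\<in>Pow S. (\<Sum>b\<in>S. c b * rsign A b)\<^sup>2) = 2 ^ card S * (\<Sum>b\<in>S. (c b)\<^sup>2)"
  using assms
proof (induction S rule: finite_induct)
  case (insert a S)
  have e: "(\<Sum>b\<in>insert a S. c b * rsign A b)\<^sup>2 + (\<Sum>b\<in>insert a S. c b * rsign (insert a A) b)\<^sup>2
      = 2 * (c a)\<^sup>2 + 2 * (\<Sum>b\<in>S. c b * rsign A b)\<^sup>2" if "A \<in> Pow S" for A
  proof -
    have "rsign A a = 1" "rsign (insert a A) a = -1" using that insert by (auto simp: rsign_def)
    moreover have "(\<Sum>b\<in>S. c b * rsign (insert a A) b) = (\<Sum>b\<in>S. c b * rsign A b)"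
      by (rule sum.cong) (use insert in \<open>auto simp: rsign_def\<close>)
    ultimately show ?thesis using insert by (simp add: power2_eq_square algebra_simps)
  qed
  have "(\<Sum>A\<in>Pow (insert a S). (\<Sum>b\<in>insert a S. c b * rsign A b)\<^sup>2) = (\<Sum>A\<in>Pow S. 2 * (c a)\<^sup>2 + 2 * (\<Sum>b\<in>S. c b * rsign A b)\<^sup>2)"
    unfolding sum_Pow_insert[OF insert(1,2)] by (rule sum.cong[OF refl e])
  also have "\<dots> = 2 ^ card (insert a S) * (\<Sum>b\<in>insert a S. (c b)\<^sup>2)"
    using insert by (simp add: sum.distrib sum_distrib_left[symmetric] card_Pow algebra_simps)
  finally show ?case .
qed (simp add: rsign_def)

text \<open>On the first chaos the noise operator is multiplication by \<open>\<sigma>\<close>, so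
  hypercontractivity from exponent 2 to exponent \<open>r\<close> gives the constant
  \<open>1 / \<sigma>\<close>.\<close>

lemma khintchine:
  assumes "0 < r"
  shows "\<exists>B\<ge>0. \<forall>S c. finite S \<and> (\<Sum>b\<in>S. (c b)\<^sup>2) = 1 \<longrightarrow>
     Lp_norm (cube S) r (\<lambda>A. \<Sum>b\<in>S. c b * rsign A b) \<le> B"
proof -
  obtain \<sigma> where \<sigma>: "0 < \<sigma>" and H: "\<And>S (x :: nat set \<Rightarrow> real). finite S \<Longrightarrow>
     Lp_norm (cube S) r (wsum S (\<lambda>B. \<sigma> ^ card B *\<^sub>R x B)) \<le> Lp_norm (cube S) 2 (wsum S x)"
    using hypercontractivity[where 'b=real, of 2 r] assms by auto
  have "Lp_norm (cube S) r (\<lambda>A. \<Sum>b\<in>S. c b * rsign A b) \<le> 1 / \<sigma>"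
    if S: "finite S" and c: "(\<Sum>b\<in>S. (c b)\<^sup>2) = 1" for S c
  proof -
    have p1: "(\<Sum>b\<in>S. c b * rsign A b) = esp S (\<lambda>b. c b * rsign A b) 1" for A
      using esp_power_1[OF S, of "\<lambda>b. c b * rsign A b" 0] esp_power_0[OF S, of "\<lambda>b. c b * rsign A b" 1] by simp
    define x where "x B = (if card B = 1 then \<Prod>b\<in>B. c b else 0)" for B
    have w: "wsum S x = (\<lambda>A. \<Sum>b\<in>S. c b * rsign A b)"
      using esp_eq_wsum[OF S, of c _ 1 "1::real"] by (auto simp: p1 x_def[abs_def] fun_eq_iff)
    have sw: "wsum S (\<lambda>B. \<sigma> ^ card B *\<^sub>R x B) = (\<lambda>A. \<sigma> *\<^sub>R wsum S x A)"
      unfolding wsum_scaleR[symmetric] by (rule ext, rule wsum_cong) (simp add: x_def)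
    have "Lp_norm (cube S) r (wsum S (\<lambda>B. \<sigma> ^ card B *\<^sub>R x B)) = \<sigma> * Lp_norm (cube S) r (wsum S x)"
      unfolding sw using assms \<sigma> Lp_norm_scaleR[of r "cube S" \<sigma> "wsum S x"] by simp
    moreover have "Lp_norm (cube S) 2 (wsum S x) = 1"
    proof -
      have "Lp_norm (cube S) 2 (wsum S x) powr 2 = 1"
        using sum_signs_square[OF S, of c] c by (subst Lp_norm_cube_powr[OF S]) (auto simp: w)
      then show ?thesis using Lp_norm_nonneg[of "cube S" 2 "wsum S x"] by (simp add: power2_eq_1_iff)
    qed
    ultimately show ?thesis using H[OF S, of x] \<sigma> unfolding w by (simp add: field_simps)
  qed
  then show ?thesis using \<sigma> by (intro exI[of _ "1 / \<sigma>"]) auto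
qed

text \<open>The two signs of one coordinate combine by
  \<open>cos (z + v) + cos (z - v) = 2 cos v cos z\<close>. The phase keeps the induction within
  cosines and makes this a real form of the characteristic function.\<close>

lemma mean_cos_signs:
  assumes "finite S"
  shows "(\<Sum>A\<in>Pow S. cos ((\<Sum>b\<in>S. v b * rsign A b) + \<theta>)) / 2 ^ card S = cos \<theta> * (\<Prod>b\<in>S. cos (v b))"
  using assms
proof (induction S arbitrary: \<theta> rule: finite_induct)
  case (insert a S)
  have e: "cos ((\<Sum>b\<in>insert a S. v b * rsign A b) + \<theta>) + cos ((\<Sum>b\<in>insert a S. v b * rsign (insert a A) b) + \<theta>)
      = 2 * cos (v a) * cos ((\<Sum>b\<in>S. v b * rsign A b) + \<theta>)" if "A \<in> Pow S" for A
  proof -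
    define z where "z = (\<Sum>b\<in>S. v b * rsign A b) + \<theta>"
    have "rsign A a = 1" "rsign (insert a A) a = -1" using that insert by (auto simp: rsign_def)
    moreover have "(\<Sum>b\<in>S. v b * rsign (insert a A) b) = (\<Sum>b\<in>S. v b * rsign A b)"
      by (rule sum.cong) (use insert in \<open>auto simp: rsign_def\<close>)
    ultimately have "(\<Sum>b\<in>insert a S. v b * rsign A b) + \<theta> = v a + z" "(\<Sum>b\<in>insert a S. v b * rsign (insert a A) b) + \<theta> = z - v a"
      using insert by (simp_all add: z_def)
    then show ?thesis by (simp add: cos_add cos_diff z_def[symmetric])
  qed
  have "(\<Sum>A\<in>Pow (insert a S). cos ((\<Sum>b\<in>insert a S. v b * rsign A b) + \<theta>))
     = (\<Sum>A\<in>Pow S. 2 * cos (v a) * cos ((\<Sum>b\<in>S. v b * rsign A b) + \<theta>))"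
    unfolding sum_Pow_insert[OF insert(1,2)] by (rule sum.cong[OF refl e])
  then show ?case using insert.IH[of \<theta>] insert(1,2) by (simp add: sum_distrib_left[symmetric] field_simps)
qed simp

section \<open>Central limit transfer from the cube to Gaussian variables\<close>

lemma sinc_mult: "x * sinc (r * x) = (if r = 0 then x else sin (r * x) / r)" for x r :: real
  by auto

text \<open>The rows \<open>t i\<close> are coordinates of the unit vectors \<open>h i\<close> in
  some orthonormal system. Only the Gram matrix is recorded, as it determines the joint law of the
  \<open>W (h i)\<close>.\<close>

locale gaussian_vector = isonormal M W for M :: "'w measure"
    and W :: "'h::{real_inner, banach, second_countable_topology} \<Rightarrow> 'w \<Rightarrow> real" +
  fixes k n :: nat and h :: "nat \<Rightarrow> 'h" and t :: "nat \<Rightarrow> nat \<Rightarrow> real"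
  assumes gram: "\<And>i l. i < k \<Longrightarrow> l < k \<Longrightarrow> inner (h i) (h l) = (\<Sum>j<n. t i j * t l j)"
    and unit: "\<And>i. i < k \<Longrightarrow> norm (h i) = 1"
begin

text \<open>Vectors of length \<open>k\<close> are encoded as sequences that vanish from index
  \<open>k\<close> on, which is the meaning of \<open>supported\<close>. The sequence type brings
  the product topology with it.\<close>

definition X :: "'w \<Rightarrow> nat \<Rightarrow> real" where
  "X w i = (if i < k then W (h i) w else 0)"

text \<open>The signs are grouped into \<open>n\<close> blocks of length \<open>K\<close>; the normalized block sums play the role
  of an orthonormal system, in which \<open>h i\<close> has the coordinates \<open>t i\<close>.\<close>

definition coef :: "nat \<Rightarrow> nat \<Rightarrow> nat \<Rightarrow> real" where
  "coef K i b = t i (b div K) / sqrt K"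

definition cubeK :: "nat \<Rightarrow> nat set" where
  "cubeK K = {..<n * K}"

definition Y :: "nat \<Rightarrow> nat set \<Rightarrow> nat \<Rightarrow> real" where
  "Y K A i = (if i < k then \<Sum>b\<in>cubeK K. coef K i b * rsign A b else 0)"

definition cmean :: "nat \<Rightarrow> ((nat \<Rightarrow> real) \<Rightarrow> real) \<Rightarrow> real" where
  "cmean K \<Phi> = (\<Sum>A\<in>Pow (cubeK K). \<Phi> (Y K A)) / 2 ^ card (cubeK K)"

definition weight :: "(nat \<Rightarrow> real) \<Rightarrow> real" where
  "weight x = 1 + (\<Sum>i<k. \<bar>x i\<bar>)"

definition supported :: "(nat \<Rightarrow> real) \<Rightarrow> bool" where
  "supported x \<longleftrightarrow> (\<forall>i\<ge>k. x i = 0)"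

text \<open>Convergence of expectations along growing blocks; \<open>Suc K\<close> keeps the block
  length in the normalization positive.\<close>

definition conv :: "((nat \<Rightarrow> real) \<Rightarrow> real) \<Rightarrow> bool" where
  "conv \<Phi> \<longleftrightarrow> integrable M (\<lambda>w. \<Phi> (X w)) \<and> (\<lambda>K. cmean (Suc K) \<Phi>) \<longlonglongrightarrow> (\<integral>w. \<Phi> (X w) \<partial>M)"

lemma finite_cubeK [simp]: "finite (cubeK K)"
  by (simp add: cubeK_def)

lemma supported_XY: "supported (X w)" "supported (Y K A)"
  by (simp_all add: supported_def X_def Y_def)

lemma weight_ge_1: "1 \<le> weight x"
  by (simp add: weight_def sum_nonneg)

lemma sum_blocks:
  assumes "0 < K"
  shows "(\<Sum>b\<in>cubeK K. f (b div K)) = real K * (\<Sum>j<n. f j :: real)"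
proof -
  have "(\<Sum>b\<in>cubeK K. f (b div K)) = (\<Sum>j<n. \<Sum>b\<in>{j * K..<j * K + K}. f (b div K))"
    unfolding cubeK_def by (rule sum.nat_group[symmetric])
  also have "\<dots> = (\<Sum>j<n. \<Sum>b\<in>{j * K..<j * K + K}. f j)"
  proof (intro sum.cong refl)
    fix j b assume "b \<in> {j * K..<j * K + K}"
    then have "b div K = j" using assms by (intro div_nat_eqI) (auto simp: mult.commute)
    then show "f (b div K) = f j" by simp
  qed
  also have "\<dots> = real K * (\<Sum>j<n. f j)" by (simp add: sum_distrib_left)
  finally show ?thesis .
qed

lemma prod_blocks:
  assumes "0 < K"
  shows "(\<Prod>b\<in>cubeK K. f (b div K)) = (\<Prod>j<n. f j ^ K :: real)"
proof -
  have "(\<Prod>b\<in>cubeK K. f (b div K)) = (\<Prod>j<n. \<Prod>b\<in>{j * K..<j * K + K}. f (b div K))"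
    unfolding cubeK_def by (rule prod.nat_group[symmetric])
  also have "\<dots> = (\<Prod>j<n. \<Prod>b\<in>{j * K..<j * K + K}. f j)"
  proof (intro prod.cong refl)
    fix j b assume "b \<in> {j * K..<j * K + K}"
    then have "b div K = j" using assms by (intro div_nat_eqI) (auto simp: mult.commute)
    then show "f (b div K) = f j" by simp
  qed
  also have "\<dots> = (\<Prod>j<n. f j ^ K)" by simp
  finally show ?thesis .
qed

lemma coef_square:
  assumes "0 < K" "i < k"
  shows "(\<Sum>b\<in>cubeK K. (coef K i b)\<^sup>2) = 1"
proof -
  have "(\<Sum>b\<in>cubeK K. (coef K i b)\<^sup>2) = (\<Sum>b\<in>cubeK K. (\<lambda>j. (t i j)\<^sup>2 / real K) (b div K))"
    by (simp add: coef_def power_divide)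
  also have "\<dots> = real K * (\<Sum>j<n. (t i j)\<^sup>2 / real K)" by (rule sum_blocks[OF assms(1)])
  also have "\<dots> = (\<Sum>j<n. t i j * t i j)" using assms by (simp add: sum_distrib_left power2_eq_square)
  also have "\<dots> = 1" using gram[OF assms(2,2)] unit[OF assms(2)] by (simp add: dot_square_norm)
  finally show ?thesis .
qed

lemma abs_coef_le:
  assumes "0 < K" "i < k" "b \<in> cubeK K"
  shows "\<bar>coef K i b\<bar> \<le> 1 / sqrt K"
proof -
  have "b div K < n" using assms by (auto simp: cubeK_def less_mult_imp_div_less)
  then have "(t i (b div K))\<^sup>2 \<le> (\<Sum>j<n. (t i j)\<^sup>2)" by (intro member_le_sum) auto
  also have "\<dots> = 1" using gram[OF assms(2,2)] unit[OF assms(2)] by (simp add: dot_square_norm power2_eq_square)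
  finally have "\<bar>t i (b div K)\<bar> \<le> 1" by (simp add: abs_square_le_1)
  then show ?thesis by (simp add: coef_def divide_right_mono)
qed

text \<open>One factor of the coefficient is at most \<open>1 / sqrt K\<close>, and two more are
  summed as squares to 1. This is the \<open>\<delta>\<close> with which the Hermite recurrence is
  perturbed.\<close>

lemma coef_power_sum:
  assumes K: "0 < K" and i: "i < k" and r: "3 \<le> r"
  shows "\<bar>\<Sum>b\<in>cubeK K. (coef K i b * rsign A b) ^ r\<bar> \<le> 1 / sqrt K"
proof -
  have rs: "\<bar>rsign A b\<bar> = 1" for b by (simp add: rsign_def)
  have sK: "1 / sqrt K \<le> 1" using K by simp
  have "\<bar>\<Sum>b\<in>cubeK K. (coef K i b * rsign A b) ^ r\<bar> \<le> (\<Sum>b\<in>cubeK K. \<bar>coef K i b\<bar> ^ r)"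
    by (rule order_trans[OF sum_abs]) (simp add: power_abs abs_mult rs)
  also have "\<dots> \<le> (\<Sum>b\<in>cubeK K. 1 / sqrt K * (coef K i b)\<^sup>2)"
  proof (rule sum_mono)
    fix b assume b: "b \<in> cubeK K"
    note c = abs_coef_le[OF K i b]
    have "\<bar>coef K i b\<bar> ^ r \<le> \<bar>coef K i b\<bar> ^ 3" using c sK r by (intro power_decreasing) auto
    also have "\<dots> = \<bar>coef K i b\<bar> * (coef K i b)\<^sup>2" by (simp add: power3_eq_cube power2_eq_square)
    also have "\<dots> \<le> 1 / sqrt K * (coef K i b)\<^sup>2" by (rule mult_right_mono[OF c]) simp
    finally show "\<bar>coef K i b\<bar> ^ r \<le> 1 / sqrt K * (coef K i b)\<^sup>2" .
  qed
  also have "\<dots> = 1 / sqrt K" using coef_square[OF K i] by (simp add: sum_divide_distrib[symmetric])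
  finally show ?thesis .
qed

lemma cmean_add: "cmean K (\<lambda>x. f x + g x) = cmean K f + cmean K g"
  by (simp add: cmean_def sum.distrib add_divide_distrib)

lemma cmean_scale: "cmean K (\<lambda>x. c * f x) = c * cmean K f"
  by (simp add: cmean_def sum_distrib_left)

lemma cmean_mono: "(\<And>x. supported x \<Longrightarrow> f x \<le> g x) \<Longrightarrow> cmean K f \<le> cmean K g"
  unfolding cmean_def by (intro divide_right_mono sum_mono) (auto simp: supported_XY)

lemma cmean_eq_Lp_norm:
  assumes "0 < r"
  shows "cmean K (\<lambda>x. norm (f x) powr r) = Lp_norm (cube (cubeK K)) r (\<lambda>A. f (Y K A)) powr r"
  using assms by (simp add: cmean_def Lp_norm_cube_powr)

lemma X_measurable [measurable]: "(\<lambda>w. X w i) \<in> borel_measurable M"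
  by (cases "i < k") (simp_all add: X_def)

lemma moments_weight: "moments (\<lambda>w. weight (X w))"
proof -
  have "moments (\<lambda>w. \<bar>X w i\<bar>)" if "i < k" for i
    using moments_mono[OF _ moments_W[of "h i"], of "\<lambda>w. \<bar>X w i\<bar>"] that by (simp add: X_def)
  then show ?thesis unfolding weight_def by (intro moments_add moments_const moments_sum) auto
qed

text \<open>Khintchine's inequality bounds every coordinate of \<open>Y\<close> independently of the
  block length, because its coefficients have square sum 1; Minkowski's inequality adds the
  coordinates.\<close>

lemma weight_bound: "\<exists>B\<ge>0. (\<integral>w. weight (X w) ^ r \<partial>M) \<le> B \<and> (\<forall>K>0. cmean K (\<lambda>x. weight x ^ r) \<le> B)"
proof -
  \<comment> \<open>The successor keeps the exponent at least 1 when \<open>r = 0\<close>; the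
    weight is at least 1, so a larger power only increases it.\<close>
  define q where "q = real (Suc r)"
  obtain C where C: "0 \<le> C" "\<And>S c. finite S \<Longrightarrow> (\<Sum>b\<in>S. (c b)\<^sup>2) = 1 \<Longrightarrow>
     Lp_norm (cube S) q (\<lambda>A. \<Sum>b\<in>S. c b * rsign A b) \<le> C"
    using khintchine[of q] by (auto simp: q_def)
  have c: "cmean K (\<lambda>x. weight x ^ r) \<le> (1 + real k * C) powr q" if K: "0 < K" for K
  proof -
    have q1: "1 \<le> q" by (simp add: q_def)
    let ?S = "cubeK K"
    have "Lp_norm (cube ?S) q (\<lambda>A. weight (Y K A)) \<le> Lp_norm (cube ?S) q (\<lambda>A. 1 :: real) + (\<Sum>i<k. Lp_norm (cube ?S) q (\<lambda>A. \<bar>Y K A i\<bar>))"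
      unfolding weight_def
      using Lp_norm_triangle[of "\<lambda>A. 1 :: real" "cube ?S" q "\<lambda>A. \<Sum>i<k. \<bar>Y K A i\<bar>"]
        Lp_norm_sum[of "{..<k}" "\<lambda>i A. \<bar>Y K A i\<bar>" "cube ?S" q] q1 by fastforce
    also have "Lp_norm (cube ?S) q (\<lambda>A. 1 :: real) = 1"
      by (simp add: cube_def Lp_norm_uniform_count_measure card_Pow)
    also have "(\<Sum>i<k. Lp_norm (cube ?S) q (\<lambda>A. \<bar>Y K A i\<bar>)) \<le> (\<Sum>i<k. C)"
    proof (rule sum_mono)
      fix i assume "i \<in> {..<k}"
      then have i: "i < k" by simp
      have "Lp_norm (cube ?S) q (\<lambda>A. \<bar>Y K A i\<bar>) = Lp_norm (cube ?S) q (\<lambda>A. \<Sum>b\<in>?S. coef K i b * rsign A b)"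
        using i by (simp add: Lp_norm_def Y_def)
      also have "\<dots> \<le> C" by (rule C(2)) (use coef_square[OF K i] in auto)
      finally show "Lp_norm (cube ?S) q (\<lambda>A. \<bar>Y K A i\<bar>) \<le> C" .
    qed
    finally have "Lp_norm (cube ?S) q (\<lambda>A. weight (Y K A)) \<le> 1 + real k * C" by simp
    then have "Lp_norm (cube ?S) q (\<lambda>A. weight (Y K A)) powr q \<le> (1 + real k * C) powr q"
      using q1 by (intro powr_mono2) auto
    then have "cmean K (\<lambda>x. norm (weight x) powr q) \<le> (1 + real k * C) powr q"
      using cmean_eq_Lp_norm[of q K weight] q1 by simp
    moreover have "cmean K (\<lambda>x. weight x ^ r) \<le> cmean K (\<lambda>x. norm (weight x) powr q)"
    proof (rule cmean_mono)
      fix x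
      have "weight x ^ r \<le> weight x ^ Suc r" using weight_ge_1[of x] by (intro power_increasing) auto
      also have "\<dots> = norm (weight x) powr q" using weight_ge_1[of x] by (simp add: q_def powr_realpow del: power_Suc of_nat_Suc)
      finally show "weight x ^ r \<le> norm (weight x) powr q" .
    qed
    ultimately show ?thesis by linarith
  qed
  show ?thesis
  proof (intro exI[of _ "max \<bar>\<integral>w. weight (X w) ^ r \<partial>M\<bar> ((1 + real k * C) powr q)"] conjI allI impI)
    fix K :: nat assume "0 < K"
    then show "cmean K (\<lambda>x. weight x ^ r) \<le> max \<bar>\<integral>w. weight (X w) ^ r \<partial>M\<bar> ((1 + real k * C) powr q)"
      using c[of K] by linarith
  qed auto
qed

section \<open>Convergence in law through trigonometric polynomials\<close>

lemma conv_add: "conv f \<Longrightarrow> conv g \<Longrightarrow> conv (\<lambda>x. f x + g x)"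
  unfolding conv_def cmean_add by (auto intro: tendsto_add)

lemma conv_scale: "conv f \<Longrightarrow> conv (\<lambda>x. c * f x)"
  unfolding conv_def cmean_scale by (auto intro: tendsto_mult_left)

text \<open>A linear combination of the coordinates has coefficient \<open>\<tau> j / sqrt K\<close>
  on block \<open>j\<close>, so the mean over the cube contains the factors
  \<open>cos (\<tau> j / sqrt K)^K\<close>, which tend to \<open>exp (- \<tau> j^2 / 2)\<close>. The
  Gram identity makes the sum of the \<open>\<tau> j^2\<close> the squared norm of \<open>g\<close>,
  matching the Gaussian side.\<close>

lemma conv_cos: "conv (\<lambda>x. cos ((\<Sum>i<k. u i * x i) + \<theta>))"
  unfolding conv_def
proof
  show "integrable M (\<lambda>w. cos ((\<Sum>i<k. u i * X w i) + \<theta>))"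
    by (rule integrable_const_bound[where B=1]) auto
  define \<tau> where "\<tau> j = (\<Sum>i<k. u i * t i j)" for j
  define g where "g = (\<Sum>i<k. u i *\<^sub>R h i)"
  have "(norm g)\<^sup>2 = (\<Sum>i<k. \<Sum>l<k. u i * u l * inner (h i) (h l))"
    unfolding g_def power2_norm_eq_inner inner_sum_left inner_sum_right by (simp add: mult_ac inner_commute)
  also have "\<dots> = (\<Sum>i<k. \<Sum>l<k. \<Sum>j<n. (u i * t i j) * (u l * t l j))"
    by (intro sum.cong refl) (simp add: gram sum_distrib_left mult_ac)
  also have "\<dots> = (\<Sum>i<k. \<Sum>j<n. \<Sum>l<k. (u i * t i j) * (u l * t l j))"
    by (intro sum.cong refl sum.swap)
  also have "\<dots> = (\<Sum>j<n. \<Sum>i<k. \<Sum>l<k. (u i * t i j) * (u l * t l j))"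
    by (rule sum.swap)
  also have "\<dots> = (\<Sum>j<n. (\<tau> j)\<^sup>2)"
    unfolding \<tau>_def power2_eq_square sum_product ..
  finally have norm_g: "(norm g)\<^sup>2 = (\<Sum>j<n. (\<tau> j)\<^sup>2)" .
  have "(\<integral>w. cos ((\<Sum>i<k. u i * X w i) + \<theta>) \<partial>M) = (\<integral>w. cos (W g w + \<theta>) \<partial>M)"
  proof (rule integral_cong_AE)
    have "AE w in M. W g w = (\<Sum>i<k. u i * W (h i) w)" unfolding g_def by (rule W_sum) simp
    then show "AE w in M. cos ((\<Sum>i<k. u i * X w i) + \<theta>) = cos (W g w + \<theta>)"
      by eventually_elim (simp add: X_def)
  qed auto
  also have "\<dots> = cos \<theta> * (\<Prod>j<n. exp (- ((\<tau> j)\<^sup>2) / 2))"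
    by (simp add: expectation_cos_W norm_g exp_sum[symmetric] sum_negf sum_divide_distrib)
  finally have E: "(\<integral>w. cos ((\<Sum>i<k. u i * X w i) + \<theta>) \<partial>M) = cos \<theta> * (\<Prod>j<n. exp (- ((\<tau> j)\<^sup>2) / 2))" .
  have "cmean K (\<lambda>x. cos ((\<Sum>i<k. u i * x i) + \<theta>)) = cos \<theta> * (\<Prod>j<n. cos (\<tau> j / sqrt K) ^ K)" if K: "0 < K" for K
  proof -
    have sY: "(\<Sum>i<k. u i * Y K A i) = (\<Sum>b\<in>cubeK K. (\<tau> (b div K) / sqrt K) * rsign A b)" for A
    proof -
      have "(\<Sum>i<k. u i * Y K A i) = (\<Sum>i<k. \<Sum>b\<in>cubeK K. u i * (coef K i b * rsign A b))"
        by (intro sum.cong refl) (simp add: Y_def sum_distrib_left)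
      also have "\<dots> = (\<Sum>b\<in>cubeK K. (\<tau> (b div K) / sqrt K) * rsign A b)"
        by (subst sum.swap) (simp add: \<tau>_def coef_def sum_distrib_right sum_divide_distrib mult.assoc)
      finally show ?thesis .
    qed
    have "cmean K (\<lambda>x. cos ((\<Sum>i<k. u i * x i) + \<theta>)) = cos \<theta> * (\<Prod>b\<in>cubeK K. cos (\<tau> (b div K) / sqrt K))"
      unfolding cmean_def sY mean_cos_signs[OF finite_cubeK] ..
    then show ?thesis using prod_blocks[OF K, of "\<lambda>j. cos (\<tau> j / sqrt K)"] by simp
  qed
  then have "(\<lambda>K. cmean (Suc K) (\<lambda>x. cos ((\<Sum>i<k. u i * x i) + \<theta>))) = (\<lambda>K. cos \<theta> * (\<Prod>j<n. cos (\<tau> j / sqrt (Suc K)) ^ Suc K))"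
    by (simp only: zero_less_Suc)
  moreover have "(\<lambda>K. cos (c / sqrt (Suc K)) ^ Suc K) \<longlonglongrightarrow> exp (- (c\<^sup>2) / 2)" for c :: real
  proof -
    have "(\<lambda>K. cos (c / sqrt (real K)) ^ K) \<longlonglongrightarrow> exp (- (c * c / 2))" by real_asymp
    then have "(\<lambda>K. cos (c / sqrt (real K)) ^ K) \<longlonglongrightarrow> exp (- (c\<^sup>2) / 2)" by (simp add: power2_eq_square)
    then show ?thesis by (rule LIMSEQ_Suc)
  qed
  ultimately show "(\<lambda>K. cmean (Suc K) (\<lambda>x. cos ((\<Sum>i<k. u i * x i) + \<theta>))) \<longlonglongrightarrow> (\<integral>w. cos ((\<Sum>i<k. u i * X w i) + \<theta>) \<partial>M)"
    unfolding E by (simp only:) (intro tendsto_mult_left tendsto_prod)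
qed

text \<open>Trigonometric polynomials in the first \<open>k\<close> coordinates. The phase includes
  the sines, and the product formula for cosines makes the class an algebra.\<close>

inductive_set trig :: "((nat \<Rightarrow> real) \<Rightarrow> real) set" where
  cos: "(\<lambda>x. cos ((\<Sum>i<k. u i * x i) + \<theta>)) \<in> trig"
| add: "f \<in> trig \<Longrightarrow> g \<in> trig \<Longrightarrow> (\<lambda>x. f x + g x) \<in> trig"
| scale: "f \<in> trig \<Longrightarrow> (\<lambda>x. c * f x) \<in> trig"

lemma trig_conv: "f \<in> trig \<Longrightarrow> conv f"
  by (induction rule: trig.induct) (auto intro: conv_cos conv_add conv_scale)

lemma trig_mult_cos:
  assumes "g \<in> trig"
  shows "(\<lambda>x. cos ((\<Sum>i<k. u i * x i) + \<theta>) * g x) \<in> trig"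
  using assms
proof (induction rule: trig.induct)
  case (cos v \<eta>)
  have "(\<lambda>x. 1 / 2 * (cos ((\<Sum>i<k. (u i - v i) * x i) + (\<theta> - \<eta>)) + cos ((\<Sum>i<k. (u i + v i) * x i) + (\<theta> + \<eta>)))) \<in> trig"
    by (intro trig.scale trig.add trig.cos)
  moreover have "1 / 2 * (cos ((\<Sum>i<k. (u i - v i) * x i) + (\<theta> - \<eta>)) + cos ((\<Sum>i<k. (u i + v i) * x i) + (\<theta> + \<eta>)))
      = cos ((\<Sum>i<k. u i * x i) + \<theta>) * cos ((\<Sum>i<k. v i * x i) + \<eta>)" for x
    unfolding cos_times_cos by (simp add: left_diff_distrib distrib_right sum.distrib sum_subtractf algebra_simps)
  ultimately show ?case by simp
next
  case (add f g)
  then show ?case using trig.add[OF add.IH] by (simp add: distrib_left)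
next
  case (scale f c)
  then show ?case using trig.scale[OF scale.IH, of c] by (simp add: mult_ac)
qed

lemma trig_mult: "f \<in> trig \<Longrightarrow> g \<in> trig \<Longrightarrow> (\<lambda>x. f x * g x) \<in> trig"
proof (induction rule: trig.induct)
  case (cos u \<theta>)
  then show ?case by (rule trig_mult_cos)
next
  case (add f1 f2)
  then show ?case using trig.add[OF add.IH(1) add.IH(2)] by (simp add: distrib_right)
next
  case (scale f c)
  then show ?case using trig.scale[OF scale.IH, of c] by (simp add: mult_ac)
qed

lemma trig_const: "(\<lambda>x. c) \<in> trig"
  using trig.scale[OF trig.cos[of "\<lambda>_. 0" 0], of c] by simp

lemma trig_sin:
  assumes "i < k"
  shows "(\<lambda>x. sin (r * x i)) \<in> trig"
proof -
  have "(\<lambda>x. cos ((\<Sum>l<k. (if l = i then r else 0) * x l) + (- (pi / 2)))) \<in> trig" by (rule trig.cos)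
  moreover have "(\<Sum>l<k. (if l = i then r else 0) * x l) = r * x i" for x :: "nat \<Rightarrow> real"
    using assms by (subst sum.cong[OF refl, of _ _ "\<lambda>l. if l = i then r * x i else 0"]) auto
  ultimately show ?thesis by (simp add: cos_diff flip: diff_conv_add_uminus)
qed

definition box :: "real \<Rightarrow> (nat \<Rightarrow> real) set" where
  "box L = {x. supported x \<and> (\<forall>i<k. \<bar>x i\<bar> \<le> L)}"

text \<open>With the coordinates from \<open>k\<close> on frozen at 0, the box is a full product of
  compact intervals and points, and Tychonoff's theorem applies.\<close>

lemma compact_box: "compact (box L)"
proof -
  have 1: "x i \<in> (if i < k then {-L..L} else {0}) \<longleftrightarrow> (if i < k then \<bar>x i\<bar> \<le> L else x i = 0)" for x :: "nat \<Rightarrow> real" and i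
    by (cases "i < k") (simp_all add: abs_le_iff minus_le_iff conj_commute)
  have 2: "supported x \<and> (\<forall>i<k. \<bar>x i\<bar> \<le> L) \<longleftrightarrow> (\<forall>i. if i < k then \<bar>x i\<bar> \<le> L else x i = 0)" for x
    unfolding supported_def by (metis not_le)
  have "box L = (\<Pi>\<^sub>E i\<in>UNIV. if i < k then {-L..L} else {0})"
    unfolding box_def PiE_UNIV_domain Pi_def by (simp only: 1 2 UNIV_I True_implies_equals simp_thms)
  moreover have "compactin (product_topology (\<lambda>i. euclidean) UNIV) (\<Pi>\<^sub>E i\<in>UNIV. if i < k then {-L..L} else {0})"
    unfolding compactin_PiE by auto
  ultimately show ?thesis by (simp add: euclidean_product_topology)
qed

text \<open>Stone-Weierstrass on the unit box, for the ring of functions that become trigonometric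
  after substituting \<open>sin (r * x i)\<close> for the coordinates. As sines never leave the box,
  the approximation is uniform over all supported \<open>x\<close>.\<close>

lemma trig_approx:
  assumes \<Theta>: "continuous_on UNIV \<Theta>" and r: "r \<noteq> 0" and e: "0 < e"
  shows "\<exists>f\<in>trig. \<forall>x. supported x \<longrightarrow> \<bar>\<Theta> (\<lambda>i. sin (r * x i)) - f x\<bar> < e"
proof -
  define R where "R = {f :: (nat \<Rightarrow> real) \<Rightarrow> real. continuous_on (box 1) f \<and> (\<exists>g\<in>trig. \<forall>x. supported x \<longrightarrow> f (\<lambda>i. sin (r * x i)) = g x)}"
  interpret function_ring_on R "box 1"
  proof
    show "compact (box 1)" by (rule compact_box)
    show "continuous_on (box 1) f" if "f \<in> R" for f using that by (simp add: R_def)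
    show "(\<lambda>x. f x + g x) \<in> R" if fg: "f \<in> R" "g \<in> R" for f g
    proof -
      obtain f' where f': "f' \<in> trig" "\<And>x. supported x \<Longrightarrow> f (\<lambda>i. sin (r * x i)) = f' x" using fg(1) unfolding R_def by blast
      obtain g' where g': "g' \<in> trig" "\<And>x. supported x \<Longrightarrow> g (\<lambda>i. sin (r * x i)) = g' x" using fg(2) unfolding R_def by blast
      show ?thesis using fg f' g' trig.add[OF f'(1) g'(1)] unfolding R_def by (auto intro!: continuous_on_add)
    qed
    show "(\<lambda>x. f x * g x) \<in> R" if fg: "f \<in> R" "g \<in> R" for f g
    proof -
      obtain f' where f': "f' \<in> trig" "\<And>x. supported x \<Longrightarrow> f (\<lambda>i. sin (r * x i)) = f' x" using fg(1) unfolding R_def by blast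
      obtain g' where g': "g' \<in> trig" "\<And>x. supported x \<Longrightarrow> g (\<lambda>i. sin (r * x i)) = g' x" using fg(2) unfolding R_def by blast
      show ?thesis using fg f' g' trig_mult[OF f'(1) g'(1)] unfolding R_def by (auto intro!: continuous_on_mult)
    qed
    show "(\<lambda>_. c) \<in> R" for c using trig_const[of c] unfolding R_def by auto
    show "\<exists>f\<in>R. f x \<noteq> f y" if xy: "x \<in> box 1" "y \<in> box 1" "x \<noteq> y" for x y
    proof -
      obtain i where i: "x i \<noteq> y i" using xy(3) by auto
      then have ik: "i < k" using xy by (cases "i < k") (auto simp: box_def supported_def)
      have "(\<lambda>z. z i) \<in> R" unfolding R_def using trig_sin[OF ik, of r]
        by (auto intro: continuous_on_subset[OF continuous_on_product_coordinates])
      then show ?thesis by (rule bexI[rotated]) (rule i)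
    qed
  qed
  have "continuous_on (box 1) \<Theta>" by (rule continuous_on_subset[OF \<Theta>]) simp
  from Stone_Weierstrass_basic[OF this e] obtain g where g: "g \<in> R" "\<And>x. x \<in> box 1 \<Longrightarrow> \<bar>\<Theta> x - g x\<bar> < e" by blast
  obtain g' where g': "g' \<in> trig" "\<And>x. supported x \<Longrightarrow> g (\<lambda>i. sin (r * x i)) = g' x" using g(1) unfolding R_def by blast
  have "\<bar>\<Theta> (\<lambda>i. sin (r * x i)) - g' x\<bar> < e" if "supported x" for x
  proof -
    have "(\<lambda>i. sin (r * x i)) \<in> box 1" using that by (auto simp: box_def supported_def)
    from g(2)[OF this] show ?thesis unfolding g'(2)[OF that] .
  qed
  then show ?thesis using g'(1) by (intro bexI[of _ g']) auto
qed

text \<open>Only characteristic functions enter the limit: a continuous function of polynomial growth is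
  approximated, uniformly with respect to a higher weight, by trigonometric polynomials, after
  replacing the coordinates \<open>x i\<close> by \<open>sin (r x i) / r\<close>.\<close>

lemma conv_continuous:
  assumes \<Phi>: "continuous_on UNIV \<Phi>" and growth: "\<And>x. supported x \<Longrightarrow> \<bar>\<Phi> x\<bar> \<le> C * weight x ^ d"
    and meas: "(\<lambda>w. \<Phi> (X w)) \<in> borel_measurable M"
  shows "conv \<Phi>"
proof -
  have C: "0 \<le> C"
  proof -
    have "supported (\<lambda>_. 0)" by (simp add: supported_def)
    from growth[OF this] show ?thesis by (simp add: weight_def)
  qed
  have wpos: "0 \<le> weight x ^ a" for x a using weight_ge_1[of x] by simp
  have approx: "\<exists>f\<in>trig. \<forall>x. supported x \<longrightarrow> \<bar>\<Phi> x - f x\<bar> \<le> e * weight x ^ Suc d" if e: "0 < e" for e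
  proof -
    \<comment> \<open>Outside the box the weight is at least \<open>L\<close>, so
      \<open>2 * C\<close> is at most \<open>e / 3\<close> times the weight. The one extra power of
      the weight thus pays for the crude bound by growth.\<close>
    define L where "L = 6 * C / e + 1"
    have L: "1 \<le> L" using C e by (simp add: L_def)
    \<comment> \<open>\<open>sinc\<close> extends \<open>sin (r x) / r\<close> continuously to
      \<open>r = 0\<close>, where it gives \<open>x\<close>. Joint continuity and compactness of the
      box make \<open>\<Psi> (r, x)\<close> uniformly close to \<open>\<Phi> x\<close> for one small
      positive \<open>r\<close>.\<close>
    define \<Psi> where "\<Psi> z = \<Phi> (\<lambda>i. snd z i * sinc (fst z * snd z i))" for z :: "real \<times> (nat \<Rightarrow> real)"
    have sinc_cont: "continuous_on UNIV sinc" by (intro continuous_at_imp_continuous_on ballI isCont_sinc)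
    have "continuous_on UNIV (\<lambda>z :: real \<times> (nat \<Rightarrow> real). \<lambda>i. snd z i * sinc (fst z * snd z i))"
    proof (rule continuous_on_coordinatewise_then_product)
      fix i
      have c: "continuous_on UNIV (\<lambda>z :: real \<times> (nat \<Rightarrow> real). snd z i)"
        by (rule continuous_on_compose2[OF continuous_on_product_coordinates continuous_on_snd]) (auto intro: continuous_on_id)
      show "continuous_on UNIV (\<lambda>z :: real \<times> (nat \<Rightarrow> real). snd z i * sinc (fst z * snd z i))"
        by (intro continuous_on_mult c continuous_on_compose2[OF sinc_cont] continuous_on_fst continuous_on_id) auto
    qed
    then have "continuous_on UNIV \<Psi>" unfolding \<Psi>_def by (rule continuous_on_compose2[OF \<Phi>]) auto
    then have cont: "continuous_on (UNIV \<times> box L) \<Psi>" by (rule continuous_on_subset) simp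
    obtain X0 where X0: "0 \<in> X0" "open X0" "\<forall>r\<in>X0 \<inter> UNIV. \<forall>x\<in>box L. dist (\<Psi> (r, x)) (\<Psi> (0, x)) \<le> e / 3"
      by (rule continuous_on_prod_compactE[OF cont compact_box UNIV_I, of "e / 3" 0]) (use e in auto)
    then obtain \<rho> where \<rho>: "0 < \<rho>" "ball 0 \<rho> \<subseteq> X0" unfolding open_contains_ball by blast
    define r where "r = \<rho> / 2"
    have r: "0 < r" "r \<in> X0" using \<rho> by (auto simp: r_def)
    define \<Theta> where "\<Theta> u = \<Phi> (\<lambda>i. u i / r)" for u
    have "continuous_on UNIV (\<lambda>u :: nat \<Rightarrow> real. \<lambda>i. u i / r)"
      by (rule continuous_on_coordinatewise_then_product) (intro continuous_on_divide continuous_on_const continuous_on_product_coordinates, use r in auto)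
    then have \<Theta>: "continuous_on UNIV \<Theta>" unfolding \<Theta>_def by (rule continuous_on_compose2[OF \<Phi>]) auto
    have \<Psi>r: "\<Psi> (r, x) = \<Theta> (\<lambda>i. sin (r * x i))" for x
      unfolding \<Psi>_def \<Theta>_def fst_conv snd_conv sinc_mult using r(1) by simp
    have \<Psi>0: "\<Psi> (0, x) = \<Phi> x" for x by (simp add: \<Psi>_def)
    have e3: "0 < e / 3" using e by simp
    from trig_approx[OF \<Theta> _ e3, of r] r(1) obtain f where f: "f \<in> trig" "\<And>x. supported x \<Longrightarrow> \<bar>\<Theta> (\<lambda>i. sin (r * x i)) - f x\<bar> < e / 3" by auto
    have "\<bar>\<Phi> x - f x\<bar> \<le> e * weight x ^ Suc d" if x: "supported x" for x
    proof -
      have w1: "1 \<le> weight x ^ Suc d" using weight_ge_1 by (rule one_le_power)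
      have "\<bar>\<Phi> x - \<Psi> (r, x)\<bar> \<le> e / 3 * weight x ^ Suc d"
      proof (cases "x \<in> box L")
        case True
        then have "dist (\<Psi> (r, x)) (\<Psi> (0, x)) \<le> e / 3" using X0(3) r(2) by blast
        then have "\<bar>\<Phi> x - \<Psi> (r, x)\<bar> \<le> e / 3" unfolding \<Psi>0 dist_real_def by (simp add: abs_minus_commute)
        also have "\<dots> \<le> e / 3 * weight x ^ Suc d" using w1 e by (simp add: mult_left_mono)
        finally show ?thesis .
      next
        case False
        then obtain i where i: "i < k" "L < \<bar>x i\<bar>" using x by (auto simp: box_def not_le)
        have "\<bar>x i\<bar> \<le> (\<Sum>i<k. \<bar>x i\<bar>)" by (rule member_le_sum) (use i in auto)
        then have Lw: "L \<le> weight x" using i by (simp add: weight_def)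
        have xi: "\<bar>x i * sinc (r * x i)\<bar> \<le> \<bar>x i\<bar>" for i
          using abs_scaled_sin_le[of "1 / r" "x i"] r(1) by (simp add: sinc_mult mult.commute)
        have sup: "supported (\<lambda>i. x i * sinc (r * x i))" using x by (simp add: supported_def)
        have ww: "weight (\<lambda>i. x i * sinc (r * x i)) \<le> weight x"
          unfolding weight_def by (intro add_left_mono sum_mono xi)
        have "\<bar>\<Psi> (r, x)\<bar> \<le> C * weight (\<lambda>i. x i * sinc (r * x i)) ^ d"
          unfolding \<Psi>_def fst_conv snd_conv by (rule growth[OF sup])
        also have "\<dots> \<le> C * weight x ^ d"
          using weight_ge_1[of "\<lambda>i. x i * sinc (r * x i)"] by (intro mult_left_mono power_mono ww C) auto
        finally have "\<bar>\<Phi> x - \<Psi> (r, x)\<bar> \<le> (2 * C) * weight x ^ d" using growth[OF x] by linarith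
        also have "\<dots> \<le> (e / 3 * L) * weight x ^ d"
          using e C by (intro mult_right_mono wpos) (simp add: L_def field_simps)
        also have "\<dots> \<le> (e / 3 * weight x) * weight x ^ d" using Lw e by (intro mult_right_mono mult_left_mono wpos) auto
        finally show ?thesis by (simp add: mult_ac)
      qed
      moreover have "\<bar>\<Psi> (r, x) - f x\<bar> \<le> e / 3 * weight x ^ Suc d"
      proof -
        have "e / 3 * 1 \<le> e / 3 * weight x ^ Suc d" using e by (intro mult_left_mono w1) auto
        then show ?thesis using f(2)[OF x] unfolding \<Psi>r by linarith
      qed
      moreover have "e / 3 * weight x ^ Suc d + e / 3 * weight x ^ Suc d \<le> e * weight x ^ Suc d"
        using e wpos[of x "Suc d"] by (simp add: field_simps del: power_Suc)
      ultimately show ?thesis by linarith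
    qed
    then show ?thesis using f(1) by (intro bexI[of _ f]) auto
  qed
  obtain B where B: "0 \<le> B" "(\<integral>w. weight (X w) ^ Suc d \<partial>M) \<le> B" "\<And>K. 0 < K \<Longrightarrow> cmean K (\<lambda>x. weight x ^ Suc d) \<le> B"
    using weight_bound[of "Suc d"] by blast
  have iw: "integrable M (\<lambda>w. weight (X w) ^ a)" for a
    by (intro moments_integrable moments_power moments_weight)
  have i\<Phi>: "integrable M (\<lambda>w. \<Phi> (X w))"
  proof (rule Bochner_Integration.integrable_bound[OF _ meas])
    show "integrable M (\<lambda>w. C * weight (X w) ^ d)" using iw by simp
    show "AE w in M. norm (\<Phi> (X w)) \<le> norm (C * weight (X w) ^ d)"
      using growth[OF supported_XY(1)] C wpos by (auto simp: abs_mult)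
  qed
  have "(\<lambda>K. cmean (Suc K) \<Phi>) \<longlonglongrightarrow> (\<integral>w. \<Phi> (X w) \<partial>M)"
  proof (rule LIMSEQ_I)
    fix c :: real assume c: "0 < c"
    define e where "e = c / 3 / (B + 1)"
    have e: "0 < e" using c B by (simp add: e_def)
    have eB: "e * B \<le> c / 3"
    proof -
      have "e * B \<le> e * (B + 1)" using e by (intro mult_left_mono) auto
      also have "\<dots> = c / 3"
      proof -
        have "B + 1 \<noteq> 0" using B(1) by linarith
        from nonzero_divide_eq_eq[OF this, of "c / 3" e] show ?thesis unfolding e_def by (simp only: refl simp_thms)
      qed
      finally show ?thesis .
    qed
    obtain f where f: "f \<in> trig" "\<And>x. supported x \<Longrightarrow> \<bar>\<Phi> x - f x\<bar> \<le> e * weight x ^ Suc d" using approx[OF e] by blast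
    have cf: "integrable M (\<lambda>w. f (X w))" "(\<lambda>K. cmean (Suc K) f) \<longlonglongrightarrow> (\<integral>w. f (X w) \<partial>M)"
      using trig_conv[OF f(1)] by (auto simp: conv_def)
    have 1: "\<bar>cmean K \<Phi> - cmean K f\<bar> \<le> c / 3" if K: "0 < K" for K
    proof -
      have "cmean K \<Phi> \<le> cmean K (\<lambda>x. f x + e * weight x ^ Suc d)"
        by (rule cmean_mono) (use f(2) in \<open>smt (verit)\<close>)
      moreover have "cmean K f \<le> cmean K (\<lambda>x. \<Phi> x + e * weight x ^ Suc d)"
        by (rule cmean_mono) (use f(2) in \<open>smt (verit)\<close>)
      moreover have "e * cmean K (\<lambda>x. weight x ^ Suc d) \<le> e * B" using B(3)[OF K] e by (intro mult_left_mono) auto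
      ultimately show ?thesis using eB unfolding cmean_add cmean_scale by linarith
    qed
    have 2: "\<bar>(\<integral>w. \<Phi> (X w) \<partial>M) - (\<integral>w. f (X w) \<partial>M)\<bar> \<le> c / 3"
    proof -
      have "\<bar>\<integral>w. \<Phi> (X w) - f (X w) \<partial>M\<bar> \<le> (\<integral>w. e * weight (X w) ^ Suc d \<partial>M)"
        by (rule order_trans[OF integral_abs_bound], rule integral_mono)
           (use i\<Phi> cf iw f(2)[OF supported_XY(1)] in \<open>auto simp del: power_Suc\<close>)
      also have "\<dots> \<le> e * B" using B(2) e by (simp add: mult_left_mono del: power_Suc)
      finally show ?thesis using i\<Phi> cf eB by simp
    qed
    have "0 < c / 3" using c by simp
    from LIMSEQ_D[OF cf(2) this] obtain K0 where K0: "\<And>K. K0 \<le> K \<Longrightarrow> norm (cmean (Suc K) f - (\<integral>w. f (X w) \<partial>M)) < c / 3" by blast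
    show "\<exists>no. \<forall>K\<ge>no. norm (cmean (Suc K) \<Phi> - (\<integral>w. \<Phi> (X w) \<partial>M)) < c"
    proof (intro exI[of _ K0] allI impI)
      fix K assume "K0 \<le> K"
      from K0[OF this] 1[OF zero_less_Suc, of K] 2 show "norm (cmean (Suc K) \<Phi> - (\<integral>w. \<Phi> (X w) \<partial>M)) < c"
        unfolding real_norm_def by linarith
    qed
  qed
  then show ?thesis using i\<Phi> by (simp add: conv_def)
qed

end

section \<open>Growth of Hermite polynomials, orthogonality on the cube and Gram matrices\<close>

lemma continuous_on_hermite: "continuous_on UNIV (hermite m)"
proof -
  have "continuous_on UNIV (hermite m) \<and> continuous_on UNIV (hermite (Suc m))"
  proof (induction m)
    case 0
    have "hermite 0 = (\<lambda>x. 1)" "hermite (Suc 0) = (\<lambda>x. x)" by (auto simp: fun_eq_iff)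
    then show ?case by simp
  next
    case (Suc m)
    have "continuous_on UNIV (\<lambda>x. (x * hermite (Suc m) x - hermite m x) / real (Suc (Suc m)))"
      using Suc by (intro continuous_on_divide continuous_on_diff continuous_on_mult continuous_on_id continuous_on_const) auto
    moreover have "hermite (Suc (Suc m)) = (\<lambda>x. (x * hermite (Suc m) x - hermite m x) / real (Suc (Suc m)))" by (rule ext) simp
    ultimately show ?case using Suc by simp
  qed
  then show ?thesis ..
qed

lemma hermite_growth: "\<exists>C\<ge>0. \<forall>x. \<bar>hermite m x\<bar> \<le> C * (1 + \<bar>x\<bar>) ^ m"
proof -
  define good where "good m \<longleftrightarrow> (\<exists>C\<ge>0. \<forall>x. \<bar>hermite m x\<bar> \<le> C * (1 + \<bar>x\<bar>) ^ m)" for m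
  have "good m \<and> good (Suc m)"
  proof (induction m)
    case 0
    show ?case unfolding good_def by (intro conjI exI[of _ 1]) auto
  next
    case (Suc m)
    obtain C where C: "0 \<le> C" "\<And>x. \<bar>hermite m x\<bar> \<le> C * (1 + \<bar>x\<bar>) ^ m" using Suc unfolding good_def by blast
    obtain D where D: "0 \<le> D" "\<And>x. \<bar>hermite (Suc m) x\<bar> \<le> D * (1 + \<bar>x\<bar>) ^ Suc m" using Suc unfolding good_def by blast
    have "\<bar>hermite (Suc (Suc m)) x\<bar> \<le> (C + D) * (1 + \<bar>x\<bar>) ^ Suc (Suc m)" for x
    proof -
      define w where "w = 1 + \<bar>x\<bar>"
      have w: "1 \<le> w" "\<bar>x\<bar> \<le> w" by (auto simp: w_def)
      have "\<bar>x * hermite (Suc m) x\<bar> \<le> w * (D * w ^ Suc m)"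
        unfolding abs_mult using D(2)[of x] w by (intro mult_mono) (auto simp: w_def)
      moreover have "C * w ^ m \<le> C * w ^ Suc (Suc m)" using w C by (intro mult_left_mono power_increasing) auto
      moreover have "\<bar>hermite m x\<bar> \<le> C * w ^ m" using C(2)[of x] by (simp add: w_def)
      ultimately have n: "\<bar>x * hermite (Suc m) x - hermite m x\<bar> \<le> (C + D) * w ^ Suc (Suc m)"
        unfolding distrib_right power_Suc[of w "Suc m"]
        using abs_triangle_ineq4[of "x * hermite (Suc m) x" "hermite m x"] by (simp only: mult.left_commute[of w D])
      have "\<bar>hermite (Suc (Suc m)) x\<bar> = \<bar>x * hermite (Suc m) x - hermite m x\<bar> / real (Suc (Suc m))" by simp
      also have "\<dots> \<le> \<bar>x * hermite (Suc m) x - hermite m x\<bar> / 1" by (rule divide_left_mono) auto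
      finally show ?thesis using n by (simp add: w_def)
    qed
    then have "good (Suc (Suc m))" unfolding good_def using C D by (intro exI[of _ "C + D"]) auto
    then show ?case using Suc by blast
  qed
  then show ?thesis unfolding good_def by blast
qed

text \<open>The product of two Walsh functions is the Walsh function of the symmetric difference,
  which is nonempty and therefore has sum 0.\<close>

lemma walsh_mult_zero:
  assumes "finite S" "B \<subseteq> S" "D \<subseteq> S" "B \<noteq> D"
  shows "(\<Sum>A\<in>Pow S. walsh B A * walsh D A) = 0"
proof -
  have fin: "finite B" "finite D" using assms finite_subset by auto
  have "walsh B A * walsh D A = walsh ((B - D) \<union> (D - B)) A" for A
  proof -
    have sq: "(\<Prod>i\<in>B \<inter> D. rsign A i) * (\<Prod>i\<in>B \<inter> D. rsign A i) = 1"
      unfolding prod.distrib[symmetric] by (rule prod.neutral) (simp add: rsign_def)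
    have "walsh B A = (\<Prod>i\<in>B - D. rsign A i) * (\<Prod>i\<in>B \<inter> D. rsign A i)"
      unfolding walsh_def by (subst prod.union_disjoint[symmetric]) (use fin in \<open>auto simp: Un_Diff_Int Int_Diff_Un Un_commute\<close>)
    moreover have "walsh D A = (\<Prod>i\<in>D - B. rsign A i) * (\<Prod>i\<in>B \<inter> D. rsign A i)"
      unfolding walsh_def Int_commute[of B D] by (subst prod.union_disjoint[symmetric]) (use fin in \<open>auto simp: Un_Diff_Int Int_Diff_Un Un_commute\<close>)
    moreover have "walsh ((B - D) \<union> (D - B)) A = (\<Prod>i\<in>B - D. rsign A i) * (\<Prod>i\<in>D - B. rsign A i)"
      unfolding walsh_def by (rule prod.union_disjoint) (use fin in auto)
    ultimately show ?thesis using sq by (metis (no_types, lifting) mult.assoc mult.commute mult_1)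
  qed
  then show ?thesis using sum_walsh[OF assms(1), of "(B - D) \<union> (D - B)"] assms by auto
qed

lemma esp_orthogonal:
  assumes S: "finite S" and ab: "a \<noteq> b"
  shows "(\<Sum>A\<in>Pow S. esp S (\<lambda>i. c i * rsign A i) a * esp S (\<lambda>i. d i * rsign A i) b) = 0"
proof -
  define x y where "x B = (if card B = a then \<Prod>i\<in>B. c i else 0)" and "y B = (if card B = b then \<Prod>i\<in>B. d i else 0)" for B
  have ex: "esp S (\<lambda>i. c i * rsign A i) a = (\<Sum>B\<in>Pow S. walsh B A * x B)" for A
    using esp_eq_wsum[OF S, of c A a "1::real"] by (simp add: wsum_def x_def)
  have ey: "esp S (\<lambda>i. d i * rsign A i) b = (\<Sum>B\<in>Pow S. walsh B A * y B)" for A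
    using esp_eq_wsum[OF S, of d A b "1::real"] by (simp add: wsum_def y_def)
  have "(\<Sum>A\<in>Pow S. esp S (\<lambda>i. c i * rsign A i) a * esp S (\<lambda>i. d i * rsign A i) b)
     = (\<Sum>A\<in>Pow S. \<Sum>B\<in>Pow S. \<Sum>D\<in>Pow S. (x B * y D) * (walsh B A * walsh D A))"
    unfolding ex ey sum_product by (simp add: mult_ac)
  also have "\<dots> = (\<Sum>B\<in>Pow S. \<Sum>A\<in>Pow S. \<Sum>D\<in>Pow S. (x B * y D) * (walsh B A * walsh D A))" by (rule sum.swap)
  also have "\<dots> = (\<Sum>B\<in>Pow S. \<Sum>D\<in>Pow S. \<Sum>A\<in>Pow S. (x B * y D) * (walsh B A * walsh D A))"
    by (intro sum.cong refl sum.swap)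
  also have "\<dots> = 0"
  proof (rule sum.neutral, rule ballI, rule sum.neutral, rule ballI)
    fix B D assume BD: "B \<in> Pow S" "D \<in> Pow S"
    show "(\<Sum>A\<in>Pow S. (x B * y D) * (walsh B A * walsh D A)) = 0"
    proof (cases "B = D")
      case True
      then have "x B * y D = 0" using ab by (auto simp: x_def y_def)
      then show ?thesis by (simp only: mult_zero_left sum.neutral_const)
    next
      case False
      then show ?thesis using walsh_mult_zero[OF S, of B D] BD unfolding sum_distrib_left[symmetric] by simp
    qed
  qed
  finally show ?thesis .
qed

text \<open>Gram-Schmidt orthonormalization: the numbers \<open>t i j\<close> are coordinates with
  respect to an orthonormal basis of the span. A vector already in the span of its predecessors
  leaves the basis unchanged.\<close>

lemma gram_representation:
  fixes h :: "nat \<Rightarrow> 'h::real_inner"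
  shows "\<exists>(n::nat) t. \<forall>i<k. \<forall>l<k. inner (h i) (h l) = (\<Sum>j<n. t i j * t l j :: real)"
proof -
  have "\<exists>(n::nat) e. (\<forall>i<n. \<forall>j<n. inner (e i) (e j) = (if i = j then 1 else 0)) \<and> (\<forall>i<k. h i = (\<Sum>j<n. inner (h i) (e j) *\<^sub>R e j))"
  proof (induction k)
    case 0
    show ?case by (intro exI[of _ 0]) auto
  next
    case (Suc k)
    then obtain n :: nat and e where e: "\<And>i j. i < n \<Longrightarrow> j < n \<Longrightarrow> inner (e i) (e j) = (if i = j then 1 else 0)"
      and he: "\<And>i. i < k \<Longrightarrow> h i = (\<Sum>j<n. inner (h i) (e j) *\<^sub>R e j)" by blast
    define r where "r = h k - (\<Sum>j<n. inner (h k) (e j) *\<^sub>R e j)"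
    have re: "inner r (e l) = 0" if "l < n" for l
    proof -
      have "(\<Sum>j<n. inner (h k) (e j) * inner (e j) (e l)) = (\<Sum>j<n. if j = l then inner (h k) (e l) else 0)"
        by (rule sum.cong) (use that e in auto)
      then show ?thesis using that by (simp add: r_def inner_diff_left inner_sum_left)
    qed
    show ?case
    proof (cases "r = 0")
      case True
      then have "h k = (\<Sum>j<n. inner (h k) (e j) *\<^sub>R e j)" by (simp add: r_def)
      then show ?thesis using e he by (intro exI[of _ n] exI[of _ e]) (auto simp: less_Suc_eq)
    next
      case False
      define e' where "e' j = (if j = n then r /\<^sub>R norm r else e j)" for j
      have hr: "inner (h i) r = 0" if "i < k" for i
        unfolding inner_commute[of _ r] by (subst he[OF that]) (simp add: inner_sum_right re)
      have hk: "inner (h k) r = (norm r)\<^sup>2"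
      proof -
        have "inner r r = inner (h k) r - (\<Sum>j<n. inner (h k) (e j) * inner (e j) r)"
          by (subst (1) r_def) (simp add: inner_diff_left inner_sum_left)
        also have "(\<Sum>j<n. inner (h k) (e j) * inner (e j) r) = 0" by (intro sum.neutral) (simp add: inner_commute[of _ r] re)
        finally show ?thesis by (simp add: power2_norm_eq_inner)
      qed
      have 1: "inner (e' i) (e' j) = (if i = j then 1 else 0)" if "i < Suc n" "j < Suc n" for i j
      proof -
        have "i < n \<or> i = n" "j < n \<or> j = n" using that by auto
        then consider "i < n" "j < n" | "i = n" "j < n" | "i < n" "j = n" | "i = n" "j = n" by blast
        then show ?thesis
        proof cases
          case 4
          have "inner r r / (norm r * norm r) = 1" using False by (simp add: dot_square_norm power2_eq_square)
          then show ?thesis using 4 by (simp add: e'_def divide_inverse mult_ac)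
        qed (simp_all add: e'_def e re inner_commute[of _ r])
      qed
      have 2: "h i = (\<Sum>j<Suc n. inner (h i) (e' j) *\<^sub>R e' j)" if "i < Suc k" for i
      proof (cases "i = k")
        case True
        have "(\<Sum>j<Suc n. inner (h k) (e' j) *\<^sub>R e' j) = (\<Sum>j<n. inner (h k) (e j) *\<^sub>R e j) + inner (h k) (e' n) *\<^sub>R e' n"
          by (simp add: e'_def)
        moreover have "inverse (norm r) * (norm r * norm r) * inverse (norm r) = 1" using False by (simp add: field_simps)
        then have "inner (h k) (e' n) *\<^sub>R e' n = r" using hk False by (simp add: e'_def power2_eq_square)
        ultimately show ?thesis using True by (simp add: r_def)
      next
        case False
        then have ik: "i < k" using that by simp
        have "(\<Sum>j<Suc n. inner (h i) (e' j) *\<^sub>R e' j) = (\<Sum>j<n. inner (h i) (e j) *\<^sub>R e j) + inner (h i) (e' n) *\<^sub>R e' n"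
          by (simp add: e'_def)
        also have "inner (h i) (e' n) = 0" using hr[OF ik] by (simp add: e'_def)
        finally show ?thesis using he[OF ik] by simp
      qed
      show ?thesis using 1 2 by (intro exI[of _ "Suc n"] exI[of _ e']) blast
    qed
  qed
  then obtain n :: nat and e where e: "\<And>i j. i < n \<Longrightarrow> j < n \<Longrightarrow> inner (e i) (e j) = (if i = j then 1 else 0)"
      and he: "\<And>i. i < k \<Longrightarrow> h i = (\<Sum>j<n. inner (h i) (e j) *\<^sub>R e j)" by blast
  have "inner (h i) (h l) = (\<Sum>j<n. inner (h i) (e j) * inner (h l) (e j))" if "i < k" "l < k" for i l
  proof -
    have "inner (h i) (h l) = inner (\<Sum>j<n. inner (h i) (e j) *\<^sub>R e j) (h l)" using he[OF that(1)] by simp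
    then show ?thesis by (simp add: inner_sum_left inner_sum_right inner_commute[of _ "h l"])
  qed
  then show ?thesis by (intro exI[of _ n] exI[of _ "\<lambda>i j. inner (h i) (e j)"]) blast
qed

section \<open>Transfer of multiplier bounds and of orthogonality\<close>

context gaussian_vector
begin

definition hpoly :: "(nat \<Rightarrow> nat) \<Rightarrow> (nat \<Rightarrow> 'b::real_normed_vector) \<Rightarrow> (nat \<Rightarrow> real) \<Rightarrow> 'b" where
  "hpoly m v x = (\<Sum>i<k. hermite (m i) (x i) *\<^sub>R v i)"

text \<open>The counterpart of \<open>hpoly\<close> on the cube, in which each Hermite polynomial is
  replaced by the symmetric polynomial of the same order, a function in a single chaos.\<close>

definition epoly :: "nat \<Rightarrow> (nat \<Rightarrow> nat) \<Rightarrow> (nat \<Rightarrow> 'b::real_normed_vector) \<Rightarrow> nat set \<Rightarrow> 'b" where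
  "epoly K m v A = (\<Sum>i<k. esp (cubeK K) (\<lambda>b. coef K i b * rsign A b) (m i) *\<^sub>R v i)"

lemma abs_le_weight: "i < k \<Longrightarrow> 1 + \<bar>x i\<bar> \<le> weight x"
  unfolding weight_def by (intro add_left_mono member_le_sum) auto

lemma hermite_le_weight: "\<exists>C\<ge>0. \<forall>x. \<forall>i<k. \<bar>hermite m (x i)\<bar> \<le> C * weight x ^ m"
proof -
  obtain C where C: "0 \<le> C" "\<And>x. \<bar>hermite m x\<bar> \<le> C * (1 + \<bar>x\<bar>) ^ m" using hermite_growth[of m] by blast
  have "\<bar>hermite m (x i)\<bar> \<le> C * weight x ^ m" if "i < k" for x i
    by (rule order_trans[OF C(2)]) (intro mult_left_mono power_mono abs_le_weight that C(1), auto)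
  then show ?thesis using C(1) by blast
qed

lemma esp_hermite_weight:
  "\<exists>C\<ge>0. \<forall>K>0. \<forall>A. \<forall>i<k. \<bar>esp (cubeK K) (\<lambda>b. coef K i b * rsign A b) m\<bar> \<le> C * weight (Y K A) ^ m \<and>
     \<bar>esp (cubeK K) (\<lambda>b. coef K i b * rsign A b) m - hermite m (Y K A i)\<bar> \<le> C / sqrt K * weight (Y K A) ^ m"
proof -
  define Q where "Q C \<longleftrightarrow> (\<forall>S y \<delta>. finite S \<and> 0 \<le> \<delta> \<and> \<delta> \<le> 1 \<and> (\<Sum>b\<in>S. (y b)\<^sup>2) = 1 \<and> (\<forall>i\<ge>3. \<bar>\<Sum>b\<in>S. y b ^ i\<bar> \<le> \<delta>) \<longrightarrow>
     \<bar>esp S y m\<bar> \<le> C * (1 + \<bar>\<Sum>b\<in>S. y b\<bar>) ^ m \<and>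
     \<bar>esp S y m - hermite m (\<Sum>b\<in>S. y b)\<bar> \<le> \<delta> * C * (1 + \<bar>\<Sum>b\<in>S. y b\<bar>) ^ m \<and>
     (\<forall>i\<ge>3. \<bar>esp_power S y m i\<bar> \<le> \<delta> * C * (1 + \<bar>\<Sum>b\<in>S. y b\<bar>) ^ m) \<and>
     \<bar>esp S y m - esp_power S y m 2\<bar> \<le> \<delta> * C * (1 + \<bar>\<Sum>b\<in>S. y b\<bar>) ^ m)" for C
  have "\<exists>C\<ge>0. Q C" using esp_hermite_bound[of m] unfolding Q_def .
  then obtain C where C: "0 \<le> C" "Q C" by blast
  show ?thesis
  proof (rule exI[of _ C], intro conjI allI impI)
    show "0 \<le> C" by (rule C(1))
  next
    fix K A i assume K: "(0::nat) < K" and i: "i < k"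
    let ?y = "\<lambda>b. coef K i b * rsign A b"
    have sq: "(\<Sum>b\<in>cubeK K. (?y b)\<^sup>2) = 1"
    proof -
      have "(rsign A b)\<^sup>2 = 1" for b by (simp add: rsign_def)
      then show ?thesis using coef_square[OF K i] by (simp add: power_mult_distrib)
    qed
    have s: "(\<Sum>b\<in>cubeK K. ?y b) = Y K A i" using i by (simp add: Y_def)
    have "finite (cubeK K) \<and> 0 \<le> 1 / sqrt K \<and> 1 / sqrt K \<le> 1 \<and> (\<Sum>b\<in>cubeK K. (?y b)\<^sup>2) = 1 \<and>
      (\<forall>i\<ge>3. \<bar>\<Sum>b\<in>cubeK K. ?y b ^ i\<bar> \<le> 1 / sqrt K)"
    proof (intro conjI allI impI)
      show "1 / sqrt K \<le> 1" using K by simp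
      show "(\<Sum>b\<in>cubeK K. (?y b)\<^sup>2) = 1" by (rule sq)
      show "\<bar>\<Sum>b\<in>cubeK K. ?y b ^ r\<bar> \<le> 1 / sqrt K" if "3 \<le> r" for r
        by (rule coef_power_sum[OF K i that])
      show "finite (cubeK K)" by (rule finite_cubeK)
      show "0 \<le> 1 / sqrt K" by simp
    qed
    note H = C(2)[unfolded Q_def, THEN spec[of _ "cubeK K"], THEN spec[of _ ?y], THEN spec[of _ "1 / sqrt K"], THEN mp, OF this, unfolded s]
    have a: "\<bar>esp (cubeK K) ?y m\<bar> \<le> C * (1 + \<bar>Y K A i\<bar>) ^ m"
      by (rule H[THEN conjunct1])
    have b: "\<bar>esp (cubeK K) ?y m - hermite m (Y K A i)\<bar> \<le> 1 / sqrt K * C * (1 + \<bar>Y K A i\<bar>) ^ m" by (rule H[THEN conjunct2, THEN conjunct1])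
    have w: "(1 + \<bar>Y K A i\<bar>) ^ m \<le> weight (Y K A) ^ m" by (intro power_mono abs_le_weight i) auto
    show "\<bar>esp (cubeK K) ?y m\<bar> \<le> C * weight (Y K A) ^ m"
      using a mult_left_mono[OF w C(1)] by linarith
    have "1 / sqrt K * C * (1 + \<bar>Y K A i\<bar>) ^ m \<le> 1 / sqrt K * C * weight (Y K A) ^ m"
      using C(1) by (intro mult_left_mono w) auto
    then show "\<bar>esp (cubeK K) ?y m - hermite m (Y K A i)\<bar> \<le> C / sqrt K * weight (Y K A) ^ m"
      using b by simp
  qed
qed

lemma hpoly_strongly_measurable: "strongly_measurable M (\<lambda>w. hpoly m v (X w))"
  unfolding hpoly_def
proof (intro strongly_measurable_sum strongly_measurable_scaleR strongly_measurable_const)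
  fix i
  have "hermite (m i) \<in> borel_measurable borel" by (rule borel_measurable_continuous_onI[OF continuous_on_hermite])
  then have "(\<lambda>w. hermite (m i) (X w i)) \<in> borel_measurable M" by measurable
  then show "strongly_measurable M (\<lambda>w. hermite (m i) (X w i))" by (simp add: strongly_measurable_real_iff)
qed

lemma conv_hpoly:
  assumes p: "1 \<le> p"
  shows "conv (\<lambda>x. norm (hpoly m v x) powr p)"
proof -
  have "\<forall>i. \<exists>C. 0 \<le> C \<and> (\<forall>x. \<forall>i'<k. \<bar>hermite (m i) (x i')\<bar> \<le> C * weight x ^ m i)"
    using hermite_le_weight by blast
  from choice[OF this] obtain C where C: "\<And>i. 0 \<le> C i" "\<And>i x i'. i' < k \<Longrightarrow> \<bar>hermite (m i) (x i')\<bar> \<le> C i * weight x ^ m i" by blast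
  define D where "D = (\<Sum>i<k. C i * norm (v i))"
  define e where "e = (\<Sum>i<k. m i)"
  have D: "0 \<le> D" unfolding D_def using C by (intro sum_nonneg mult_nonneg_nonneg) auto
  have b: "norm (hpoly m v x) \<le> D * weight x ^ e" for x
  proof -
    have "norm (hpoly m v x) \<le> (\<Sum>i<k. \<bar>hermite (m i) (x i)\<bar> * norm (v i))"
      unfolding hpoly_def by (rule order_trans[OF norm_sum]) simp
    also have "\<dots> \<le> (\<Sum>i<k. (C i * weight x ^ e) * norm (v i))"
    proof (intro sum_mono mult_right_mono)
      fix i assume "i \<in> {..<k}"
      then have i: "i < k" and me: "m i \<le> e" unfolding e_def by (auto intro: member_le_sum)
      have "\<bar>hermite (m i) (x i)\<bar> \<le> C i * weight x ^ m i" by (rule C(2)[OF i])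
      also have "\<dots> \<le> C i * weight x ^ e" by (intro mult_left_mono power_increasing me weight_ge_1 C(1))
      finally show "\<bar>hermite (m i) (x i)\<bar> \<le> C i * weight x ^ e" .
    qed auto
    also have "\<dots> = D * weight x ^ e" by (simp add: D_def sum_distrib_left sum_distrib_right mult_ac)
    finally show ?thesis .
  qed
  define d where "d = nat \<lceil>real e * p\<rceil>"
  have d: "real e * p \<le> real d" unfolding d_def by linarith
  show ?thesis
  proof (rule conv_continuous[where C="D powr p" and d=d])
    have hc: "continuous_on UNIV (\<lambda>x. hpoly m v x)" unfolding hpoly_def
      by (intro continuous_on_sum continuous_on_scaleR continuous_on_const
         continuous_on_compose2[OF continuous_on_hermite continuous_on_product_coordinates]) auto
    show "continuous_on UNIV (\<lambda>x. norm (hpoly m v x) powr p)"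
      using p by (intro continuous_on_powr' continuous_on_norm hc continuous_on_const) auto
    show "\<bar>norm (hpoly m v x) powr p\<bar> \<le> D powr p * weight x ^ d" for x
    proof -
      have w0: "0 < weight x" using weight_ge_1[of x] by linarith
      have "norm (hpoly m v x) powr p \<le> (D * weight x ^ e) powr p" using b p by (intro powr_mono2) auto
      also have "\<dots> = D powr p * (weight x ^ e) powr p" by (rule powr_mult)
      also have "(weight x ^ e) powr p = weight x powr (real e * p)"
        using w0 by (simp add: powr_powr flip: powr_realpow)
      also have "D powr p * \<dots> \<le> D powr p * weight x powr real d"
        by (intro mult_left_mono powr_mono d weight_ge_1) auto
      also have "weight x powr real d = weight x ^ d" using w0 by (rule powr_realpow)
      finally show ?thesis by simp
    qed
    show "(\<lambda>w. norm (hpoly m v (X w)) powr p) \<in> borel_measurable M"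
      using strongly_measurable_norm[OF hpoly_strongly_measurable[of m v]] by measurable
  qed
qed

lemma hpoly_cube_limit:
  fixes v :: "nat \<Rightarrow> 'b::real_normed_vector"
  assumes p: "1 \<le> p"
  shows "(\<lambda>K. Lp_norm (cube (cubeK (Suc K))) p (\<lambda>A. hpoly m v (Y (Suc K) A))) \<longlonglongrightarrow> Lp_norm M p (\<lambda>w. hpoly m v (X w))"
proof -
  have p0: "0 < p" using p by simp
  have e: "Lp_norm (cube (cubeK K)) p f = (Lp_norm (cube (cubeK K)) p f powr p) powr (1 / p)" for K and f :: "nat set \<Rightarrow> 'b"
    using p0 by (simp add: powr_powr)
  have "(\<lambda>K. cmean (Suc K) (\<lambda>x. norm (hpoly m v x) powr p) powr (1 / p)) \<longlonglongrightarrow> (\<integral>w. norm (hpoly m v (X w)) powr p \<partial>M) powr (1 / p)"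
    using conv_hpoly[OF p, of m v] p0 unfolding conv_def
    by (intro tendsto_powr' tendsto_const) (auto intro!: always_eventually divide_nonneg_nonneg sum_nonneg simp: cmean_def)
  then show ?thesis
    unfolding Lp_norm_def[of M] cmean_eq_Lp_norm[OF p0] by (subst e)
qed

text \<open>Each summand is off by \<open>1 / sqrt K\<close> times a power of the weight, whose
  moments do not depend on the block length.\<close>

lemma epoly_hpoly_limit:
  fixes v :: "nat \<Rightarrow> 'b::real_normed_vector"
  assumes p: "1 \<le> p"
  shows "(\<lambda>K. Lp_norm (cube (cubeK (Suc K))) p (\<lambda>A. epoly (Suc K) m v A - hpoly m v (Y (Suc K) A))) \<longlonglongrightarrow> 0"
proof -
  have p0: "0 < p" using p by simp
  have "\<exists>C. \<forall>K>0. Lp_norm (cube (cubeK K)) p (\<lambda>A. (esp (cubeK K) (\<lambda>b. coef K i b * rsign A b) (m i) - hermite (m i) (Y K A i)) *\<^sub>R v i) \<le> C / sqrt K" if i: "i < k" for i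
  proof -
    obtain C where C: "0 \<le> C" "\<And>K A. 0 < K \<Longrightarrow> \<bar>esp (cubeK K) (\<lambda>b. coef K i b * rsign A b) (m i) - hermite (m i) (Y K A i)\<bar> \<le> C / sqrt K * weight (Y K A) ^ m i"
      using esp_hermite_weight[of "m i"] i by blast
    define d where "d = nat \<lceil>real (m i) * p\<rceil>"
    have d: "real (m i) * p \<le> real d" unfolding d_def by linarith
    obtain B where B: "0 \<le> B" "\<And>K. 0 < K \<Longrightarrow> cmean K (\<lambda>x. weight x ^ d) \<le> B" using weight_bound[of d] by blast
    have "Lp_norm (cube (cubeK K)) p (\<lambda>A. (esp (cubeK K) (\<lambda>b. coef K i b * rsign A b) (m i) - hermite (m i) (Y K A i)) *\<^sub>R v i)
       \<le> (C * norm (v i) * B powr (1 / p)) / sqrt K" if K: "0 < K" for K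
    proof -
      let ?S = "cubeK K"
      have w: "Lp_norm (cube ?S) p (\<lambda>A. weight (Y K A) ^ m i) \<le> B powr (1 / p)"
      proof (rule powr_le_cancel[OF _ _ p0])
        have "Lp_norm (cube ?S) p (\<lambda>A. weight (Y K A) ^ m i) powr p = cmean K (\<lambda>x. norm (weight x ^ m i) powr p)"
          using cmean_eq_Lp_norm[OF p0, of K "\<lambda>x. weight x ^ m i"] by simp
        also have "\<dots> \<le> cmean K (\<lambda>x. weight x ^ d)"
        proof (rule cmean_mono)
          fix x
          have w0: "0 < weight x" using weight_ge_1[of x] by linarith
          have "norm (weight x ^ m i) powr p = weight x powr (real (m i) * p)"
            using w0 by (simp add: powr_powr flip: powr_realpow)
          also have "\<dots> \<le> weight x powr real d" by (intro powr_mono d weight_ge_1)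
          also have "\<dots> = weight x ^ d" using w0 by (rule powr_realpow)
          finally show "norm (weight x ^ m i) powr p \<le> weight x ^ d" .
        qed
        also have "\<dots> \<le> B" by (rule B(2)[OF K])
        finally show "Lp_norm (cube ?S) p (\<lambda>A. weight (Y K A) ^ m i) powr p \<le> (B powr (1 / p)) powr p"
          using B p0 by (simp add: powr_powr)
      qed simp
      have "Lp_norm (cube ?S) p (\<lambda>A. (esp ?S (\<lambda>b. coef K i b * rsign A b) (m i) - hermite (m i) (Y K A i)) *\<^sub>R v i)
         \<le> Lp_norm (cube ?S) p (\<lambda>A. (C / sqrt K * norm (v i)) *\<^sub>R weight (Y K A) ^ m i)"
      proof (rule Lp_norm_mono[OF LpD(1)[OF Lp_cube] Lp_cube _ p0])
        show "AE A in cube ?S. norm ((esp ?S (\<lambda>b. coef K i b * rsign A b) (m i) - hermite (m i) (Y K A i)) *\<^sub>R v i)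
          \<le> norm ((C / sqrt K * norm (v i)) *\<^sub>R weight (Y K A) ^ m i)"
        proof (rule AE_I2)
          fix A
          have w0: "0 \<le> weight (Y K A)" using weight_ge_1[of "Y K A"] by linarith
          show "norm ((esp ?S (\<lambda>b. coef K i b * rsign A b) (m i) - hermite (m i) (Y K A i)) *\<^sub>R v i)
          \<le> norm ((C / sqrt K * norm (v i)) *\<^sub>R weight (Y K A) ^ m i)"
            using mult_right_mono[OF C(2)[OF K, of A] norm_ge_zero[of "v i"]] C(1) w0 by (simp add: abs_mult mult_ac)
        qed
      qed auto
      also have "\<dots> = (C / sqrt K * norm (v i)) * Lp_norm (cube ?S) p (\<lambda>A. weight (Y K A) ^ m i)"
        using C(1) by (subst Lp_norm_scaleR[OF p0]) simp
      also have "\<dots> \<le> (C / sqrt K * norm (v i)) * B powr (1 / p)" using C(1) by (intro mult_left_mono w) auto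
      finally show ?thesis by simp
    qed
    then show ?thesis by (intro exI[of _ "C * norm (v i) * B powr (1 / p)"]) auto
  qed
  then have "\<forall>i\<in>{..<k}. \<exists>C. \<forall>K>0. Lp_norm (cube (cubeK K)) p (\<lambda>A. (esp (cubeK K) (\<lambda>b. coef K i b * rsign A b) (m i) - hermite (m i) (Y K A i)) *\<^sub>R v i) \<le> C / sqrt K"
    by blast
  from bchoice[OF this] obtain C where C: "\<And>i K. i < k \<Longrightarrow> 0 < K \<Longrightarrow>
     Lp_norm (cube (cubeK K)) p (\<lambda>A. (esp (cubeK K) (\<lambda>b. coef K i b * rsign A b) (m i) - hermite (m i) (Y K A i)) *\<^sub>R v i) \<le> C i / sqrt K" by blast
  show ?thesis
  proof (rule Lim_null_comparison)
    show "\<forall>\<^sub>F K in sequentially. norm (Lp_norm (cube (cubeK (Suc K))) p (\<lambda>A. epoly (Suc K) m v A - hpoly m v (Y (Suc K) A))) \<le> (\<Sum>i<k. C i / sqrt (Suc K))"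
    proof (intro always_eventually allI)
      fix K
      let ?S = "cubeK (Suc K)"
      have "(\<lambda>A. epoly (Suc K) m v A - hpoly m v (Y (Suc K) A)) = (\<lambda>A. \<Sum>i<k. (esp ?S (\<lambda>b. coef (Suc K) i b * rsign A b) (m i) - hermite (m i) (Y (Suc K) A i)) *\<^sub>R v i)"
        by (rule ext) (simp add: epoly_def hpoly_def sum_subtractf scaleR_diff_left)
      then have "Lp_norm (cube ?S) p (\<lambda>A. epoly (Suc K) m v A - hpoly m v (Y (Suc K) A))
         \<le> (\<Sum>i<k. Lp_norm (cube ?S) p (\<lambda>A. (esp ?S (\<lambda>b. coef (Suc K) i b * rsign A b) (m i) - hermite (m i) (Y (Suc K) A i)) *\<^sub>R v i))"
        using p by (simp add: Lp_norm_sum)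
      also have "\<dots> \<le> (\<Sum>i<k. C i / sqrt (Suc K))" by (intro sum_mono C) auto
      finally show "norm (Lp_norm (cube ?S) p (\<lambda>A. epoly (Suc K) m v A - hpoly m v (Y (Suc K) A))) \<le> (\<Sum>i<k. C i / sqrt (Suc K))" by simp
    qed
    have "(\<lambda>K. c / sqrt (real (Suc K))) \<longlonglongrightarrow> 0" for c :: real by real_asymp
    then show "(\<lambda>K. \<Sum>i<k. C i / sqrt (Suc K)) \<longlonglongrightarrow> 0" by (intro tendsto_null_sum)
  qed
qed

lemma epoly_limit:
  fixes v :: "nat \<Rightarrow> 'b::real_normed_vector"
  assumes p: "1 \<le> p"
  shows "(\<lambda>K. Lp_norm (cube (cubeK (Suc K))) p (epoly (Suc K) m v)) \<longlonglongrightarrow> Lp_norm M p (\<lambda>w. hpoly m v (X w))"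
proof -
  have "(\<lambda>K. Lp_norm (cube (cubeK (Suc K))) p (epoly (Suc K) m v) - Lp_norm (cube (cubeK (Suc K))) p (\<lambda>A. hpoly m v (Y (Suc K) A))) \<longlonglongrightarrow> 0"
  proof (rule Lim_null_comparison[OF always_eventually epoly_hpoly_limit[OF p, of m v]], rule allI)
    fix K
    show "norm (Lp_norm (cube (cubeK (Suc K))) p (epoly (Suc K) m v) - Lp_norm (cube (cubeK (Suc K))) p (\<lambda>A. hpoly m v (Y (Suc K) A)))
      \<le> Lp_norm (cube (cubeK (Suc K))) p (\<lambda>A. epoly (Suc K) m v A - hpoly m v (Y (Suc K) A))"
      using Lp_norm_dist_le[OF Lp_cube[OF finite_cubeK, of "epoly (Suc K) m v"] Lp_cube[OF finite_cubeK, of "\<lambda>A. hpoly m v (Y (Suc K) A)"] p]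
      by simp
  qed
  from tendsto_add[OF this hpoly_cube_limit[OF p, of m v]] show ?thesis by simp
qed

text \<open>On the cube, rescaling the terms of \<open>epoly\<close> by \<open>c (m i)\<close> is
  exactly the multiplier acting on Walsh coefficients. The bound there has the same \<open>C\<close>
  for every block length, and both norms converge to their Gaussian versions.\<close>

lemma multiplier_transfer:
  fixes v :: "nat \<Rightarrow> 'b::real_normed_vector"
  assumes c: "mult_bounded TYPE('b) p c C" and p: "1 \<le> p"
  shows "Lp_norm M p (\<lambda>w. hpoly m (\<lambda>i. c (m i) *\<^sub>R v i) (X w)) \<le> C * Lp_norm M p (\<lambda>w. hpoly m v (X w))"
proof (rule LIMSEQ_le[OF epoly_limit[OF p, of m "\<lambda>i. c (m i) *\<^sub>R v i"] tendsto_mult_left[OF epoly_limit[OF p, of m v]]], rule exI[of _ 0], rule allI, rule impI)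
  fix K
  let ?S = "cubeK (Suc K)"
  define x where "x B = (\<Sum>i<k. (if card B = m i then \<Prod>b\<in>B. coef (Suc K) i b else 0) *\<^sub>R v i)" for B
  have e: "epoly (Suc K) m u = wsum ?S (\<lambda>B. \<Sum>i<k. (if card B = m i then \<Prod>b\<in>B. coef (Suc K) i b else 0) *\<^sub>R u i)" for u :: "nat \<Rightarrow> 'b"
    by (rule ext) (simp add: epoly_def wsum_sum esp_eq_wsum)
  have "epoly (Suc K) m v = wsum ?S x" unfolding e x_def ..
  moreover have "epoly (Suc K) m (\<lambda>i. c (m i) *\<^sub>R v i) = wsum ?S (\<lambda>B. c (card B) *\<^sub>R x B)"
    unfolding e x_def scaleR_sum_right
    by (rule arg_cong[where f="wsum ?S"], rule ext, rule sum.cong) auto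
  ultimately show "Lp_norm (cube ?S) p (epoly (Suc K) m (\<lambda>i. c (m i) *\<^sub>R v i)) \<le> C * Lp_norm (cube ?S) p (epoly (Suc K) m v)"
    using mult_boundedD[OF c finite_cubeK] by simp
qed

text \<open>Symmetric polynomials of different orders are exactly orthogonal on the cube, even for
  different coefficient systems. Exchanging them for Hermite polynomials costs
  \<open>1 / sqrt K\<close>, so the orthogonality holds in the limit for arbitrarily correlated
  variables.\<close>

lemma hermite_orthogonal:
  assumes ab: "a \<noteq> b" and k: "i < k" "l < k"
  shows "(\<integral>w. hermite a (W (h i) w) * hermite b (W (h l) w) \<partial>M) = 0"
proof -
  define \<Phi> where "\<Phi> x = hermite a (x i) * hermite b (x l)" for x :: "nat \<Rightarrow> real"
  obtain C where C: "0 \<le> C" "\<And>x. \<bar>hermite a (x i)\<bar> \<le> C * weight x ^ a" using hermite_le_weight[of a] k by blast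
  obtain D where D: "0 \<le> D" "\<And>x. \<bar>hermite b (x l)\<bar> \<le> D * weight x ^ b" using hermite_le_weight[of b] k by blast
  define ea eb where "ea K A = esp (cubeK K) (\<lambda>c. coef K i c * rsign A c) a" and "eb K A = esp (cubeK K) (\<lambda>c. coef K l c * rsign A c) b" for K A
  from esp_hermite_weight[of a] obtain C' where "0 \<le> C'" and qa: "\<forall>K>0. \<forall>A. \<forall>i<k. \<bar>esp (cubeK K) (\<lambda>b. coef K i b * rsign A b) a\<bar> \<le> C' * weight (Y K A) ^ a \<and>
     \<bar>esp (cubeK K) (\<lambda>b. coef K i b * rsign A b) a - hermite a (Y K A i)\<bar> \<le> C' / sqrt K * weight (Y K A) ^ a" by (elim exE conjE) (rule that)
  note C' = \<open>0 \<le> C'\<close>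
  have ea: "\<bar>ea K A\<bar> \<le> C' * weight (Y K A) ^ a" "\<bar>ea K A - hermite a (Y K A i)\<bar> \<le> C' / sqrt K * weight (Y K A) ^ a" if "0 < K" for K A
    using qa[rule_format, OF that k(1), of A] unfolding ea_def by auto
  from esp_hermite_weight[of b] obtain D' where "0 \<le> D'" and qb: "\<forall>K>0. \<forall>A. \<forall>i<k. \<bar>esp (cubeK K) (\<lambda>b. coef K i b * rsign A b) b\<bar> \<le> D' * weight (Y K A) ^ b \<and>
     \<bar>esp (cubeK K) (\<lambda>b. coef K i b * rsign A b) b - hermite b (Y K A i)\<bar> \<le> D' / sqrt K * weight (Y K A) ^ b" by (elim exE conjE) (rule that)
  note D' = \<open>0 \<le> D'\<close>
  have eb: "\<bar>eb K A - hermite b (Y K A l)\<bar> \<le> D' / sqrt K * weight (Y K A) ^ b" if "0 < K" for K A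
    using qb[rule_format, OF that k(2), of A] unfolding eb_def by auto
  have w0: "0 \<le> weight x ^ d" for x d using weight_ge_1[of x] by simp
  have "conv \<Phi>"
  proof (rule conv_continuous[where C="C * D" and d="a + b"])
    show "continuous_on UNIV \<Phi>" unfolding \<Phi>_def
      by (intro continuous_on_mult continuous_on_compose2[OF continuous_on_hermite continuous_on_product_coordinates]) auto
    show "\<bar>\<Phi> x\<bar> \<le> C * D * weight x ^ (a + b)" for x
    proof -
      have "\<bar>\<Phi> x\<bar> \<le> (C * weight x ^ a) * (D * weight x ^ b)"
        unfolding \<Phi>_def abs_mult using C D w0 by (intro mult_mono) auto
      then show ?thesis by (simp add: power_add mult_ac)
    qed
    have "hermite a \<in> borel_measurable borel" "hermite b \<in> borel_measurable borel"
      by (rule borel_measurable_continuous_onI[OF continuous_on_hermite])+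
    then show "(\<lambda>w. \<Phi> (X w)) \<in> borel_measurable M" unfolding \<Phi>_def by measurable
  qed
  then have lim: "(\<lambda>K. cmean (Suc K) \<Phi>) \<longlonglongrightarrow> (\<integral>w. \<Phi> (X w) \<partial>M)" by (simp add: conv_def)
  obtain B where B: "0 \<le> B" "\<And>K. 0 < K \<Longrightarrow> cmean K (\<lambda>x. weight x ^ (a + b)) \<le> B" using weight_bound[of "a + b"] by blast
  have bound: "\<bar>cmean K \<Phi>\<bar> \<le> ((C' * D + C' * D') * B) / sqrt K" if K: "0 < K" for K
  proof -
    let ?S = "cubeK K"
    have orth: "(\<Sum>A\<in>Pow ?S. ea K A * eb K A) = 0" unfolding ea_def eb_def by (rule esp_orthogonal[OF finite_cubeK ab])
    have pt: "\<bar>\<Phi> (Y K A) - ea K A * eb K A\<bar> \<le> (C' * D + C' * D') / sqrt K * weight (Y K A) ^ (a + b)" for A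
    proof -
      have "\<Phi> (Y K A) - ea K A * eb K A = - ((ea K A - hermite a (Y K A i)) * hermite b (Y K A l)) - ea K A * (eb K A - hermite b (Y K A l))"
        by (simp add: \<Phi>_def algebra_simps)
      then have "\<bar>\<Phi> (Y K A) - ea K A * eb K A\<bar> \<le> \<bar>ea K A - hermite a (Y K A i)\<bar> * \<bar>hermite b (Y K A l)\<bar> + \<bar>ea K A\<bar> * \<bar>eb K A - hermite b (Y K A l)\<bar>"
        unfolding abs_mult[symmetric] by linarith
      also have "\<dots> \<le> (C' / sqrt K * weight (Y K A) ^ a) * (D * weight (Y K A) ^ b) + (C' * weight (Y K A) ^ a) * (D' / sqrt K * weight (Y K A) ^ b)"
        using C' D D' K w0 ea eb by (intro add_mono mult_mono) auto
      also have "\<dots> = (C' * D + C' * D') / sqrt K * weight (Y K A) ^ (a + b)"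
        by (simp add: power_add add_divide_distrib algebra_simps)
      finally show ?thesis .
    qed
    have "cmean K \<Phi> = (\<Sum>A\<in>Pow ?S. \<Phi> (Y K A) - ea K A * eb K A) / 2 ^ card ?S"
      unfolding cmean_def sum_subtractf orth by simp
    then have "\<bar>cmean K \<Phi>\<bar> \<le> (\<Sum>A\<in>Pow ?S. \<bar>\<Phi> (Y K A) - ea K A * eb K A\<bar>) / 2 ^ card ?S"
      by (simp add: divide_right_mono)
    also have "\<dots> \<le> (\<Sum>A\<in>Pow ?S. (C' * D + C' * D') / sqrt K * weight (Y K A) ^ (a + b)) / 2 ^ card ?S"
      by (intro divide_right_mono sum_mono pt) auto
    also have "\<dots> = (C' * D + C' * D') / sqrt K * cmean K (\<lambda>x. weight x ^ (a + b))"
      unfolding cmean_def sum_distrib_left[symmetric] by simp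
    also have "\<dots> \<le> (C' * D + C' * D') / sqrt K * B" using C' D D' by (intro mult_left_mono B(2) K) auto
    finally show ?thesis by simp
  qed
  have "(\<lambda>K. cmean (Suc K) \<Phi>) \<longlonglongrightarrow> 0"
  proof (rule Lim_null_comparison)
    show "\<forall>\<^sub>F K in sequentially. norm (cmean (Suc K) \<Phi>) \<le> ((C' * D + C' * D') * B) / sqrt (real (Suc K))"
    proof (intro always_eventually allI)
      fix K show "norm (cmean (Suc K) \<Phi>) \<le> ((C' * D + C' * D') * B) / sqrt (real (Suc K))"
        using bound[of "Suc K"] by (simp del: of_nat_Suc)
    qed
    have "(\<lambda>K. c / sqrt (real (Suc K))) \<longlonglongrightarrow> 0" for c :: real by real_asymp
    then show "(\<lambda>K. ((C' * D + C' * D') * B) / sqrt (real (Suc K))) \<longlonglongrightarrow> 0" .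
  qed
  then have "(\<integral>w. \<Phi> (X w) \<partial>M) = 0" by (rule LIMSEQ_unique[OF lim])
  then show ?thesis using k by (simp add: \<Phi>_def X_def)
qed

end

context isonormal
begin

lemma hsum_multiplier:
  fixes v :: "nat \<Rightarrow> 'b::real_normed_vector"
  assumes c: "mult_bounded TYPE('b) p c C" and p: "1 \<le> p" and h: "\<And>i. i < k \<Longrightarrow> norm (h i) = 1"
  shows "Lp_norm M p (hsum k m h (\<lambda>i. c (m i) *\<^sub>R v i)) \<le> C * Lp_norm M p (hsum k m h v)"
proof -
  obtain n :: nat and t where t: "\<And>i l. i < k \<Longrightarrow> l < k \<Longrightarrow> inner (h i) (h l) = (\<Sum>j<n. t i j * t l j :: real)"
    using gram_representation[of k h] by blast
  interpret gaussian_vector M W k n h t by unfold_locales (use t h in auto)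
  have "hsum k m h u = (\<lambda>w. hpoly m u (X w))" for u :: "nat \<Rightarrow> 'b"
    by (rule ext) (simp add: hsum_def hpoly_def X_def)
  then show ?thesis using multiplier_transfer[OF c p, of m v] by simp
qed

lemma expectation_hermite_mult:
  assumes "a \<noteq> b" "norm g = 1" "norm h = 1"
  shows "(\<integral>w. hermite a (W g w) * hermite b (W h w) \<partial>M) = 0"
proof -
  define f where "f i = (if i = (0::nat) then g else h)" for i
  obtain n :: nat and t where t: "\<And>i l. i < 2 \<Longrightarrow> l < 2 \<Longrightarrow> inner (f i) (f l) = (\<Sum>j<n. t i j * t l j :: real)"
    using gram_representation[of 2 f] by blast
  interpret gaussian_vector M W 2 n f t by unfold_locales (use t assms in \<open>auto simp: f_def\<close>)
  show ?thesis using hermite_orthogonal[OF assms(1), of 0 1] by (simp add: f_def)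
qed

lemma moments_hermite: "moments (\<lambda>w. hermite m (W h w))"
proof -
  obtain C where C: "0 \<le> C" "\<And>x. \<bar>hermite m x\<bar> \<le> C * (1 + \<bar>x\<bar>) ^ m" using hermite_growth[of m] by blast
  have [measurable]: "hermite m \<in> borel_measurable borel" by (rule borel_measurable_continuous_onI[OF continuous_on_hermite])
  have a: "moments (\<lambda>w. \<bar>W h w\<bar>)" by (rule moments_mono[OF _ moments_W[of h]]) auto
  show ?thesis
  proof (rule moments_mono)
    show "moments (\<lambda>w. C * (1 + \<bar>W h w\<bar>) ^ m)" by (intro moments_mult moments_power moments_add moments_const a)
    show "AE w in M. \<bar>hermite m (W h w)\<bar> \<le> \<bar>C * (1 + \<bar>W h w\<bar>) ^ m\<bar>"
      using C by (auto intro!: AE_I2 order_trans[OF C(2)] simp: abs_mult)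
  qed measurable
qed

lemma hsum_Lp: "1 \<le> p \<Longrightarrow> hsum k m h v \<in> Lp M p"
  unfolding hsum_def[abs_def] by (intro Lp_sum Lp_moments_scaleR moments_hermite)

end

section \<open>Chaos projections\<close>

text \<open>The discriminant condition, evaluated at the minimum \<open>t = I / B\<close>; for
  \<open>B = 0\<close> the expression is affine in \<open>t\<close>, and a nonzero slope would make
  it negative somewhere.\<close>

lemma quadratic_nonneg:
  fixes A B I :: real
  assumes q: "\<And>t. 0 \<le> A - 2 * t * I + t\<^sup>2 * B" and B: "0 \<le> B"
  shows "I\<^sup>2 \<le> A * B"
proof (cases "B = 0")
  case True
  have "I = 0"
  proof (rule ccontr)
    assume "I \<noteq> 0"
    then show False using q[of "(A + 1) / (2 * I)"] True by simp
  qed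
  then show ?thesis using True by simp
next
  case False
  then have "A - 2 * (I / B) * I + (I / B)\<^sup>2 * B = A - I\<^sup>2 / B" by (simp add: power2_eq_square field_simps)
  then have "I\<^sup>2 / B \<le> A" using q[of "I / B"] by simp
  then show ?thesis using False B by (simp add: pos_divide_le_eq)
qed

section \<open>Hilbert space geometry of square integrable functions\<close>

lemma L2_mult_integrable:
  fixes f g :: "'a \<Rightarrow> real"
  assumes "f \<in> Lp M 2" "g \<in> Lp M 2"
  shows "integrable M (\<lambda>w. f w * g w)"
proof (rule Bochner_Integration.integrable_bound)
  have [measurable]: "f \<in> borel_measurable M" "g \<in> borel_measurable M"
    using assms by (auto simp: Lp_def strongly_measurable_real_iff)
  show "integrable M (\<lambda>w. norm (f w) powr 2 + norm (g w) powr 2)" using assms by (simp add: Lp_def)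
  have "\<bar>a * b\<bar> \<le> a\<^sup>2 + b\<^sup>2" for a b :: real
  proof -
    have "0 \<le> \<bar>a\<bar> * \<bar>b\<bar>" by simp
    then show ?thesis using sum_squares_bound[of "\<bar>a\<bar>" "\<bar>b\<bar>"] unfolding abs_mult power2_abs by linarith
  qed
  then show "AE w in M. norm (f w * g w) \<le> norm (norm (f w) powr 2 + norm (g w) powr 2)" by simp
qed (use assms in \<open>auto simp: Lp_def strongly_measurable_real_iff\<close>)

lemma L2_norm_square: "(Lp_norm M 2 f)\<^sup>2 = (\<integral>w. f w * f w \<partial>M)" for f :: "'a \<Rightarrow> real"
  using Lp_norm_powr[of 2 M f] by (simp add: power2_eq_square)

lemma L2_norm_square_diff:
  fixes f g :: "'a \<Rightarrow> real"
  assumes f: "f \<in> Lp M 2" and g: "g \<in> Lp M 2"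
  shows "(Lp_norm M 2 (\<lambda>w. f w - t * g w))\<^sup>2 = (Lp_norm M 2 f)\<^sup>2 - 2 * t * (\<integral>w. f w * g w \<partial>M) + t\<^sup>2 * (Lp_norm M 2 g)\<^sup>2"
proof -
  note i = L2_mult_integrable[OF f f] L2_mult_integrable[OF f g] L2_mult_integrable[OF g g]
  have "(Lp_norm M 2 (\<lambda>w. f w - t * g w))\<^sup>2 = (\<integral>w. f w * f w - 2 * t * (f w * g w) + t\<^sup>2 * (g w * g w) \<partial>M)"
    unfolding L2_norm_square by (rule Bochner_Integration.integral_cong) (auto simp: algebra_simps power2_eq_square)
  then show ?thesis unfolding L2_norm_square using i by simp
qed

lemma L2_Cauchy_Schwarz:
  fixes f g :: "'a \<Rightarrow> real"
  assumes "f \<in> Lp M 2" "g \<in> Lp M 2"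
  shows "\<bar>\<integral>w. f w * g w \<partial>M\<bar> \<le> Lp_norm M 2 f * Lp_norm M 2 g"
proof -
  have "(\<integral>w. f w * g w \<partial>M)\<^sup>2 \<le> (Lp_norm M 2 f)\<^sup>2 * (Lp_norm M 2 g)\<^sup>2"
    by (rule quadratic_nonneg) (simp_all flip: L2_norm_square_diff[OF assms])
  then have "\<bar>\<integral>w. f w * g w \<partial>M\<bar>\<^sup>2 \<le> (Lp_norm M 2 f * Lp_norm M 2 g)\<^sup>2" by (simp add: power_mult_distrib)
  then show ?thesis by (rule power2_le_imp_le) simp
qed

text \<open>The projection theorem for functions in place of classes: the parallelogram law makes a
  minimizing sequence Cauchy, its limit lies in \<open>V\<close> and attains the minimal distance,
  and varying it along \<open>k\<close> gives orthogonality.\<close>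

lemma (in prob_space) L2_projection:
  fixes V :: "('a \<Rightarrow> real) set"
  assumes V: "V \<subseteq> Lp M 2" "(\<lambda>w. 0) \<in> V"
    and add: "\<And>f g. f \<in> V \<Longrightarrow> g \<in> V \<Longrightarrow> (\<lambda>w. f w + g w) \<in> V"
    and scale: "\<And>c f. f \<in> V \<Longrightarrow> (\<lambda>w. c * f w) \<in> V"
    and closed: "\<And>f. f \<in> Lp M 2 \<Longrightarrow> (\<And>e. 0 < e \<Longrightarrow> \<exists>g\<in>V. Lp_norm M 2 (\<lambda>w. f w - g w) < e) \<Longrightarrow> f \<in> V"
    and f: "f \<in> Lp M 2"
  shows "\<exists>g\<in>V. \<forall>k\<in>V. (\<integral>w. (f w - g w) * k w \<partial>M) = 0"
proof -
  define d where "d g = Lp_norm M 2 (\<lambda>w. f w - g w)" for g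
  define q where "q = (INF g\<in>V. (d g)\<^sup>2)"
  have bdd: "bdd_below ((\<lambda>g. (d g)\<^sup>2) ` V)" by (rule bdd_belowI[of _ 0]) auto
  have q: "q \<le> (d g)\<^sup>2" if "g \<in> V" for g unfolding q_def by (rule cINF_lower[OF bdd that])
  have "\<exists>g\<in>V. (d g)\<^sup>2 < q + inverse (real (Suc n))" for n
    using cINF_less_iff[of V "\<lambda>g. (d g)\<^sup>2" "q + inverse (real (Suc n))"] bdd V(2)
    unfolding q_def[symmetric] by (metis empty_iff inverse_positive_iff_positive less_add_same_cancel1 of_nat_0_less_iff zero_less_Suc)
  then have "\<forall>n. \<exists>g. g \<in> V \<and> (d g)\<^sup>2 < q + inverse (real (Suc n))" by blast
  from choice[OF this] obtain g where g: "\<And>n. g n \<in> V" "\<And>n. (d (g n))\<^sup>2 < q + inverse (real (Suc n))" by blast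
  have gL: "g n \<in> Lp M 2" for n using g(1) V(1) by blast
  have par: "(Lp_norm M 2 (\<lambda>w. g m w - g n w))\<^sup>2 \<le> 2 * inverse (real (Suc m)) + 2 * inverse (real (Suc n))" for m n
  proof -
    let ?a = "\<lambda>w. f w - g m w" and ?b = "\<lambda>w. f w - g n w"
    have a: "?a \<in> Lp M 2" and b: "?b \<in> Lp M 2" using Lp_diff[OF f gL] by auto
    define I where "I = (\<integral>w. ?a w * ?b w \<partial>M)"
    have "(Lp_norm M 2 (\<lambda>w. ?a w - 1 * ?b w))\<^sup>2 = (d (g m))\<^sup>2 - 2 * I + (d (g n))\<^sup>2"
      unfolding L2_norm_square_diff[OF a b] I_def d_def by simp
    moreover have "Lp_norm M 2 (\<lambda>w. g m w - g n w) = Lp_norm M 2 (\<lambda>w. ?a w - 1 * ?b w)"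
      by (subst Lp_norm_minus_commute) simp
    moreover have "(Lp_norm M 2 (\<lambda>w. ?a w - (-1) * ?b w))\<^sup>2 = (d (g m))\<^sup>2 + 2 * I + (d (g n))\<^sup>2"
      unfolding L2_norm_square_diff[OF a b] I_def d_def by simp
    \<comment> \<open>The midpoint of \<open>g m\<close> and \<open>g n\<close> belongs to
      \<open>V\<close>, so its squared distance from \<open>f\<close> is at least
      \<open>q\<close>.\<close>
    moreover have "4 * q \<le> (Lp_norm M 2 (\<lambda>w. ?a w - (-1) * ?b w))\<^sup>2"
    proof -
      have "(\<lambda>w. ?a w - (-1) * ?b w) = (\<lambda>w. 2 *\<^sub>R (f w - (1/2) * (g m w + g n w)))" by (auto simp: algebra_simps)
      then have "Lp_norm M 2 (\<lambda>w. ?a w - (-1) * ?b w) = 2 * d (\<lambda>w. (1/2) * (g m w + g n w))"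
        unfolding d_def by (simp add: Lp_norm_scaleR del: scaleR_conv_of_real real_scaleR_def)
      moreover have "q \<le> (d (\<lambda>w. (1/2) * (g m w + g n w)))\<^sup>2" by (intro q scale add g(1))
      ultimately show ?thesis by (simp add: power_mult_distrib)
    qed
    ultimately show ?thesis using g(2)[of m] g(2)[of n] by simp
  qed
  have "\<exists>N. \<forall>m\<ge>N. \<forall>n\<ge>N. Lp_norm M 2 (\<lambda>w. g m w - g n w) < e" if e: "0 < e" for e
  proof -
    obtain N where N: "inverse (real (Suc N)) < e\<^sup>2 / 4" using reals_Archimedean[of "e\<^sup>2 / 4"] e by auto
    have "Lp_norm M 2 (\<lambda>w. g m w - g n w) < e" if "N \<le> m" "N \<le> n" for m n
    proof -
      have "inverse (real (Suc m)) \<le> inverse (real (Suc N))" "inverse (real (Suc n)) \<le> inverse (real (Suc N))"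
        using that by (auto intro!: le_imp_inverse_le)
      then have "(Lp_norm M 2 (\<lambda>w. g m w - g n w))\<^sup>2 < e\<^sup>2" using par[of m n] N by linarith
      then show ?thesis using e by (intro power2_less_imp_less[of _ e]) auto
    qed
    then show ?thesis by blast
  qed
  from Lp_complete[OF gL _ this] obtain h where h: "h \<in> Lp M 2" "(\<lambda>n. Lp_norm M 2 (\<lambda>w. g n w - h w)) \<longlonglongrightarrow> 0" by auto
  have hV: "h \<in> V"
  proof (rule closed[OF h(1)])
    fix e :: real assume "0 < e"
    from order_tendstoD(2)[OF h(2) this] obtain n where "Lp_norm M 2 (\<lambda>w. g n w - h w) < e"
      by (auto simp: eventually_sequentially)
    then show "\<exists>g\<in>V. Lp_norm M 2 (\<lambda>w. h w - g w) < e"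
      using g(1) by (subst Lp_norm_minus_commute) blast
  qed
  have "(d h)\<^sup>2 \<le> q"
  proof (rule LIMSEQ_le_const)
    have "(\<lambda>n. d (g n)) \<longlonglongrightarrow> d h"
    proof (rule LIM_zero_cancel, rule Lim_null_comparison[OF always_eventually h(2)], rule allI)
      fix n
      have "\<bar>d (g n) - d h\<bar> \<le> Lp_norm M 2 (\<lambda>w. (f w - g n w) - (f w - h w))"
        unfolding d_def by (rule Lp_norm_dist_le[OF Lp_diff[OF f gL] Lp_diff[OF f h(1)]]) auto
      then show "norm (d (g n) - d h) \<le> Lp_norm M 2 (\<lambda>w. g n w - h w)"
        by (subst Lp_norm_minus_commute) (simp add: algebra_simps)
    qed
    then have "(\<lambda>n. q + inverse (real (Suc n)) - (d (g n))\<^sup>2) \<longlonglongrightarrow> q + 0 - (d h)\<^sup>2"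
      by (intro tendsto_diff tendsto_add tendsto_power tendsto_const LIMSEQ_inverse_real_of_nat)
    then show "(\<lambda>n. (d h)\<^sup>2 + (q + inverse (real (Suc n)) - (d (g n))\<^sup>2)) \<longlonglongrightarrow> q"
      using tendsto_add[OF tendsto_const[of "(d h)\<^sup>2"]] by fastforce
    show "\<exists>N. \<forall>n\<ge>N. (d h)\<^sup>2 \<le> (d h)\<^sup>2 + (q + inverse (real (Suc n)) - (d (g n))\<^sup>2)"
      using g(2) by (intro exI[of _ 0]) (auto intro: less_imp_le)
  qed
  have "(\<integral>w. (f w - h w) * k w \<partial>M) = 0" if k: "k \<in> V" for k
  proof -
    have kL: "k \<in> Lp M 2" using k V(1) by blast
    have fh: "(\<lambda>w. f w - h w) \<in> Lp M 2" by (rule Lp_diff[OF f h(1)]) simp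
    \<comment> \<open>Minimality at \<open>h\<close> gives a quadratic in \<open>t\<close> that is
      nonnegative and has constant term 0, so its linear coefficient vanishes.\<close>
    have "0 \<le> 0 - 2 * t * (\<integral>w. (f w - h w) * k w \<partial>M) + t\<^sup>2 * (Lp_norm M 2 k)\<^sup>2" for t
    proof -
      have "q \<le> (d (\<lambda>w. h w + t * k w))\<^sup>2" by (intro q add hV scale k)
      also have "d (\<lambda>w. h w + t * k w) = Lp_norm M 2 (\<lambda>w. (f w - h w) - t * k w)"
        unfolding d_def by (simp add: algebra_simps)
      finally show ?thesis using L2_norm_square_diff[OF fh kL, of t] \<open>(d h)\<^sup>2 \<le> q\<close> unfolding d_def by linarith
    qed
    from quadratic_nonneg[OF this] show ?thesis by simp
  qed
  then show ?thesis using hV by blast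
qed

section \<open>Orthogonal projections onto the chaoses\<close>

context isonormal
begin

lemma chaos_L2: "chaos M W m \<subseteq> Lp M 2"
  by (auto simp: chaos_def)

abbreviation hspan :: "nat \<Rightarrow> ('w \<Rightarrow> real) set" where
  "hspan m \<equiv> fun_span {\<lambda>w. hermite m (W h w) | h. norm h = 1}"

lemma hspan_L2:
  assumes "f \<in> hspan m"
  shows "f \<in> Lp M 2"
proof -
  obtain k c u where "lin_comb {\<lambda>w. hermite m (W h w) | h. norm h = 1} f k c u"
    using fun_span_memE[OF assms] by blast
  note f = lin_combD[OF this]
  show ?thesis unfolding f(1)
  proof (intro Lp_sum Lp_scaleR)
    fix i assume "i \<in> {..<k}"
    then show "u i \<in> Lp M 2" using f(2)[of i] momentsD[OF moments_hermite] by auto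
  qed simp
qed

lemma hspan_chaos: "f \<in> hspan m \<Longrightarrow> f \<in> chaos M W m"
  unfolding chaos_def by (auto intro!: hspan_L2 bexI[of _ f])

lemma chaos_approx:
  assumes "f \<in> chaos M W m" "0 < e"
  obtains g where "g \<in> hspan m" "Lp_norm M 2 (\<lambda>w. f w - g w) < e"
  using assms unfolding chaos_def by blast

lemma chaosI:
  "f \<in> Lp M 2 \<Longrightarrow> (\<And>e. 0 < e \<Longrightarrow> \<exists>g\<in>hspan m. Lp_norm M 2 (\<lambda>w. f w - g w) < e) \<Longrightarrow> f \<in> chaos M W m"
  unfolding chaos_def by blast

lemma chaos_add:
  assumes f: "f \<in> chaos M W m" and g: "g \<in> chaos M W m"
  shows "(\<lambda>\<omega>. f \<omega> + g \<omega>) \<in> chaos M W m"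
proof (rule chaosI)
  have L: "f \<in> Lp M 2" "g \<in> Lp M 2" using f g chaos_L2 by auto
  then show "(\<lambda>\<omega>. f \<omega> + g \<omega>) \<in> Lp M 2" by (rule Lp_add) simp
  fix e :: real assume e: "0 < e"
  obtain u where u: "u \<in> hspan m" "Lp_norm M 2 (\<lambda>\<omega>. f \<omega> - u \<omega>) < e / 2" using chaos_approx[OF f, of "e / 2"] e by auto
  obtain v where v: "v \<in> hspan m" "Lp_norm M 2 (\<lambda>\<omega>. g \<omega> - v \<omega>) < e / 2" using chaos_approx[OF g, of "e / 2"] e by auto
  have "Lp_norm M 2 (\<lambda>\<omega>. (f \<omega> - u \<omega>) + (g \<omega> - v \<omega>)) \<le> Lp_norm M 2 (\<lambda>\<omega>. f \<omega> - u \<omega>) + Lp_norm M 2 (\<lambda>\<omega>. g \<omega> - v \<omega>)"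
    by (intro Lp_norm_triangle Lp_diff L hspan_L2[OF u(1)] hspan_L2[OF v(1)]) auto
  then have "Lp_norm M 2 (\<lambda>\<omega>. (f \<omega> + g \<omega>) - (u \<omega> + v \<omega>)) < e" using u(2) v(2) by (simp add: algebra_simps)
  then show "\<exists>w\<in>hspan m. Lp_norm M 2 (\<lambda>\<omega>. (f \<omega> + g \<omega>) - w \<omega>) < e"
    by (rule bexI[of _ "\<lambda>\<omega>. u \<omega> + v \<omega>"]) (rule fun_span_add[OF u(1) v(1)])
qed

lemma chaos_scale:
  assumes f: "f \<in> chaos M W m"
  shows "(\<lambda>\<omega>. c * f \<omega>) \<in> chaos M W m"
proof (rule chaosI)
  have L: "f \<in> Lp M 2" using f chaos_L2 by auto
  then show "(\<lambda>\<omega>. c * f \<omega>) \<in> Lp M 2" using Lp_scaleR[of f M 2 c] by simp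
  fix e :: real assume e: "0 < e"
  then have "0 < e / (\<bar>c\<bar> + 1)" by (simp add: divide_pos_pos)
  then obtain u where u: "u \<in> hspan m" "Lp_norm M 2 (\<lambda>\<omega>. f \<omega> - u \<omega>) < e / (\<bar>c\<bar> + 1)" using chaos_approx[OF f] by blast
  have "Lp_norm M 2 (\<lambda>\<omega>. c *\<^sub>R (f \<omega> - u \<omega>)) = \<bar>c\<bar> * Lp_norm M 2 (\<lambda>\<omega>. f \<omega> - u \<omega>)" by (rule Lp_norm_scaleR) simp
  also have "\<dots> \<le> (\<bar>c\<bar> + 1) * Lp_norm M 2 (\<lambda>\<omega>. f \<omega> - u \<omega>)" by (intro mult_right_mono) auto
  also have "\<dots> < e" using u(2) by (simp add: pos_less_divide_eq mult.commute)
  finally have "Lp_norm M 2 (\<lambda>\<omega>. c * f \<omega> - c *\<^sub>R u \<omega>) < e" by (simp add: algebra_simps)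
  then show "\<exists>w\<in>hspan m. Lp_norm M 2 (\<lambda>\<omega>. c * f \<omega> - w \<omega>) < e"
    by (rule bexI[of _ "\<lambda>\<omega>. c *\<^sub>R u \<omega>"]) (rule fun_span_scaleR[OF u(1)])
qed

lemma chaos_closed:
  assumes f: "f \<in> Lp M 2" and a: "\<And>e. 0 < e \<Longrightarrow> \<exists>g\<in>chaos M W m. Lp_norm M 2 (\<lambda>\<omega>. f \<omega> - g \<omega>) < e"
  shows "f \<in> chaos M W m"
proof (rule chaosI[OF f])
  fix e :: real assume e: "0 < e"
  obtain g where g: "g \<in> chaos M W m" "Lp_norm M 2 (\<lambda>\<omega>. f \<omega> - g \<omega>) < e / 2" using a[of "e / 2"] e by auto
  obtain u where u: "u \<in> hspan m" "Lp_norm M 2 (\<lambda>\<omega>. g \<omega> - u \<omega>) < e / 2" using chaos_approx[OF g(1), of "e / 2"] e by auto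
  have gL: "g \<in> Lp M 2" using g(1) chaos_L2 by auto
  have "Lp_norm M 2 (\<lambda>\<omega>. f \<omega> - u \<omega>) < e"
    using Lp_norm_diff_triangle[OF f gL hspan_L2[OF u(1)]] g(2) u(2) by simp
  then show "\<exists>w\<in>hspan m. Lp_norm M 2 (\<lambda>\<omega>. f \<omega> - w \<omega>) < e" using u(1) by (rule bexI)
qed

lemma chaos_proj:
  assumes "f \<in> Lp M 2"
  shows "chaos_proj M W m f \<in> chaos M W m"
    "\<And>k. k \<in> chaos M W m \<Longrightarrow> (\<integral>w. (f w - chaos_proj M W m f w) * k w \<partial>M) = 0"
proof -
  have "\<exists>g\<in>chaos M W m. \<forall>k\<in>chaos M W m. (\<integral>w. (f w - g w) * k w \<partial>M) = 0"
    by (rule L2_projection[OF chaos_L2 hspan_chaos[OF fun_span_zero] chaos_add chaos_scale chaos_closed assms])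
  then have "\<exists>g. g \<in> chaos M W m \<and> (\<forall>k\<in>chaos M W m. (\<integral>w. (f w - g w) * k w \<partial>M) = 0)" by (simp only: Bex_def)
  note s = someI_ex[OF this, folded chaos_proj_def]
  show "chaos_proj M W m f \<in> chaos M W m" using s ..
  show "(\<integral>w. (f w - chaos_proj M W m f w) * k w \<partial>M) = 0" if "k \<in> chaos M W m" for k
    using s[THEN conjunct2] that by (rule bspec)
qed

lemma chaos_proj_L2: "f \<in> Lp M 2 \<Longrightarrow> chaos_proj M W m f \<in> Lp M 2"
  using chaos_proj(1) chaos_L2 by blast

text \<open>The difference of two candidates lies in the chaos and is orthogonal to itself. As
  \<open>chaos_proj\<close> only selects some representative, its values are computed through this
  characterization.\<close>

lemma chaos_proj_unique:
  assumes f: "f \<in> Lp M 2" and g: "g \<in> chaos M W m"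
    and orth: "\<And>k. k \<in> chaos M W m \<Longrightarrow> (\<integral>w. (f w - g w) * k w \<partial>M) = 0"
  shows "AE w in M. chaos_proj M W m f w = g w"
proof -
  let ?J = "chaos_proj M W m f"
  let ?k = "\<lambda>w. ?J w + (-1) * g w"
  have k: "?k \<in> chaos M W m" by (intro chaos_add chaos_scale chaos_proj f g)
  have L: "?k \<in> Lp M 2" "g \<in> Lp M 2" "?J \<in> Lp M 2" using k g chaos_proj(1)[OF f] chaos_L2 by blast+
  have i: "integrable M (\<lambda>w. (f w - g w) * ?k w)" "integrable M (\<lambda>w. (f w - ?J w) * ?k w)"
    by (intro L2_mult_integrable Lp_diff L f; simp)+
  have "(Lp_norm M 2 ?k)\<^sup>2 = (\<integral>w. (f w - g w) * ?k w - (f w - ?J w) * ?k w \<partial>M)"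
    unfolding L2_norm_square by (rule Bochner_Integration.integral_cong) (auto simp: algebra_simps)
  also have "\<dots> = 0" using Bochner_Integration.integral_diff[OF i] orth[OF k] chaos_proj(2)[OF f k] by simp
  finally have "Lp_norm M 2 ?k = 0" by simp
  then have "AE w in M. ?k w = 0" using Lp_norm_eq_0_iff[OF L(1)] by simp
  then show ?thesis by eventually_elim simp
qed

lemma chaos_proj_lincomb:
  assumes f: "f \<in> Lp M 2" and g: "g \<in> Lp M 2"
  shows "AE w in M. chaos_proj M W m (\<lambda>w. f w + c * g w) w = chaos_proj M W m f w + c * chaos_proj M W m g w"
proof (rule chaos_proj_unique)
  show "(\<lambda>w. f w + c * g w) \<in> Lp M 2" using Lp_add[OF f Lp_scaleR[OF g, of c]] by simp
  show "(\<lambda>w. chaos_proj M W m f w + c * chaos_proj M W m g w) \<in> chaos M W m"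
    by (intro chaos_add chaos_scale chaos_proj f g)
  fix k assume k: "k \<in> chaos M W m"
  then have kL: "k \<in> Lp M 2" using chaos_L2 by blast
  have i: "integrable M (\<lambda>w. (f w - chaos_proj M W m f w) * k w)" "integrable M (\<lambda>w. c * ((g w - chaos_proj M W m g w) * k w))"
    by (intro integrable_mult_right L2_mult_integrable Lp_diff kL f g chaos_proj_L2; simp)+
  have "(\<integral>w. (f w + c * g w - (chaos_proj M W m f w + c * chaos_proj M W m g w)) * k w \<partial>M)
     = (\<integral>w. (f w - chaos_proj M W m f w) * k w + c * ((g w - chaos_proj M W m g w) * k w) \<partial>M)"
    by (rule Bochner_Integration.integral_cong) (auto simp: algebra_simps)
  also have "\<dots> = 0" unfolding Bochner_Integration.integral_add[OF i] by (simp add: chaos_proj(2) f g k)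
  finally show "(\<integral>w. (f w + c * g w - (chaos_proj M W m f w + c * chaos_proj M W m g w)) * k w \<partial>M) = 0" .
qed

lemma chaos_proj_AE_zero:
  assumes f: "f \<in> Lp M 2" and z: "AE w in M. f w = 0"
  shows "AE w in M. chaos_proj M W m f w = 0"
proof (rule chaos_proj_unique[OF f])
  show "(\<lambda>w. 0) \<in> chaos M W m" by (rule hspan_chaos[OF fun_span_zero])
  show "(\<integral>w. (f w - 0) * k w \<partial>M) = 0" if "k \<in> chaos M W m" for k
    by (rule integral_eq_zero_AE) (use z in auto)
qed

text \<open>Orthogonality to the generators extends to their closure by the Cauchy-Schwarz
  inequality.\<close>

lemma hermite_orthogonal_chaos:
  assumes ab: "a \<noteq> b" and h: "norm h = 1" and k: "k \<in> chaos M W b"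
  shows "(\<integral>w. hermite a (W h w) * k w \<partial>M) = 0"
proof -
  let ?H = "\<lambda>w. hermite a (W h w)"
  have HL: "?H \<in> Lp M 2" by (rule momentsD[OF moments_hermite]) simp
  have kL: "k \<in> Lp M 2" using k chaos_L2 by blast
  define I where "I = (\<integral>w. ?H w * k w \<partial>M)"
  have "\<bar>I\<bar> \<le> Lp_norm M 2 ?H * e" if e: "0 < e" for e
  proof -
    obtain g where g: "g \<in> hspan b" "Lp_norm M 2 (\<lambda>w. k w - g w) < e" by (rule chaos_approx[OF k e])
    obtain n c u where "lin_comb {\<lambda>w. hermite b (W h w) | h. norm h = 1} g n c u"
      using fun_span_memE[OF g(1)] by blast
    note g' = lin_combD[OF this]
    have u: "integrable M (\<lambda>w. c i * (?H w * u i w))" "(\<integral>w. ?H w * u i w \<partial>M) = 0" if i: "i < n" for i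
    proof -
      obtain h' where "norm h' = 1" "u i = (\<lambda>w. hermite b (W h' w))" using g'(2)[OF i] by blast
      then show "(\<integral>w. ?H w * u i w \<partial>M) = 0" "integrable M (\<lambda>w. c i * (?H w * u i w))"
        using expectation_hermite_mult[OF ab h] L2_mult_integrable[OF HL, of "u i"] momentsD[OF moments_hermite, of 2 b h'] by auto
    qed
    have "(\<integral>w. ?H w * g w \<partial>M) = (\<integral>w. (\<Sum>i<n. c i * (?H w * u i w)) \<partial>M)"
      unfolding g'(1) by (simp add: sum_distrib_left mult_ac)
    also have "\<dots> = (\<Sum>i<n. c i * (\<integral>w. ?H w * u i w \<partial>M))"
      by (subst Bochner_Integration.integral_sum) (use u(1) in auto)
    also have "\<dots> = 0" using u(2) by simp
    finally have "I = (\<integral>w. ?H w * k w \<partial>M) - (\<integral>w. ?H w * g w \<partial>M)" by (simp add: I_def)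
    also have "\<dots> = (\<integral>w. ?H w * k w - ?H w * g w \<partial>M)"
      by (intro Bochner_Integration.integral_diff[symmetric] L2_mult_integrable HL kL hspan_L2[OF g(1)])
    also have "\<dots> = (\<integral>w. ?H w * (k w - g w) \<partial>M)" by (simp add: algebra_simps)
    finally have "\<bar>I\<bar> \<le> Lp_norm M 2 ?H * Lp_norm M 2 (\<lambda>w. k w - g w)"
      using L2_Cauchy_Schwarz[OF HL Lp_diff[OF kL hspan_L2[OF g(1)]]] by simp
    also have "\<dots> \<le> Lp_norm M 2 ?H * e" using g(2) by (intro mult_left_mono) auto
    finally show ?thesis .
  qed
  moreover have "(\<lambda>n. Lp_norm M 2 ?H * inverse (real (Suc n))) \<longlonglongrightarrow> Lp_norm M 2 ?H * 0"
    by (intro tendsto_mult tendsto_const LIMSEQ_inverse_real_of_nat)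
  ultimately have "\<bar>I\<bar> \<le> Lp_norm M 2 ?H * 0" by (intro LIMSEQ_le_const) auto
  then show ?thesis by (simp add: I_def)
qed

lemma chaos_proj_hermite:
  assumes h: "norm h = 1"
  shows "AE w in M. chaos_proj M W j (\<lambda>w. hermite m (W h w)) w = (if m = j then 1 else 0) * hermite m (W h w)"
proof (rule chaos_proj_unique)
  show "(\<lambda>w. hermite m (W h w)) \<in> Lp M 2" by (rule momentsD[OF moments_hermite]) simp
  show "(\<lambda>w. (if m = j then 1 else 0) * hermite m (W h w)) \<in> chaos M W j"
    using hspan_chaos[OF fun_span_zero] hspan_chaos[OF fun_span_base, of "\<lambda>w. hermite m (W h w)" m] h by auto
  show "(\<integral>w. (hermite m (W h w) - (if m = j then 1 else 0) * hermite m (W h w)) * k w \<partial>M) = 0" if "k \<in> chaos M W j" for k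
    using hermite_orthogonal_chaos[OF _ h that, of m] by (cases "m = j") auto
qed

text \<open>This makes the tensor extension independent of the representation. A vector depending
  linearly on the others is eliminated by moving its coefficient function to them, which the linear
  projection respects. Once the vectors are independent, every coefficient function vanishes almost
  everywhere, and so does its projection.\<close>

lemma chaos_proj_null_combination:
  fixes z :: "'i \<Rightarrow> 'b::real_vector"
  assumes "finite I" "\<And>i. i \<in> I \<Longrightarrow> g i \<in> Lp M 2" "AE w in M. (\<Sum>i\<in>I. g i w *\<^sub>R z i) = 0"
  shows "AE w in M. (\<Sum>i\<in>I. chaos_proj M W m (g i) w *\<^sub>R z i) = 0"
  using assms
proof (induction "card I" arbitrary: I g)
  case 0
  then show ?case by simp
next
  case (Suc n)
  show ?case
  proof (cases "\<exists>a\<in>I. \<exists>c. z a = (\<Sum>i\<in>I - {a}. c i *\<^sub>R z i)")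
    case True
    then obtain a c where a: "a \<in> I" "z a = (\<Sum>i\<in>I - {a}. c i *\<^sub>R z i)" by blast
    have split: "(\<Sum>i\<in>I. u i *\<^sub>R z i) = (\<Sum>i\<in>I - {a}. (u i + c i * u a) *\<^sub>R z i)" for u :: "'i \<Rightarrow> real"
    proof -
      have "(\<Sum>i\<in>I. u i *\<^sub>R z i) = u a *\<^sub>R (\<Sum>i\<in>I - {a}. c i *\<^sub>R z i) + (\<Sum>i\<in>I - {a}. u i *\<^sub>R z i)"
        using sum.remove[OF Suc.prems(1) a(1), of "\<lambda>i. u i *\<^sub>R z i"] a(2) by simp
      then show ?thesis by (simp add: scaleR_add_left sum.distrib scaleR_sum_right mult.commute add.commute)
    qed
    have "AE w in M. (\<Sum>i\<in>I - {a}. chaos_proj M W m (\<lambda>w. g i w + c i * g a w) w *\<^sub>R z i) = 0"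
    proof (rule Suc.hyps(1))
      show "n = card (I - {a})" using Suc.hyps(2) Suc.prems(1) a(1) by simp
      show "(\<lambda>w. g i w + c i * g a w) \<in> Lp M 2" if "i \<in> I - {a}" for i
        using Lp_add[OF Suc.prems(2) Lp_scaleR[OF Suc.prems(2)[OF a(1)], of "c i"], of i] that by simp
      show "AE w in M. (\<Sum>i\<in>I - {a}. (g i w + c i * g a w) *\<^sub>R z i) = 0"
        using Suc.prems(3) unfolding split[of "\<lambda>i. g i _"] .
    qed (use Suc.prems in auto)
    moreover have "AE w in M. \<forall>i\<in>I - {a}. chaos_proj M W m (\<lambda>w. g i w + c i * g a w) w = chaos_proj M W m (g i) w + c i * chaos_proj M W m (g a) w"
      by (intro AE_finite_allI chaos_proj_lincomb Suc.prems(2) a(1)) (use Suc.prems in auto)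
    ultimately show ?thesis unfolding split[of "\<lambda>i. chaos_proj M W m (g i) _"]
    proof eventually_elim
      case (elim w)
      then show ?case by (metis (mono_tags, lifting) sum.cong)
    qed
  next
    case False
    have indep: "u a = 0" if u: "(\<Sum>i\<in>I. u i *\<^sub>R z i) = 0" and a: "a \<in> I" for u :: "'i \<Rightarrow> real" and a
    proof (rule ccontr)
      assume ua: "u a \<noteq> 0"
      have "u a *\<^sub>R z a = - (\<Sum>i\<in>I - {a}. u i *\<^sub>R z i)"
        using sum.remove[OF Suc.prems(1) a, of "\<lambda>i. u i *\<^sub>R z i"] u by (simp add: eq_neg_iff_add_eq_0)
      then have "inverse (u a) *\<^sub>R u a *\<^sub>R z a = - inverse (u a) *\<^sub>R (\<Sum>i\<in>I - {a}. u i *\<^sub>R z i)" by simp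
      then have "z a = (\<Sum>i\<in>I - {a}. (- inverse (u a) * u i) *\<^sub>R z i)"
        using ua by (simp add: scaleR_sum_right sum_negf)
      then have "\<exists>a\<in>I. \<exists>c. z a = (\<Sum>i\<in>I - {a}. c i *\<^sub>R z i)"
        by (intro bexI[OF _ a] exI[of _ "\<lambda>i. - inverse (u a) * u i"])
      with False show False by (rule notE)
    qed
    have "AE w in M. \<forall>i\<in>I. chaos_proj M W m (g i) w = 0"
    proof (intro AE_finite_allI chaos_proj_AE_zero Suc.prems)
      fix i assume i: "i \<in> I"
      show "AE w in M. g i w = 0" using Suc.prems(3) by eventually_elim (rule indep[OF _ i])
    qed
    then show ?thesis by eventually_elim simp
  qed
qed

end

section \<open>Vector-valued chaos projections of polynomials\<close>

context isonormal
begin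

lemma wiener_polynomial_tensor:
  fixes F :: "'w \<Rightarrow> 'b::real_normed_vector"
  assumes "F \<in> wiener_polynomials W"
  shows "\<exists>(n::nat) f x. (\<forall>i<n. f i \<in> Lp M 2) \<and> (AE w in M. F w = (\<Sum>i<n. f i w *\<^sub>R x i))"
proof -
  obtain k c u where "lin_comb {\<lambda>w. monomial gs w *\<^sub>R x | gs x. True} F k c u"
    using assms unfolding wiener_polynomials_eq_monomials by (blast dest: fun_span_memE)
  note F = lin_combD(1)[OF this] and u = lin_combD(2)[OF this]
  have "\<forall>i\<in>{..<k}. \<exists>y. u i = (\<lambda>w. monomial (fst y) w *\<^sub>R snd y)" using u by fastforce
  from bchoice[OF this] obtain y where y: "\<And>i. i < k \<Longrightarrow> u i = (\<lambda>w. monomial (fst (y i)) w *\<^sub>R snd (y i))" by blast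
  have "F w = (\<Sum>i<k. monomial (fst (y i)) w *\<^sub>R (c i *\<^sub>R snd (y i)))" for w
    unfolding F by (rule sum.cong) (auto simp: y mult.commute)
  moreover have "monomial (fst (y i)) \<in> Lp M 2" for i by (rule momentsD[OF moments_monomial]) simp
  ultimately show ?thesis by (intro exI[of _ k] exI[of _ "\<lambda>i. monomial (fst (y i))"] exI[of _ "\<lambda>i. c i *\<^sub>R snd (y i)"]) auto
qed

lemma vchaos_proj_tensor:
  fixes F :: "'w \<Rightarrow> 'b::real_normed_vector"
  assumes "F \<in> wiener_polynomials W"
  shows "\<exists>(n::nat) f x. (\<forall>i<n. f i \<in> Lp M 2) \<and> (AE w in M. F w = (\<Sum>i<n. f i w *\<^sub>R x i)) \<and>
     vchaos_proj M W j F = (\<lambda>w. \<Sum>i<n. chaos_proj M W j (f i) w *\<^sub>R x i)"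
proof -
  obtain n :: nat and f x where "\<forall>i<n. f i \<in> Lp M 2" "AE w in M. F w = (\<Sum>i<n. f i w *\<^sub>R x i)"
    using wiener_polynomial_tensor[OF assms] by (elim exE conjE) (rule that)
  then have "\<exists>G (n::nat) f x. (\<forall>i<n. f i \<in> Lp M 2) \<and> (AE w in M. F w = (\<Sum>i<n. f i w *\<^sub>R x i)) \<and>
     G = (\<lambda>w. \<Sum>i<n. chaos_proj M W j (f i) w *\<^sub>R x i)"
    by (intro exI[of _ "\<lambda>w. \<Sum>i<n. chaos_proj M W j (f i) w *\<^sub>R x i"] exI[of _ n] exI[of _ f] exI[of _ x] conjI refl)
  from someI_ex[OF this] show ?thesis unfolding vchaos_proj_def .
qed

text \<open>The chosen representation minus the given one is a combination over the disjoint union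
  of the index sets that vanishes almost everywhere. Any convenient representation may therefore be
  used to compute the projection.\<close>

lemma vchaos_proj_eq:
  fixes F :: "'w \<Rightarrow> 'b::real_normed_vector" and I :: "'i set"
  assumes F: "F \<in> wiener_polynomials W" "AE w in M. F w = (\<Sum>i\<in>I. g i w *\<^sub>R z i)"
    and I: "finite I" "\<And>i. i \<in> I \<Longrightarrow> g i \<in> Lp M 2"
  shows "AE w in M. vchaos_proj M W j F w = (\<Sum>i\<in>I. chaos_proj M W j (g i) w *\<^sub>R z i)"
proof -
  obtain n :: nat and f x where f: "\<forall>i<n. f i \<in> Lp M 2" "AE w in M. F w = (\<Sum>i<n. f i w *\<^sub>R x i)"
    "vchaos_proj M W j F = (\<lambda>w. \<Sum>i<n. chaos_proj M W j (f i) w *\<^sub>R x i)"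
    using vchaos_proj_tensor[OF F(1), of j] by (elim exE conjE) (rule that)
  have "AE w in M. (\<Sum>i\<in>{..<n} <+> I. chaos_proj M W j (case_sum f g i) w *\<^sub>R case_sum x (\<lambda>i. - z i) i) = 0"
  proof (rule chaos_proj_null_combination)
    show "case_sum f g i \<in> Lp M 2" if "i \<in> {..<n} <+> I" for i
      using that f(1) I(2) by auto
    show "AE w in M. (\<Sum>i\<in>{..<n} <+> I. case_sum f g i w *\<^sub>R case_sum x (\<lambda>i. - z i) i) = 0"
      using F(2) f(2) by eventually_elim (simp add: sum.Plus I(1) sum_negf)
  qed (simp add: I(1))
  then show ?thesis
    unfolding f(3) by eventually_elim (simp add: sum.Plus I(1) sum_negf)
qed

lemma vchaos_proj_add:
  fixes F G :: "'w \<Rightarrow> 'b::real_normed_vector"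
  assumes F: "F \<in> wiener_polynomials W" and G: "G \<in> wiener_polynomials W"
  shows "AE w in M. vchaos_proj M W j (\<lambda>w. F w + G w) w = vchaos_proj M W j F w + vchaos_proj M W j G w"
proof -
  obtain n :: nat and f x where f: "\<forall>i<n. f i \<in> Lp M 2" "AE w in M. F w = (\<Sum>i<n. f i w *\<^sub>R x i)"
    "vchaos_proj M W j F = (\<lambda>w. \<Sum>i<n. chaos_proj M W j (f i) w *\<^sub>R x i)"
    using vchaos_proj_tensor[OF F, of j] by (elim exE conjE) (rule that)
  obtain l :: nat and g z where g: "\<forall>i<l. g i \<in> Lp M 2" "AE w in M. G w = (\<Sum>i<l. g i w *\<^sub>R z i)"
    "vchaos_proj M W j G = (\<lambda>w. \<Sum>i<l. chaos_proj M W j (g i) w *\<^sub>R z i)"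
    using vchaos_proj_tensor[OF G, of j] by (elim exE conjE) (rule that)
  have "AE w in M. vchaos_proj M W j (\<lambda>w. F w + G w) w
     = (\<Sum>i\<in>{..<n} <+> {..<l}. chaos_proj M W j (case_sum f g i) w *\<^sub>R case_sum x z i)"
  proof (rule vchaos_proj_eq[OF wiener_polynomials_add[OF F G]])
    show "AE w in M. F w + G w = (\<Sum>i\<in>{..<n} <+> {..<l}. case_sum f g i w *\<^sub>R case_sum x z i)"
      using f(2) g(2) by eventually_elim (simp add: sum.Plus)
    show "case_sum f g i \<in> Lp M 2" if "i \<in> {..<n} <+> {..<l}" for i
      using that f(1) g(1) by auto
  qed simp
  then show ?thesis unfolding f(3) g(3) by eventually_elim (simp add: sum.Plus)
qed

lemma vchaos_proj_scaleR:
  fixes F :: "'w \<Rightarrow> 'b::real_normed_vector"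
  assumes F: "F \<in> wiener_polynomials W"
  shows "AE w in M. vchaos_proj M W j (\<lambda>w. c *\<^sub>R F w) w = c *\<^sub>R vchaos_proj M W j F w"
proof -
  obtain n :: nat and f x where f: "\<forall>i<n. f i \<in> Lp M 2" "AE w in M. F w = (\<Sum>i<n. f i w *\<^sub>R x i)"
    "vchaos_proj M W j F = (\<lambda>w. \<Sum>i<n. chaos_proj M W j (f i) w *\<^sub>R x i)"
    using vchaos_proj_tensor[OF F, of j] by (elim exE conjE) (rule that)
  have "AE w in M. vchaos_proj M W j (\<lambda>w. c *\<^sub>R F w) w = (\<Sum>i<n. chaos_proj M W j (f i) w *\<^sub>R c *\<^sub>R x i)"
  proof (rule vchaos_proj_eq[OF wiener_polynomials_scaleR[OF F]])
    show "AE w in M. c *\<^sub>R F w = (\<Sum>i<n. f i w *\<^sub>R c *\<^sub>R x i)"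
      using f(2) by eventually_elim (simp add: scaleR_sum_right mult.commute)
  qed (use f(1) in auto)
  then show ?thesis unfolding f(3) by eventually_elim (simp add: scaleR_sum_right mult.commute)
qed

lemma vchaos_proj_hsum:
  fixes F :: "'w \<Rightarrow> 'b::real_normed_vector"
  assumes F: "F \<in> wiener_polynomials W" "AE w in M. F w = hsum k m h v w" and h: "\<And>i. i < k \<Longrightarrow> norm (h i) = 1"
  shows "AE w in M. vchaos_proj M W j F w = hsum k m h (\<lambda>i. (if m i = j then 1 else 0) *\<^sub>R v i) w"
proof -
  have "AE w in M. vchaos_proj M W j F w = (\<Sum>i<k. chaos_proj M W j (\<lambda>w. hermite (m i) (W (h i) w)) w *\<^sub>R v i)"
  proof (rule vchaos_proj_eq[OF F(1)])
    show "AE w in M. F w = (\<Sum>i<k. hermite (m i) (W (h i) w) *\<^sub>R v i)" using F(2) unfolding hsum_def .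
    show "(\<lambda>w. hermite (m i) (W (h i) w)) \<in> Lp M 2" for i by (rule momentsD[OF moments_hermite]) simp
  qed simp
  moreover have "AE w in M. \<forall>i\<in>{..<k}. chaos_proj M W j (\<lambda>w. hermite (m i) (W (h i) w)) w = (if m i = j then 1 else 0) * hermite (m i) (W (h i) w)"
    by (intro AE_finite_allI chaos_proj_hermite h) auto
  ultimately show ?thesis
  proof eventually_elim
    case (elim w)
    show ?case unfolding elim(1) hsum_def by (rule sum.cong) (use elim(2) in auto)
  qed
qed

lemma vchaos_proj_strongly_measurable:
  fixes F :: "'w \<Rightarrow> 'b::real_normed_vector"
  assumes F: "F \<in> wiener_polynomials W"
  shows "strongly_measurable M (vchaos_proj M W j F)"
proof -
  obtain n :: nat and f x where f: "\<forall>i<n. f i \<in> Lp M 2"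
    "vchaos_proj M W j F = (\<lambda>w. \<Sum>i<n. chaos_proj M W j (f i) w *\<^sub>R x i)"
    using vchaos_proj_tensor[OF F, of j] by (elim exE conjE) (rule that)
  show ?thesis unfolding f(2)
    by (intro strongly_measurable_sum strongly_measurable_scaleR strongly_measurable_const LpD(1)[OF chaos_proj_L2])
       (use f(1) in auto)
qed

text \<open>Without unit vectors the generating set of every chaos is empty, order 0 included, so
  each chaos consists of null functions.\<close>

lemma vchaos_proj_degenerate:
  fixes F :: "'w \<Rightarrow> 'b::real_normed_vector"
  assumes no: "\<And>h :: 'h. norm h \<noteq> 1" and F: "F \<in> wiener_polynomials W"
  shows "AE w in M. vchaos_proj M W j F w = 0"
proof -
  obtain n :: nat and f x where f: "\<forall>i<n. f i \<in> Lp M 2"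
    "vchaos_proj M W j F = (\<lambda>w. \<Sum>i<n. chaos_proj M W j (f i) w *\<^sub>R x i)"
    using vchaos_proj_tensor[OF F, of j] by (elim exE conjE) (rule that)
  have zero: "AE w in M. g w = 0" if g: "g \<in> chaos M W j" for g
  proof -
    have gL: "g \<in> Lp M 2" using g chaos_L2 by blast
    have "Lp_norm M 2 g < e" if e: "0 < e" for e
    proof -
      obtain u where u: "u \<in> hspan j" "Lp_norm M 2 (\<lambda>w. g w - u w) < e" by (rule chaos_approx[OF g e])
      have "u = (\<lambda>w. 0)" using u(1) no unfolding fun_span_def by (auto intro!: ext sum.neutral)
      then show ?thesis using u(2) by simp
    qed
    then have "Lp_norm M 2 g = 0" using Lp_norm_nonneg[of M 2 g] less_irrefl by (metis order_le_less)
    then show ?thesis using Lp_norm_eq_0_iff[OF gL] by simp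
  qed
  have "AE w in M. \<forall>i\<in>{..<n}. chaos_proj M W j (f i) w = 0"
    by (intro AE_finite_allI zero chaos_proj) (use f(1) in auto)
  then show ?thesis unfolding f(2) by eventually_elim simp
qed

end

section \<open>Operators on Bochner spaces\<close>

lemma Lp_operatorD:
  assumes "Lp_operator M p T"
  shows "\<And>f. f \<in> Lp M p \<Longrightarrow> T f \<in> Lp M p"
    "\<And>f g. f \<in> Lp M p \<Longrightarrow> g \<in> Lp M p \<Longrightarrow> AE w in M. T (\<lambda>w. f w + g w) w = T f w + T g w"
    "\<And>f c. f \<in> Lp M p \<Longrightarrow> AE w in M. T (\<lambda>w. c *\<^sub>R f w) w = c *\<^sub>R T f w"
    "\<exists>C. \<forall>f\<in>Lp M p. Lp_norm M p (T f) \<le> C * Lp_norm M p f"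
  using assms unfolding Lp_operator_def by blast+

text \<open>Boundedness makes the supremum of the quotients finite. Functions of norm 0, whose
  quotient is 0, are handled by the given bound, which forces their image to have norm 0.\<close>

lemma Lp_opnorm_bounds:
  fixes T :: "('w \<Rightarrow> 'b::real_normed_vector) \<Rightarrow> ('w \<Rightarrow> 'b)" and f :: "'w \<Rightarrow> 'b"
  assumes b: "\<exists>C. \<forall>f\<in>Lp M p. Lp_norm M p (T f) \<le> C * Lp_norm M p f"
  shows "f \<in> Lp M p \<Longrightarrow> Lp_norm M p (T f) \<le> Lp_opnorm M p T * Lp_norm M p f"
    and "0 \<le> Lp_opnorm M p T"
proof -
  obtain C where C: "\<And>f. f \<in> Lp M p \<Longrightarrow> Lp_norm M p (T f) \<le> C * Lp_norm M p f" using b by blast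
  have bdd: "bdd_above ((\<lambda>f. Lp_norm M p (T f) / Lp_norm M p f) ` Lp M p)"
  proof (rule bdd_aboveI2)
    fix f :: "'w \<Rightarrow> 'b" assume f: "f \<in> Lp M p"
    have "0 < Lp_norm M p f \<or> Lp_norm M p f = 0" using Lp_norm_nonneg[of M p f] by linarith
    then show "Lp_norm M p (T f) / Lp_norm M p f \<le> \<bar>C\<bar>"
    proof
      assume pos: "0 < Lp_norm M p f"
      then have "Lp_norm M p (T f) / Lp_norm M p f \<le> C" using C[OF f] by (simp add: pos_divide_le_eq)
      then show ?thesis by linarith
    qed simp
  qed
  have le: "Lp_norm M p (T f) / Lp_norm M p f \<le> Lp_opnorm M p T" if "f \<in> Lp M p" for f
    unfolding Lp_opnorm_def by (rule cSUP_upper[OF that bdd])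
  show "0 \<le> Lp_opnorm M p T" using le[OF Lp_zero] by simp
  assume f: "f \<in> Lp M p"
  have "0 < Lp_norm M p f \<or> Lp_norm M p f = 0" using Lp_norm_nonneg[of M p f] by linarith
  then show "Lp_norm M p (T f) \<le> Lp_opnorm M p T * Lp_norm M p f"
  proof
    assume "0 < Lp_norm M p f"
    then show ?thesis using le[OF f] by (simp add: pos_divide_le_eq)
  next
    assume "Lp_norm M p f = 0"
    then show ?thesis using C[OF f] by simp
  qed
qed

lemma Lp_operator_null:
  assumes T: "Lp_operator M p T" and p: "1 \<le> p" and f: "f \<in> Lp M p" "AE w in M. f w = 0"
  shows "AE w in M. T f w = 0"
proof -
  have p0: "0 < p" using p by simp
  have "Lp_norm M p f = 0" using Lp_norm_eq_0_iff[OF f(1) p0] f(2) by simp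
  then have "Lp_norm M p (T f) \<le> 0" using Lp_opnorm_bounds(1)[OF Lp_operatorD(4)[OF T] f(1)] by simp
  then have "Lp_norm M p (T f) = 0" using Lp_norm_nonneg[of M p "T f"] by linarith
  then show ?thesis using Lp_norm_eq_0_iff[OF Lp_operatorD(1)[OF T f(1)] p0] by simp
qed

lemma Lp_operator_cong_AE:
  assumes T: "Lp_operator M p T" and p: "1 \<le> p" and f: "f \<in> Lp M p" and g: "g \<in> Lp M p"
    and eq: "AE w in M. f w = g w"
  shows "AE w in M. T f w = T g w"
proof -
  have d: "(\<lambda>w. f w - g w) \<in> Lp M p" by (rule Lp_diff[OF f g p])
  have "AE w in M. T (\<lambda>w. f w - g w) w = 0"
    by (rule Lp_operator_null[OF T p d]) (use eq in auto)
  moreover have "AE w in M. T f w = T (\<lambda>w. f w - g w) w + T g w" using Lp_operatorD(2)[OF T d g] by simp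
  ultimately show ?thesis by eventually_elim simp
qed

lemma Lp_operator_lincomb:
  assumes T: "Lp_operator M p T" and p: "1 \<le> p" and I: "finite I" and f: "\<And>i. i \<in> I \<Longrightarrow> f i \<in> Lp M p"
  shows "AE w in M. T (\<lambda>w. \<Sum>i\<in>I. c i *\<^sub>R f i w) w = (\<Sum>i\<in>I. c i *\<^sub>R T (f i) w)"
  using I f
proof (induction I)
  case empty
  show ?case using Lp_operator_null[OF T p Lp_zero] by simp
next
  case (insert i I)
  have "AE w in M. T (\<lambda>w. c i *\<^sub>R f i w + (\<Sum>i\<in>I. c i *\<^sub>R f i w)) w
     = T (\<lambda>w. c i *\<^sub>R f i w) w + T (\<lambda>w. \<Sum>i\<in>I. c i *\<^sub>R f i w) w"
    by (intro Lp_operatorD(2)[OF T] Lp_scaleR Lp_sum insert.prems p) auto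
  moreover have "AE w in M. T (\<lambda>w. c i *\<^sub>R f i w) w = c i *\<^sub>R T (f i) w"
    by (intro Lp_operatorD(3)[OF T] insert.prems) auto
  moreover have "AE w in M. T (\<lambda>w. \<Sum>i\<in>I. c i *\<^sub>R f i w) w = (\<Sum>i\<in>I. c i *\<^sub>R T (f i) w)"
    by (rule insert.IH) (use insert.prems in auto)
  ultimately show ?case by eventually_elim (simp add: insert.hyps)
qed

text \<open>The convergence in \<open>Lp_op_sums\<close> is stated through a supremum; finiteness
  for the remainders of the series is what allows it to be evaluated at a single function.\<close>

lemma Lp_operator_series_norm_bound:
  fixes T :: "('w \<Rightarrow> 'b::real_normed_vector) \<Rightarrow> ('w \<Rightarrow> 'b)"
  assumes a: "\<And>k. Lp_operator M p (a k)" and T: "Lp_operator M p T" and p: "1 \<le> p"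
  shows "\<exists>C. \<forall>f\<in>Lp M p. Lp_norm M p (\<lambda>w. (\<Sum>k<m. c k *\<^sub>R a k f w) - T f w) \<le> C * Lp_norm M p f"
proof (intro exI ballI)
  fix f :: "'w \<Rightarrow> 'b" assume f: "f \<in> Lp M p"
  note L = Lp_scaleR[OF Lp_operatorD(1)[OF a f]] Lp_operatorD(1)[OF T f]
  have "Lp_norm M p (\<lambda>w. (\<Sum>k<m. c k *\<^sub>R a k f w) - T f w)
     \<le> Lp_norm M p (\<lambda>w. \<Sum>k<m. c k *\<^sub>R a k f w) + Lp_norm M p (T f)"
    by (intro Lp_norm_triangle_diff Lp_sum L p)
  also have "\<dots> \<le> (\<Sum>k<m. Lp_norm M p (\<lambda>w. c k *\<^sub>R a k f w)) + Lp_norm M p (T f)"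
    by (intro add_right_mono Lp_norm_sum L p)
  also have "\<dots> \<le> (\<Sum>k<m. \<bar>c k\<bar> * (Lp_opnorm M p (a k) * Lp_norm M p f)) + Lp_opnorm M p T * Lp_norm M p f"
  proof (intro add_mono sum_mono)
    fix k
    have "Lp_norm M p (\<lambda>w. c k *\<^sub>R a k f w) = \<bar>c k\<bar> * Lp_norm M p (a k f)" using p by (intro Lp_norm_scaleR) simp
    then show "Lp_norm M p (\<lambda>w. c k *\<^sub>R a k f w) \<le> \<bar>c k\<bar> * (Lp_opnorm M p (a k) * Lp_norm M p f)"
      using Lp_opnorm_bounds(1)[OF Lp_operatorD(4)[OF a] f] by (simp add: mult_left_mono)
  qed (rule Lp_opnorm_bounds(1)[OF Lp_operatorD(4)[OF T] f])
  also have "\<dots> = ((\<Sum>k<m. \<bar>c k\<bar> * Lp_opnorm M p (a k)) + Lp_opnorm M p T) * Lp_norm M p f"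
    by (simp add: sum_distrib_right distrib_right mult.assoc)
  finally show "Lp_norm M p (\<lambda>w. (\<Sum>k<m. c k *\<^sub>R a k f w) - T f w)
     \<le> ((\<Sum>k<m. \<bar>c k\<bar> * Lp_opnorm M p (a k)) + Lp_opnorm M p T) * Lp_norm M p f" .
qed

section \<open>Spectral multipliers\<close>

context isonormal
begin

lemma hsum_lincomb: "(\<Sum>n\<in>I. c n *\<^sub>R hsum k m h (u n) w) = hsum k m h (\<lambda>i. \<Sum>n\<in>I. c n *\<^sub>R u n i) w"
proof -
  have "(\<Sum>n\<in>I. c n *\<^sub>R hsum k m h (u n) w) = (\<Sum>n\<in>I. \<Sum>i<k. c n *\<^sub>R hermite (m i) (W (h i) w) *\<^sub>R u n i)"
    by (simp add: hsum_def scaleR_sum_right)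
  also have "\<dots> = (\<Sum>i<k. \<Sum>n\<in>I. c n *\<^sub>R hermite (m i) (W (h i) w) *\<^sub>R u n i)" by (rule sum.swap)
  finally show ?thesis by (simp add: hsum_def scaleR_sum_right mult.commute)
qed

lemma vchaos_proj_Lp:
  fixes F :: "'w \<Rightarrow> 'b::real_normed_vector"
  assumes F: "F \<in> wiener_polynomials W" and p: "1 \<le> p"
  shows "vchaos_proj M W j F \<in> Lp M p"
proof -
  have p0: "0 < p" using p by simp
  obtain G :: "'w \<Rightarrow> 'b" where G: "G \<in> Lp M p" "AE w in M. vchaos_proj M W j F w = G w"
  proof (cases "\<exists>e :: 'h. norm e = 1")
    case True
    then obtain e :: 'h where "norm e = 1" ..
    from wiener_polynomial_hsum[OF this F] obtain k m h v where h: "\<forall>i<k. norm (h i) = 1" and "AE w in M. F w = hsum k m h v w"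
      by (elim exE conjE) (rule that)
    from vchaos_proj_hsum[OF F this(2), of j] h show ?thesis by (intro that[OF hsum_Lp[OF p]]) auto
  next
    case False
    then show ?thesis using vchaos_proj_degenerate[OF _ F, of j] by (intro that[OF Lp_zero]) auto
  qed
  show ?thesis
  proof (rule Lp_bound[OF vchaos_proj_strongly_measurable[OF F] LpD(2)[OF G(1)]])
    show "AE w in M. norm (vchaos_proj M W j F w) \<le> norm (G w)" using G(2) by eventually_elim simp
  qed (use p0 in simp)
qed

text \<open>On the chaoses of order at least \<open>N\<close>, interchanging the sums over the chaoses and over \<open>k\<close> leaves the
  operators \<open>a k\<close> applied to the inverse powers of the number operator, whose norms decay like \<open>N\<^sup>-\<^sup>k\<close>.\<close>

lemma spectral_multiplier_bound:
  fixes a \<phi> :: "nat \<Rightarrow> ('w \<Rightarrow> 'e::banach) \<Rightarrow> ('w \<Rightarrow> 'e)"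
  assumes p: "1 < p" and U: "UMD_space TYPE('e)" and e: "norm (e :: 'h) = 1"
    and a: "\<And>k. Lp_operator M p (a k)" and \<phi>: "\<And>n. Lp_operator M p (\<phi> n)"
    and N: "1 \<le> N" and s: "summable (\<lambda>k. Lp_opnorm M p (a k) / N ^ k)"
    and sums: "\<And>n. N \<le> real n \<Longrightarrow> Lp_op_sums M p (\<lambda>k f w. (1 / real n ^ k) *\<^sub>R a k f w) (\<phi> n)"
  shows "\<exists>C. \<forall>F\<in>wiener_polynomials W. \<exists>D. (\<forall>n\<ge>D. AE w in M. vchaos_proj M W n F w = 0) \<and>
    (\<forall>D'\<ge>D. Lp_norm M p (\<lambda>w. \<Sum>n<D'. \<phi> n (vchaos_proj M W n F) w) \<le> C * Lp_norm M p F)"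
proof -
  have p1: "1 \<le> p" and p0: "0 < p" using p by auto
  \<comment> \<open>Orders are integers, so the operator series applies from \<open>N0\<close> on,
    and \<open>1 / N0\<close> is at most \<open>1 / N\<close>.\<close>
  define N0 where "N0 = nat \<lceil>N\<rceil>"
  have N0: "1 \<le> N0" "N \<le> real N0" using N unfolding N0_def by linarith+
  obtain A where A: "1 \<le> A" "\<And>n. mult_bounded TYPE('e) p (\<lambda>j. if j = n then 1 else 0) (A ^ n)"
    using mult_bounded_chaos[OF U p] by blast
  obtain B where B: "0 \<le> B" "\<And>k. mult_bounded TYPE('e) p (\<lambda>m. if N0 \<le> m then (1 / real m) ^ k else 0) (B * (1 / real N0) ^ k)"
    using mult_bounded_inverse_powers[OF U p N0(1)] by blast
  define \<alpha> where "\<alpha> k = Lp_opnorm M p (a k)" for k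
  define \<beta> where "\<beta> n = Lp_opnorm M p (\<phi> n)" for n
  have \<alpha>: "0 \<le> \<alpha> k" "f \<in> Lp M p \<Longrightarrow> Lp_norm M p (a k f) \<le> \<alpha> k * Lp_norm M p f" for k f
    unfolding \<alpha>_def using Lp_opnorm_bounds[OF Lp_operatorD(4)[OF a]] by auto
  have \<beta>: "0 \<le> \<beta> n" "f \<in> Lp M p \<Longrightarrow> Lp_norm M p (\<phi> n f) \<le> \<beta> n * Lp_norm M p f" for n f
    unfolding \<beta>_def using Lp_opnorm_bounds[OF Lp_operatorD(4)[OF \<phi>]] by auto
  define C where "C = (\<Sum>n<N0. \<beta> n * A ^ n) + (\<Sum>k. \<alpha> k / N ^ k) * B"
  show ?thesis
  proof (rule exI[of _ C], rule ballI)
    fix F :: "'w \<Rightarrow> 'e" assume F: "F \<in> wiener_polynomials W"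
    from wiener_polynomial_hsum[OF e F] obtain K m h v where hK: "\<forall>i<K. norm (h i) = 1" and Fh: "AE w in M. F w = hsum K m h v w"
      by (elim exE conjE) (rule that)
    have h: "norm (h i) = 1" if "i < K" for i using hK that by simp
    define P where "P n = vchaos_proj M W n F" for n
    have PL: "P n \<in> Lp M p" for n unfolding P_def by (rule vchaos_proj_Lp[OF F p1])
    have Ph: "AE w in M. P n w = hsum K m h (\<lambda>i. (if m i = n then 1 else 0) *\<^sub>R v i) w" for n
      unfolding P_def by (rule vchaos_proj_hsum[OF F Fh h])
    have FL: "F \<in> Lp M p" by (rule wiener_polynomials_Lp[OF F p1])
    have sm: "strongly_measurable M (hsum K m h u)" for u :: "nat \<Rightarrow> 'e" by (rule LpD(1)[OF hsum_Lp[OF p1]])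
    have Fn: "Lp_norm M p (hsum K m h v) = Lp_norm M p F"
      using Lp_norm_cong_AE[OF LpD(1)[OF FL] sm Fh] by simp
    \<comment> \<open>The sum dominates every order \<open>m i\<close> that occurs in
      \<open>F\<close>; being at least \<open>N0\<close> as well, \<open>D\<close> permits the range
      of summation to be split at \<open>N0\<close>.\<close>
    define D where "D = max N0 (Suc (\<Sum>i<K. m i))"
    have mD: "m i < D" if "i < K" for i
      using member_le_sum[of i "{..<K}" m] that unfolding D_def by simp
    have van: "AE w in M. P n w = 0" if n: "D \<le> n" for n
      using Ph[of n]
    proof eventually_elim
      case (elim w)
      have "hsum K m h (\<lambda>i. (if m i = n then 1 else 0) *\<^sub>R v i) w = 0"
        unfolding hsum_def by (rule sum.neutral) (use mD n in force)
      then show ?case using elim by simp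
    qed
    have low: "Lp_norm M p (P n) \<le> A ^ n * Lp_norm M p F" for n
      using hsum_multiplier[where k=K and h=h and m=m and v=v, OF A(2)[of n] p1 h] Lp_norm_cong_AE[OF LpD(1)[OF PL] sm Ph[of n]] unfolding Fn by simp
    have "Lp_norm M p (\<lambda>w. \<Sum>n<D'. \<phi> n (P n) w) \<le> C * Lp_norm M p F" if D': "D \<le> D'" for D'
    proof -
      define J where "J = {N0..<D'}"
      have J: "finite J" "n \<in> J \<Longrightarrow> N \<le> real n" for n using N0(2) unfolding J_def by auto
      define S where "S w = (\<Sum>n\<in>J. \<phi> n (P n) w)" for w
      define R where "R l w = (\<Sum>n\<in>J. \<Sum>k<l. (1 / real n ^ k) *\<^sub>R a k (P n) w)" for l :: nat and w
      \<comment> \<open>The inverse of the number operator, raised to the power \<open>k\<close> and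
        applied to the part of \<open>F\<close> of order at least \<open>N0\<close>. Because
        \<open>D'\<close> exceeds all orders in \<open>F\<close>, the cut-off loses nothing and the
        norm is controlled by a multiplier bound.\<close>
      define Q where "Q k w = (\<Sum>n\<in>J. (1 / real n ^ k) *\<^sub>R P n w)" for k :: nat and w
      have \<phi>L: "\<phi> n (P n) \<in> Lp M p" for n by (rule Lp_operatorD(1)[OF \<phi> PL])
      have aL: "a k (P n) \<in> Lp M p" for k n by (rule Lp_operatorD(1)[OF a PL])
      have SL: "S \<in> Lp M p" unfolding S_def[abs_def] by (intro Lp_sum \<phi>L p1)
      have RL: "R l \<in> Lp M p" for l unfolding R_def[abs_def] by (intro Lp_sum Lp_scaleR aL p1)
      have QL: "Q k \<in> Lp M p" for k unfolding Q_def[abs_def] by (intro Lp_sum Lp_scaleR PL p1)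
      have Qn: "Lp_norm M p (Q k) \<le> B * (1 / N) ^ k * Lp_norm M p F" for k
      proof -
        have "AE w in M. \<forall>n\<in>J. P n w = hsum K m h (\<lambda>i. (if m i = n then 1 else 0) *\<^sub>R v i) w"
          by (intro AE_finite_allI J(1) Ph)
        then have "AE w in M. Q k w = hsum K m h (\<lambda>i. (if N0 \<le> m i then (1 / real (m i)) ^ k else 0) *\<^sub>R v i) w"
        proof eventually_elim
          case (elim w)
          have "Q k w = (\<Sum>n\<in>J. (1 / real n ^ k) *\<^sub>R hsum K m h (\<lambda>i. (if m i = n then 1 else 0) *\<^sub>R v i) w)"
            unfolding Q_def by (rule sum.cong) (use elim in auto)
          also have "\<dots> = hsum K m h (\<lambda>i. \<Sum>n\<in>J. (1 / real n ^ k) *\<^sub>R (if m i = n then 1 else 0) *\<^sub>R v i) w"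
            by (rule hsum_lincomb)
          also have "\<dots> = hsum K m h (\<lambda>i. (if N0 \<le> m i then (1 / real (m i)) ^ k else 0) *\<^sub>R v i) w"
            unfolding hsum_def
          proof (rule sum.cong[OF refl])
            fix i assume "i \<in> {..<K}"
            then have mi: "m i < D'" using mD[of i] D' by simp
            have "(\<Sum>n\<in>J. (1 / real n ^ k) *\<^sub>R (if m i = n then 1 else 0) *\<^sub>R v i)
               = (\<Sum>n\<in>J. if m i = n then (1 / real n ^ k) *\<^sub>R v i else 0)" by (rule sum.cong) auto
            also have "\<dots> = (if N0 \<le> m i then (1 / real (m i)) ^ k else 0) *\<^sub>R v i"
              using mi by (simp add: sum.delta'[OF J(1)] J_def power_one_over)
            finally show "hermite (m i) (W (h i) w) *\<^sub>R (\<Sum>n\<in>J. (1 / real n ^ k) *\<^sub>R (if m i = n then 1 else 0) *\<^sub>R v i)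
               = hermite (m i) (W (h i) w) *\<^sub>R (if N0 \<le> m i then (1 / real (m i)) ^ k else 0) *\<^sub>R v i" by simp
          qed
          finally show ?case .
        qed
        then have "Lp_norm M p (Q k) \<le> (B * (1 / real N0) ^ k) * Lp_norm M p F"
          using hsum_multiplier[where k=K and h=h and m=m and v=v, OF B(2)[of k] p1 h] Lp_norm_cong_AE[OF LpD(1)[OF QL] sm] unfolding Fn by simp
        also have "\<dots> \<le> (B * (1 / N) ^ k) * Lp_norm M p F"
          using N N0 B(1) by (intro mult_right_mono mult_left_mono power_mono) (auto intro: divide_left_mono)
        finally show ?thesis .
      qed
      have Rn: "Lp_norm M p (R l) \<le> ((\<Sum>k. \<alpha> k / N ^ k) * B) * Lp_norm M p F" for l
      proof -
        have "AE w in M. \<forall>k\<in>{..<l}. a k (Q k) w = (\<Sum>n\<in>J. (1 / real n ^ k) *\<^sub>R a k (P n) w)"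
          unfolding Q_def[abs_def] by (intro AE_finite_allI Lp_operator_lincomb[OF a p1 J(1) PL]) auto
        then have "AE w in M. R l w = (\<Sum>k<l. a k (Q k) w)"
        proof eventually_elim
          case (elim w)
          have "R l w = (\<Sum>k<l. \<Sum>n\<in>J. (1 / real n ^ k) *\<^sub>R a k (P n) w)" unfolding R_def by (rule sum.swap)
          also have "\<dots> = (\<Sum>k<l. a k (Q k) w)" by (rule sum.cong) (use elim in auto)
          finally show ?case .
        qed
        then have "Lp_norm M p (R l) = Lp_norm M p (\<lambda>w. \<Sum>k<l. a k (Q k) w)"
          by (intro Lp_norm_cong_AE LpD(1)[OF RL] LpD(1)[OF Lp_sum[where p=p]] Lp_operatorD(1)[OF a QL] p1)
        also have "\<dots> \<le> (\<Sum>k<l. Lp_norm M p (a k (Q k)))" by (intro Lp_norm_sum Lp_operatorD(1)[OF a QL] p1)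
        also have "\<dots> \<le> (\<Sum>k<l. \<alpha> k * (B * (1 / N) ^ k * Lp_norm M p F))"
          by (intro sum_mono order_trans[OF \<alpha>(2)[OF QL]] mult_left_mono Qn \<alpha>(1))
        also have "\<dots> = (\<Sum>k<l. \<alpha> k / N ^ k) * (B * Lp_norm M p F)"
          unfolding sum_distrib_right by (rule sum.cong) (simp_all add: power_one_over)
        also have "\<dots> \<le> (\<Sum>k. \<alpha> k / N ^ k) * (B * Lp_norm M p F)"
          using s \<alpha>(1) N B(1) unfolding \<alpha>_def[symmetric] by (intro mult_right_mono sum_le_suminf) auto
        finally show ?thesis by (simp add: mult.assoc)
      qed
      \<comment> \<open>The truncated series \<open>R l\<close> satisfies the bound for every
        \<open>l\<close>. It differs from \<open>S\<close> by operator norm errors at the finitely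
        many functions \<open>P n\<close>, which tend to 0.\<close>
      have "Lp_norm M p S \<le> ((\<Sum>k. \<alpha> k / N ^ k) * B) * Lp_norm M p F"
      proof (rule LIMSEQ_le_const)
        define \<epsilon> where "\<epsilon> l n = Lp_opnorm M p (\<lambda>f w. (\<Sum>k<l. (1 / real n ^ k) *\<^sub>R a k f w) - \<phi> n f w)" for l n
        have \<epsilon>: "(\<lambda>l. \<epsilon> l n) \<longlonglongrightarrow> 0" if "n \<in> J" for n
          using sums[OF J(2)[OF that]] unfolding Lp_op_sums_def \<epsilon>_def .
        have "(\<lambda>l. (\<Sum>n\<in>J. \<epsilon> l n * Lp_norm M p (P n))) \<longlonglongrightarrow> (\<Sum>n\<in>J. 0 * Lp_norm M p (P n))"
          by (intro tendsto_sum tendsto_mult \<epsilon> tendsto_const)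
        from tendsto_add[OF tendsto_const this]
        show "(\<lambda>l. ((\<Sum>k. \<alpha> k / N ^ k) * B) * Lp_norm M p F + (\<Sum>n\<in>J. \<epsilon> l n * Lp_norm M p (P n))) \<longlonglongrightarrow> ((\<Sum>k. \<alpha> k / N ^ k) * B) * Lp_norm M p F"
          by simp
        have "Lp_norm M p S \<le> ((\<Sum>k. \<alpha> k / N ^ k) * B) * Lp_norm M p F + (\<Sum>n\<in>J. \<epsilon> l n * Lp_norm M p (P n))" for l
        proof -
          have "Lp_norm M p S - Lp_norm M p (R l) \<le> Lp_norm M p (\<lambda>w. R l w - S w)"
            using Lp_norm_dist_le[OF RL SL p1, of l] by linarith
          also have "(\<lambda>w. R l w - S w) = (\<lambda>w. \<Sum>n\<in>J. (\<Sum>k<l. (1 / real n ^ k) *\<^sub>R a k (P n) w) - \<phi> n (P n) w)"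
            unfolding R_def S_def by (simp add: sum_subtractf)
          also have "Lp_norm M p \<dots> \<le> (\<Sum>n\<in>J. Lp_norm M p (\<lambda>w. (\<Sum>k<l. (1 / real n ^ k) *\<^sub>R a k (P n) w) - \<phi> n (P n) w))"
            by (intro Lp_norm_sum Lp_diff Lp_sum Lp_scaleR aL \<phi>L p1)
          also have "\<dots> \<le> (\<Sum>n\<in>J. \<epsilon> l n * Lp_norm M p (P n))"
            unfolding \<epsilon>_def by (intro sum_mono Lp_opnorm_bounds(1)[OF Lp_operator_series_norm_bound[OF a \<phi> p1] PL])
          finally show ?thesis using Rn[of l] by linarith
        qed
        then show "\<exists>m. \<forall>l\<ge>m. Lp_norm M p S \<le> ((\<Sum>k. \<alpha> k / N ^ k) * B) * Lp_norm M p F + (\<Sum>n\<in>J. \<epsilon> l n * Lp_norm M p (P n))"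
          by blast
      qed
      moreover have "Lp_norm M p (\<lambda>w. \<Sum>n<N0. \<phi> n (P n) w) \<le> (\<Sum>n<N0. \<beta> n * A ^ n) * Lp_norm M p F"
      proof -
        have "Lp_norm M p (\<lambda>w. \<Sum>n<N0. \<phi> n (P n) w) \<le> (\<Sum>n<N0. Lp_norm M p (\<phi> n (P n)))"
          by (intro Lp_norm_sum \<phi>L p1)
        also have "\<dots> \<le> (\<Sum>n<N0. \<beta> n * (A ^ n * Lp_norm M p F))"
          by (intro sum_mono order_trans[OF \<beta>(2)[OF PL]] mult_left_mono low \<beta>(1))
        finally show ?thesis by (simp add: sum_distrib_right mult.assoc)
      qed
      moreover have "Lp_norm M p (\<lambda>w. \<Sum>n<D'. \<phi> n (P n) w) = Lp_norm M p (\<lambda>w. (\<Sum>n<N0. \<phi> n (P n) w) + S w)"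
      proof -
        have "N0 \<le> D'" using D' unfolding D_def by simp
        then show ?thesis unfolding S_def J_def lessThan_atLeast0
          by (intro arg_cong[where f="Lp_norm M p"] ext sum.atLeastLessThan_concat[symmetric]) auto
      qed
      moreover have "Lp_norm M p (\<lambda>w. (\<Sum>n<N0. \<phi> n (P n) w) + S w) \<le> Lp_norm M p (\<lambda>w. \<Sum>n<N0. \<phi> n (P n) w) + Lp_norm M p S"
        by (intro Lp_norm_triangle Lp_sum \<phi>L SL p1)
      ultimately show ?thesis unfolding C_def distrib_right by linarith
    qed
    then show "\<exists>D. (\<forall>n\<ge>D. AE w in M. vchaos_proj M W n F w = 0) \<and>
      (\<forall>D'\<ge>D. Lp_norm M p (\<lambda>w. \<Sum>n<D'. \<phi> n (vchaos_proj M W n F) w) \<le> C * Lp_norm M p F)"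
      using van unfolding P_def by blast
  qed
qed

end

theorem theorem6p5:
  fixes M :: "'w measure"
    and W :: "'h::{real_inner, banach, second_countable_topology} \<Rightarrow> 'w \<Rightarrow> real"
    and a \<phi> :: "nat \<Rightarrow> ('w \<Rightarrow> 'e::banach) \<Rightarrow> ('w \<Rightarrow> 'e)"
    and p N :: real
  assumes "prob_space M" and "complete_measure M"
    and "isonormal_process M W" and "sigma_algebra_generated_by M W"
    and "1 < p"
    and "UMD_space TYPE('e)"
    and "\<And>k. Lp_operator M p (a k)"
    and "1 \<le> N"
    and "summable (\<lambda>k. Lp_opnorm M p (a k) / N ^ k)"
    and "\<And>n. Lp_operator M p (\<phi> n)"
    and "\<And>n. N \<le> real n \<Longrightarrow> Lp_op_sums M p (\<lambda>k f \<omega>. (1 / real n ^ k) *\<^sub>R a k f \<omega>) (\<phi> n)"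
  shows "\<exists>T. Lp_operator M p T \<and>
    (\<forall>F \<in> wiener_polynomials W. Lp_sums M p (\<lambda>n. \<phi> n (vchaos_proj M W n F)) (T F))"
proof -
  interpret prob_space M by fact
  interpret isonormal M W by unfold_locales fact
  note a = assms(7) and \<phi> = assms(10)
  have p0: "0 < p" and p1: "1 \<le> p" using \<open>1 < p\<close> by auto
  define S where "S n F = \<phi> n (vchaos_proj M W n F)" for n and F :: "'w \<Rightarrow> 'e"
  have PL: "vchaos_proj M W n F \<in> Lp M p" if "F \<in> wiener_polynomials W" for n and F :: "'w \<Rightarrow> 'e"
    by (rule vchaos_proj_Lp[OF that p1])
  have SL: "S n F \<in> Lp M p" if "F \<in> wiener_polynomials W" for n F
    unfolding S_def by (rule Lp_operatorD(1)[OF \<phi> PL[OF that]])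
  have S0: "AE \<omega> in M. S n F \<omega> = 0" if "F \<in> wiener_polynomials W" "AE \<omega> in M. vchaos_proj M W n F \<omega> = 0" for n F
    unfolding S_def by (rule Lp_operator_null[OF \<phi> p1 PL[OF that(1)] that(2)])
  show ?thesis
  \<comment> \<open>If \<open>H\<close> is trivial, all chaos projections are null functions and the
    zero operator serves.\<close>
  proof (cases "\<exists>e :: 'h. norm e = 1")
    case False
    show ?thesis
    proof (intro exI[of _ "\<lambda>f \<omega>. 0"] conjI ballI)
      show "Lp_operator M p (\<lambda>(f :: 'w \<Rightarrow> 'e) \<omega>. 0)"
        unfolding Lp_operator_def by (auto intro!: exI[of _ 0])
      fix F :: "'w \<Rightarrow> 'e" assume F: "F \<in> wiener_polynomials W"
      have "Lp_norm M p (\<lambda>\<omega>. \<Sum>n<m. S n F \<omega>) = 0" for m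
      proof -
        have "AE \<omega> in M. \<forall>n\<in>{..<m}. S n F \<omega> = 0"
          using False by (intro AE_finite_allI S0[OF F] vchaos_proj_degenerate F) auto
        then have "AE \<omega> in M. (\<Sum>n<m. S n F \<omega>) = 0" by eventually_elim simp
        moreover have "(\<lambda>\<omega>. \<Sum>n<m. S n F \<omega>) \<in> Lp M p" by (intro Lp_sum SL F p1)
        ultimately show ?thesis using Lp_norm_eq_0_iff[OF _ p0] by blast
      qed
      then show "Lp_sums M p (\<lambda>n. \<phi> n (vchaos_proj M W n F)) (\<lambda>\<omega>. 0)"
        using SL[OF F] unfolding Lp_sums_def S_def by simp
    qed
  next
    case True
    then obtain e :: 'h where e: "norm e = 1" ..
    obtain C where "\<forall>F\<in>wiener_polynomials W. \<exists>D. (\<forall>n\<ge>D. AE \<omega> in M. vchaos_proj M W n F \<omega> = 0) \<and>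
      (\<forall>D'\<ge>D. Lp_norm M p (\<lambda>\<omega>. \<Sum>n<D'. S n F \<omega>) \<le> C * Lp_norm M p F)"
      using spectral_multiplier_bound[OF \<open>1 < p\<close> assms(6) e a \<phi> \<open>1 \<le> N\<close> assms(9,11)] unfolding S_def by (rule exE)
    from bchoice[OF this] obtain D where D: "\<forall>F\<in>wiener_polynomials W. (\<forall>n\<ge>D F. AE \<omega> in M. vchaos_proj M W n F \<omega> = 0) \<and>
      (\<forall>D'\<ge>D F. Lp_norm M p (\<lambda>\<omega>. \<Sum>n<D'. S n F \<omega>) \<le> C * Lp_norm M p F)" ..
    \<comment> \<open>The cut-off \<open>D F\<close> depends on \<open>F\<close>, so
      \<open>T0\<close> is not linear on its face. By \<open>eq\<close> every later cut-off gives
      the same function up to a null set, and functions to be compared are cut off at a common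
      index.\<close>
    define T0 where "T0 F \<omega> = (\<Sum>n<D F. S n F \<omega>)" for F \<omega>
    have eq: "AE \<omega> in M. (\<Sum>n<D'. S n F \<omega>) = T0 F \<omega>" if F: "F \<in> wiener_polynomials W" and D': "D F \<le> D'" for F D'
    proof -
      have "AE \<omega> in M. \<forall>n\<in>{D F..<D'}. S n F \<omega> = 0"
        using D F by (intro AE_finite_allI S0) auto
      then show ?thesis
      proof eventually_elim
        case (elim \<omega>)
        have "(\<Sum>n<D'. S n F \<omega>) = T0 F \<omega> + (\<Sum>n\<in>{D F..<D'}. S n F \<omega>)"
          unfolding T0_def lessThan_atLeast0 by (rule sum.atLeastLessThan_concat[symmetric]) (use D' in auto)
        then show ?case using elim by simp
      qed
    qed
    have "\<exists>T. Lp_operator M p T \<and> (\<forall>F\<in>wiener_polynomials W. AE \<omega> in M. T F \<omega> = T0 F \<omega>)"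
    proof (rule Lp_extension[OF p1])
      show "wiener_polynomials W \<subseteq> Lp M p" using wiener_polynomials_Lp[OF _ p1] by blast
      show "\<exists>v\<in>wiener_polynomials W. Lp_norm M p (\<lambda>\<omega>. f \<omega> - v \<omega>) < r" if "f \<in> Lp M p" "0 < r" for f :: "'w \<Rightarrow> 'e" and r
        by (rule polynomials_dense[OF assms(4) p1 that])
      fix F :: "'w \<Rightarrow> 'e" assume F: "F \<in> wiener_polynomials W"
      show "T0 F \<in> Lp M p" unfolding T0_def[abs_def] by (intro Lp_sum SL F p1)
      show "Lp_norm M p (T0 F) \<le> C * Lp_norm M p F" using D F unfolding T0_def[abs_def] by blast
      show "(\<lambda>\<omega>. c *\<^sub>R F \<omega>) \<in> wiener_polynomials W" for c by (rule wiener_polynomials_scaleR[OF F])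
      show "AE \<omega> in M. T0 (\<lambda>\<omega>. c *\<^sub>R F \<omega>) \<omega> = c *\<^sub>R T0 F \<omega>" for c
      proof -
        note cF = wiener_polynomials_scaleR[OF F, of c]
        define m where "m = max (D F) (D (\<lambda>\<omega>. c *\<^sub>R F \<omega>))"
        have "AE \<omega> in M. S n (\<lambda>\<omega>. c *\<^sub>R F \<omega>) \<omega> = c *\<^sub>R S n F \<omega>" for n
        proof -
          have "AE \<omega> in M. S n (\<lambda>\<omega>. c *\<^sub>R F \<omega>) \<omega> = \<phi> n (\<lambda>\<omega>. c *\<^sub>R vchaos_proj M W n F \<omega>) \<omega>"
            unfolding S_def by (rule Lp_operator_cong_AE[OF \<phi> p1 PL[OF cF] Lp_scaleR[OF PL[OF F]] vchaos_proj_scaleR[OF F]])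
          with Lp_operatorD(3)[OF \<phi> PL[OF F], of n c n] show ?thesis unfolding S_def by eventually_elim simp
        qed
        then have "AE \<omega> in M. \<forall>n\<in>{..<m}. S n (\<lambda>\<omega>. c *\<^sub>R F \<omega>) \<omega> = c *\<^sub>R S n F \<omega>" by (intro AE_finite_allI) auto
        moreover have "AE \<omega> in M. (\<Sum>n<m. S n F \<omega>) = T0 F \<omega>" by (rule eq[OF F]) (simp add: m_def)
        moreover have "AE \<omega> in M. (\<Sum>n<m. S n (\<lambda>\<omega>. c *\<^sub>R F \<omega>) \<omega>) = T0 (\<lambda>\<omega>. c *\<^sub>R F \<omega>) \<omega>"
          by (rule eq[OF cF]) (simp add: m_def)
        ultimately show ?thesis by eventually_elim (simp flip: scaleR_sum_right)
      qed
      fix G :: "'w \<Rightarrow> 'e" assume G: "G \<in> wiener_polynomials W"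
      note FG = wiener_polynomials_add[OF F G]
      show "(\<lambda>\<omega>. F \<omega> + G \<omega>) \<in> wiener_polynomials W" by (rule FG)
      show "AE \<omega> in M. T0 (\<lambda>\<omega>. F \<omega> + G \<omega>) \<omega> = T0 F \<omega> + T0 G \<omega>"
      proof -
        define m where "m = max (D F) (max (D G) (D (\<lambda>\<omega>. F \<omega> + G \<omega>)))"
        have "AE \<omega> in M. S n (\<lambda>\<omega>. F \<omega> + G \<omega>) \<omega> = S n F \<omega> + S n G \<omega>" for n
        proof -
          have "AE \<omega> in M. S n (\<lambda>\<omega>. F \<omega> + G \<omega>) \<omega> = \<phi> n (\<lambda>\<omega>. vchaos_proj M W n F \<omega> + vchaos_proj M W n G \<omega>) \<omega>"
            unfolding S_def by (rule Lp_operator_cong_AE[OF \<phi> p1 PL[OF FG] Lp_add[OF PL[OF F] PL[OF G] p1] vchaos_proj_add[OF F G]])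
          with Lp_operatorD(2)[OF \<phi> PL[OF F] PL[OF G], of n n n] show ?thesis unfolding S_def by eventually_elim simp
        qed
        then have "AE \<omega> in M. \<forall>n\<in>{..<m}. S n (\<lambda>\<omega>. F \<omega> + G \<omega>) \<omega> = S n F \<omega> + S n G \<omega>" by (intro AE_finite_allI) auto
        moreover have "AE \<omega> in M. (\<Sum>n<m. S n F \<omega>) = T0 F \<omega>" by (rule eq[OF F]) (simp add: m_def)
        moreover have "AE \<omega> in M. (\<Sum>n<m. S n G \<omega>) = T0 G \<omega>" by (rule eq[OF G]) (simp add: m_def)
        moreover have "AE \<omega> in M. (\<Sum>n<m. S n (\<lambda>\<omega>. F \<omega> + G \<omega>) \<omega>) = T0 (\<lambda>\<omega>. F \<omega> + G \<omega>) \<omega>"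
          by (rule eq[OF FG]) (simp add: m_def)
        ultimately show ?thesis by eventually_elim (simp add: sum.distrib)
      qed
    qed
    then obtain T where T: "Lp_operator M p T" "\<And>F. F \<in> wiener_polynomials W \<Longrightarrow> AE \<omega> in M. T F \<omega> = T0 F \<omega>" by blast
    have "Lp_sums M p (\<lambda>n. \<phi> n (vchaos_proj M W n F)) (T F)" if F: "F \<in> wiener_polynomials W" for F
      unfolding Lp_sums_def S_def[symmetric]
    proof (intro conjI allI)
      show "S n F \<in> Lp M p" for n by (rule SL[OF F])
      show TL: "T F \<in> Lp M p" by (rule Lp_operatorD(1)[OF T(1) wiener_polynomials_Lp[OF F p1]])
      \<comment> \<open>From \<open>D F\<close> on the partial sums agree with \<open>T F\<close>
        almost everywhere, so the convergence is that of an eventually constant sequence.\<close>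
      have "Lp_norm M p (\<lambda>\<omega>. (\<Sum>n<m. S n F \<omega>) - T F \<omega>) = 0" if m: "D F \<le> m" for m
      proof -
        have "(\<lambda>\<omega>. (\<Sum>n<m. S n F \<omega>) - T F \<omega>) \<in> Lp M p" by (intro Lp_diff Lp_sum SL F TL p1)
        moreover have "AE \<omega> in M. (\<Sum>n<m. S n F \<omega>) - T F \<omega> = 0"
          using eq[OF F m] T(2)[OF F] by eventually_elim simp
        ultimately show ?thesis using Lp_norm_eq_0_iff[OF _ p0] by blast
      qed
      then show "(\<lambda>m. Lp_norm M p (\<lambda>\<omega>. (\<Sum>n<m. S n F \<omega>) - T F \<omega>)) \<longlonglongrightarrow> 0"
        by (intro tendsto_eventually eventually_sequentiallyI[of "D F"])
    qed
    then show ?thesis using T(1) by blast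
  qed
qed

end
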